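(* Let $t\in\mathbb K\setminus\mathbb N$, let $n\ge0$, and let $\lambda$ be a partition of $n$. Let $f(x_1,\ldots,x_n):=(t-x_1)\cdots(t-x_n)$ and $\rho:=(n-1,n-2,\ldots,0)$. Then, in the category $\mathcal T=\mathcal T(\mathcal A,\delta)$ with $\mathcal A=\mathsf{Set}^{\mathrm{op}}$ the opposite of the category of finite sets and $\delta(e)=t^{|B|-|A|}$ for every injective map of finite sets $e:A\hookrightarrow B$, $$\dim_{\mathcal T}[n]^0_{\chi^\lambda}=\sum_{\mu\vdash n}(-1)^{\ell(\mu)}z_\mu^{-1}\chi^\lambda_\mu\,\mathcal C_{m_1(\mu)}(t)=\frac{\deg\chi^\lambda}{n!}f(\lambda+\rho),$$ where $\lambda=(\lambda_1\ge\cdots\ge\lambda_n\ge0)$ is regarded as an $n$-tuple.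
   Context: $\mathbb K$ is an algebraically closed field of characteristic $0$, $\mathbb N=\{0,1,2,\ldots\}$. Combinatorial notation. $\chi^\lambda$ is the irreducible character of the symmetric group $S_n$ corresponding to the partition $\lambda$ of $n$; $\chi^\lambda_\mu$ is its value at a permutation of cycle type $\mu$; $\deg\chi^\lambda=\chi^\lambda_{(1^n)}$. For a partition $\mu$, $m_i(\mu)$ is the number of parts equal to $i$, $\ell(\mu)$ the number of nonzero parts, and $z_\mu=\prod_i i^{m_i(\mu)}m_i(\mu)!$. With $(t)_k:=t(t-1)\cdots(t-k+1)$, put $\mathcal C_m(t):=\sum_{k=0}^m(-1)^k\binom mk(t)_k$. The category $\mathcal T=\mathcal T(\mathcal A,\delta)$ for $\mathcal A=\mathsf{Set}^{\mathrm{op}}$. In $\mathcal A$ the monomorphisms ("injective" morphisms) are the surjective maps of finite sets read backwards, the "surjective" morphisms are the injective maps read backwards, the terminal object is $\ast=\varnothing$, and $x\times y$ is the disjoint union. A relation between $x$ and $y$ is a subobject $r\subseteq x\times y$ in $\mathcal A$. $\mathcal T^0$ has objects $[x]$, $x\in\mathcal A$; $\mathrm{Hom}([x],[y])$ is the $\mathbb K$-vector space with basis $\langle r\rangle$, $r\subseteq x\times y$ a subobject; $\langle r\rangle:[x]\to[y]$ followed by $\langle s\rangle:[y]\to[z]$ is $\delta(r\times_ys\twoheadrightarrow r\circ s)\langle r\circ s\rangle$, where $r\circ s=\mathrm{image}(r\times_ys\to x\times z)$ (fibre product and image taken in $\mathcal A$). $\mathcal T$ is the pseudo-abelian (idempotent)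 completion of the additive completion of $\mathcal T^0$. For $t\notin\mathbb N$ it is a semisimple rigid symmetric monoidal category with $[x]\otimes[y]=[x\times y]$, unit $I=[\varnothing]$, $\mathrm{End}(I)=\mathbb K$, $[x]^\vee=[x]$ and $\langle r\rangle^\vee=\langle r^\vee\rangle$ (factors swapped). (It is Deligne's category $\mathrm{Rep}\,S_t$.) An $\mathcal A$-morphism $f:x\to y$ gives $[f]=\langle\Gamma_f\rangle$ with $\Gamma_f$ its graph. $\dim_{\mathcal T}X$ is the internal (categorical) dimension, i.e. the categorical trace of $\mathrm{id}_X$. Simple objects. $z$ is a subquotient of $x$ if there are in $\mathcal A$ a subobject $y\subseteq x$ and a surjection $y\twoheadrightarrow z$ (equivalently, here, $|z|\le|x|$ with $z$ a subset of a quotient set of $x$); it is proper if $z\not\cong x$. $[x]^1$ denotes the unique direct summand of $[x]$ which is isomorphic to a direct summand of a finite direct sum $\bigoplus[z_i]$ with all $z_i$ proper subquotients of $x$, and such that every morphism $[z]\to[x]$ with $z$ a proper subquotient of $x$ factors through $[x]^1$. It has a unique complement $[x]^0$ in $[x]$, and $\mathbb K[\mathrm{Aut}_{\mathcal A}(x)]\to\mathrm{End}_{\mathcal T}([x]^0)$ is an isomorphism. Hence $[x]^0=\bigoplus_\chi V_\chi\otimes_{\mathbb K}[x]^0_\chi$ ($\chi$ over irreducible characters of $\mathrm{Aut}_{\mathcal A}(x)$, $V_\chi$ the irreducible module with character $\chi$) with $[x]^0_\chi$ simple. $[n]^0_{\chi^\lambda}$ denotes $[x]^0_{\chi^\lambda}$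 for $x=\{1,\ldots,n\}$, with $\mathrm{Aut}_{\mathcal A}(x)=S_n$. *)

theory Defs
  imports
    "HOL-Library.Function_Algebras"
    "HOL-Library.Nat_Bijection"
    "HOL-Library.Multiset"
    "HOL-Computational_Algebra.Polynomial"
    "HOL-Combinatorics.Permutations"
    "HOL-Combinatorics.Orbits"
begin

section \<open>Partitions and symmetric group characters\<close>

definition partitions_of :: "nat \<Rightarrow> nat list set" where
  "partitions_of n = {mu. sorted_wrt (\<ge>) mu \<and> 0 \<notin> set mu \<and> sum_list mu = n}"

text \<open>The parts of a partition are 0-indexed and extended by zeros.\<close>

definition part :: "nat list \<Rightarrow> nat \<Rightarrow> nat" where
  "part lam i = (if i < length lam then lam ! i else 0)"

definition z_part :: "nat list \<Rightarrow> nat" where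
  "z_part mu = (\<Prod>i\<in>set mu. i ^ count_list mu i * fact (count_list mu i))"

definition falling :: "'k::comm_ring_1 \<Rightarrow> nat \<Rightarrow> 'k" where
  "falling t k = (\<Prod>i<k. t - of_nat i)"

definition charlier :: "nat \<Rightarrow> 'k::comm_ring_1 \<Rightarrow> 'k" where
  "charlier m t = (\<Sum>k\<le>m. (- 1) ^ k * of_nat (m choose k) * falling t k)"

definition perms :: "nat \<Rightarrow> (nat \<Rightarrow> nat) set" where
  "perms n = {p. p permutes {1..n}}"

definition cycle_type :: "nat \<Rightarrow> (nat \<Rightarrow> nat) \<Rightarrow> nat multiset" where
  "cycle_type n p = image_mset card (mset_set (orbit p ` {1..n}))"

text \<open>The standard tableau with entries \<open>1..n\<close> filled in row by row; \<open>row_of\<close> and \<open>col_of\<close>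
  give the (0-indexed) row and the (1-indexed) column of an entry.\<close>

definition row_of :: "nat list \<Rightarrow> nat \<Rightarrow> nat" where
  "row_of lam k = (LEAST i. k \<le> sum_list (take (Suc i) lam))"

definition col_of :: "nat list \<Rightarrow> nat \<Rightarrow> nat" where
  "col_of lam k = k - sum_list (take (row_of lam k) lam)"

definition row_group :: "nat list \<Rightarrow> (nat \<Rightarrow> nat) set" where
  "row_group lam =
     {p \<in> perms (sum_list lam). \<forall>k\<in>{1..sum_list lam}. row_of lam (p k) = row_of lam k}"

definition col_group :: "nat list \<Rightarrow> (nat \<Rightarrow> nat) set" where
  "col_group lam =
     {p \<in> perms (sum_list lam). \<forall>k\<in>{1..sum_list lam}. col_of lam (p k) = col_of lam k}"

text \<open>Elements of the group algebra of \<open>S\<^sub>n\<close> are functions supported on \<^term>\<open>perms n\<close>;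
  \<open>perm_act\<close> is left multiplication.  The irreducible module of a partition is the left ideal
  generated by its Young symmetrizer.\<close>

definition young_symmetrizer :: "nat list \<Rightarrow> (nat \<Rightarrow> nat) \<Rightarrow> 'k::comm_ring_1" where
  "young_symmetrizer lam = (\<lambda>s. \<Sum>p\<in>row_group lam. \<Sum>q\<in>col_group lam.
     if s = p \<circ> q then of_int (sign q) else 0)"

definition perm_act :: "(nat \<Rightarrow> nat) \<Rightarrow> ((nat \<Rightarrow> nat) \<Rightarrow> 'k) \<Rightarrow> (nat \<Rightarrow> nat) \<Rightarrow> 'k" where
  "perm_act s v = (\<lambda>u. v (inv s \<circ> u))"

definition fscale :: "'k::field \<Rightarrow> ('a \<Rightarrow> 'k) \<Rightarrow> 'a \<Rightarrow> 'k" where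
  "fscale c v = (\<lambda>x. c * v x)"

interpretation fvs: vector_space "fscale :: 'k::field \<Rightarrow> ('a \<Rightarrow> 'k) \<Rightarrow> 'a \<Rightarrow> 'k"
  by unfold_locales (auto simp: fscale_def fun_eq_iff algebra_simps)

definition is_basis :: "('a \<Rightarrow> 'k::field) set \<Rightarrow> ('a \<Rightarrow> 'k) set \<Rightarrow> bool" where
  "is_basis B V \<longleftrightarrow> B \<subseteq> V \<and> fvs.independent B \<and> V \<subseteq> fvs.span B"

definition trace_on :: "('a \<Rightarrow> 'k::field) set \<Rightarrow> (('a \<Rightarrow> 'k) \<Rightarrow> 'a \<Rightarrow> 'k) \<Rightarrow> 'k" where
  "trace_on V f = (let B = (SOME B. is_basis B V) in \<Sum>b\<in>B. fvs.representation B (f b) b)"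

definition specht :: "nat list \<Rightarrow> ((nat \<Rightarrow> nat) \<Rightarrow> 'k::field) set" where
  "specht lam = fvs.span ((\<lambda>s. perm_act s (young_symmetrizer lam)) ` perms (sum_list lam))"

definition sym_character :: "nat list \<Rightarrow> (nat \<Rightarrow> nat) \<Rightarrow> 'k::field" where
  "sym_character lam s = trace_on (specht lam) (perm_act s)"

definition sym_character_at :: "nat list \<Rightarrow> nat list \<Rightarrow> 'k::field" where
  "sym_character_at lam mu =
     sym_character lam (SOME s. s \<in> perms (sum_list mu) \<and> cycle_type (sum_list mu) s = mset mu)"

definition character_degree :: "nat list \<Rightarrow> 'k::field" where
  "character_degree lam = sym_character_at lam (replicate (sum_list lam) 1)"

section \<open>Relations in the opposite category of finite sets\<close>

text \<open>Objects of \<open>A = Set\<^sup>o\<^sup>p\<close> are finite sets of natural numbers.  A morphism \<open>x \<rightarrow> y\<close> of \<open>A\<close> is a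
  map from \<open>y\<close> to \<open>x\<close>.  The product of \<open>A\<close> is the disjoint union, encoded again as a set of
  naturals by \<open>obj_prod\<close>; inside a single relation the disjoint union type is used directly.

  A subobject in \<open>A\<close> of the product of \<open>x\<close> and \<open>y\<close> is a quotient of the disjoint union of \<open>x\<close>
  and \<open>y\<close>, that is, an equivalence relation on it (the kernel of the quotient map).\<close>

type_synonym arel = "(nat + nat) rel"

definition obj_prod :: "nat set \<Rightarrow> nat set \<Rightarrow> nat set" where
  "obj_prod x y = sum_encode ` (x <+> y)"

definition arels :: "nat set \<Rightarrow> nat set \<Rightarrow> arel set" where
  "arels x y = {r. equiv (x <+> y) r}"

definition kernel_on :: "'a set \<Rightarrow> ('a \<Rightarrow> 'b) \<Rightarrow> 'a rel" where
  "kernel_on S h = {(u, v). u \<in> S \<and> v \<in> S \<and> h u = h v}"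

text \<open>The graph of the \<open>A\<close>-morphism \<open>x \<rightarrow> y\<close> given by the map \<open>f\<close> from \<open>y\<close> to \<open>x\<close>: the subobject
  \<open>(id, f)\<close> of the product is the quotient map \<open>[id, f]\<close> of the disjoint union.\<close>

definition graph_rel :: "nat set \<Rightarrow> nat set \<Rightarrow> (nat \<Rightarrow> nat) \<Rightarrow> arel" where
  "graph_rel x y f = kernel_on (x <+> y) (case_sum id f)"

text \<open>The fibre product over \<open>y\<close> in \<open>A\<close> is the pushout of the two quotients, that is, the quotient
  of \<open>x <+> (y <+> z)\<close> by the equivalence relation generated by \<open>r\<close> and \<open>s\<close>.  Its image in the
  product of \<open>x\<close> and \<open>z\<close> is the image of \<open>x <+> z\<close> in the pushout, that is, the quotient by the
  restricted equivalence relation.\<close>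

definition fibre_rel :: "arel \<Rightarrow> arel \<Rightarrow> (nat + (nat + nat)) rel" where
  "fibre_rel r s = (map_prod (map_sum id Inl) (map_sum id Inl) ` r \<union> map_prod Inr Inr ` s)\<^sup>+"

definition comp_rel :: "nat set \<Rightarrow> nat set \<Rightarrow> arel \<Rightarrow> arel \<Rightarrow> arel" where
  "comp_rel x z r s = {(u, v). u \<in> x <+> z \<and> v \<in> x <+> z
     \<and> (map_sum id Inr u, map_sum id Inr v) \<in> fibre_rel r s}"

definition dual_rel :: "arel \<Rightarrow> arel" where
  "dual_rel r = map_prod (case_sum Inr Inl) (case_sum Inr Inl) ` r"

definition prod_rel :: "arel \<Rightarrow> arel \<Rightarrow> arel" where
  "prod_rel r r' =
     map_prod (map_sum (sum_encode \<circ> Inl) (sum_encode \<circ> Inl))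
              (map_sum (sum_encode \<circ> Inl) (sum_encode \<circ> Inl)) ` r
   \<union> map_prod (map_sum (sum_encode \<circ> Inr) (sum_encode \<circ> Inr))
              (map_sum (sum_encode \<circ> Inr) (sum_encode \<circ> Inr)) ` r'"

definition codiag :: "nat \<Rightarrow> nat" where
  "codiag m = case_sum id id (sum_decode m)"

text \<open>The degree function on an injective map \<open>A \<rightarrow> B\<close>.\<close>

definition delta :: "'k::field \<Rightarrow> 'a set \<Rightarrow> 'b set \<Rightarrow> 'k" where
  "delta t A B = t ^ (card B - card A)"

section \<open>The category of relations\<close>

text \<open>A morphism of \<open>T\<^sup>0\<close> is a formal linear combination of relations, given by its coefficients.\<close>

definition hom0 :: "nat set \<Rightarrow> nat set \<Rightarrow> (arel \<Rightarrow> 'k::field) set" where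
  "hom0 x y = {f. \<forall>r. r \<notin> arels x y \<longrightarrow> f r = 0}"

definition bas :: "arel \<Rightarrow> arel \<Rightarrow> 'k::field" where
  "bas r = (\<lambda>u. if u = r then 1 else 0)"

text \<open>\<open>comp0 t x y z g f\<close> is \<open>f : x \<rightarrow> y\<close> followed by \<open>g : y \<rightarrow> z\<close>.\<close>

definition comp0 :: "'k::field \<Rightarrow> nat set \<Rightarrow> nat set \<Rightarrow> nat set
    \<Rightarrow> (arel \<Rightarrow> 'k) \<Rightarrow> (arel \<Rightarrow> 'k) \<Rightarrow> arel \<Rightarrow> 'k" where
  "comp0 t x y z g f = (\<lambda>u. \<Sum>r\<in>arels x y. \<Sum>s\<in>arels y z.
     f r * g s * delta t ((x <+> z) // comp_rel x z r s) ((x <+> (y <+> z)) // fibre_rel r s)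
       * bas (comp_rel x z r s) u)"

definition id0 :: "nat set \<Rightarrow> arel \<Rightarrow> 'k::field" where
  "id0 x = bas (graph_rel x x id)"

definition tens0 :: "nat set \<Rightarrow> nat set \<Rightarrow> nat set \<Rightarrow> nat set
    \<Rightarrow> (arel \<Rightarrow> 'k::field) \<Rightarrow> (arel \<Rightarrow> 'k) \<Rightarrow> arel \<Rightarrow> 'k" where
  "tens0 x y x' y' f g = (\<lambda>u. \<Sum>r\<in>arels x y. \<Sum>r'\<in>arels x' y'.
     f r * g r' * bas (prod_rel r r') u)"

definition dual0 :: "(arel \<Rightarrow> 'k::field) \<Rightarrow> arel \<Rightarrow> 'k" where
  "dual0 f = (\<lambda>u. f (dual_rel u))"

text \<open>The symmetry \<open>[x] \<otimes> [y] \<rightarrow> [y] \<otimes> [x]\<close>, and the evaluation \<open>[x] \<otimes> [x] \<rightarrow> I\<close> and coevaluation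
  \<open>I \<rightarrow> [x] \<otimes> [x]\<close> given by the diagonal subobject.\<close>

definition braid0 :: "nat set \<Rightarrow> nat set \<Rightarrow> arel \<Rightarrow> 'k::field" where
  "braid0 x y = bas (graph_rel (obj_prod x y) (obj_prod y x)
     (sum_encode \<circ> case_sum Inr Inl \<circ> sum_decode))"

definition ev0 :: "nat set \<Rightarrow> arel \<Rightarrow> 'k::field" where
  "ev0 x = bas (kernel_on (obj_prod x x <+> {}) (case_sum codiag id))"

definition coev0 :: "nat set \<Rightarrow> arel \<Rightarrow> 'k::field" where
  "coev0 x = bas (kernel_on ({} <+> obj_prod x x) (case_sum id codiag))"

section \<open>Additive and idempotent completion\<close>

text \<open>Objects of the additive completion are lists of objects.  A morphism \<open>f\<close> is a matrix, where
  \<open>f i j\<close> is the component from the \<open>i\<close>-th summand of the source to the \<open>j\<close>-th summand of the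
  target, with zeros outside of the index range.\<close>

type_synonym 'k mor = "nat \<Rightarrow> nat \<Rightarrow> arel \<Rightarrow> 'k"

definition homA :: "nat set list \<Rightarrow> nat set list \<Rightarrow> 'k::field mor set" where
  "homA xs ys = {f. \<forall>i j. if i < length xs \<and> j < length ys then f i j \<in> hom0 (xs ! i) (ys ! j)
                          else f i j = 0}"

definition compA :: "'k::field \<Rightarrow> nat set list \<Rightarrow> nat set list \<Rightarrow> nat set list
    \<Rightarrow> 'k mor \<Rightarrow> 'k mor \<Rightarrow> 'k mor" where
  "compA t xs ys zs g f =
     (\<lambda>i k. \<Sum>j<length ys. comp0 t (xs ! i) (ys ! j) (zs ! k) (g j k) (f i j))"

definition idA :: "nat set list \<Rightarrow> 'k::field mor" where
  "idA xs = (\<lambda>i j. if i = j \<and> i < length xs then id0 (xs ! i) else 0)"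

definition tens_list :: "nat set list \<Rightarrow> nat set list \<Rightarrow> nat set list" where
  "tens_list xs ys = map (\<lambda>(x, y). obj_prod x y) (List.product xs ys)"

text \<open>The pair of summands \<open>(a, b)\<close> has the index \<open>a * length ys + b\<close> in \<^term>\<open>tens_list xs ys\<close>.
  \<open>tensA xs ys xs' ys' f g\<close> is \<open>f \<otimes> g\<close> for \<open>f : xs \<rightarrow> ys\<close> and \<open>g : xs' \<rightarrow> ys'\<close>.\<close>

definition tensA :: "nat set list \<Rightarrow> nat set list \<Rightarrow> nat set list \<Rightarrow> nat set list
    \<Rightarrow> 'k::field mor \<Rightarrow> 'k mor \<Rightarrow> 'k mor" where
  "tensA xs ys xs' ys' f g = (\<lambda>i j.
     let a = i div length xs'; a' = i mod length xs'; b = j div length ys'; b' = j mod length ys'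
     in tens0 (xs ! a) (ys ! b) (xs' ! a') (ys' ! b') (f a b) (g a' b'))"

definition dualA :: "'k::field mor \<Rightarrow> 'k mor" where
  "dualA f = (\<lambda>i j. dual0 (f j i))"

definition braidA :: "nat set list \<Rightarrow> nat set list \<Rightarrow> 'k::field mor" where
  "braidA xs ys = (\<lambda>i j.
     if i < length xs * length ys \<and> j < length ys * length xs
        \<and> i div length ys = j mod length xs \<and> i mod length ys = j div length xs
     then braid0 (xs ! (i div length ys)) (ys ! (i mod length ys)) else 0)"

definition evA :: "nat set list \<Rightarrow> 'k::field mor" where
  "evA xs = (\<lambda>i j.
     if i < length xs * length xs \<and> j = 0 \<and> i div length xs = i mod length xs
     then ev0 (xs ! (i div length xs)) else 0)"

definition coevA :: "nat set list \<Rightarrow> 'k::field mor" where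
  "coevA xs = (\<lambda>i j.
     if i = 0 \<and> j < length xs * length xs \<and> j div length xs = j mod length xs
     then coev0 (xs ! (j div length xs)) else 0)"

datatype 'k tobj = Obj (summands: "nat set list") (idem: "'k mor")

definition is_tobj :: "'k::field \<Rightarrow> 'k tobj \<Rightarrow> bool" where
  "is_tobj t X \<longleftrightarrow> (\<forall>x\<in>set (summands X). finite x) \<and> idem X \<in> homA (summands X) (summands X)
     \<and> compA t (summands X) (summands X) (summands X) (idem X) (idem X) = idem X"

definition tcomp :: "'k::field \<Rightarrow> 'k tobj \<Rightarrow> 'k tobj \<Rightarrow> 'k tobj \<Rightarrow> 'k mor \<Rightarrow> 'k mor \<Rightarrow> 'k mor" where
  "tcomp t X Y Z g f = compA t (summands X) (summands Y) (summands Z) g f"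

text \<open>The identity of \<open>X\<close> in the idempotent completion is \<^term>\<open>idem X\<close>.\<close>

definition thom :: "'k::field \<Rightarrow> 'k tobj \<Rightarrow> 'k tobj \<Rightarrow> 'k mor set" where
  "thom t X Y = {f \<in> homA (summands X) (summands Y).
     tcomp t X X Y f (idem X) = f \<and> tcomp t X Y Y (idem Y) f = f}"

definition dsum :: "nat set list \<Rightarrow> 'k::field tobj" where
  "dsum xs = Obj xs (idA xs)"

abbreviation ob :: "nat set \<Rightarrow> 'k::field tobj" where
  "ob x \<equiv> dsum [x]"

definition mat1 :: "(arel \<Rightarrow> 'k::field) \<Rightarrow> 'k mor" where
  "mat1 f = (\<lambda>i j. if i = 0 \<and> j = 0 then f else 0)"

definition is_iso :: "'k::field \<Rightarrow> 'k tobj \<Rightarrow> 'k tobj \<Rightarrow> 'k mor \<Rightarrow> bool" where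
  "is_iso t X Y f \<longleftrightarrow> f \<in> thom t X Y
     \<and> (\<exists>g\<in>thom t Y X. tcomp t X Y X g f = idem X \<and> tcomp t Y X Y f g = idem Y)"

definition is_mono :: "'k::field \<Rightarrow> 'k tobj \<Rightarrow> 'k tobj \<Rightarrow> 'k mor \<Rightarrow> bool" where
  "is_mono t X Y f \<longleftrightarrow> f \<in> thom t X Y
     \<and> (\<forall>W. is_tobj t W \<longrightarrow> (\<forall>g\<in>thom t W X. \<forall>h\<in>thom t W X.
            tcomp t W X Y f g = tcomp t W X Y f h \<longrightarrow> g = h))"

definition is_simple :: "'k::field \<Rightarrow> 'k tobj \<Rightarrow> bool" where
  "is_simple t X \<longleftrightarrow> is_tobj t X \<and> idem X \<noteq> 0
     \<and> (\<forall>Y f. is_tobj t Y \<and> is_mono t Y X f \<and> f \<noteq> 0 \<longrightarrow> is_iso t Y X f)"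

definition is_summand :: "'k::field \<Rightarrow> 'k tobj \<Rightarrow> 'k tobj \<Rightarrow> bool" where
  "is_summand t Y Z \<longleftrightarrow>
     (\<exists>i\<in>thom t Y Z. \<exists>q\<in>thom t Z Y. tcomp t Y Z Y q i = idem Y)"

section \<open>Internal dimension\<close>

definition tens :: "'k::field tobj \<Rightarrow> 'k tobj \<Rightarrow> 'k tobj" where
  "tens X Y = Obj (tens_list (summands X) (summands Y))
     (tensA (summands X) (summands X) (summands Y) (summands Y) (idem X) (idem Y))"

definition dual :: "'k::field tobj \<Rightarrow> 'k tobj" where
  "dual X = Obj (summands X) (dualA (idem X))"

definition tunit :: "'k::field tobj" where
  "tunit = ob {}"

definition ev :: "'k::field \<Rightarrow> 'k tobj \<Rightarrow> 'k mor" where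
  "ev t X = tcomp t (tens (dual X) X) (tens (dual X) X) tunit
     (evA (summands X)) (idem (tens (dual X) X))"

definition coev :: "'k::field \<Rightarrow> 'k tobj \<Rightarrow> 'k mor" where
  "coev t X = tcomp t tunit (tens X (dual X)) (tens X (dual X))
     (idem (tens X (dual X))) (coevA (summands X))"

definition braid :: "'k::field \<Rightarrow> 'k tobj \<Rightarrow> 'k tobj \<Rightarrow> 'k mor" where
  "braid t X Y = tcomp t (tens X Y) (tens Y X) (tens Y X) (idem (tens Y X))
     (tcomp t (tens X Y) (tens X Y) (tens Y X)
        (braidA (summands X) (summands Y)) (idem (tens X Y)))"

text \<open>The categorical trace of \<open>f : X \<rightarrow> X\<close> is the composite
  \<open>I \<rightarrow> X \<otimes> X\<^sup>\<or> \<rightarrow> X \<otimes> X\<^sup>\<or> \<rightarrow> X\<^sup>\<or> \<otimes> X \<rightarrow> I\<close> of coevaluation, \<open>f \<otimes> id\<close>, symmetry and evaluation,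
  which is an element of \<open>End(I)\<close>.  The latter is identified with the field by taking the
  coefficient of the only relation \<open>{}\<close> between empty sets, which is the identity of \<open>I\<close>.\<close>

definition cat_trace :: "'k::field \<Rightarrow> 'k tobj \<Rightarrow> 'k mor \<Rightarrow> 'k" where
  "cat_trace t X f =
     (let XD = tens X (dual X); DX = tens (dual X) X;
          fD = tensA (summands X) (summands X) (summands X) (summands X) f (idem (dual X))
      in tcomp t tunit DX tunit (ev t X)
           (tcomp t tunit XD DX (braid t X (dual X))
              (tcomp t tunit XD XD fD (coev t X)))) 0 0 {}"

definition cat_dim :: "'k::field \<Rightarrow> 'k tobj \<Rightarrow> 'k" where
  "cat_dim t X = cat_trace t X (idem X)"

section \<open>Simple objects\<close>

text \<open>A subobject in \<open>A\<close> of \<open>x\<close> is an image \<open>y\<close> of \<open>x\<close> under a map of sets, and a surjection in \<open>A\<close>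
  from \<open>y\<close> to \<open>z\<close> is an injective map of sets from \<open>z\<close> to \<open>y\<close>.\<close>

definition subquotient :: "nat set \<Rightarrow> nat set \<Rightarrow> bool" where
  "subquotient z x \<longleftrightarrow> finite z
     \<and> (\<exists>(y :: nat set) q e. q ` x = y \<and> inj_on e z \<and> e ` z \<subseteq> y)"

definition proper_subquotient :: "nat set \<Rightarrow> nat set \<Rightarrow> bool" where
  "proper_subquotient z x \<longleftrightarrow> subquotient z x \<and> \<not> (\<exists>h. bij_betw h z x)"

text \<open>\<open>is_lower t x p\<close> states that the image of the idempotent \<open>p\<close> of \<open>[x]\<close> is the direct summand
  \<open>[x]\<^sup>1\<close>.  Its inclusion into \<open>[x]\<close> is \<open>p\<close> itself.\<close>

definition is_lower :: "'k::field \<Rightarrow> nat set \<Rightarrow> 'k mor \<Rightarrow> bool" where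
  "is_lower t x p \<longleftrightarrow> is_tobj t (Obj [x] p)
     \<and> (\<exists>zs. (\<forall>z\<in>set zs. proper_subquotient z x) \<and> is_summand t (Obj [x] p) (dsum zs))
     \<and> (\<forall>z. proper_subquotient z x \<longrightarrow> (\<forall>f\<in>thom t (ob z) (ob x).
           \<exists>g\<in>thom t (ob z) (Obj [x] p). f = tcomp t (ob z) (Obj [x] p) (ob x) p g))"

text \<open>A permutation \<open>s\<close> of \<open>x\<close> is identified with the \<open>A\<close>-automorphism given by the map \<open>inv s\<close>, so
  that the identification is a group homomorphism; \<open>upper_act\<close> is its action on the direct summand
  of \<open>[x]\<close> that belongs to the idempotent \<open>e\<close>.\<close>

definition upper_act :: "'k::field \<Rightarrow> nat set \<Rightarrow> 'k mor \<Rightarrow> (nat \<Rightarrow> nat) \<Rightarrow> 'k mor" where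
  "upper_act t x e s =
     compA t [x] [x] [x] e (compA t [x] [x] [x] (mat1 (bas (graph_rel x x (inv s)))) e)"

text \<open>\<open>is_top_family t n X\<close> states that the objects \<open>X lam\<close>, for \<open>lam\<close> a partition of \<open>n\<close>, are
  the simple constituents of \<open>U = [n]\<^sup>0\<close>, the complement of \<open>[n]\<^sup>1\<close>: with \<open>V lam\<close> denoting the
  irreducible module \<^term>\<open>specht lam\<close>, there is an \<open>S\<^sub>n\<close>-equivariant isomorphism to \<open>U\<close> from
  the direct sum of the objects \<open>V lam \<otimes> X lam\<close>.  This determines every \<open>X lam\<close> up to isomorphism.

  A morphism from \<open>V \<otimes> X\<close> to \<open>U\<close>, for a vector space \<open>V\<close>, is a linear map \<open>\<iota>\<close> from \<open>V\<close> to
  \<open>Hom(X, U)\<close>.  As \<open>V \<otimes> X\<close> is a direct sum of copies of \<open>X\<close> indexed by a basis of \<open>V\<close>, the maps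
  \<open>\<iota> lam\<close> together give an isomorphism iff the morphisms \<open>\<iota> lam b\<close>, for \<open>b\<close> in a basis
  \<open>B lam\<close>, are the inclusions of a direct sum decomposition of \<open>U\<close>, with projections \<open>\<pi> lam b\<close>.\<close>

definition is_top_family :: "'k::field \<Rightarrow> nat \<Rightarrow> (nat list \<Rightarrow> 'k tobj) \<Rightarrow> bool" where
  "is_top_family t n X \<longleftrightarrow>
     (\<forall>lam\<in>partitions_of n. is_simple t (X lam)) \<and>
     (\<exists>p e U (\<iota> :: nat list \<Rightarrow> ((nat \<Rightarrow> nat) \<Rightarrow> 'k) \<Rightarrow> 'k mor) B
        (\<pi> :: nat list \<Rightarrow> ((nat \<Rightarrow> nat) \<Rightarrow> 'k) \<Rightarrow> 'k mor).
        is_lower t {1..n} p \<and> e = idA [{1..n}] - p \<and> U = Obj [{1..n}] e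
      \<and> (\<forall>lam\<in>partitions_of n.
           (\<forall>v\<in>specht lam. \<iota> lam v \<in> thom t (X lam) U)
         \<and> (\<forall>v\<in>specht lam. \<forall>w\<in>specht lam. \<iota> lam (v + w) = \<iota> lam v + \<iota> lam w)
         \<and> (\<forall>c. \<forall>v\<in>specht lam. \<iota> lam (fscale c v) = (\<lambda>i j. fscale c (\<iota> lam v i j)))
         \<and> (\<forall>s\<in>perms n. \<forall>v\<in>specht lam.
              \<iota> lam (perm_act s v) = tcomp t (X lam) U U (upper_act t {1..n} e s) (\<iota> lam v)))
      \<and> (\<forall>lam\<in>partitions_of n. is_basis (B lam) (specht lam)
           \<and> (\<forall>b\<in>B lam. \<pi> lam b \<in> thom t U (X lam)))
      \<and> (\<forall>lam\<in>partitions_of n. \<forall>mu\<in>partitions_of n. \<forall>b\<in>B lam. \<forall>c\<in>B mu.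
           tcomp t (X mu) U (X lam) (\<pi> lam b) (\<iota> mu c)
             = (if lam = mu \<and> b = c then idem (X lam) else 0))
      \<and> (\<Sum>lam\<in>partitions_of n. \<Sum>b\<in>B lam. tcomp t U (X lam) U (\<iota> lam b) (\<pi> lam b)) = e)"

end

theory Submission
  imports Defs "HOL-Combinatorics.Cycles"
begin

text \<open>Let \<open>e\<close> be the idempotent of \<open>[n]\<^sup>0\<close> and \<open>\<Psi>(s)\<close> the trace of the action of a permutation \<open>s\<close>
  on \<open>[n]\<^sup>0\<close>, so that \<open>\<Psi>\<close> is the sum of the \<open>dim(X lam) \<chi>\<^sup>lam\<close>.  As \<open>e\<close> kills every relation that
  factors through a smaller set, the traces of \<open>e\<close> composed with arbitrary relations are determined
  by \<open>\<Psi>\<close>.  Inverting the trace form over the poset of equivalence relations expresses the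
  coefficient of \<open>s\<close> in \<open>e\<close>, which is 1 for the identity and 0 otherwise, as the convolution of \<open>\<Psi>\<close>
  with the class function \<open>G(s)\<close>, the sum of \<open>1 / (t)\<^sub>n\<^sub>+\<^sub>k\<close> with \<open>k = card B\<close> over
  all subsets \<open>B\<close> permuted by \<open>s\<close>.
  Now pair with the Young symmetrizer \<open>c\<close> of \<open>lam\<close>: characters are orthogonal to it unless they
  belong to \<open>lam\<close>, and \<open>G\<close> multiplies it by a scalar.

  This scalar is the sum of \<open>c(s) G(s)\<close>.  For fixed \<open>B\<close> the signs of the column permutations cancel
  unless \<open>B\<close> has at most one cell in each column, and the resulting sum over such \<open>B\<close> is a product,
  obtained by adding one column after the other.  The sum over cycle types leads to the same
  computation with rows and columns exchanged, because the sign \<open>(-1)\<^sup>\<ell>\<close> times the Charlier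
  polynomial, as a class function, is \<open>sign s\<close> times a sum over the subsets that are permuted.\<close>

section \<open>Coarsenings and saturated sets\<close>

text \<open>The idempotent \<open>e\<close> is given only by its universal property, without a
  formula. What can be used is that its complement factors through smaller sets and so has
  coefficient 0 at every permutation. The trace form sends relations \<open>r\<close> and
  \<open>q\<close> to \<open>t\<close> to the number of classes of their join. Counting functions by
  their kernel writes this power as a sum of falling factorials (t)_j over the common coarsenings
  with j classes. The Gram matrix is thus triangular times diagonal times transpose, and the
  diagonal entries are nonzero as \<open>t\<close> is no natural number. Below a permutation the
  poset is Boolean, its elements being partial matchings; a matching with a pairs has 2n - a
  classes, which is n + k if k points of one copy stay unmatched. This is the index of the falling
  factorial in G. The powers of \<open>t\<close> make identities between composites of relations
  awkward. They are checked on matrices indexed by subsets, where a power of \<open>t\<close>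
  becomes the same power of 2. That the Young symmetrizer has a nonzero square follows from
  positivity over the integers, in place of the hook length formula.\<close>

lemma bij_betw_quotient_funcset:
  assumes "equiv S q"
  shows "bij_betw (\<lambda>g. \<lambda>x\<in>S. g (q `` {x})) ((S // q) \<rightarrow>\<^sub>E V) {f \<in> S \<rightarrow>\<^sub>E V. q \<subseteq> kernel_on S f}"
    (is "bij_betw ?F ?A ?B")
\<comment> \<open>The inverse evaluates at a chosen representative of each class; the functions on
  the right are constant on classes.\<close>
proof (rule bij_betwI[where g = "\<lambda>f. \<lambda>X\<in>S // q. f (SOME x. x \<in> X)"])
  have q: "q \<subseteq> S \<times> S" using assms by (auto simp: equiv_def refl_on_def)
  have cls: "q `` {u} = q `` {v}" if "(u, v) \<in> q" for u v
    using equiv_class_eq[OF assms that] .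
  show "?F \<in> ?A \<rightarrow> ?B"
    using q cls by (fastforce simp: kernel_on_def quotient_def)
  have some: "(SOME x. x \<in> X) \<in> X" if "X \<in> S // q" for X
    using that assms by (metis in_quotient_imp_non_empty some_in_eq)
  show "(\<lambda>f. \<lambda>X\<in>S // q. f (SOME x. x \<in> X)) \<in> ?B \<rightarrow> ?A"
    using some in_quotient_imp_subset[OF assms] by fastforce
  show "(\<lambda>X\<in>S // q. ?F g (SOME x. x \<in> X)) = g" if "g \<in> ?A" for g
  proof
    fix X
    show "(\<lambda>X\<in>S // q. ?F g (SOME x. x \<in> X)) X = g X"
    proof (cases "X \<in> S // q")
      case True
      then obtain a where a: "a \<in> S" "X = q `` {a}" by (auto simp: quotient_def)
      define b where "b = (SOME x. x \<in> X)"
      have "b \<in> X" unfolding b_def by (rule some[OF True])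
      then have "(a, b) \<in> q" using a by auto
      then have "q `` {b} = X" "b \<in> S" using cls[of a b] a q by auto
      then show ?thesis using True by (simp flip: b_def)
    next
      case False
      then show ?thesis using that by (auto simp: PiE_def extensional_def)
    qed
  qed
  show "?F (\<lambda>X\<in>S // q. f (SOME x. x \<in> X)) = f" if "f \<in> ?B" for f
  proof
    fix x
    show "?F (\<lambda>X\<in>S // q. f (SOME x. x \<in> X)) x = f x"
    proof (cases "x \<in> S")
      case True
      then have X: "q `` {x} \<in> S // q" by (auto simp: quotient_def)
      have "(x, SOME y. y \<in> q `` {x}) \<in> q" using some[OF X] by auto
      then have "f (SOME y. y \<in> q `` {x}) = f x" using that by (auto simp: kernel_on_def)
      then show ?thesis using True X by simp
    next
      case False
      then show ?thesis using that by (auto simp: PiE_def extensional_def)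
    qed
  qed
qed

lemma equiv_kernel_on: "equiv S (kernel_on S f)"
  by (auto simp: kernel_on_def equiv_def refl_on_def sym_def trans_def)

text \<open>Turns the count of functions on \<open>S\<close> with exact kernel \<open>q\<close> into
  a count of injections from the quotient, hence into a falling factorial.\<close>

lemma kernel_on_quotient_funcset:
  assumes "equiv S q" "g \<in> (S // q) \<rightarrow>\<^sub>E V"
  shows "kernel_on S (\<lambda>x\<in>S. g (q `` {x})) = q \<longleftrightarrow> inj_on g (S // q)"
proof
  have q: "q \<subseteq> S \<times> S" using assms by (auto simp: equiv_def refl_on_def)
  show "inj_on g (S // q)" if k: "kernel_on S (\<lambda>x\<in>S. g (q `` {x})) = q"
  proof (rule inj_onI)
    fix X Y assume X: "X \<in> S // q" and Y: "Y \<in> S // q" and e: "g X = g Y"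
    obtain a b where ab: "a \<in> S" "X = q `` {a}" "b \<in> S" "Y = q `` {b}"
      using X Y by (auto simp: quotient_def)
    then have "(a, b) \<in> kernel_on S (\<lambda>x\<in>S. g (q `` {x}))" using e by (auto simp: kernel_on_def)
    then show "X = Y" using k ab equiv_class_eq[OF assms(1)] by auto
  qed
  show "kernel_on S (\<lambda>x\<in>S. g (q `` {x})) = q" if i: "inj_on g (S // q)"
  proof (intro set_eqI, clarify)
    fix a b
    have "g (q `` {a}) = g (q `` {b}) \<longleftrightarrow> (a, b) \<in> q" if "a \<in> S" "b \<in> S"
      using that i assms(1) by (simp add: inj_on_eq_iff quotientI eq_equiv_class_iff)
    then show "(a, b) \<in> kernel_on S (\<lambda>x\<in>S. g (q `` {x})) \<longleftrightarrow> (a, b) \<in> q"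
      using q by (auto simp: kernel_on_def)
  qed
qed

text \<open>Subtraction on \<open>nat\<close> truncates, but as soon as some index exceeds
  \<open>N\<close>, the factor at i = \<open>N\<close> makes both products 0.\<close>

lemma falling_of_nat: "falling (of_nat N :: 'a::comm_ring_1) k = of_nat (\<Prod>i<k. N - i)"
proof (cases "k \<le> N")
  case True
  then have "(\<Prod>i<k. of_nat N - of_nat i :: 'a) = (\<Prod>i<k. of_nat (N - i))"
    by (intro prod.cong) auto
  then show ?thesis by (simp add: falling_def)
next
  case False
  then have "N \<in> {..<k}" by auto
  then have "(\<Prod>i<k. of_nat N - of_nat i :: 'a) = 0"
    by (intro prod_zero bexI[of _ N]) auto
  moreover have "(\<Prod>i<k. N - i) = 0" using \<open>N \<in> {..<k}\<close>
    by (intro prod_zero bexI[of _ N]) auto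
  ultimately show ?thesis by (simp only: falling_def of_nat_0)
qed

definition coarsenings :: "'a set \<Rightarrow> 'a rel \<Rightarrow> 'a rel set" where
  "coarsenings S q = {q'. equiv S q' \<and> q \<subseteq> q'}"

lemma finite_coarsenings: "finite S \<Longrightarrow> finite (coarsenings S q)"
  by (rule finite_subset[of _ "Pow (S \<times> S)"]) (auto simp: coarsenings_def equiv_def refl_on_def)

text \<open>Double counting of the functions from \<open>S\<close> to an \<open>N\<close>-element
  set that are constant on the classes of \<open>q\<close>: they are the functions on the quotient,
  and sorting them by their kernel, a coarsening of \<open>q\<close>, gives the left-hand
  side.\<close>

lemma sum_coarsenings_nat:
  fixes N :: nat
  assumes "finite S" "equiv S q"
  shows "(\<Sum>q'\<in>coarsenings S q. \<Prod>i<card (S // q'). N - i) = N ^ card (S // q)"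
proof -
  let ?B = "\<lambda>q. {f \<in> S \<rightarrow>\<^sub>E {..<N}. q \<subseteq> kernel_on S f}"
  let ?K = "\<lambda>q. {f \<in> S \<rightarrow>\<^sub>E {..<N}. kernel_on S f = q}"
  have fin: "finite (S // q')" if "equiv S q'" for q'
    using assms(1) that by (meson finite_quotient equiv_def refl_on_def)
  have "N ^ card (S // q) = card ((S // q) \<rightarrow>\<^sub>E {..<N})"
    using fin[OF assms(2)] by (simp add: card_funcsetE)
  also have "\<dots> = card (?B q)"
    by (rule bij_betw_same_card[OF bij_betw_quotient_funcset[OF assms(2)]])
  also have "?B q = (\<Union>q'\<in>coarsenings S q. ?K q')"
    using equiv_kernel_on by (auto simp: coarsenings_def)
  also have "card \<dots> = (\<Sum>q'\<in>coarsenings S q. card (?K q'))"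
    by (rule card_UN_disjoint) (auto simp: finite_coarsenings assms finite_PiE)
  also have "\<dots> = (\<Sum>q'\<in>coarsenings S q. \<Prod>i<card (S // q'). N - i)"
  proof (rule sum.cong[OF refl])
    fix q' assume "q' \<in> coarsenings S q"
    then have e: "equiv S q'" by (simp add: coarsenings_def)
    have "bij_betw (\<lambda>g. \<lambda>x\<in>S. g (q' `` {x})) {g \<in> (S // q') \<rightarrow>\<^sub>E {..<N}. inj_on g (S // q')} (?K q')"
    proof (rule bij_betw_imageI)
      note b = bij_betw_quotient_funcset[OF e, where V = "{..<N}"]
      show "inj_on (\<lambda>g. \<lambda>x\<in>S. g (q' `` {x})) {g \<in> (S // q') \<rightarrow>\<^sub>E {..<N}. inj_on g (S // q')}"
        using b by (auto simp: bij_betw_def intro: inj_on_subset)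
      have "?K q' = {f \<in> ?B q'. kernel_on S f = q'}" by auto
      also have "\<dots> = (\<lambda>g. \<lambda>x\<in>S. g (q' `` {x})) ` {g \<in> (S // q') \<rightarrow>\<^sub>E {..<N}. inj_on g (S // q')}"
        unfolding bij_betw_imp_surj_on[OF b, symmetric]
        using kernel_on_quotient_funcset[OF e, where V = "{..<N}"] by blast
      finally show "(\<lambda>g. \<lambda>x\<in>S. g (q' `` {x})) ` {g \<in> (S // q') \<rightarrow>\<^sub>E {..<N}. inj_on g (S // q')} = ?K q'" ..
    qed
    from bij_betw_same_card[OF this, symmetric]
    show "card (?K q') = (\<Prod>i<card (S // q'). N - i)"
      using fin[OF e] card_inj_on_subset_funcset[of "S // q'" "{..<N}" "S // q'"]
      by (simp add: atLeast0LessThan)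
  qed
  finally show ?thesis ..
qed

lemma poly_falling: "poly (falling [:0, 1:] k) t = falling (t :: 'a::comm_ring_1) k"
  by (simp add: falling_def poly_prod)

text \<open>Both sides are polynomials in \<open>t\<close> that agree at every natural number.
  Applied to a join, the identity splits a power of \<open>t\<close> into contributions of the
  common coarsenings, which diagonalizes the trace form.\<close>

lemma sum_coarsenings_falling:
  fixes t :: "'k::field_char_0"
  assumes "finite S" "equiv S q"
  shows "(\<Sum>q'\<in>coarsenings S q. falling t (card (S // q'))) = t ^ card (S // q)"
proof -
  \<comment> \<open>At the argument \<open>[:0, 1:]\<close>, \<open>falling\<close> is the falling
    factorial as a polynomial.\<close>
  let ?P = "(\<Sum>q'\<in>coarsenings S q. falling [:0, 1:] (card (S // q'))) - monom 1 (card (S // q)) :: 'k poly"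
  have "poly ?P (of_nat N) = 0" for N
  proof -
    have "poly ?P (of_nat N) = of_nat (\<Sum>q'\<in>coarsenings S q. \<Prod>i<card (S // q'). N - i) - of_nat (N ^ card (S // q))"
      unfolding poly_diff poly_sum poly_falling falling_of_nat poly_monom by simp
    then show ?thesis using sum_coarsenings_nat[OF assms, of N] by simp
  qed
  then have "range of_nat \<subseteq> {x. poly ?P x = 0}" by auto
  moreover have "infinite (range (of_nat :: nat \<Rightarrow> 'k))"
    by (rule range_inj_infinite[OF inj_of_nat])
  ultimately have "infinite {x. poly ?P x = 0}" by (rule infinite_super)
  then have "?P = 0" using poly_roots_finite by blast
  from arg_cong[OF this, of "\<lambda>p. poly p t"]
  show ?thesis unfolding poly_diff poly_sum poly_falling poly_monom poly_0 by simp
qed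

text \<open>For an equivalence relation these are the unions of classes. They determine the
  relation, can be tested on generators, and number 2 to the number of classes; so they replace
  arguments about paths in generated equivalence relations.\<close>

definition sat :: "'a rel \<Rightarrow> 'a set \<Rightarrow> bool" where
  "sat r c \<longleftrightarrow> (\<forall>(u, v)\<in>r. u \<in> c \<longleftrightarrow> v \<in> c)"

text \<open>The classes of \<open>Q\<close> are the traces on \<open>T\<close> of those classes of
  \<open>R\<close> that meet \<open>T\<close>. Extending a saturated \<open>D\<close> is forced on
  these classes and free on the remaining ones, which gives the power of 2. When \<open>T\<close> is
  the outer part of a glued diagram, the exponent counts its closed components.\<close>

lemma card_sat_extensions:
  assumes "finite S" "equiv S R" "T \<subseteq> S" "D \<subseteq> T"
  defines "Q \<equiv> R \<inter> T \<times> T"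
  shows "card {C \<in> Pow S. sat R C \<and> C \<inter> T = D} =
    (if sat Q D then 2 ^ (card (S // R) - card (T // Q)) else 0)"
    and "card (T // Q) \<le> card (S // R)" and "equiv T Q"
proof -
  have R: "R \<subseteq> S \<times> S" using assms by (auto simp: equiv_def refl_on_def)
  have refl: "(x, x) \<in> R" if "x \<in> S" for x using assms(2) that by (auto simp: equiv_def refl_on_def)
  have symR: "(y, x) \<in> R" if "(x, y) \<in> R" for x y using assms(2) that by (auto simp: equiv_def sym_def)
  have transR: "(x, z) \<in> R" if "(x, y) \<in> R" "(y, z) \<in> R" for x y z
    using assms(2) that by (auto simp: equiv_def trans_def)
  show eq: "equiv T Q"
  proof (rule equivI)
    show "Q \<subseteq> T \<times> T" by (auto simp: Q_def)
    show "refl_on T Q" using assms(3) refl by (auto simp: Q_def refl_on_def)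
    show "sym Q" using symR by (auto simp: Q_def sym_def)
    show "trans Q" using transR unfolding Q_def trans_def by blast
  qed
  let ?M = "{X \<in> S // R. X \<inter> T \<noteq> {}}"
  have fS: "finite (S // R)" using assms(1) R by (rule finite_quotient)
  have img: "(\<lambda>X. X \<inter> T) ` ?M = T // Q"
  proof (intro set_eqI iffI)
    fix Y assume "Y \<in> (\<lambda>X. X \<inter> T) ` ?M"
    then obtain a b where "Y = R `` {a} \<inter> T" "b \<in> Y" by (auto simp: quotient_def)
    then have "b \<in> T" "(a, b) \<in> R" by auto
    moreover then have "R `` {a} = R `` {b}" using equiv_class_eq[OF assms(2)] by blast
    ultimately have "b \<in> T" "Y = Q `` {b}" using \<open>Y = _\<close> by (auto simp: Q_def)
    then show "Y \<in> T // Q" by (auto simp: quotient_def)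
  next
    fix Y assume "Y \<in> T // Q"
    then obtain a where "a \<in> T" "Y = Q `` {a}" by (auto simp: quotient_def)
    then have "Y = R `` {a} \<inter> T" "a \<in> Y" "a \<in> S" using refl assms(3) by (auto simp: Q_def)
    then show "Y \<in> (\<lambda>X. X \<inter> T) ` ?M" by (intro image_eqI[of _ _ "R `` {a}"]) (auto simp: quotient_def)
  qed
  have inj: "inj_on (\<lambda>X. X \<inter> T) ?M"
  proof (rule inj_onI)
    fix X Y assume X: "X \<in> ?M" and Y: "Y \<in> ?M" and e: "X \<inter> T = Y \<inter> T"
    then have "X \<inter> Y \<noteq> {}" by auto
    then show "X = Y" using X Y quotient_disj[OF assms(2)] by auto
  qed
  have cM: "card (T // Q) = card ?M" using card_image[OF inj] img by simp
  then show "card (T // Q) \<le> card (S // R)" using fS by (simp add: card_mono)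
  have cdiff: "card (S // R - ?M) = card (S // R) - card (T // Q)"
    using cM fS by (simp add: card_Diff_subset)
  show "card {C \<in> Pow S. sat R C \<and> C \<inter> T = D} = (if sat Q D then 2 ^ (card (S // R) - card (T // Q)) else 0)"
  proof (cases "sat Q D")
    case False
    have "sat Q D" if "sat R C" "C \<inter> T = D" for C
      using that by (fastforce simp: sat_def Q_def)
    then have "{C \<in> Pow S. sat R C \<and> C \<inter> T = D} = {}" using False by blast
    then have "card {C \<in> Pow S. sat R C \<and> C \<inter> T = D} = 0" by (metis card.empty)
    then show ?thesis using False by simp
  next
    case True
    \<comment> \<open>\<open>K\<close> is the free choice among the classes that miss
      \<open>T\<close>; the classes that meet \<open>D\<close> are forced. The inverse
      \<open>k\<close> reads the free part off again.\<close>
    define h where "h K = {x \<in> S. R `` {x} \<in> K \<or> R `` {x} \<inter> D \<noteq> {}}" for K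
    define k where "k C = {X \<in> S // R - ?M. X \<inter> C \<noteq> {}}" for C
    have cls: "R `` {x} = R `` {y}" if "(x, y) \<in> R" for x y
      using equiv_class_eq[OF assms(2) that] .
    have D: "R `` {x} \<inter> D \<noteq> {} \<longleftrightarrow> x \<in> D" if "x \<in> T" for x
    proof
      assume "R `` {x} \<inter> D \<noteq> {}"
      then obtain y where "(x, y) \<in> R" "y \<in> D" by auto
      then have "(x, y) \<in> Q" using that assms(4) by (auto simp: Q_def)
      then show "x \<in> D" using True \<open>y \<in> D\<close> unfolding sat_def by fast
    next
      assume "x \<in> D"
      then show "R `` {x} \<inter> D \<noteq> {}" using refl[of x] assms(3,4) by blast
    qed
    have "bij_betw h (Pow (S // R - ?M)) {C \<in> Pow S. sat R C \<and> C \<inter> T = D}"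
    proof (rule bij_betwI[where g = k])
      show "h \<in> Pow (S // R - ?M) \<rightarrow> {C \<in> Pow S. sat R C \<and> C \<inter> T = D}"
      proof (rule funcsetI)
        fix K assume K: "K \<in> Pow (S // R - ?M)"
        have "x \<in> h K \<longleftrightarrow> y \<in> h K" if "(x, y) \<in> R" for x y
          using that R cls[OF that] by (auto simp: h_def)
        then have "sat R (h K)" unfolding sat_def by fast
        moreover have "x \<in> h K \<longleftrightarrow> x \<in> D" if x: "x \<in> T" for x
        proof -
          have "x \<in> S" using x assms(3) by blast
          then have "x \<in> R `` {x} \<inter> T" using x refl by simp
          then have "R `` {x} \<notin> K" using K by blast
          then show ?thesis using D[OF x] \<open>x \<in> S\<close> unfolding h_def by simp
        qed
        then have "h K \<inter> T = D" using assms(4) by blast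
        moreover have "h K \<subseteq> S" by (simp add: h_def)
        ultimately show "h K \<in> {C \<in> Pow S. sat R C \<and> C \<inter> T = D}" by simp
      qed
      show "k (h K) = K" if K: "K \<in> Pow (S // R - ?M)" for K
      proof (rule set_eqI)
        fix X
        show "X \<in> k (h K) \<longleftrightarrow> X \<in> K"
        proof
          assume "X \<in> k (h K)"
          then obtain x where X: "X \<in> S // R" "X \<inter> T = {}" and x: "x \<in> X" "x \<in> h K" by (auto simp: k_def)
          then have "R `` {x} = X" using cls by (auto simp: quotient_def)
          then show "X \<in> K" using x X assms(4) by (auto simp: h_def)
        next
          assume X: "X \<in> K"
          then have "X \<in> S // R - ?M" using K by blast
          then obtain a where "a \<in> S" "X = R `` {a}" by (auto simp: quotient_def)
          then have "a \<in> X \<inter> h K" using X refl by (simp add: h_def)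
          then show "X \<in> k (h K)" using \<open>X \<in> S // R - ?M\<close> unfolding k_def by blast
        qed
      qed
      show "h (k C) = C" if C: "C \<in> {C \<in> Pow S. sat R C \<and> C \<inter> T = D}" for C
      proof (rule set_eqI)
        fix x
        have CS: "C \<subseteq> S" and satC: "sat R C" and CT: "C \<inter> T = D" using C by simp_all
        show "x \<in> h (k C) \<longleftrightarrow> x \<in> C"
        proof (cases "x \<in> S")
          case x: True
          have c: "R `` {x} \<inter> C \<noteq> {} \<longleftrightarrow> x \<in> C"
            using satC refl[OF x] unfolding sat_def by fast
          have "R `` {x} \<in> S // R" using x by (rule quotientI)
          then have "R `` {x} \<in> k C \<longleftrightarrow> R `` {x} \<inter> T = {} \<and> x \<in> C"
            using c by (simp add: k_def)
          moreover have "R `` {x} \<inter> D \<noteq> {} \<longleftrightarrow> R `` {x} \<inter> T \<noteq> {} \<and> x \<in> C"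
          proof
            show "R `` {x} \<inter> D \<noteq> {} \<Longrightarrow> R `` {x} \<inter> T \<noteq> {} \<and> x \<in> C" using c CT by blast
            assume "R `` {x} \<inter> T \<noteq> {} \<and> x \<in> C"
            then obtain y where y: "(x, y) \<in> R" "y \<in> T" "x \<in> C" by auto
            then have "y \<in> C" using satC unfolding sat_def by fast
            then show "R `` {x} \<inter> D \<noteq> {}" using y CT by blast
          qed
          ultimately show ?thesis using x unfolding h_def by (simp, argo)
        next
          case False
          then show ?thesis using CS by (auto simp: h_def)
        qed
      qed
      show "k \<in> {C \<in> Pow S. sat R C \<and> C \<inter> T = D} \<rightarrow> Pow (S // R - ?M)"
        by (auto simp: k_def)
    qed
    from bij_betw_same_card[OF this]
    have "card {C \<in> Pow S. sat R C \<and> C \<inter> T = D} = card (Pow (S // R - ?M))" ..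
    then show ?thesis using True cdiff fS by (simp only: card_Pow if_True finite_Diff)
  qed
qed

lemma card_sat:
  assumes "finite S" "equiv S R"
  shows "card {C \<in> Pow S. sat R C} = 2 ^ card (S // R)"
  using card_sat_extensions(1)[OF assms empty_subsetI, of "{}"] by (simp add: sat_def)

text \<open>The class of a point under one relation is saturated for it, hence for the other one,
  whose classes therefore cannot leave it.\<close>

lemma sat_eqI:
  assumes "equiv S r" "equiv S s" "\<And>c. c \<subseteq> S \<Longrightarrow> sat r c \<longleftrightarrow> sat s c"
  shows "r = s"
proof -
  have *: "r \<subseteq> s" if r: "equiv S r" and s: "equiv S s" and sat: "\<And>c. c \<subseteq> S \<Longrightarrow> sat s c \<Longrightarrow> sat r c" for r s
  proof (rule subrelI)
    fix u v assume uv: "(u, v) \<in> r"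
    have sub: "s \<subseteq> S \<times> S" "r \<subseteq> S \<times> S" using r s by (simp_all add: equiv_def)
    have "u \<in> S" using uv sub by auto
    have "x \<in> s `` {u} \<longleftrightarrow> y \<in> s `` {u}" if "(x, y) \<in> s" for x y
      using s that unfolding equiv_def sym_def trans_def by blast
    then have "sat s (s `` {u})"
      unfolding sat_def by auto
    moreover have "s `` {u} \<subseteq> S" using sub by auto
    ultimately have "sat r (s `` {u})" using sat by simp
    moreover have "(u, u) \<in> s"
      using s \<open>u \<in> S\<close> by (simp add: equiv_def refl_on_def)
    ultimately show "(u, v) \<in> s" using uv unfolding sat_def by fast
  qed
  show ?thesis
    using *[OF assms(1,2)] *[OF assms(2,1)] assms(3) by (intro equalityI) simp_all
qed

lemma sat_trancl: "sat (r\<^sup>+) c \<longleftrightarrow> sat r c"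
proof
  assume r: "sat r c"
  have "u \<in> c \<longleftrightarrow> v \<in> c" if "(u, v) \<in> r\<^sup>+" for u v
    using that by induct (use r in \<open>auto simp: sat_def\<close>)
  then show "sat (r\<^sup>+) c" by (auto simp: sat_def)
qed (auto simp: sat_def)

lemma sat_Un: "sat (r \<union> s) c \<longleftrightarrow> sat r c \<and> sat s c"
  by (auto simp: sat_def)

text \<open>Reflexivity is asked of the union, because in a glued diagram each of the two relations
  lives on a part of the points.\<close>

lemma equiv_trancl_Un:
  assumes "refl_on S (r \<union> s)" "sym r" "sym s" "r \<union> s \<subseteq> S \<times> S"
  shows "equiv S ((r \<union> s)\<^sup>+)"
proof (rule equivI)
  show "(r \<union> s)\<^sup>+ \<subseteq> S \<times> S" using assms(4) by (rule trancl_subset_Sigma)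
  show "refl_on S ((r \<union> s)\<^sup>+)" using assms(1) by (auto simp: refl_on_def)
  show "sym ((r \<union> s)\<^sup>+)" using assms by (intro sym_trancl sym_Un)
qed simp

lemma equiv_inj_preimage:
  fixes j :: "'a \<Rightarrow> 'b"
  assumes "finite U" "inj_on j U" "equiv (j ` U) Q"
  defines "Q' \<equiv> {(u, v). u \<in> U \<and> v \<in> U \<and> (j u, j v) \<in> Q}"
  shows "equiv U Q'" "card (U // Q') = card ((j ` U) // Q)"
    "\<And>C. C \<subseteq> U \<Longrightarrow> sat Q (j ` C) \<longleftrightarrow> sat Q' C"
proof -
  have Q: "Q \<subseteq> j ` U \<times> j ` U" using assms(3) by (simp add: equiv_def)
  show e: "equiv U Q'"
  proof (rule equivI)
    show "Q' \<subseteq> U \<times> U" by (auto simp: Q'_def)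
    show "refl_on U Q'" using assms(3) by (auto simp: Q'_def refl_on_def equiv_def)
    show "sym Q'" using assms(3) by (auto simp: Q'_def sym_def equiv_def)
    show "trans Q'" using assms(3) unfolding Q'_def trans_def equiv_def by blast
  qed
  have jC: "j u \<in> j ` C \<longleftrightarrow> u \<in> C" if "u \<in> U" "C \<subseteq> U" for u C
    using that assms(2) by (auto simp: inj_on_def)
  show s: "sat Q (j ` C) \<longleftrightarrow> sat Q' C" if "C \<subseteq> U" for C
  proof
    assume l: "sat Q (j ` C)"
    have "u \<in> C \<longleftrightarrow> v \<in> C" if uv: "(u, v) \<in> Q'" for u v
    proof -
      have "u \<in> U" "v \<in> U" "(j u, j v) \<in> Q" using uv by (auto simp: Q'_def)
      then have "j u \<in> j ` C \<longleftrightarrow> j v \<in> j ` C" using l unfolding sat_def by fast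
      then show ?thesis using jC \<open>C \<subseteq> U\<close> \<open>u \<in> U\<close> \<open>v \<in> U\<close> by simp
    qed
    then show "sat Q' C" unfolding sat_def by fast
  next
    assume r: "sat Q' C"
    have "u \<in> j ` C \<longleftrightarrow> v \<in> j ` C" if uv: "(u, v) \<in> Q" for u v :: 'b
    proof -
      obtain u' v' where "u = j u'" "v = j v'" "u' \<in> U" "v' \<in> U" using uv Q by blast
      moreover then have "(u', v') \<in> Q'" using uv by (simp add: Q'_def)
      then have "u' \<in> C \<longleftrightarrow> v' \<in> C" using r unfolding sat_def by fast
      ultimately show ?thesis using jC[OF _ \<open>C \<subseteq> U\<close>] by simp
    qed
    then show "sat Q (j ` C)" unfolding sat_def by fast
  qed
  \<comment> \<open>The numbers of classes are compared through the numbers of saturated sets, which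
    are powers of 2.\<close>
  have "bij_betw ((`) j) {C \<in> Pow U. sat Q' C} {C \<in> Pow (j ` U). sat Q C}"
  proof (rule bij_betw_imageI)
    show "inj_on ((`) j) {C \<in> Pow U. sat Q' C}"
      using inj_on_image_Pow[OF assms(2)] by (rule inj_on_subset) auto
    show "(`) j ` {C \<in> Pow U. sat Q' C} = {C \<in> Pow (j ` U). sat Q C}"
      using s by (auto simp: subset_image_iff)
  qed
  from bij_betw_same_card[OF this] have "(2::nat) ^ card (U // Q') = 2 ^ card ((j ` U) // Q)"
    using card_sat[OF assms(1) e] card_sat[OF _ assms(3)] assms(1) by simp
  then show "card (U // Q') = card ((j ` U) // Q)" by simp
qed

text \<open>The entry at (\<open>a\<close>, \<open>b\<close>) of a 0-1 matrix attached to
  \<open>r\<close>, with rows indexed by the subsets of \<open>x\<close> and columns by those of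
  \<open>y\<close>. It tells whether the two subsets together form a union of classes.\<close>

definition relsem :: "arel \<Rightarrow> nat set \<Rightarrow> nat set \<Rightarrow> bool" where
  "relsem r a b \<longleftrightarrow> sat r (a <+> b)"

lemma relsemI: "(\<And>u v. (u, v) \<in> r \<Longrightarrow> u \<in> a <+> b \<longleftrightarrow> v \<in> a <+> b) \<Longrightarrow> relsem r a b"
  unfolding relsem_def sat_def by fast

text \<open>This entry is 1 for every relation, so the scalar of a scaled matrix can be read off
  there.\<close>

lemma relsem_empty: "r \<in> arels x y \<Longrightarrow> relsem r {} {}"
  by (rule relsemI) auto

lemma subset_Plus_iff: "C \<subseteq> x <+> y \<longleftrightarrow> (\<exists>a b. a \<subseteq> x \<and> b \<subseteq> y \<and> C = a <+> b)"
proof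
  assume C: "C \<subseteq> x <+> y"
  have "C = (Inl -` C) <+> (Inr -` C)"
  proof (rule set_eqI)
    fix u show "u \<in> C \<longleftrightarrow> u \<in> (Inl -` C) <+> (Inr -` C)" by (cases u) auto
  qed
  moreover have "Inl -` C \<subseteq> x" "Inr -` C \<subseteq> y" using C by auto
  ultimately show "\<exists>a b. a \<subseteq> x \<and> b \<subseteq> y \<and> C = a <+> b" by metis
qed auto

lemma Plus_mono: "a \<subseteq> x \<Longrightarrow> b \<subseteq> y \<Longrightarrow> a <+> b \<subseteq> x <+> y"
  by auto

lemma Plus_eq_Plus_iff: "a <+> b = a' <+> b' \<longleftrightarrow> a = a' \<and> b = b'"
proof
  assume e: "a <+> b = a' <+> b'"
  have "Inl u \<in> a <+> b \<longleftrightarrow> Inl u \<in> a' <+> b'" "Inr v \<in> a <+> b \<longleftrightarrow> Inr v \<in> a' <+> b'" for u v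
    using e by simp_all
  then show "a = a' \<and> b = b'" by auto
qed simp

section \<open>Composition of relations\<close>

lemma finite_arels: "finite x \<Longrightarrow> finite y \<Longrightarrow> finite (arels x y)"
  by (rule finite_subset[of _ "Pow ((x <+> y) \<times> (x <+> y))"]) (auto simp: arels_def equiv_def)

lemma relsem_inject:
  assumes "r \<in> arels x y" "s \<in> arels x y"
    and "\<And>a b. a \<subseteq> x \<Longrightarrow> b \<subseteq> y \<Longrightarrow> relsem r a b \<longleftrightarrow> relsem s a b"
  shows "r = s"
proof (rule sat_eqI)
  show "equiv (x <+> y) r" "equiv (x <+> y) s" using assms by (simp_all add: arels_def)
  show "sat r c \<longleftrightarrow> sat s c" if "c \<subseteq> x <+> y" for c
    using that assms(3) unfolding subset_Plus_iff relsem_def by metis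
qed

lemma sat_image: "sat (map_prod f f ` r) C \<longleftrightarrow> sat r (f -` C)"
  by (auto simp: sat_def)

lemma vimage_Plus:
  "map_sum id Inl -` (a <+> (b <+> c)) = a <+> b"
  "map_sum id Inr -` (a <+> (b <+> c)) = a <+> c"
  "Inr -` (a <+> (b <+> c)) = b <+> c"
proof -
  show "map_sum id Inl -` (a <+> (b <+> c)) = a <+> b"
  proof (rule set_eqI)
    fix u show "u \<in> map_sum id Inl -` (a <+> (b <+> c)) \<longleftrightarrow> u \<in> a <+> b" by (cases u) auto
  qed
  show "map_sum id Inr -` (a <+> (b <+> c)) = a <+> c"
  proof (rule set_eqI)
    fix u show "u \<in> map_sum id Inr -` (a <+> (b <+> c)) \<longleftrightarrow> u \<in> a <+> c" by (cases u) auto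
  qed
qed auto

text \<open>The condition for a triple of subsets is a condition on each pair of neighbours, which
  is the shape of a summand in a matrix product.\<close>

lemma sat_fibre: "sat (fibre_rel r s) (a <+> (b <+> c)) \<longleftrightarrow> relsem r a b \<and> relsem s b c"
  unfolding fibre_rel_def sat_trancl sat_Un sat_image relsem_def vimage_Plus ..

lemma equiv_fibre:
  assumes "r \<in> arels x y" "s \<in> arels y z"
  shows "equiv (x <+> (y <+> z)) (fibre_rel r s)"
  unfolding fibre_rel_def
proof (rule equiv_trancl_Un)
  have r: "r \<subseteq> (x <+> y) \<times> (x <+> y)" "refl_on (x <+> y) r" "sym r"
    and s: "s \<subseteq> (y <+> z) \<times> (y <+> z)" "refl_on (y <+> z) s" "sym s"
    using assms by (simp_all add: arels_def equiv_def)
  define I where "I = (map_sum id Inl :: nat + nat \<Rightarrow> nat + (nat + nat))"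
  define J where "J = (Inr :: nat + nat \<Rightarrow> nat + (nat + nat))"
  let ?r = "map_prod I I ` r" and ?s = "map_prod J J ` s"
  show "sym (map_prod (map_sum id Inl) (map_sum id Inl) ` r)" "sym (map_prod Inr Inr ` s)" using r(3) s(3) by (auto simp: sym_def)
  have "?r \<subseteq> (x <+> (y <+> z)) \<times> (x <+> (y <+> z))"
  proof
    fix p assume "p \<in> ?r"
    then obtain u v where "(u, v) \<in> r" "p = (I u, I v)" by auto
    moreover have "I u \<in> x <+> (y <+> z)" if "u \<in> x <+> y" for u
      using that by (cases u) (auto simp: I_def)
    ultimately show "p \<in> (x <+> (y <+> z)) \<times> (x <+> (y <+> z))" using r(1) by auto
  qed
  moreover have "?s \<subseteq> (x <+> (y <+> z)) \<times> (x <+> (y <+> z))" using s(1) by (auto simp: J_def)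
  ultimately show "map_prod (map_sum id Inl) (map_sum id Inl) ` r \<union> map_prod Inr Inr ` s
      \<subseteq> (x <+> (y <+> z)) \<times> (x <+> (y <+> z))" unfolding I_def J_def by blast
  have "(w, w) \<in> ?r \<union> ?s" if "w \<in> x <+> (y <+> z)" for w
  proof (cases w)
    case (Inl i)
    then have "(Inl i, Inl i) \<in> r" using that r(2) by (auto simp: refl_on_def)
    then have "map_prod I I (Inl i, Inl i) \<in> ?r" by (rule imageI)
    then show ?thesis using Inl by (simp add: I_def)
  next
    case (Inr v)
    then have "(v, v) \<in> s" using that s(2) by (auto simp: refl_on_def)
    then have "map_prod J J (v, v) \<in> ?s" by (rule imageI)
    then show ?thesis using Inr by (simp add: J_def)
  qed
  then show "refl_on (x <+> (y <+> z)) (map_prod (map_sum id Inl) (map_sum id Inl) ` r \<union> map_prod Inr Inr ` s)"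
    unfolding refl_on_def I_def J_def by blast
qed

text \<open>The exponent of \<open>t\<close> produced by a composition: the number of components of
  the glued diagram that lie wholly in the middle object. The classes of \<open>comp_rel\<close>
  correspond to the components that reach \<open>x\<close> or \<open>z\<close>.\<close>

definition loops :: "nat set \<Rightarrow> nat set \<Rightarrow> nat set \<Rightarrow> arel \<Rightarrow> arel \<Rightarrow> nat" where
  "loops x y z r s = card ((x <+> (y <+> z)) // fibre_rel r s) - card ((x <+> z) // comp_rel x z r s)"

text \<open>For given outer subsets, the middle subset is forced on the components that reach
  \<open>x\<close> or \<open>z\<close> and free on the closed ones. Hence composition at
  \<open>t\<close> = 2 is multiplication of the 0-1 matrices.\<close>

lemma relsem_comp:
  assumes "finite x" "finite y" "finite z" "r \<in> arels x y" "s \<in> arels y z"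
  shows "comp_rel x z r s \<in> arels x z"
    and "a \<subseteq> x \<Longrightarrow> c \<subseteq> z \<Longrightarrow> card {b \<in> Pow y. relsem r a b \<and> relsem s b c}
      = (if relsem (comp_rel x z r s) a c then 2 ^ loops x y z r s else 0)"
proof -
  let ?S = "x <+> (y <+> z)" and ?R = "fibre_rel r s" and ?U = "x <+> z"
  \<comment> \<open>\<open>j\<close> embeds the outer points into the glued diagram.\<close>
  define j where "j = (map_sum id Inr :: nat + nat \<Rightarrow> nat + (nat + nat))"
  let ?T = "j ` ?U"
  have inj: "inj_on j ?U" by (rule inj_onI) (auto simp: j_def map_sum_def split: sum.splits)
  have fin: "finite ?S" "finite ?U" using assms by auto
  have T: "?T \<subseteq> ?S" by (auto simp: j_def)
  have e: "equiv ?S ?R" using assms(4,5) by (rule equiv_fibre)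
  let ?Q = "?R \<inter> ?T \<times> ?T"
  note ext = card_sat_extensions[OF fin(1) e T]
  have eQ: "equiv ?T ?Q" by (rule ext(3)[OF empty_subsetI])
  have comp: "comp_rel x z r s = {(u, v). u \<in> ?U \<and> v \<in> ?U \<and> (j u, j v) \<in> ?Q}"
    by (auto simp: comp_rel_def j_def)
  note pre = equiv_inj_preimage[OF fin(2) inj eQ, folded comp]
  show "comp_rel x z r s \<in> arels x z" using pre(1) by (simp add: arels_def)
  assume a: "a \<subseteq> x" and c: "c \<subseteq> z"
  have D: "a <+> c \<subseteq> ?U" using a c by auto
  then have jD: "j ` (a <+> c) \<subseteq> ?T" by (rule image_mono)
  have jT: "(a <+> (b <+> c)) \<inter> ?T = j ` (a <+> c)" if "a \<subseteq> x" "c \<subseteq> z" for a b c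
  proof (rule set_eqI)
    fix u
    show "u \<in> (a <+> (b <+> c)) \<inter> ?T \<longleftrightarrow> u \<in> j ` (a <+> c)"
    proof (cases u)
      case (Inl i)
      then show ?thesis using that by (auto simp: j_def image_iff Bex_def)
    next
      case (Inr v)
      then show ?thesis using that by (cases v) (auto simp: j_def image_iff Bex_def)
    qed
  qed
  have mem: "C \<inter> ?T = j ` (a <+> c) \<longleftrightarrow> (\<exists>b\<subseteq>y. C = a <+> (b <+> c))" if "C \<subseteq> ?S" for C
  proof
    obtain a' bc where C: "C = a' <+> bc" "a' \<subseteq> x" "bc \<subseteq> y <+> z" using \<open>C \<subseteq> ?S\<close> subset_Plus_iff by metis
    then obtain b c' where bc: "bc = b <+> c'" "b \<subseteq> y" "c' \<subseteq> z" using subset_Plus_iff by metis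
    have eq: "C \<inter> ?T = j ` (a' <+> c')" unfolding C(1) bc(1) using C(2) bc(3) by (rule jT)
    assume "C \<inter> ?T = j ` (a <+> c)"
    then have "j ` (a' <+> c') = j ` (a <+> c)" using eq by simp
    moreover have "a' <+> c' \<subseteq> ?U" using C(2) bc(3) by (rule Plus_mono)
    ultimately have "a' <+> c' = a <+> c" using D by (simp add: inj_on_image_eq_iff[OF inj])
    then have "a' = a" "c' = c" by (simp_all add: Plus_eq_Plus_iff)
    then show "\<exists>b\<subseteq>y. C = a <+> (b <+> c)" using C(1) bc(1,2) by auto
  next
    assume "\<exists>b\<subseteq>y. C = a <+> (b <+> c)"
    then obtain b where "C = a <+> (b <+> c)" by auto
    then show "C \<inter> ?T = j ` (a <+> c)" using jT[OF a c] by simp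
  qed
  have "bij_betw (\<lambda>b. a <+> (b <+> c)) {b \<in> Pow y. relsem r a b \<and> relsem s b c}
      {C \<in> Pow ?S. sat ?R C \<and> C \<inter> ?T = j ` (a <+> c)}"
  proof (rule bij_betw_imageI)
    show "inj_on (\<lambda>b. a <+> (b <+> c)) {b \<in> Pow y. relsem r a b \<and> relsem s b c}"
      by (rule inj_onI) (auto simp: Plus_eq_Plus_iff)
    have sub: "a <+> (b <+> c) \<subseteq> ?S" if "b \<subseteq> y" for b using that a c by (intro Plus_mono)
    show "(\<lambda>b. a <+> (b <+> c)) ` {b \<in> Pow y. relsem r a b \<and> relsem s b c} =
       {C \<in> Pow ?S. sat ?R C \<and> C \<inter> ?T = j ` (a <+> c)}"
      (is "?f ` ?A = ?B")
    proof (intro equalityI subsetI)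
      fix C assume "C \<in> ?f ` ?A"
      then obtain b where b: "b \<subseteq> y" "relsem r a b" "relsem s b c" "C = a <+> (b <+> c)" by auto
      then show "C \<in> ?B" using jT[OF a c, of b] sub[of b] by (simp add: sat_fibre)
    next
      fix C assume C: "C \<in> ?B"
      then obtain b where "b \<subseteq> y" "C = a <+> (b <+> c)" using mem[of C] by auto
      then show "C \<in> ?f ` ?A" using C by (simp add: sat_fibre)
    qed
  qed
  from bij_betw_same_card[OF this] ext(1)[OF jD]
  show "card {b \<in> Pow y. relsem r a b \<and> relsem s b c}
      = (if relsem (comp_rel x z r s) a c then 2 ^ loops x y z r s else 0)"
    by (simp add: loops_def relsem_def pre(2) pre(3)[OF D])
qed

section \<open>Linear extension of the composition of relations\<close>

lemma fscale_simps [simp]: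
  "fscale c (fscale d f) = fscale (c * d) f" "fscale 1 f = f" "fscale c 0 = 0"
  "fscale c (f + g) = fscale c f + fscale c g"
  by (auto simp: fscale_def fun_eq_iff algebra_simps)

lemma sum_fun_apply: "sum f A u = (\<Sum>i\<in>A. f i u)"
  by (induction A rule: infinite_finite_induct) auto

lemma hom0_expand:
  assumes "finite x" "finite y" "f \<in> hom0 x y"
  shows "f = (\<Sum>r\<in>arels x y. fscale (f r) (bas r))"
proof
  fix u
  show "f u = (\<Sum>r\<in>arels x y. fscale (f r) (bas r)) u"
    using assms(3) finite_arels[OF assms(1,2)]
    by (auto simp: sum_fun_apply fscale_def bas_def hom0_def if_distrib cong: if_cong)
qed

text \<open>Composition, tensor product, dual and trace are linear in each morphism, so this rule
  reduces their identities to single relations.\<close>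

lemma hom0_induct [consumes 3, case_names zero add scale bas]:
  assumes "finite x" "finite y" "f \<in> hom0 x y"
    and "P 0" and "\<And>f g. P f \<Longrightarrow> P g \<Longrightarrow> P (f + g)" and "\<And>c f. P f \<Longrightarrow> P (fscale c f)"
    and "\<And>r. r \<in> arels x y \<Longrightarrow> P (bas r)"
  shows "P f"
proof -
  have "P (\<Sum>r\<in>A. fscale (f r) (bas r))" if "finite A" "A \<subseteq> arels x y" for A
    using that by (induction A) (simp_all add: assms)
  from this[OF finite_arels[OF assms(1,2)] subset_refl] show ?thesis
    by (subst hom0_expand[OF assms(1-3)])
qed

lemma hom0_zero [simp]: "0 \<in> hom0 x y" and hom0_add: "f \<in> hom0 x y \<Longrightarrow> g \<in> hom0 x y \<Longrightarrow> f + g \<in> hom0 x y"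
  and hom0_scale: "f \<in> hom0 x y \<Longrightarrow> fscale c f \<in> hom0 x y"
  and hom0_bas: "r \<in> arels x y \<Longrightarrow> bas r \<in> hom0 x y"
  by (auto simp: hom0_def fscale_def bas_def)

lemma hom0_sum: "(\<And>i. i \<in> I \<Longrightarrow> f i \<in> hom0 x y) \<Longrightarrow> sum f I \<in> hom0 x y"
  by (induction I rule: infinite_finite_induct) (auto intro: hom0_add)

lemma comp0_linear:
  "comp0 t x y z (g + g') f = comp0 t x y z g f + comp0 t x y z g' f"
  "comp0 t x y z g (f + f') = comp0 t x y z g f + comp0 t x y z g f'"
  "comp0 t x y z (fscale c g) f = fscale c (comp0 t x y z g f)"
  "comp0 t x y z g (fscale c f) = fscale c (comp0 t x y z g f)"
  "comp0 t x y z 0 f = 0" "comp0 t x y z g 0 = 0"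
  by (auto simp: comp0_def fscale_def fun_eq_iff sum_distrib_left sum.distrib[symmetric] algebra_simps)

lemma comp0_sum:
  "comp0 t x y z (sum g' I) f = (\<Sum>i\<in>I. comp0 t x y z (g' i) f)"
  "comp0 t x y z g (sum f' I) = (\<Sum>i\<in>I. comp0 t x y z g (f' i))"
  by (induction I rule: infinite_finite_induct) (auto simp: comp0_linear)

lemma comp0_diff:
  "comp0 t x y z (g - g') f = comp0 t x y z g f - comp0 t x y z g' f"
  "comp0 t x y z g (f - f') = comp0 t x y z g f - comp0 t x y z g f'"
  by (auto simp: comp0_def fun_eq_iff sum_subtractf[symmetric] algebra_simps)

lemma comp0_bas:
  assumes "finite x" "finite y" "finite z" "r \<in> arels x y" "s \<in> arels y z"
  shows "comp0 t x y z (bas s) (bas r) = fscale (t ^ loops x y z r s) (bas (comp_rel x z r s))"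
proof
  fix u
  have "comp0 t x y z (bas s) (bas r) u = (\<Sum>r'\<in>arels x y. if r' = r then \<Sum>s'\<in>arels y z.
      if s' = s then t ^ loops x y z r s * bas (comp_rel x z r s) u else 0 else 0)"
    unfolding comp0_def by (intro sum.cong) (auto simp: bas_def delta_def loops_def intro!: sum.cong sum.neutral)
  then show "comp0 t x y z (bas s) (bas r) u = fscale (t ^ loops x y z r s) (bas (comp_rel x z r s)) u"
    using assms finite_arels by (simp add: fscale_def)
qed

lemma comp0_hom0:
  assumes "finite x" "finite y" "finite z"
  shows "comp0 t x y z g f \<in> hom0 x z"
proof -
  have "bas (comp_rel x z r s) u = (0::'a)" if "r \<in> arels x y" "s \<in> arels y z" "u \<notin> arels x z" for r s u
    using relsem_comp(1)[OF assms that(1,2)] that(3) by (auto simp: bas_def)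
  then show ?thesis unfolding hom0_def comp0_def by (auto intro!: sum.neutral)
qed

text \<open>A scaled diagram is encoded by the 0-1 matrix which it has in the case \<open>t = 2\<close>, with rows and
  columns indexed by subsets.  This matrix determines both the diagram and the exponent of \<open>t\<close>, so
  that equations between composites of diagrams can be checked for \<open>t = 2\<close>.\<close>

definition represents :: "'k::field \<Rightarrow> nat set \<Rightarrow> nat set \<Rightarrow> (arel \<Rightarrow> 'k) \<Rightarrow> (nat set \<Rightarrow> nat set \<Rightarrow> nat) \<Rightarrow> bool" where
  "represents t x y f M \<longleftrightarrow> (\<exists>k. \<exists>r\<in>arels x y. f = fscale (t ^ k) (bas r)
     \<and> (\<forall>a\<subseteq>x. \<forall>b\<subseteq>y. M a b = (if relsem r a b then 2 ^ k else 0)))"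

lemma represents_bas:
  "r \<in> arels x y \<Longrightarrow> represents t x y (bas r) (\<lambda>a b. if relsem r a b then 1 else 0)"
  unfolding represents_def by (rule exI[of _ 0]) auto

lemma represents_cong:
  assumes "represents t x y f M" "\<And>a b. a \<subseteq> x \<Longrightarrow> b \<subseteq> y \<Longrightarrow> M a b = N a b"
  shows "represents t x y f N"
  using assms unfolding represents_def by metis

text \<open>The entry at the empty sets is the full power of 2 and gives the exponent; the support
  then gives the relation. Equations that involve \<open>t\<close> are thus proved by comparing
  matrices of natural numbers.\<close>

lemma represents_unique:
  assumes "represents t x y f M" "represents t x y g N" "\<And>a b. a \<subseteq> x \<Longrightarrow> b \<subseteq> y \<Longrightarrow> M a b = N a b"
  shows "f = g"
proof -
  obtain k r where r: "r \<in> arels x y" "f = fscale (t ^ k) (bas r)"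
    "\<And>a b. a \<subseteq> x \<Longrightarrow> b \<subseteq> y \<Longrightarrow> M a b = (if relsem r a b then 2 ^ k else 0)"
    using assms(1) unfolding represents_def by metis
  obtain l s where s: "s \<in> arels x y" "g = fscale (t ^ l) (bas s)"
    "\<And>a b. a \<subseteq> x \<Longrightarrow> b \<subseteq> y \<Longrightarrow> N a b = (if relsem s a b then 2 ^ l else 0)"
    using assms(2) unfolding represents_def by metis
  have "k = l"
    using r(3)[of "{}" "{}"] s(3)[of "{}" "{}"] assms(3)[of "{}" "{}"] relsem_empty[OF r(1)] relsem_empty[OF s(1)]
    by simp
  moreover have "r = s"
  proof (rule relsem_inject[OF r(1) s(1)])
    fix a b assume "a \<subseteq> x" "b \<subseteq> y"
    then have "(if relsem r a b then 2 ^ k else 0) = (if relsem s a b then 2 ^ l else (0::nat))"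
      using r(3) s(3) assms(3) by metis
    then show "relsem r a b \<longleftrightarrow> relsem s a b" by (simp split: if_splits)
  qed
  ultimately show ?thesis using r s by simp
qed

text \<open>The exponents of the factors and the number of closed components add up, and the matrix
  product shows the same exponent at the base 2.\<close>

lemma represents_comp:
  assumes "finite x" "finite y" "finite z" "represents t x y f M" "represents t y z g N"
  shows "represents t x z (comp0 t x y z g f) (\<lambda>a c. \<Sum>b\<in>Pow y. M a b * N b c)"
proof -
  obtain k r where r: "r \<in> arels x y" "f = fscale (t ^ k) (bas r)"
    "\<And>a b. a \<subseteq> x \<Longrightarrow> b \<subseteq> y \<Longrightarrow> M a b = (if relsem r a b then 2 ^ k else 0)"
    using assms(4) unfolding represents_def by metis
  obtain l s where s: "s \<in> arels y z" "g = fscale (t ^ l) (bas s)"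
    "\<And>a b. a \<subseteq> y \<Longrightarrow> b \<subseteq> z \<Longrightarrow> N a b = (if relsem s a b then 2 ^ l else 0)"
    using assms(5) unfolding represents_def by metis
  show ?thesis unfolding represents_def
  proof (intro exI[of _ "k + l + loops x y z r s"] bexI[of _ "comp_rel x z r s"] conjI allI impI)
    show "comp_rel x z r s \<in> arels x z" using assms(1-3) r(1) s(1) by (rule relsem_comp)
    show "comp0 t x y z g f = fscale (t ^ (k + l + loops x y z r s)) (bas (comp_rel x z r s))"
      unfolding r(2) s(2) comp0_linear comp0_bas[OF assms(1-3) r(1) s(1)] by (simp add: power_add algebra_simps)
    fix a c assume a: "a \<subseteq> x" and c: "c \<subseteq> z"
    have "(\<Sum>b\<in>Pow y. M a b * N b c) = (\<Sum>b\<in>Pow y. if relsem r a b \<and> relsem s b c then 2 ^ (k + l) else 0)"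
      by (rule sum.cong) (use a c r(3) s(3) in \<open>auto simp: power_add\<close>)
    also have "\<dots> = 2 ^ (k + l) * card {b \<in> Pow y. relsem r a b \<and> relsem s b c}"
      using assms(2) by (simp add: sum.If_cases Int_def)
    finally show "(\<Sum>b\<in>Pow y. M a b * N b c) = (if relsem (comp_rel x z r s) a c then 2 ^ (k + l + loops x y z r s) else 0)"
      unfolding relsem_comp(2)[OF assms(1-3) r(1) s(1) a c] by (simp add: power_add)
  qed
qed

text \<open>On single relations this is associativity of the matrix product, that is, an exchange of
  two sums.\<close>

lemma comp0_assoc:
  assumes fin: "finite w" "finite x" "finite y" "finite z"
    and "f \<in> hom0 w x" "g \<in> hom0 x y" "h \<in> hom0 y z"
  shows "comp0 t w x z (comp0 t x y z h g) f = comp0 t w y z h (comp0 t w x y g f)"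
  using fin(1,2) assms(5)
proof (induction rule: hom0_induct)
  case (bas r)
  show ?case using fin(2,3) assms(6)
  proof (induction rule: hom0_induct)
    case (bas s)
    show ?case using fin(3,4) assms(7)
    proof (induction rule: hom0_induct)
      case (bas q)
      note R = represents_bas[OF \<open>r \<in> _\<close>, of t] represents_bas[OF \<open>s \<in> _\<close>, of t] represents_bas[OF bas, of t]
      show ?case 
        apply (rule represents_unique[OF represents_comp[OF fin(1,2,4) R(1) represents_comp[OF fin(2-4) R(2,3)]]
           represents_comp[OF fin(1,3,4) represents_comp[OF fin(1-3) R(1,2)] R(3)]])
        apply (simp only: sum_distrib_left sum_distrib_right mult.assoc)
        apply (rule sum.swap)
        done
    qed (simp_all only: comp0_linear)
  qed (simp_all only: comp0_linear)
qed (simp_all only: comp0_linear)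

section \<open>Tensor products and duals of relations\<close>

lemma Inl_mem_Plus [simp]: "Inl i \<in> x <+> y \<longleftrightarrow> i \<in> x" and Inr_mem_Plus [simp]: "Inr j \<in> x <+> y \<longleftrightarrow> j \<in> y"
  by auto

text \<open>A subset of \<open>obj_prod x y\<close> amounts to a pair of subsets, which is an index
  of a Kronecker product.\<close>

definition lpart :: "nat set \<Rightarrow> nat set" where "lpart A = {i. sum_encode (Inl i) \<in> A}"
definition rpart :: "nat set \<Rightarrow> nat set" where "rpart A = {i. sum_encode (Inr i) \<in> A}"

lemma sum_encode_eq_iff [simp]: "sum_encode u = sum_encode v \<longleftrightarrow> u = v"
  by (metis sum_encode_inverse)

lemma mem_obj_prod [simp]: "sum_encode u \<in> obj_prod x y \<longleftrightarrow> u \<in> x <+> y"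
  by (auto simp: obj_prod_def)

lemma parts_obj_prod [simp]: "lpart (obj_prod a b) = a" "rpart (obj_prod a b) = b"
  by (auto simp: lpart_def rpart_def)

lemma obj_prod_parts: "A = obj_prod (lpart A) (rpart A)"
proof (rule set_eqI)
  fix m
  obtain u where u: "m = sum_encode u" by (metis sum_decode_inverse)
  show "m \<in> A \<longleftrightarrow> m \<in> obj_prod (lpart A) (rpart A)"
    unfolding u by (cases u) (simp_all add: lpart_def rpart_def)
qed

lemma obj_prod_subset_iff: "obj_prod a b \<subseteq> obj_prod x y \<longleftrightarrow> a \<subseteq> x \<and> b \<subseteq> y"
proof
  assume "obj_prod a b \<subseteq> obj_prod x y"
  then have "sum_encode u \<in> obj_prod a b \<Longrightarrow> sum_encode u \<in> obj_prod x y" for u by blast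
  then have "u \<in> a <+> b \<Longrightarrow> u \<in> x <+> y" for u by simp
  from this[of "Inl _"] this[of "Inr _"] show "a \<subseteq> x \<and> b \<subseteq> y" by auto
next
  assume "a \<subseteq> x \<and> b \<subseteq> y"
  then show "obj_prod a b \<subseteq> obj_prod x y" unfolding obj_prod_def by (intro image_mono Plus_mono) simp_all
qed

lemma parts_subset: "A \<subseteq> obj_prod x y \<Longrightarrow> lpart A \<subseteq> x" "A \<subseteq> obj_prod x y \<Longrightarrow> rpart A \<subseteq> y"
  by (metis obj_prod_parts obj_prod_subset_iff)+

lemma finite_obj_prod: "finite x \<Longrightarrow> finite y \<Longrightarrow> finite (obj_prod x y)"
  by (simp add: obj_prod_def)

lemma sum_Pow_obj_prod:
  "(\<Sum>A\<in>Pow (obj_prod x y). h A) = (\<Sum>a\<in>Pow x. \<Sum>b\<in>Pow y. h (obj_prod a b))"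
  unfolding sum.cartesian_product
proof (rule sum.reindex_bij_witness[of _ "\<lambda>(a, b). obj_prod a b" "\<lambda>A. (lpart A, rpart A)"])
  fix A assume "A \<in> Pow (obj_prod x y)"
  then show "(case (lpart A, rpart A) of (a, b) \<Rightarrow> obj_prod a b) = A"
    "(lpart A, rpart A) \<in> Pow x \<times> Pow y"
    "(case (lpart A, rpart A) of (a, b) \<Rightarrow> h (obj_prod a b)) = h A"
    using parts_subset obj_prod_parts[symmetric] by simp_all
next
  fix p assume "p \<in> Pow x \<times> Pow y"
  then obtain a b where p: "p = (a, b)" "a \<subseteq> x" "b \<subseteq> y" by auto
  then show "(lpart (case p of (a, b) \<Rightarrow> obj_prod a b), rpart (case p of (a, b) \<Rightarrow> obj_prod a b)) = p" by simp
  show "(case p of (a, b) \<Rightarrow> obj_prod a b) \<in> Pow (obj_prod x y)"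
    using p(2,3) by (simp add: p(1) obj_prod_subset_iff)
qed

text \<open>No class of a product meets both halves, so the matrix of a tensor product is the
  Kronecker product of the matrices.\<close>

lemma relsem_prod: "relsem (prod_rel r r') A B \<longleftrightarrow> relsem r (lpart A) (lpart B) \<and> relsem r' (rpart A) (rpart B)"
proof -
  have l: "map_sum (sum_encode \<circ> Inl) (sum_encode \<circ> Inl) -` (A <+> B) = lpart A <+> lpart B"
  proof (rule set_eqI)
    fix u show "u \<in> map_sum (sum_encode \<circ> Inl) (sum_encode \<circ> Inl) -` (A <+> B) \<longleftrightarrow> u \<in> lpart A <+> lpart B"
      by (cases u) (simp_all add: lpart_def)
  qed
  have r: "map_sum (sum_encode \<circ> Inr) (sum_encode \<circ> Inr) -` (A <+> B) = rpart A <+> rpart B"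
  proof (rule set_eqI)
    fix u show "u \<in> map_sum (sum_encode \<circ> Inr) (sum_encode \<circ> Inr) -` (A <+> B) \<longleftrightarrow> u \<in> rpart A <+> rpart B"
      by (cases u) (simp_all add: rpart_def)
  qed
  show ?thesis unfolding relsem_def prod_rel_def sat_Un sat_image l r ..
qed

lemma equiv_disjoint_images:
  assumes "equiv S r" "equiv T s" "inj f" "inj g" "range f \<inter> range g = {}"
  shows "equiv (f ` S \<union> g ` T) (map_prod f f ` r \<union> map_prod g g ` s)"
proof (rule equivI)
  have r: "r \<subseteq> S \<times> S" "\<And>u. u \<in> S \<Longrightarrow> (u, u) \<in> r" "sym r" "trans r"
    and s: "s \<subseteq> T \<times> T" "\<And>u. u \<in> T \<Longrightarrow> (u, u) \<in> s" "sym s" "trans s"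
    using assms(1,2) by (simp_all add: equiv_def refl_on_def)
  show "map_prod f f ` r \<union> map_prod g g ` s \<subseteq> (f ` S \<union> g ` T) \<times> (f ` S \<union> g ` T)"
    using r(1) s(1) by auto
  have "(f u, f u) \<in> map_prod f f ` r" if "u \<in> S" for u
    using imageI[OF r(2)[OF that], of "map_prod f f"] by simp
  moreover have "(g u, g u) \<in> map_prod g g ` s" if "u \<in> T" for u
    using imageI[OF s(2)[OF that], of "map_prod g g"] by simp
  ultimately show "refl_on (f ` S \<union> g ` T) (map_prod f f ` r \<union> map_prod g g ` s)"
    unfolding refl_on_def by blast
  show "sym (map_prod f f ` r \<union> map_prod g g ` s)"
    using r(3) s(3) by (auto simp: sym_def)
  \<comment> \<open>The ranges of \<open>f\<close> and \<open>g\<close> are disjoint, so a pair that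
    starts in the range of \<open>f\<close> comes from \<open>r\<close>.\<close>
  have f: "(f u, w) \<in> map_prod f f ` r \<union> map_prod g g ` s \<longleftrightarrow> (\<exists>v. w = f v \<and> (u, v) \<in> r)" for u w
  proof
    assume "(f u, w) \<in> map_prod f f ` r \<union> map_prod g g ` s"
    then consider a b where "(a, b) \<in> r" "f u = f a" "w = f b" | a where "f u = g a" by auto
    then show "\<exists>v. w = f v \<and> (u, v) \<in> r"
    proof cases
      case 1
      then show ?thesis using assms(3) by (auto dest: injD)
    next
      case 2
      then have "f u \<in> range f \<inter> range g" by (metis IntI rangeI)
      then show ?thesis using assms(5) by simp
    qed
  next
    assume "\<exists>v. w = f v \<and> (u, v) \<in> r"
    then obtain v where "w = f v" "(u, v) \<in> r" by auto
    from imageI[OF this(2), of "map_prod f f"] this(1)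
    show "(f u, w) \<in> map_prod f f ` r \<union> map_prod g g ` s" by simp
  qed
  have g: "(g u, w) \<in> map_prod f f ` r \<union> map_prod g g ` s \<longleftrightarrow> (\<exists>v. w = g v \<and> (u, v) \<in> s)" for u w
  proof
    assume "(g u, w) \<in> map_prod f f ` r \<union> map_prod g g ` s"
    then consider a b where "(a, b) \<in> s" "g u = g a" "w = g b" | a where "f a = g u" by auto
    then show "\<exists>v. w = g v \<and> (u, v) \<in> s"
    proof cases
      case 1
      then show ?thesis using assms(4) by (auto dest: injD)
    next
      case 2
      then have "f a \<in> range f \<inter> range g" by (metis IntI rangeI)
      then show ?thesis using assms(5) by simp
    qed
  next
    assume "\<exists>v. w = g v \<and> (u, v) \<in> s"
    then obtain v where "w = g v" "(u, v) \<in> s" by auto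
    from imageI[OF this(2), of "map_prod g g"] this(1)
    show "(g u, w) \<in> map_prod f f ` r \<union> map_prod g g ` s" by simp
  qed
  show "trans (map_prod f f ` r \<union> map_prod g g ` s)"
  proof (rule transI)
    fix a b c assume ab: "(a, b) \<in> map_prod f f ` r \<union> map_prod g g ` s"
      and bc: "(b, c) \<in> map_prod f f ` r \<union> map_prod g g ` s"
    from ab consider u where "a = f u" | u where "a = g u" by auto
    then show "(a, c) \<in> map_prod f f ` r \<union> map_prod g g ` s"
    proof cases
      case 1
      obtain v where v: "b = f v" "(u, v) \<in> r" using ab f unfolding 1 by metis
      then obtain w where "c = f w" "(v, w) \<in> r" using bc f by metis
      then show ?thesis using transD[OF r(4)] v(2) f unfolding 1 by metis
    next
      case 2
      obtain v where v: "b = g v" "(u, v) \<in> s" using ab g unfolding 2 by metis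
      then obtain w where "c = g w" "(v, w) \<in> s" using bc g by metis
      then show ?thesis using transD[OF s(4)] v(2) g unfolding 2 by metis
    qed
  qed
qed

lemma prod_rel_arels:
  assumes "r \<in> arels x y" "r' \<in> arels x' y'"
  shows "prod_rel r r' \<in> arels (obj_prod x x') (obj_prod y y')"
proof -
  define f where "f = (map_sum (sum_encode \<circ> Inl) (sum_encode \<circ> Inl) :: nat + nat \<Rightarrow> nat + nat)"
  define g where "g = (map_sum (sum_encode \<circ> Inr) (sum_encode \<circ> Inr) :: nat + nat \<Rightarrow> nat + nat)"
  have fg: "inj f" "inj g" "range f \<inter> range g = {}"
    by (auto simp: f_def g_def inj_def map_sum_def split: sum.splits)
  have "f ` (x <+> y) \<union> g ` (x' <+> y') = obj_prod x x' <+> obj_prod y y'"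
    by (simp add: Plus_def obj_prod_def f_def g_def image_Un image_image Un_ac)
  moreover have "equiv (f ` (x <+> y) \<union> g ` (x' <+> y')) (map_prod f f ` r \<union> map_prod g g ` r')"
    using assms fg by (intro equiv_disjoint_images) (simp_all add: arels_def)
  ultimately show ?thesis by (simp add: arels_def prod_rel_def f_def g_def)
qed

lemma dual_rel_dual_rel [simp]: "dual_rel (dual_rel r) = r"
proof -
  have "case_sum Inr Inl (case_sum Inr Inl u) = u" for u :: "nat + nat" by (cases u) auto
  then show ?thesis by (simp add: dual_rel_def image_image case_prod_unfold map_prod_def)
qed

text \<open>Swapping the factors of a relation transposes its matrix.\<close>

lemma relsem_dual: "relsem (dual_rel r) b a \<longleftrightarrow> relsem r a b"
proof -
  have "case_sum Inr Inl -` (b <+> a) = a <+> b"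
  proof (rule set_eqI)
    fix u show "u \<in> case_sum Inr Inl -` (b <+> a) \<longleftrightarrow> u \<in> a <+> b" by (cases u) auto
  qed
  then show ?thesis unfolding relsem_def dual_rel_def sat_image by simp
qed

lemma dual_rel_arels:
  assumes "r \<in> arels x y" shows "dual_rel r \<in> arels y x"
proof -
  define f where "f = (case_sum Inr Inl :: nat + nat \<Rightarrow> nat + nat)"
  have "inj f" by (auto simp: f_def inj_def split: sum.splits)
  have im: "f ` (x <+> y) = y <+> x" by (force simp: f_def image_iff)
  have inv: "f (f u) = u" for u by (cases u) (auto simp: f_def)
  have "dual_rel r = {(u, v). u \<in> y <+> x \<and> v \<in> y <+> x \<and> (f u, f v) \<in> r}"
  proof (intro set_eqI, clarify)
    fix u v
    have "(u, v) \<in> dual_rel r \<longleftrightarrow> (f u, f v) \<in> r"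
    proof
      assume "(u, v) \<in> dual_rel r"
      then obtain a b where "(a, b) \<in> r" "u = f a" "v = f b" by (auto simp: dual_rel_def f_def)
      then show "(f u, f v) \<in> r" using inv by simp
    next
      assume "(f u, f v) \<in> r"
      from imageI[OF this, of "map_prod f f"] show "(u, v) \<in> dual_rel r"
        unfolding dual_rel_def f_def[symmetric] by (simp add: inv)
    qed
    moreover have "u \<in> y <+> x" "v \<in> y <+> x" if "(f u, f v) \<in> r"
    proof -
      have "f u \<in> x <+> y" "f v \<in> x <+> y" using assms that by (auto simp: arels_def equiv_def)
      then show "u \<in> y <+> x" "v \<in> y <+> x" using im inv by (metis imageI)+
    qed
    ultimately show "(u, v) \<in> dual_rel r \<longleftrightarrow> (u, v) \<in> {(u, v). u \<in> y <+> x \<and> v \<in> y <+> x \<and> (f u, f v) \<in> r}"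
      by auto
  qed
  moreover have "equiv (y <+> x) {(u, v). u \<in> y <+> x \<and> v \<in> y <+> x \<and> (f u, f v) \<in> r}"
  proof (rule equivI)
    have r: "\<And>u. u \<in> x <+> y \<Longrightarrow> (u, u) \<in> r" "sym r" "trans r"
      using assms by (simp_all add: arels_def equiv_def refl_on_def)
    have f: "f u \<in> x <+> y" if "u \<in> y <+> x" for u using that by (cases u) (auto simp: f_def)
    show "refl_on (y <+> x) {(u, v). u \<in> y <+> x \<and> v \<in> y <+> x \<and> (f u, f v) \<in> r}"
      using r(1) f by (simp add: refl_on_def)
    show "sym {(u, v). u \<in> y <+> x \<and> v \<in> y <+> x \<and> (f u, f v) \<in> r}"
      using r(2) by (simp add: sym_def)
    show "trans {(u, v). u \<in> y <+> x \<and> v \<in> y <+> x \<and> (f u, f v) \<in> r}"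
      using r(3) unfolding trans_def by blast
  qed auto
  ultimately show ?thesis by (simp add: arels_def)
qed

lemma dual0_bas: "dual0 (bas r) = bas (dual_rel r)"
proof -
  have "dual_rel u = r \<longleftrightarrow> u = dual_rel r" for u using dual_rel_dual_rel by metis
  then show ?thesis by (simp add: dual0_def bas_def)
qed

lemma dual0_linear:
  "dual0 (f + g) = dual0 f + dual0 g" "dual0 (fscale c f) = fscale c (dual0 f)" "dual0 0 = 0"
  by (auto simp: dual0_def fscale_def fun_eq_iff)

lemma dual0_sum: "dual0 (sum f I) = (\<Sum>i\<in>I. dual0 (f i))"
  by (induction I rule: infinite_finite_induct) (simp_all only: dual0_linear sum.infinite sum.empty sum.insert simp_thms)

lemma dual0_hom0: "f \<in> hom0 x y \<Longrightarrow> dual0 f \<in> hom0 y x"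
  using dual_rel_arels[of "dual_rel _" x y] by (auto simp: hom0_def dual0_def)

lemma tens0_linear:
  "tens0 x y x' y' (f + f') g = tens0 x y x' y' f g + tens0 x y x' y' f' g"
  "tens0 x y x' y' f (g + g') = tens0 x y x' y' f g + tens0 x y x' y' f g'"
  "tens0 x y x' y' (fscale c f) g = fscale c (tens0 x y x' y' f g)"
  "tens0 x y x' y' f (fscale c g) = fscale c (tens0 x y x' y' f g)"
  "tens0 x y x' y' 0 g = 0" "tens0 x y x' y' f 0 = 0"
  by (auto simp: tens0_def fscale_def fun_eq_iff sum_distrib_left sum.distrib[symmetric] algebra_simps)

lemma tens0_sum:
  "tens0 x y x' y' (sum f' I) g = (\<Sum>i\<in>I. tens0 x y x' y' (f' i) g)"
  "tens0 x y x' y' f (sum g' I) = (\<Sum>i\<in>I. tens0 x y x' y' f (g' i))"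
  by (induction I rule: infinite_finite_induct) (simp_all only: tens0_linear sum.infinite sum.empty sum.insert simp_thms)

lemma tens0_bas:
  assumes "finite x" "finite y" "finite x'" "finite y'" "r \<in> arels x y" "r' \<in> arels x' y'"
  shows "tens0 x y x' y' (bas r) (bas r') = bas (prod_rel r r')"
proof
  fix u
  have "tens0 x y x' y' (bas r) (bas r') u = (\<Sum>q\<in>arels x y. if q = r then \<Sum>q'\<in>arels x' y'.
      if q' = r' then bas (prod_rel r r') u else 0 else 0)"
    unfolding tens0_def by (intro sum.cong) (auto simp: bas_def intro!: sum.cong sum.neutral)
  then show "tens0 x y x' y' (bas r) (bas r') u = bas (prod_rel r r') u"
    using assms finite_arels by simp
qed

lemma tens0_hom0: "tens0 x y x' y' f g \<in> hom0 (obj_prod x x') (obj_prod y y')"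
proof -
  have "bas (prod_rel r s) u = (0::'a)" if "r \<in> arels x y" "s \<in> arels x' y'" "u \<notin> arels (obj_prod x x') (obj_prod y y')" for r s u
    using prod_rel_arels[OF that(1,2)] that(3) by (auto simp: bas_def)
  then show ?thesis unfolding hom0_def tens0_def by (auto intro!: sum.neutral)
qed

lemma represents_tens:
  assumes "finite x" "finite y" "finite x'" "finite y'" "represents t x y f M" "represents t x' y' g N"
  shows "represents t (obj_prod x x') (obj_prod y y') (tens0 x y x' y' f g)
    (\<lambda>A B. M (lpart A) (lpart B) * N (rpart A) (rpart B))"
proof -
  obtain k r where r: "r \<in> arels x y" "f = fscale (t ^ k) (bas r)"
    "\<And>a b. a \<subseteq> x \<Longrightarrow> b \<subseteq> y \<Longrightarrow> M a b = (if relsem r a b then 2 ^ k else 0)"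
    using assms(5) unfolding represents_def by metis
  obtain l s where s: "s \<in> arels x' y'" "g = fscale (t ^ l) (bas s)"
    "\<And>a b. a \<subseteq> x' \<Longrightarrow> b \<subseteq> y' \<Longrightarrow> N a b = (if relsem s a b then 2 ^ l else 0)"
    using assms(6) unfolding represents_def by metis
  show ?thesis unfolding represents_def
  proof (intro exI[of _ "k + l"] bexI[of _ "prod_rel r s"] conjI allI impI)
    show "prod_rel r s \<in> arels (obj_prod x x') (obj_prod y y')" using r(1) s(1) by (rule prod_rel_arels)
    show "tens0 x y x' y' f g = fscale (t ^ (k + l)) (bas (prod_rel r s))"
      unfolding r(2) s(2) tens0_linear tens0_bas[OF assms(1-4) r(1) s(1)] by (simp add: power_add algebra_simps)
    fix A B assume "A \<subseteq> obj_prod x x'" "B \<subseteq> obj_prod y y'"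
    then show "M (lpart A) (lpart B) * N (rpart A) (rpart B) = (if relsem (prod_rel r s) A B then 2 ^ (k + l) else 0)"
      using r(3) s(3) parts_subset by (simp add: relsem_prod power_add)
  qed
qed

lemma represents_dual:
  assumes "represents t x y f M"
  shows "represents t y x (dual0 f) (\<lambda>b a. M a b)"
proof -
  obtain k r where r: "r \<in> arels x y" "f = fscale (t ^ k) (bas r)"
    "\<And>a b. a \<subseteq> x \<Longrightarrow> b \<subseteq> y \<Longrightarrow> M a b = (if relsem r a b then 2 ^ k else 0)"
    using assms(1) unfolding represents_def by metis
  show ?thesis unfolding represents_def
    by (intro exI[of _ k] bexI[of _ "dual_rel r"]) (auto simp: r dual0_linear dual0_bas relsem_dual dual_rel_arels)
qed

section \<open>Matrices of identity, braiding, evaluation and coevaluation\<close>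

lemma relsem_kernel:
  assumes "a \<subseteq> x" "b \<subseteq> y"
  shows "relsem (kernel_on (x <+> y) h) a b \<longleftrightarrow>
    (\<forall>u\<in>x <+> y. \<forall>v\<in>x <+> y. h u = h v \<longrightarrow> (u \<in> a <+> b \<longleftrightarrow> v \<in> a <+> b))"
  unfolding relsem_def sat_def kernel_on_def by blast

lemma kernel_arels: "kernel_on (x <+> y) h \<in> arels x y"
  by (simp add: arels_def equiv_kernel_on)

lemma graph_rel_arels: "graph_rel x y f \<in> arels x y"
  by (simp add: graph_rel_def kernel_arels)

text \<open>A graph acts on subsets by taking preimages under \<open>f\<close>, so its matrix has
  exactly one entry 1 in each row.\<close>

lemma relsem_graph:
  assumes "a \<subseteq> x" "b \<subseteq> y" "f ` y \<subseteq> x"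
  shows "relsem (graph_rel x y f) a b \<longleftrightarrow> b = {j \<in> y. f j \<in> a}"
  unfolding graph_rel_def relsem_kernel[OF assms(1,2)]
proof
  assume l: "\<forall>u\<in>x <+> y. \<forall>v\<in>x <+> y. case_sum id f u = case_sum id f v \<longrightarrow> (u \<in> a <+> b) = (v \<in> a <+> b)"
  have "j \<in> b \<longleftrightarrow> f j \<in> a" if "j \<in> y" for j
    using l[rule_format, of "Inr j" "Inl (f j)"] that assms(3) by auto
  then show "b = {j \<in> y. f j \<in> a}" using assms(2) by blast
next
  assume b: "b = {j \<in> y. f j \<in> a}"
  have "u \<in> a <+> b \<longleftrightarrow> case_sum id f u \<in> a" if "u \<in> x <+> y" for u
    using that b by (cases u) auto
  then show "\<forall>u\<in>x <+> y. \<forall>v\<in>x <+> y. case_sum id f u = case_sum id f v \<longrightarrow> (u \<in> a <+> b) = (v \<in> a <+> b)"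
    by simp
qed

lemma represents_graph:
  assumes "f ` y \<subseteq> x"
  shows "represents t x y (bas (graph_rel x y f)) (\<lambda>a b. if b = {j \<in> y. f j \<in> a} then 1 else 0)"
  using represents_bas[OF graph_rel_arels[of x y f]]
  by (rule represents_cong) (simp add: relsem_graph assms)

lemma represents_id: "represents t x x (id0 x) (\<lambda>a b. if a = b then 1 else 0)"
  unfolding id0_def
  by (rule represents_cong[OF represents_graph]) auto

lemma represents_braid:
  "represents t (obj_prod x y) (obj_prod y x) (braid0 x y)
    (\<lambda>A B. if lpart A = rpart B \<and> rpart A = lpart B then 1 else 0)"
  unfolding braid0_def
proof (rule represents_cong[OF represents_graph])
  let ?f = "sum_encode \<circ> case_sum Inr Inl \<circ> sum_decode"
  show "?f ` obj_prod y x \<subseteq> obj_prod x y" by (force simp: obj_prod_def)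
  fix A B assume "A \<subseteq> obj_prod x y" "B \<subseteq> obj_prod y x"
  then obtain a b a' b' where ab: "A = obj_prod a b" "B = obj_prod b' a'" "a \<subseteq> x" "a' \<subseteq> x" "b \<subseteq> y" "b' \<subseteq> y"
    using parts_subset obj_prod_parts by metis
  have "{j \<in> obj_prod y x. ?f j \<in> A} = obj_prod b a"
  proof (rule set_eqI)
    fix m
    obtain u where u: "m = sum_encode u" by (metis sum_decode_inverse)
    show "m \<in> {j \<in> obj_prod y x. ?f j \<in> A} \<longleftrightarrow> m \<in> obj_prod b a"
      unfolding u using ab by (cases u) auto
  qed
  moreover have "obj_prod b' a' = obj_prod b a \<longleftrightarrow> b' = b \<and> a' = a"
    by (metis parts_obj_prod)
  ultimately show "(if B = {j \<in> obj_prod y x. ?f j \<in> A} then 1 else 0) =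
      (if lpart A = rpart B \<and> rpart A = lpart B then 1 else (0::nat))"
    by (auto simp: ab(1,2))
qed

lemma codiag_simps [simp]: "codiag (sum_encode (Inl i)) = i" "codiag (sum_encode (Inr i)) = i"
  by (simp_all add: codiag_def)

text \<open>The codiagonal joins the two copies of each point, so a saturated set consists of the
  same subset twice. Evaluation and coevaluation therefore have the Kronecker delta as their
  matrix.\<close>

lemma codiag_separates:
  assumes "A \<subseteq> obj_prod x x"
  shows "(\<forall>m\<in>obj_prod x x. \<forall>m'\<in>obj_prod x x. codiag m = codiag m' \<longrightarrow> (m \<in> A \<longleftrightarrow> m' \<in> A)) \<longleftrightarrow> lpart A = rpart A"
proof
  assume l: "\<forall>m\<in>obj_prod x x. \<forall>m'\<in>obj_prod x x. codiag m = codiag m' \<longrightarrow> (m \<in> A \<longleftrightarrow> m' \<in> A)"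
  have "i \<in> lpart A \<longleftrightarrow> i \<in> rpart A" if "i \<in> x" for i
    using l[rule_format, of "sum_encode (Inl i)" "sum_encode (Inr i)"] that
    by (simp add: lpart_def rpart_def)
  then show "lpart A = rpart A" using parts_subset[OF assms] by blast
next
  assume e: "lpart A = rpart A"
  have "m \<in> A \<longleftrightarrow> codiag m \<in> lpart A" for m
  proof -
    obtain u where u: "m = sum_encode u" by (metis sum_decode_inverse)
    show ?thesis unfolding u using e by (cases u) (auto simp: lpart_def rpart_def)
  qed
  then show "\<forall>m\<in>obj_prod x x. \<forall>m'\<in>obj_prod x x. codiag m = codiag m' \<longrightarrow> (m \<in> A \<longleftrightarrow> m' \<in> A)" by simp
qed

lemma represents_ev: "represents t (obj_prod x x) {} (ev0 x) (\<lambda>A B. if lpart A = rpart A then 1 else 0)"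
  unfolding ev0_def
proof (rule represents_cong[OF represents_bas[OF kernel_arels]])
  fix A B :: "nat set" assume A: "A \<subseteq> obj_prod x x" and B: "B \<subseteq> {}"
  have "relsem (kernel_on (obj_prod x x <+> {}) (case_sum codiag id)) A B \<longleftrightarrow> lpart A = rpart A"
    using B unfolding relsem_kernel[OF A B] codiag_separates[OF A, symmetric] by (simp add: Plus_def inj_image_mem_iff)
  then show "(if relsem (kernel_on (obj_prod x x <+> {}) (case_sum codiag id)) A B then 1 else 0) =
    (if lpart A = rpart A then 1 else (0::nat))" by simp
qed

lemma represents_coev: "represents t {} (obj_prod x x) (coev0 x) (\<lambda>A B. if lpart B = rpart B then 1 else 0)"
  unfolding coev0_def
proof (rule represents_cong[OF represents_bas[OF kernel_arels]])
  fix A B :: "nat set" assume A: "A \<subseteq> {}" and B: "B \<subseteq> obj_prod x x"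
  have "relsem (kernel_on ({} <+> obj_prod x x) (case_sum id codiag)) A B \<longleftrightarrow> lpart B = rpart B"
    using A unfolding relsem_kernel[OF A B] codiag_separates[OF B, symmetric] by (simp add: Plus_def inj_image_mem_iff)
  then show "(if relsem (kernel_on ({} <+> obj_prod x x) (case_sum id codiag)) A B then 1 else 0) =
    (if lpart B = rpart B then 1 else (0::nat))" by simp
qed

lemma represents_hom0: "represents t x y f M \<Longrightarrow> f \<in> hom0 x y"
  unfolding represents_def using hom0_scale hom0_bas by metis

lemmas base_hom0 = represents_hom0[OF represents_id] represents_hom0[OF represents_braid]
  represents_hom0[OF represents_ev] represents_hom0[OF represents_coev]

lemma sum_delta_Pow:
  assumes "finite x"
  shows "b \<subseteq> x \<Longrightarrow> (\<Sum>a\<in>Pow x. (if a = b then 1 else 0) * (h a :: nat)) = h b"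
    "b \<subseteq> x \<Longrightarrow> (\<Sum>a\<in>Pow x. (if b = a then 1 else 0) * (h a :: nat)) = h b"
    "b \<subseteq> x \<Longrightarrow> (\<Sum>a\<in>Pow x. (h a :: nat) * (if a = b then 1 else 0)) = h b"
    "b \<subseteq> x \<Longrightarrow> (\<Sum>a\<in>Pow x. (h a :: nat) * (if b = a then 1 else 0)) = h b"
  using assms by (auto simp: if_distrib[of "\<lambda>z. z * _"] if_distrib[of "\<lambda>z. _ * z"] cong: if_cong)

lemma comp0_id:
  assumes "finite x" "finite y" "f \<in> hom0 x y"
  shows "comp0 t x x y f (id0 x) = f" "comp0 t x y y (id0 y) f = f"
proof -
  show "comp0 t x x y f (id0 x) = f" using assms
  proof (induction rule: hom0_induct)
    case (bas r)
    show ?case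
      by (rule represents_unique[OF represents_comp[OF assms(1,1,2) represents_id represents_bas[OF bas]] represents_bas[OF bas]])
        (rule sum_delta_Pow[OF assms(1)])
  qed (simp_all only: comp0_linear)
  show "comp0 t x y y (id0 y) f = f" using assms
  proof (induction rule: hom0_induct)
    case (bas r)
    show ?case
      by (rule represents_unique[OF represents_comp[OF assms(1,2,2) represents_bas[OF bas] represents_id] represents_bas[OF bas]])
        (rule sum_delta_Pow[OF assms(2)])
  qed (simp_all only: comp0_linear)
qed

text \<open>On single relations this is the mixed product rule for Kronecker products.\<close>

lemma tens0_comp:
  assumes fin: "finite x" "finite y" "finite z" "finite x'" "finite y'" "finite z'"
    and "f \<in> hom0 x y" "g \<in> hom0 y z" "f' \<in> hom0 x' y'" "g' \<in> hom0 y' z'"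
  shows "comp0 t (obj_prod x x') (obj_prod y y') (obj_prod z z') (tens0 y z y' z' g g') (tens0 x y x' y' f f')
    = tens0 x z x' z' (comp0 t x y z g f) (comp0 t x' y' z' g' f')"
  using fin(1,2) assms(7)
proof (induction rule: hom0_induct)
  case (bas r)
  show ?case using fin(2,3) assms(8)
  proof (induction rule: hom0_induct)
    case (bas s)
    show ?case using fin(4,5) assms(9)
    proof (induction rule: hom0_induct)
      case (bas r')
      show ?case using fin(5,6) assms(10)
      proof (induction rule: hom0_induct)
        case (bas s')
        note R = represents_bas[OF \<open>r \<in> _\<close>, of t] represents_bas[OF \<open>s \<in> _\<close>, of t]
          represents_bas[OF \<open>r' \<in> _\<close>, of t] represents_bas[OF bas, of t]
        note P = finite_obj_prod[OF fin(1,4)] finite_obj_prod[OF fin(2,5)] finite_obj_prod[OF fin(3,6)]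
        show ?case
        proof (rule represents_unique[OF
            represents_comp[OF P represents_tens[OF fin(1,2,4,5) R(1,3)] represents_tens[OF fin(2,3,5,6) R(2,4)]]
            represents_tens[OF fin(1,3,4,6) represents_comp[OF fin(1-3) R(1,2)] represents_comp[OF fin(4-6) R(3,4)]]])
        qed (unfold sum_Pow_obj_prod parts_obj_prod sum_product, intro sum.cong refl, simp add: ac_simps)
      qed (simp_all only: comp0_linear tens0_linear)
    qed (simp_all only: comp0_linear tens0_linear)
  qed (simp_all only: comp0_linear tens0_linear)
qed (simp_all only: comp0_linear tens0_linear)

lemma dual0_comp:
  assumes fin: "finite x" "finite y" "finite z" and "f \<in> hom0 x y" "g \<in> hom0 y z"
  shows "dual0 (comp0 t x y z g f) = comp0 t z y x (dual0 f) (dual0 g)"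
  using fin(1,2) assms(4)
proof (induction rule: hom0_induct)
  case (bas r)
  show ?case using fin(2,3) assms(5)
  proof (induction rule: hom0_induct)
    case (bas s)
    note R = represents_bas[OF \<open>r \<in> _\<close>, of t] represents_bas[OF \<open>s \<in> _\<close>, of t]
    show ?case
      by (rule represents_unique[OF represents_dual[OF represents_comp[OF fin R]]
        represents_comp[OF fin(3,2,1) represents_dual[OF R(2)] represents_dual[OF R(1)]]])
       (simp only: mult.commute)
  qed (simp_all only: comp0_linear dual0_linear)
qed (simp_all only: comp0_linear dual0_linear)

text \<open>The braiding is a permutation matrix that exchanges the two halves of an index, so both
  double sums collapse to a single term.\<close>

lemma braid0_natural:
  assumes fin: "finite x" "finite y" "finite x'" "finite y'" and "f \<in> hom0 x y" "g \<in> hom0 x' y'"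
  shows "comp0 t (obj_prod x x') (obj_prod x' x) (obj_prod y' y) (tens0 x' y' x y g f) (braid0 x x')
    = comp0 t (obj_prod x x') (obj_prod y y') (obj_prod y' y) (braid0 y y') (tens0 x y x' y' f g)"
  using fin(1,2) assms(5)
proof (induction rule: hom0_induct)
  case (bas r)
  show ?case using fin(3,4) assms(6)
  proof (induction rule: hom0_induct)
    case (bas s)
    note R = represents_bas[OF \<open>r \<in> _\<close>, of t] represents_bas[OF \<open>s \<in> _\<close>, of t]
    note P = finite_obj_prod[OF fin(1,3)] finite_obj_prod[OF fin(3,1)] finite_obj_prod[OF fin(4,2)] finite_obj_prod[OF fin(2,4)]
    show ?case
    proof (rule represents_unique[OF
        represents_comp[OF P(1-3) represents_braid represents_tens[OF fin(3,4,1,2) R(2,1)]]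
        represents_comp[OF P(1,4,3) represents_tens[OF fin R] represents_braid]])
      fix A B assume A: "A \<subseteq> obj_prod x x'" and B: "B \<subseteq> obj_prod y' y"
      have l: "(\<Sum>a\<in>Pow x'. \<Sum>b\<in>Pow x. (if lpart A = b \<and> rpart A = a then 1 else 0) * h a b) = h (rpart A) (lpart A)"
        for h :: "nat set \<Rightarrow> nat set \<Rightarrow> nat"
      proof -
        have "(\<Sum>a\<in>Pow x'. \<Sum>b\<in>Pow x. (if lpart A = b \<and> rpart A = a then 1 else 0) * h a b)
          = (\<Sum>a\<in>Pow x'. (if rpart A = a then 1 else 0) * (\<Sum>b\<in>Pow x. (if lpart A = b then 1 else 0) * h a b))"
          unfolding sum_distrib_left by (intro sum.cong) auto
        then show ?thesis using parts_subset[OF A] by (simp only: sum_delta_Pow fin)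
      qed
      have r: "(\<Sum>a\<in>Pow y. \<Sum>b\<in>Pow y'. h a b * (if a = rpart B \<and> b = lpart B then 1 else 0)) = h (rpart B) (lpart B)"
        for h :: "nat set \<Rightarrow> nat set \<Rightarrow> nat"
      proof -
        have "(\<Sum>a\<in>Pow y. \<Sum>b\<in>Pow y'. h a b * (if a = rpart B \<and> b = lpart B then 1 else 0))
          = (\<Sum>a\<in>Pow y. (\<Sum>b\<in>Pow y'. h a b * (if b = lpart B then 1 else 0)) * (if a = rpart B then 1 else 0))"
          unfolding sum_distrib_right by (intro sum.cong) auto
        then show ?thesis using parts_subset[OF B] by (simp only: sum_delta_Pow fin)
      qed
      show "(\<Sum>C\<in>Pow (obj_prod x' x). (if lpart A = rpart C \<and> rpart A = lpart C then 1 else 0) *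
            ((if relsem s (lpart C) (lpart B) then 1 else 0) * (if relsem r (rpart C) (rpart B) then 1 else 0)))
        = (\<Sum>C\<in>Pow (obj_prod y y'). (if relsem r (lpart A) (lpart C) then 1 else 0) * (if relsem s (rpart A) (rpart C) then 1 else 0) *
            (if lpart C = rpart B \<and> rpart C = lpart B then 1 else (0::nat)))"
        unfolding sum_Pow_obj_prod parts_obj_prod l r by simp
    qed
  qed (simp_all only: comp0_linear tens0_linear)
qed (simp_all only: comp0_linear tens0_linear)

lemma ev0_braid0:
  assumes "finite x"
  shows "comp0 t (obj_prod x x) (obj_prod x x) {} (ev0 x) (braid0 x x) = ev0 x"
proof (rule represents_unique[OF represents_comp[OF _ _ _ represents_braid represents_ev] represents_ev])
  show f: "finite (obj_prod x x)" "finite (obj_prod x x)" "finite ({} :: nat set)" using assms by (simp_all add: finite_obj_prod)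
  fix A B assume A: "A \<subseteq> obj_prod x x"
  have "(if lpart A = rpart C \<and> rpart A = lpart C then 1 else 0) * (if lpart C = rpart C then 1 else 0)
    = (if C = obj_prod (rpart A) (lpart A) then 1 else 0) * (if lpart A = rpart A then 1 else (0::nat))" for C
  proof -
    have "C = obj_prod (rpart A) (lpart A) \<longleftrightarrow> lpart C = rpart A \<and> rpart C = lpart A"
      using obj_prod_parts[of C] parts_obj_prod by metis
    then show ?thesis by auto
  qed
  moreover have "obj_prod (rpart A) (lpart A) \<subseteq> obj_prod x x" using parts_subset[OF A] by (simp add: obj_prod_subset_iff)
  ultimately show "(\<Sum>C\<in>Pow (obj_prod x x). (if lpart A = rpart C \<and> rpart A = lpart C then 1 else 0) * (if lpart C = rpart C then 1 else 0))
    = (if lpart A = rpart A then 1 else (0::nat))"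
    using sum_delta_Pow(1)[OF f(1), of "obj_prod (rpart A) (lpart A)" "\<lambda>_. if lpart A = rpart A then 1 else 0"] by simp
qed

section \<open>The trace on the category of relations\<close>

text \<open>The exponent in the trace form: \<open>t\<close> to this power is the trace of
  \<open>r\<close> followed by the dual of \<open>s\<close>, the diagram in which the two relations
  are glued along both \<open>x\<close> and \<open>y\<close>.\<close>

definition joins :: "nat set \<Rightarrow> nat set \<Rightarrow> arel \<Rightarrow> arel \<Rightarrow> nat" where
  "joins x y r s = card ((x <+> y) // (r \<union> s)\<^sup>+)"

lemma equiv_join:
  assumes "r \<in> arels x y" "s \<in> arels x y"
  shows "equiv (x <+> y) ((r \<union> s)\<^sup>+)"
  using assms by (intro equiv_trancl_Un) (auto simp: arels_def equiv_def refl_on_def)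

text \<open>A pair of subsets that is saturated for both relations is a saturated set of their join,
  and the double sum counts such pairs.\<close>

lemma card_joins:
  assumes "finite x" "finite y" "r \<in> arels x y" "s \<in> arels x y"
  shows "2 ^ joins x y r s = (\<Sum>a\<in>Pow x. \<Sum>b\<in>Pow y. if relsem r a b \<and> relsem s a b then 1 else (0::nat))"
proof -
  have "bij_betw (\<lambda>(a, b). a <+> b) {(a, b) \<in> Pow x \<times> Pow y. relsem r a b \<and> relsem s a b}
     {C \<in> Pow (x <+> y). sat ((r \<union> s)\<^sup>+) C}"
  proof (rule bij_betw_imageI)
    show "inj_on (\<lambda>(a, b). a <+> b) {(a, b) \<in> Pow x \<times> Pow y. relsem r a b \<and> relsem s a b}"
      by (auto simp: inj_on_def Plus_eq_Plus_iff)
    show "(\<lambda>(a, b). a <+> b) ` {(a, b) \<in> Pow x \<times> Pow y. relsem r a b \<and> relsem s a b} =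
      {C \<in> Pow (x <+> y). sat ((r \<union> s)\<^sup>+) C}" (is "?f ` ?A = ?B")
    proof (intro equalityI subsetI)
      fix C assume "C \<in> ?f ` ?A"
      then obtain a b where "a \<subseteq> x" "b \<subseteq> y" "relsem r a b" "relsem s a b" "C = a <+> b" by auto
      then show "C \<in> ?B" using Plus_mono by (simp add: sat_trancl sat_Un relsem_def)
    next
      fix C assume C: "C \<in> ?B"
      then obtain a b where "a \<subseteq> x" "b \<subseteq> y" "C = a <+> b" using subset_Plus_iff[of C x y] by auto
      then show "C \<in> ?f ` ?A" using C by (auto simp: sat_trancl sat_Un relsem_def)
    qed
  qed
  from bij_betw_same_card[OF this]
  have "2 ^ joins x y r s = card {(a, b) \<in> Pow x \<times> Pow y. relsem r a b \<and> relsem s a b}"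
    unfolding joins_def using card_sat[OF _ equiv_join[OF assms(3,4)]] assms(1,2) by simp
  also have "\<dots> = (\<Sum>p\<in>Pow x \<times> Pow y. if relsem r (fst p) (snd p) \<and> relsem s (fst p) (snd p) then 1 else 0)"
    using assms(1,2) by (simp add: sum.If_cases Int_def case_prod_unfold mem_Times_iff)
  also have "\<dots> = (\<Sum>a\<in>Pow x. \<Sum>b\<in>Pow y. if relsem r a b \<and> relsem s a b then 1 else 0)"
    by (simp add: sum.cartesian_product case_prod_unfold)
  finally show ?thesis .
qed

text \<open>Joining \<open>r\<close> with the diagonal identifies the two copies of \<open>x\<close>
  and so closes the diagram; each component of the result contributes a factor
  \<open>t\<close>.\<close>

definition tr0 :: "'k::field \<Rightarrow> nat set \<Rightarrow> (arel \<Rightarrow> 'k) \<Rightarrow> 'k" where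
  "tr0 t x f = (\<Sum>r\<in>arels x x. f r * t ^ joins x x r (graph_rel x x id))"

lemma tr0_linear:
  "tr0 t x (f + g) = tr0 t x f + tr0 t x g" "tr0 t x (fscale c f) = c * tr0 t x f" "tr0 t x 0 = 0"
  by (auto simp: tr0_def fscale_def sum.distrib sum_distrib_left algebra_simps)

lemma tr0_sum: "tr0 t x (sum f I) = (\<Sum>i\<in>I. tr0 t x (f i))"
  by (induction I rule: infinite_finite_induct) (simp_all only: tr0_linear sum.infinite sum.empty sum.insert simp_thms)

lemma tr0_bas:
  assumes "finite x" "r \<in> arels x x"
  shows "tr0 t x (bas r) = t ^ joins x x r (graph_rel x x id)"
  using assms finite_arels[of x x] by (simp add: tr0_def bas_def if_distrib[of "\<lambda>z. z * _"] cong: if_cong)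

text \<open>At \<open>t\<close> = 2 this is the ordinary trace of the matrix, a power of 2 whose
  exponent is that of \<open>t\<close>.\<close>

lemma tr0_represents:
  assumes "finite x" "represents t x x f M"
  obtains k where "tr0 t x f = t ^ k" "2 ^ k = (\<Sum>a\<in>Pow x. M a a)"
proof -
  obtain k r where r: "r \<in> arels x x" "f = fscale (t ^ k) (bas r)"
    "\<And>a b. a \<subseteq> x \<Longrightarrow> b \<subseteq> x \<Longrightarrow> M a b = (if relsem r a b then 2 ^ k else 0)"
    using assms(2) unfolding represents_def by metis
  let ?j = "joins x x r (graph_rel x x id)"
  have "2 ^ ?j = (\<Sum>a\<in>Pow x. \<Sum>b\<in>Pow x. if relsem r a b \<and> relsem (graph_rel x x id) a b then 1 else (0::nat))"
    by (rule card_joins) (use assms(1) r(1) graph_rel_arels in auto)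
  also have "\<dots> = (\<Sum>a\<in>Pow x. \<Sum>b\<in>Pow x. (if relsem r a b then 1 else 0) * (if b = a then 1 else 0))"
  proof (intro sum.cong refl)
    fix a b assume "a \<in> Pow x" "b \<in> Pow x"
    then have "relsem (graph_rel x x id) a b \<longleftrightarrow> b = a" by (subst relsem_graph) auto
    then show "(if relsem r a b \<and> relsem (graph_rel x x id) a b then 1 else (0::nat))
      = (if relsem r a b then 1 else 0) * (if b = a then 1 else 0)" by simp
  qed
  also have "\<dots> = (\<Sum>a\<in>Pow x. if relsem r a a then 1 else 0)"
    by (intro sum.cong refl sum_delta_Pow(3)) (use assms(1) in auto)
  finally have "2 ^ (k + ?j) = (\<Sum>a\<in>Pow x. 2 ^ k * (if relsem r a a then 1 else (0::nat)))"
    by (simp only: power_add sum_distrib_left)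
  also have "\<dots> = (\<Sum>a\<in>Pow x. M a a)"
    by (intro sum.cong refl) (simp add: r(3))
  finally have "2 ^ (k + ?j) = (\<Sum>a\<in>Pow x. M a a)" .
  moreover have "tr0 t x f = t ^ (k + ?j)"
    unfolding r(2) tr0_linear tr0_bas[OF assms(1) r(1)] by (simp add: power_add)
  ultimately show ?thesis using that by blast
qed

text \<open>The matrix trace of a product sums the entries of one factor against the transposed
  entries of the other, which counts the pairs that are saturated for \<open>r\<close> and for the
  dual of \<open>s\<close>.\<close>

lemma tr0_comp_bas:
  assumes "finite x" "finite y" "r \<in> arels x y" "s \<in> arels y x"
  shows "tr0 t x (comp0 t x y x (bas s) (bas r)) = t ^ joins x y r (dual_rel s)"
proof -
  obtain k where k: "tr0 t x (comp0 t x y x (bas s) (bas r)) = t ^ k"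
    "2 ^ k = (\<Sum>a\<in>Pow x. \<Sum>b\<in>Pow y. (if relsem r a b then 1 else 0) * (if relsem s b a then 1 else (0::nat)))"
    by (rule tr0_represents[OF assms(1) represents_comp[OF assms(1,2,1) represents_bas[OF assms(3)] represents_bas[OF assms(4)]]])
  have "2 ^ joins x y r (dual_rel s) = (2::nat) ^ k"
    unfolding k(2) card_joins[OF assms(1-3) dual_rel_arels[OF assms(4)]] relsem_dual
    by (intro sum.cong) auto
  then show ?thesis using k(1) by simp
qed

lemma tr0_cyclic:
  assumes fin: "finite x" "finite y" and "f \<in> hom0 x y" "g \<in> hom0 y x"
  shows "tr0 t x (comp0 t x y x g f) = tr0 t y (comp0 t y x y f g)"
  using fin assms(3)
proof (induction rule: hom0_induct)
  case (bas r)
  show ?case using fin(2,1) assms(4)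
  proof (induction rule: hom0_induct)
    case (bas s)
    have "(2::nat) ^ joins x y r (dual_rel s) = 2 ^ joins y x s (dual_rel r)"
      unfolding card_joins[OF fin \<open>r \<in> _\<close> dual_rel_arels[OF bas]] card_joins[OF fin(2,1) bas dual_rel_arels[OF \<open>r \<in> _\<close>]]
      relsem_dual by (subst sum.swap) (simp only: conj_commute)
    then show ?case unfolding tr0_comp_bas[OF fin \<open>r \<in> _\<close> bas] tr0_comp_bas[OF fin(2,1) bas \<open>r \<in> _\<close>] by simp
  qed (simp_all only: comp0_linear tr0_linear)
qed (simp_all only: comp0_linear tr0_linear)

section \<open>The categorical trace in the additive and idempotent completions\<close>

lemma represents_scalar:
  assumes "represents t {} {} f M"
  obtains k where "f {} = t ^ k" "2 ^ k = M {} {}"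
proof -
  obtain k r where r: "r \<in> arels {} {}" "f = fscale (t ^ k) (bas r)"
    "\<And>a b. a \<subseteq> {} \<Longrightarrow> b \<subseteq> {} \<Longrightarrow> M a b = (if relsem r a b then 2 ^ k else 0)"
    using assms unfolding represents_def by metis
  have "r = {}" using r(1) by (auto simp: arels_def equiv_def)
  then have "f {} = t ^ k" using r(2) by (simp add: fscale_def bas_def)
  moreover have "M {} {} = 2 ^ k" using r(3)[of "{}" "{}"] relsem_empty[OF r(1)] by simp
  ultimately show ?thesis using that by simp
qed

text \<open>The identification of End(I) with the field, as a constant of its own so that its
  linearity is available as rewriting rules.\<close>

definition at_empty :: "(arel \<Rightarrow> 'k::field) \<Rightarrow> 'k" where "at_empty f = f {}"

lemma at_empty_linear:
  "at_empty (f + g) = at_empty f + at_empty g" "at_empty (fscale c f) = c * at_empty f" "at_empty 0 = 0"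
  by (simp_all add: at_empty_def fscale_def)

lemma at_empty_sum: "at_empty (sum f I) = (\<Sum>i\<in>I. at_empty (f i))"
  by (simp add: at_empty_def sum_fun_apply)

text \<open>Two objects occur because the entries of a matrix between direct sums lead from one
  summand to another. The second tensor factor is a dual because, in the completion, the idempotent
  of the dual object stands there.\<close>

lemma closure_tens0:
  assumes fin: "finite x" "finite y" and "f \<in> hom0 x y" "g \<in> hom0 y x"
  shows "at_empty (comp0 t {} (obj_prod y y) {} (ev0 y) (comp0 t {} (obj_prod x x) (obj_prod y y)
      (tens0 x y x y f (dual0 g)) (coev0 x))) = tr0 t x (comp0 t x y x g f)"
  using fin assms(3)
proof (induction rule: hom0_induct)
  case (bas r)
  show ?case using fin(2,1) assms(4)
  proof (induction rule: hom0_induct)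
    case (bas s)
    note P = finite.emptyI finite_obj_prod[OF fin(1,1)] finite_obj_prod[OF fin(2,2)]
    note R = represents_bas[OF \<open>r \<in> _\<close>, of t] represents_bas[OF bas, of t]
    obtain k where k: "comp0 t {} (obj_prod y y) {} (ev0 y) (comp0 t {} (obj_prod x x) (obj_prod y y)
      (tens0 x y x y (bas r) (dual0 (bas s))) (coev0 x)) {} = t ^ k"
      "2 ^ k = (\<Sum>B\<in>Pow (obj_prod y y). (\<Sum>A\<in>Pow (obj_prod x x). (if lpart A = rpart A then 1 else 0) *
        ((if relsem r (lpart A) (lpart B) then 1 else 0) * (if relsem s (rpart B) (rpart A) then 1 else 0))) *
        (if lpart B = rpart B then 1 else (0::nat)))"
      by (rule represents_scalar[OF represents_comp[OF P(1,3,1) represents_comp[OF P represents_coev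
            represents_tens[OF fin fin R(1) represents_dual[OF R(2)]]] represents_ev]])
    have A: "(\<Sum>a\<in>Pow x. \<Sum>a'\<in>Pow x. (if a = a' then 1 else 0) * h a a') = (\<Sum>a\<in>Pow x. h a a)"
      for h :: "nat set \<Rightarrow> nat set \<Rightarrow> nat"
      by (intro sum.cong refl sum_delta_Pow(2)) (use fin in auto)
    have B: "(\<Sum>a\<in>Pow y. \<Sum>a'\<in>Pow y. h a a' * (if a = a' then 1 else 0)) = (\<Sum>a\<in>Pow y. h a a)"
      for h :: "nat set \<Rightarrow> nat set \<Rightarrow> nat"
      by (intro sum.cong refl sum_delta_Pow(4)) (use fin in auto)
    have "2 ^ joins x y r (dual_rel s) = (2::nat) ^ k"
      unfolding k(2) sum_Pow_obj_prod parts_obj_prod A B card_joins[OF fin \<open>r \<in> _\<close> dual_rel_arels[OF bas]] relsem_dual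
      by (subst sum.swap) (auto intro!: sum.cong)
    then show ?case unfolding at_empty_def k(1) tr0_comp_bas[OF fin \<open>r \<in> _\<close> bas] by simp
  qed (simp_all only: comp0_linear tens0_linear dual0_linear tr0_linear at_empty_linear)
qed (simp_all only: comp0_linear tens0_linear tr0_linear at_empty_linear)

text \<open>Equality within the index range. Outside of it \<open>!\<close> is unspecified, and
  composites and tensor products are compared only where the summands exist.\<close>

definition meq :: "nat set list \<Rightarrow> nat set list \<Rightarrow> 'k::field mor \<Rightarrow> 'k mor \<Rightarrow> bool" where
  "meq xs ys f g \<longleftrightarrow> (\<forall>i<length xs. \<forall>j<length ys. f i j = g i j)"

definition homs :: "nat set list \<Rightarrow> nat set list \<Rightarrow> 'k::field mor \<Rightarrow> bool" where
  "homs xs ys f \<longleftrightarrow> (\<forall>i<length xs. \<forall>j<length ys. f i j \<in> hom0 (xs ! i) (ys ! j))"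

definition fins :: "nat set list \<Rightarrow> bool" where "fins xs \<longleftrightarrow> (\<forall>x\<in>set xs. finite x)"

lemma fins_nth: "fins xs \<Longrightarrow> i < length xs \<Longrightarrow> finite (xs ! i)" by (simp add: fins_def)

lemma meq_refl: "meq xs ys f f" and meq_sym: "meq xs ys f g \<Longrightarrow> meq xs ys g f"
  and meq_trans [trans]: "meq xs ys f g \<Longrightarrow> meq xs ys g h \<Longrightarrow> meq xs ys f h"
  by (simp_all add: meq_def)

lemma meq_comp:
  assumes "meq ys zs g g'" "meq xs ys f f'"
  shows "meq xs zs (compA t xs ys zs g f) (compA t xs ys zs g' f')"
  using assms by (auto simp: meq_def compA_def intro!: sum.cong)

lemma homA_homs: "f \<in> homA xs ys \<Longrightarrow> homs xs ys f"
  by (auto simp: homA_def homs_def)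

lemma homs_comp: "fins xs \<Longrightarrow> fins ys \<Longrightarrow> fins zs \<Longrightarrow> homs xs zs (compA t xs ys zs g f)"
  unfolding homs_def compA_def by (auto intro!: hom0_sum comp0_hom0 simp: fins_nth)

lemma compA_assoc:
  assumes "fins ws" "fins xs" "fins ys" "fins zs" "homs ws xs f" "homs xs ys g" "homs ys zs h"
  shows "meq ws zs (compA t ws xs zs (compA t xs ys zs h g) f) (compA t ws ys zs h (compA t ws xs ys g f))"
  unfolding meq_def
proof (intro allI impI)
  fix i l assume i: "i < length ws" and l: "l < length zs"
  have "compA t ws xs zs (compA t xs ys zs h g) f i l =
    (\<Sum>j<length xs. \<Sum>k<length ys. comp0 t (ws ! i) (xs ! j) (zs ! l) (comp0 t (xs ! j) (ys ! k) (zs ! l) (h k l) (g j k)) (f i j))"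
    unfolding compA_def comp0_sum ..
  also have "\<dots> = (\<Sum>j<length xs. \<Sum>k<length ys. comp0 t (ws ! i) (ys ! k) (zs ! l) (h k l) (comp0 t (ws ! i) (xs ! j) (ys ! k) (g j k) (f i j)))"
    by (intro sum.cong refl comp0_assoc) (use assms i l in \<open>auto simp: fins_nth homs_def\<close>)
  also have "\<dots> = compA t ws ys zs h (compA t ws xs ys g f) i l"
    unfolding compA_def comp0_sum by (rule sum.swap)
  finally show "compA t ws xs zs (compA t xs ys zs h g) f i l = compA t ws ys zs h (compA t ws xs ys g f) i l" .
qed

definition trA :: "'k::field \<Rightarrow> nat set list \<Rightarrow> 'k mor \<Rightarrow> 'k" where
  "trA t xs f = (\<Sum>i<length xs. tr0 t (xs ! i) (f i i))"

lemma trA_cong: "meq xs xs f g \<Longrightarrow> trA t xs f = trA t xs g"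
  by (auto simp: trA_def meq_def intro!: sum.cong)

lemma trA_cyclic:
  assumes "fins xs" "fins ys" "homs xs ys f" "homs ys xs g"
  shows "trA t xs (compA t xs ys xs g f) = trA t ys (compA t ys xs ys f g)"
proof -
  have "trA t xs (compA t xs ys xs g f) = (\<Sum>i<length xs. \<Sum>j<length ys. tr0 t (xs ! i) (comp0 t (xs ! i) (ys ! j) (xs ! i) (g j i) (f i j)))"
    unfolding trA_def compA_def tr0_sum ..
  also have "\<dots> = (\<Sum>i<length xs. \<Sum>j<length ys. tr0 t (ys ! j) (comp0 t (ys ! j) (xs ! i) (ys ! j) (f i j) (g j i)))"
    by (intro sum.cong refl tr0_cyclic) (use assms in \<open>auto simp: fins_nth homs_def\<close>)
  also have "\<dots> = trA t ys (compA t ys xs ys f g)"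
    unfolding trA_def compA_def tr0_sum by (rule sum.swap)
  finally show ?thesis .
qed


text \<open>Splits the index of a summand of a tensor product into the pair of indices that it
  encodes.\<close>

lemma sum_lessThan_mult:
  "(\<Sum>i<m * n. h i) = (\<Sum>a<m. \<Sum>b<n. h (a * n + b :: nat))"
proof -
  have "(\<Sum>a<m. \<Sum>b<n. h (a * n + b)) = (\<Sum>a<m. sum h {a * n..<a * n + n})"
    using sum.shift_bounds_nat_ivl[of h 0 "_ * n" n] by (simp add: add.commute atLeast0LessThan)
  then show ?thesis by (simp add: sum.nat_group)
qed

lemma mult_add_less: "a < m \<Longrightarrow> b < n \<Longrightarrow> a * n + b < m * (n :: nat)"
  by (metis add_le_imp_le_right add_strict_left_mono less_le_trans mult_Suc mult_le_mono1 Suc_leI add.commute)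

lemma mult_add_div [simp]: "b < n \<Longrightarrow> (a * n + b) div n = (a :: nat)"
  by simp

lemma length_tens_list: "length (tens_list xs ys) = length xs * length ys"
  by (simp add: tens_list_def)

lemma nth_tens_list:
  assumes "a < length xs" "b < length ys"
  shows "tens_list xs ys ! (a * length ys + b) = obj_prod (xs ! a) (ys ! b)"
proof -
  have "a * length ys + b < length xs * length ys" using assms
    by (simp add: mult_add_less)
  then show ?thesis using assms by (simp add: tens_list_def product_nth)
qed

lemma all_less_mult:
  "(\<forall>i<m * n. P i) \<longleftrightarrow> (\<forall>a<m. \<forall>b<n. P (a * n + b :: nat))"
proof safe
  fix a b assume P: "\<forall>i<m * n. P i" and "a < m" "b < n"
  then have "a * n + b < m * n" by (simp add: mult_add_less)
  then show "P (a * n + b)" using P by simp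
next
  fix i assume P: "\<forall>a<m. \<forall>b<n. P (a * n + b)" and "i < m * n"
  then have "n > 0" "i div n < m" by (auto simp: less_mult_imp_div_less intro: Nat.gr0I)
  then show "P i" using P[rule_format, of "i div n" "i mod n"] by simp
qed

lemma fins_tens: "fins xs \<Longrightarrow> fins ys \<Longrightarrow> fins (tens_list xs ys)"
  by (auto simp: fins_def tens_list_def finite_obj_prod)

lemma meq_tens_iff:
  "meq (tens_list xs xs') (tens_list ys ys') f g \<longleftrightarrow>
    (\<forall>a<length xs. \<forall>a'<length xs'. \<forall>b<length ys. \<forall>b'<length ys'.
      f (a * length xs' + a') (b * length ys' + b') = g (a * length xs' + a') (b * length ys' + b'))"
  unfolding meq_def length_tens_list all_less_mult ..

lemma homs_tens_iff:
  "homs (tens_list xs xs') (tens_list ys ys') f \<longleftrightarrow>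
    (\<forall>a<length xs. \<forall>a'<length xs'. \<forall>b<length ys. \<forall>b'<length ys'.
      f (a * length xs' + a') (b * length ys' + b') \<in> hom0 (obj_prod (xs ! a) (xs' ! a')) (obj_prod (ys ! b) (ys' ! b')))"
  unfolding homs_def length_tens_list all_less_mult by (simp add: nth_tens_list)

lemma tensA_apply:
  "a' < length xs' \<Longrightarrow> b' < length ys' \<Longrightarrow>
    tensA xs ys xs' ys' f g (a * length xs' + a') (b * length ys' + b') =
    tens0 (xs ! a) (ys ! b) (xs' ! a') (ys' ! b') (f a b) (g a' b')"
  by (simp add: tensA_def Let_def)

lemma homs_tensA: "homs (tens_list xs xs') (tens_list ys ys') (tensA xs ys xs' ys' f g)"
  unfolding homs_tens_iff by (simp add: tensA_apply tens0_hom0)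

lemma tensA_comp:
  assumes "fins xs" "fins ys" "fins zs" "fins xs'" "fins ys'" "fins zs'"
    "homs xs ys f" "homs ys zs g" "homs xs' ys' f'" "homs ys' zs' g'"
  shows "meq (tens_list xs xs') (tens_list zs zs')
    (compA t (tens_list xs xs') (tens_list ys ys') (tens_list zs zs') (tensA ys zs ys' zs' g g') (tensA xs ys xs' ys' f f'))
    (tensA xs zs xs' zs' (compA t xs ys zs g f) (compA t xs' ys' zs' g' f'))"
  unfolding meq_tens_iff
proof (intro allI impI)
  fix a a' c c' assume l: "a < length xs" "a' < length xs'" "c < length zs" "c' < length zs'"
  let ?o = "obj_prod (xs ! a) (xs' ! a')" and ?q = "obj_prod (zs ! c) (zs' ! c')"
  have "compA t (tens_list xs xs') (tens_list ys ys') (tens_list zs zs') (tensA ys zs ys' zs' g g')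
      (tensA xs ys xs' ys' f f') (a * length xs' + a') (c * length zs' + c')
    = (\<Sum>b<length ys. \<Sum>b'<length ys'. comp0 t ?o (obj_prod (ys ! b) (ys' ! b')) ?q
       (tens0 (ys ! b) (zs ! c) (ys' ! b') (zs' ! c') (g b c) (g' b' c'))
       (tens0 (xs ! a) (ys ! b) (xs' ! a') (ys' ! b') (f a b) (f' a' b')))"
    unfolding compA_def length_tens_list sum_lessThan_mult
    by (intro sum.cong refl) (simp add: l nth_tens_list tensA_apply)
  also have "\<dots> = (\<Sum>b<length ys. \<Sum>b'<length ys'. tens0 (xs ! a) (zs ! c) (xs' ! a') (zs' ! c')
      (comp0 t (xs ! a) (ys ! b) (zs ! c) (g b c) (f a b)) (comp0 t (xs' ! a') (ys' ! b') (zs' ! c') (g' b' c') (f' a' b')))"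
    by (intro sum.cong refl tens0_comp) (use assms l in \<open>auto simp: fins_nth homs_def\<close>)
  also have "\<dots> = tensA xs zs xs' zs' (compA t xs ys zs g f) (compA t xs' ys' zs' g' f') (a * length xs' + a') (c * length zs' + c')"
    unfolding tensA_apply[OF l(2,4)] compA_def tens0_sum by (rule sum.swap)
  finally show "compA t (tens_list xs xs') (tens_list ys ys') (tens_list zs zs') (tensA ys zs ys' zs' g g')
      (tensA xs ys xs' ys' f f') (a * length xs' + a') (c * length zs' + c')
    = tensA xs zs xs' zs' (compA t xs ys zs g f) (compA t xs' ys' zs' g' f') (a * length xs' + a') (c * length zs' + c')" .
qed

lemma dualA_comp:
  assumes "fins xs" "fins ys" "fins zs" "homs xs ys f" "homs ys zs g"
  shows "meq zs xs (dualA (compA t xs ys zs g f)) (compA t zs ys xs (dualA f) (dualA g))"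
  unfolding meq_def
proof (intro allI impI)
  fix k i assume l: "k < length zs" "i < length xs"
  show "dualA (compA t xs ys zs g f) k i = compA t zs ys xs (dualA f) (dualA g) k i"
    unfolding dualA_def compA_def dual0_sum
    by (intro sum.cong refl dual0_comp) (use assms l in \<open>auto simp: fins_nth homs_def\<close>)
qed

lemma homs_dualA: "homs xs ys f \<Longrightarrow> homs ys xs (dualA f)"
  by (simp add: homs_def dualA_def dual0_hom0)

lemma braidA_apply:
  "a < length xs \<Longrightarrow> b < length ys \<Longrightarrow> b' < length ys \<Longrightarrow> a' < length xs \<Longrightarrow>
    braidA xs ys (a * length ys + b) (b' * length xs + a') = (if a = a' \<and> b = b' then braid0 (xs ! a) (ys ! b) else 0)"
proof -
  assume l: "a < length xs" "b < length ys" "b' < length ys" "a' < length xs"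
  have "a * length ys + b < length xs * length ys" "b' * length xs + a' < length ys * length xs"
    using l by (simp_all add: mult_add_less)
  then show ?thesis using l by (simp add: braidA_def)
qed

lemma evA_apply:
  "a < length xs \<Longrightarrow> b < length xs \<Longrightarrow> evA xs (a * length xs + b) 0 = (if a = b then ev0 (xs ! a) else 0)"
  "a < length xs \<Longrightarrow> b < length xs \<Longrightarrow> coevA xs 0 (a * length xs + b) = (if a = b then coev0 (xs ! a) else 0)"
proof -
  assume l: "a < length xs" "b < length xs"
  have "a * length xs + b < length xs * length xs"
    using l by (simp add: mult_add_less)
  then show "evA xs (a * length xs + b) 0 = (if a = b then ev0 (xs ! a) else 0)"
    "coevA xs 0 (a * length xs + b) = (if a = b then coev0 (xs ! a) else 0)"
    using l by (simp_all add: evA_def coevA_def)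
qed

lemma homs_structure:
  "homs (tens_list xs ys) (tens_list ys xs) (braidA xs ys)"
  "homs (tens_list xs xs) [{}] (evA xs)" "homs [{}] (tens_list xs xs) (coevA xs)"
proof -
  show "homs (tens_list xs ys) (tens_list ys xs) (braidA xs ys)"
    unfolding homs_tens_iff by (simp add: braidA_apply base_hom0)
  show "homs (tens_list xs xs) [{}] (evA xs)"
    unfolding homs_def length_tens_list all_less_mult by (simp add: evA_apply base_hom0 nth_tens_list)
  show "homs [{}] (tens_list xs xs) (coevA xs)"
    unfolding homs_def length_tens_list all_less_mult by (simp add: evA_apply base_hom0 nth_tens_list)
qed

lemma sum_if_eq:
  assumes "a < (m::nat)" "b < (n::nat)"
  shows "(\<Sum>a'<m. \<Sum>b'<n. if a = a' \<and> b = b' then h a' b' else 0) = h a b"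
proof -
  have "(\<Sum>a'<m. \<Sum>b'<n. if a = a' \<and> b = b' then h a' b' else 0) = (\<Sum>a'<m. if a = a' then h a' b else 0)"
    using assms(2) by (intro sum.cong refl) auto
  then show ?thesis using assms(1) by simp
qed

lemma sum_if_diag:
  fixes n :: nat
  shows "(\<Sum>a<n. \<Sum>b<n. if a = b then h a b else 0) = (\<Sum>a<n. h a a)"
  by (intro sum.cong refl) auto

text \<open>The braiding has one nonzero entry for each pair of summands, so both sums collapse and
  the claim is naturality for that entry.\<close>

lemma braidA_natural:
  assumes "fins xs" "fins ys" "homs xs xs f" "homs ys ys g"
  shows "meq (tens_list xs ys) (tens_list ys xs)
    (compA t (tens_list xs ys) (tens_list ys xs) (tens_list ys xs) (tensA ys ys xs xs g f) (braidA xs ys))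
    (compA t (tens_list xs ys) (tens_list xs ys) (tens_list ys xs) (braidA xs ys) (tensA xs xs ys ys f g))"
  unfolding meq_tens_iff
proof (intro allI impI)
  fix a b d c assume l: "a < length xs" "b < length ys" "d < length ys" "c < length xs"
  let ?L = "length xs" and ?M = "length ys" and ?o = "obj_prod (xs ! a) (ys ! b)" and ?q = "obj_prod (ys ! d) (xs ! c)"
  have "compA t (tens_list xs ys) (tens_list ys xs) (tens_list ys xs) (tensA ys ys xs xs g f) (braidA xs ys) (a * ?M + b) (d * ?L + c)
    = (\<Sum>b'<?M. \<Sum>a'<?L. if b = b' \<and> a = a' then comp0 t ?o (obj_prod (ys ! b') (xs ! a')) ?q
       (tens0 (ys ! b') (ys ! d) (xs ! a') (xs ! c) (g b' d) (f a' c)) (braid0 (xs ! a) (ys ! b)) else 0)"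
    unfolding compA_def length_tens_list sum_lessThan_mult
    by (intro sum.cong refl) (auto simp: l nth_tens_list tensA_apply braidA_apply comp0_linear)
  also have "\<dots> = comp0 t ?o (obj_prod (ys ! b) (xs ! a)) ?q
       (tens0 (ys ! b) (ys ! d) (xs ! a) (xs ! c) (g b d) (f a c)) (braid0 (xs ! a) (ys ! b))"
    using l by (simp only: sum_if_eq)
  also have "\<dots> = comp0 t ?o (obj_prod (xs ! c) (ys ! d)) ?q (braid0 (xs ! c) (ys ! d))
       (tens0 (xs ! a) (xs ! c) (ys ! b) (ys ! d) (f a c) (g b d))"
    by (rule braid0_natural) (use assms l in \<open>auto simp: fins_nth homs_def\<close>)
  also have "\<dots> = (\<Sum>a'<?L. \<Sum>b'<?M. if c = a' \<and> d = b' then comp0 t ?o (obj_prod (xs ! a') (ys ! b')) ?q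
       (braid0 (xs ! a') (ys ! b')) (tens0 (xs ! a) (xs ! a') (ys ! b) (ys ! b') (f a a') (g b b')) else 0)"
    using l by (simp only: sum_if_eq)
  also have "\<dots> = compA t (tens_list xs ys) (tens_list xs ys) (tens_list ys xs) (braidA xs ys) (tensA xs xs ys ys f g) (a * ?M + b) (d * ?L + c)"
    unfolding compA_def length_tens_list sum_lessThan_mult
    by (intro sum.cong refl) (auto simp: l nth_tens_list tensA_apply braidA_apply comp0_linear)
  finally show "compA t (tens_list xs ys) (tens_list ys xs) (tens_list ys xs) (tensA ys ys xs xs g f) (braidA xs ys) (a * ?M + b) (d * ?L + c)
    = compA t (tens_list xs ys) (tens_list xs ys) (tens_list ys xs) (braidA xs ys) (tensA xs xs ys ys f g) (a * ?M + b) (d * ?L + c)" .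
qed

lemma evA_braidA:
  assumes "fins xs"
  shows "meq (tens_list xs xs) [{}] (compA t (tens_list xs xs) (tens_list xs xs) [{}] (evA xs) (braidA xs xs)) (evA xs)"
  unfolding meq_def length_tens_list all_less_mult
proof (intro allI impI)
  fix a b j assume l: "a < length xs" "b < length xs" "j < length [{}::nat set]"
  let ?L = "length xs" and ?o = "obj_prod (xs ! a) (xs ! b)"
  have "compA t (tens_list xs xs) (tens_list xs xs) [{}] (evA xs) (braidA xs xs) (a * ?L + b) j
    = (\<Sum>b'<?L. \<Sum>a'<?L. if b = b' \<and> a = a' then comp0 t ?o (obj_prod (xs ! b') (xs ! a')) {}
      (if b' = a' then ev0 (xs ! b') else 0) (braid0 (xs ! a) (xs ! b)) else 0)"
    using l(3) unfolding compA_def length_tens_list sum_lessThan_mult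
    by (intro sum.cong refl) (auto simp: l(1,2) nth_tens_list evA_apply braidA_apply comp0_linear )
  also have "\<dots> = comp0 t ?o (obj_prod (xs ! b) (xs ! a)) {} (if b = a then ev0 (xs ! b) else 0) (braid0 (xs ! a) (xs ! b))"
    using l by (simp only: sum_if_eq)
  also have "\<dots> = evA xs (a * ?L + b) j"
    using l assms by (auto simp: evA_apply comp0_linear ev0_braid0 fins_nth)
  finally show "compA t (tens_list xs xs) (tens_list xs xs) [{}] (evA xs) (braidA xs xs) (a * ?L + b) j = evA xs (a * ?L + b) j" .
qed

text \<open>Evaluation and coevaluation are supported on pairs of equal summands. The two surviving
  indices run over the entries of both matrices, as in the trace of a matrix product.\<close>

lemma closure_tensA:
  assumes "fins xs" "homs xs xs f" "homs xs xs g"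
  shows "compA t [{}] (tens_list xs xs) [{}] (evA xs) (compA t [{}] (tens_list xs xs) (tens_list xs xs)
    (tensA xs xs xs xs f (dualA g)) (coevA xs)) 0 0 {} = trA t xs (compA t xs xs xs g f)"
proof -
  let ?L = "length xs" and ?D = "tens_list xs xs"
  have inner: "compA t [{}] ?D ?D (tensA xs xs xs xs f (dualA g)) (coevA xs) 0 (b * ?L + b) =
    (\<Sum>a<?L. comp0 t {} (obj_prod (xs ! a) (xs ! a)) (obj_prod (xs ! b) (xs ! b))
      (tens0 (xs ! a) (xs ! b) (xs ! a) (xs ! b) (f a b) (dual0 (g b a))) (coev0 (xs ! a)))" if b: "b < ?L" for b
  proof -
    have "compA t [{}] ?D ?D (tensA xs xs xs xs f (dualA g)) (coevA xs) 0 (b * ?L + b) =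
      (\<Sum>a<?L. \<Sum>a'<?L. if a = a' then comp0 t {} (obj_prod (xs ! a) (xs ! a')) (obj_prod (xs ! b) (xs ! b))
      (tens0 (xs ! a) (xs ! b) (xs ! a') (xs ! b) (f a b) (dual0 (g b a'))) (coev0 (xs ! a)) else 0)"
      unfolding compA_def length_tens_list sum_lessThan_mult
      by (intro sum.cong refl) (auto simp: b nth_tens_list evA_apply tensA_apply comp0_linear dualA_def)
    then show ?thesis unfolding sum_if_diag .
  qed
  have "compA t [{}] ?D [{}] (evA xs) (compA t [{}] ?D ?D (tensA xs xs xs xs f (dualA g)) (coevA xs)) 0 0 =
    (\<Sum>b<?L. \<Sum>b'<?L. if b = b' then comp0 t {} (obj_prod (xs ! b) (xs ! b')) {} (ev0 (xs ! b))
      (compA t [{}] ?D ?D (tensA xs xs xs xs f (dualA g)) (coevA xs) 0 (b * ?L + b')) else 0)"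
    unfolding compA_def[of t "[{}]" ?D "[{}]"] length_tens_list sum_lessThan_mult
    by (intro sum.cong refl) (auto simp: nth_tens_list evA_apply comp0_linear)
  also have "\<dots> = (\<Sum>b<?L. comp0 t {} (obj_prod (xs ! b) (xs ! b)) {} (ev0 (xs ! b))
      (compA t [{}] ?D ?D (tensA xs xs xs xs f (dualA g)) (coevA xs) 0 (b * ?L + b)))"
    by (rule sum_if_diag)
  finally have "at_empty (compA t [{}] ?D [{}] (evA xs) (compA t [{}] ?D ?D (tensA xs xs xs xs f (dualA g)) (coevA xs)) 0 0)
    = at_empty (\<Sum>b<?L. comp0 t {} (obj_prod (xs ! b) (xs ! b)) {} (ev0 (xs ! b))
      (compA t [{}] ?D ?D (tensA xs xs xs xs f (dualA g)) (coevA xs) 0 (b * ?L + b)))"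
    by (rule arg_cong)
  also have "\<dots> = (\<Sum>b<?L. \<Sum>a<?L. tr0 t (xs ! a) (comp0 t (xs ! a) (xs ! b) (xs ! a) (g b a) (f a b)))"
    unfolding at_empty_sum
  proof (intro sum.cong refl)
    fix b assume b: "b \<in> {..<?L}"
    show "at_empty (comp0 t {} (obj_prod (xs ! b) (xs ! b)) {} (ev0 (xs ! b))
      (compA t [{}] ?D ?D (tensA xs xs xs xs f (dualA g)) (coevA xs) 0 (b * ?L + b)))
      = (\<Sum>a<?L. tr0 t (xs ! a) (comp0 t (xs ! a) (xs ! b) (xs ! a) (g b a) (f a b)))"
      using b unfolding inner[OF b[unfolded lessThan_iff]] comp0_sum at_empty_sum
      by (intro sum.cong refl closure_tens0) (use assms b in \<open>auto simp: fins_nth homs_def\<close>)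
  qed
  also have "\<dots> = trA t xs (compA t xs xs xs g f)"
    unfolding trA_def compA_def tr0_sum by (rule sum.swap)
  finally show ?thesis unfolding at_empty_def .
qed

lemma tensA_cong:
  assumes "meq xs ys f f'" "meq xs' ys' g g'"
  shows "meq (tens_list xs xs') (tens_list ys ys') (tensA xs ys xs' ys' f g) (tensA xs ys xs' ys' f' g')"
  using assms unfolding meq_tens_iff by (simp add: tensA_apply meq_def)

text \<open>The trace is defined with coevaluation, braiding and evaluation cut down by the
  idempotents of tensor products. These idempotents pass through the braiding by naturality and are
  absorbed by \<open>f\<close>. What remains is the plain closure of \<open>f\<close> with the
  idempotent of the dual, which is a matrix trace.\<close>

lemma cat_trace_eq:
  assumes X: "is_tobj t X" and f: "f \<in> thom t X X"
  shows "cat_trace t X f = trA t (summands X) f"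
proof -
  define xs where "xs = summands X"
  define E where "E = idem X"
  define D where "D = tens_list xs xs"
  define I :: "nat set list" where "I = [{}]"
  have fin: "fins xs" using X by (simp add: is_tobj_def fins_def xs_def)
  have finD: "fins D" unfolding D_def using fin by (intro fins_tens)
  have finI: "fins I" by (simp add: I_def fins_def)
  have hE: "homs xs xs E" using X by (simp add: is_tobj_def xs_def E_def homA_homs)
  have hf: "homs xs xs f" using f by (simp add: thom_def xs_def homA_homs)
  have EE: "compA t xs xs xs E E = E" using X by (simp add: is_tobj_def xs_def E_def)
  have fE: "compA t xs xs xs f E = f" "compA t xs xs xs E f = f"
    using f by (simp_all add: thom_def tcomp_def xs_def E_def)
  define Ed where "Ed = dualA E"
  have hEd: "homs xs xs Ed" unfolding Ed_def using hE by (rule homs_dualA)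
  have EdEd: "meq xs xs (compA t xs xs xs Ed Ed) Ed"
    using dualA_comp[OF fin fin fin hE hE, of t] unfolding EE Ed_def by (rule meq_sym)
  \<comment> \<open>The idempotent of X tensored with its dual; then that of the dual tensored with
    X, and \<open>f\<close> tensored with the identity of the dual.\<close>
  define MI where "MI = tensA xs xs xs xs E Ed"
  define MD where "MD = tensA xs xs xs xs Ed E"
  define MF where "MF = tensA xs xs xs xs f Ed"
  note hM = homs_tensA[where xs = xs and ys = xs and xs' = xs and ys' = xs, folded D_def]
  have hMI: "homs D D MI" and hMD: "homs D D MD" and hMF: "homs D D MF"
    unfolding MI_def MD_def MF_def by (rule hM)+
  define br where "br = (braidA xs xs :: 'a mor)"
  define eva where "eva = (evA xs :: 'a mor)"
  define coe where "coe = (coevA xs :: 'a mor)"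
  have hbr: "homs D D br" and heva: "homs D I eva" and hcoe: "homs I D coe"
    unfolding br_def eva_def coe_def D_def I_def by (rule homs_structure)+
  have tc: "meq D D (compA t D D D (tensA xs xs xs xs g g') (tensA xs xs xs xs h h')) (tensA xs xs xs xs k k')"
    if "homs xs xs g" "homs xs xs g'" "homs xs xs h" "homs xs xs h'"
      "meq xs xs (compA t xs xs xs g h) k" "meq xs xs (compA t xs xs xs g' h') k'" for g g' h h' k k'
    unfolding D_def
    by (rule meq_trans[OF tensA_comp[OF fin fin fin fin fin fin that(3,1,4,2)] tensA_cong[OF that(5,6)]])
  have MFI: "meq D D (compA t D D D MF MI) MF" unfolding MF_def MI_def
    by (rule tc[OF hf hEd hE hEd _ EdEd]) (simp add: fE meq_refl)
  have MIF: "meq D D (compA t D D D MI MF) MF" unfolding MF_def MI_def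
    by (rule tc[OF hE hEd hf hEd _ EdEd]) (simp add: fE meq_refl)
  have MDD: "meq D D (compA t D D D MD MD) MD" unfolding MD_def
    by (rule tc[OF hEd hE hEd hE EdEd]) (simp add: EE meq_refl)
  define Y where "Y = compA t I D D MF coe"
  have hY: "homs I D Y" unfolding Y_def by (rule homs_comp[OF finI finD finD])
  have hc: "homs I D (compA t I D D g h)" "homs D D (compA t D D D g h)" for g h
    by (rule homs_comp[OF finI finD finD] homs_comp[OF finD finD finD])+
  have IY: "meq I D (compA t I D D MI Y) Y"
    unfolding Y_def
    by (rule meq_trans[OF meq_sym[OF compA_assoc[OF finI finD finD finD hcoe hMF hMI]] meq_comp[OF MIF meq_refl]])
  have 1: "meq I D (compA t I D D MF (compA t I D D MI coe)) Y"
    unfolding Y_def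
    by (rule meq_trans[OF meq_sym[OF compA_assoc[OF finI finD finD finD hcoe hMI hMF]] meq_comp[OF MFI meq_refl]])
  define Z where "Z = compA t I D D br Y"
  have hZ: "homs I D Z" unfolding Z_def by (rule hc)
  have bIY: "meq I D (compA t I D D (compA t D D D br MI) Y) Z"
    unfolding Z_def
    by (rule meq_trans[OF compA_assoc[OF finI finD finD finD hY hMI hbr] meq_comp[OF meq_refl IY]])
  have 2: "meq I D (compA t I D D (compA t D D D MD (compA t D D D br MI)) Y) (compA t I D D MD Z)"
    by (rule meq_trans[OF compA_assoc[OF finI finD finD finD hY hc(2) hMD] meq_comp[OF meq_refl bIY]])
  have nat: "meq D D (compA t D D D MD br) (compA t D D D br MI)"
    unfolding MD_def MI_def br_def D_def by (rule braidA_natural[OF fin fin hE hEd])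
  \<comment> \<open>The idempotent passes through the braiding, where it becomes \<open>MI\<close>,
    and is absorbed by \<open>Y\<close>.\<close>
  have MDZ: "meq I D (compA t I D D MD Z) Z"
  proof -
    have "meq I D (compA t I D D MD Z) (compA t I D D (compA t D D D MD br) Y)"
      unfolding Z_def by (rule meq_sym[OF compA_assoc[OF finI finD finD finD hY hbr hMD]])
    also have "meq I D \<dots> (compA t I D D (compA t D D D br MI) Y)"
      by (rule meq_comp[OF nat meq_refl])
    also note bIY
    finally show ?thesis .
  qed
  have evb: "meq D I (compA t D D I eva br) eva"
    unfolding D_def I_def eva_def br_def by (rule evA_braidA[OF fin])
  have 3: "meq I I (compA t I D I (compA t D D I eva MD) Z) (compA t I D I eva Y)"
  proof -
    have "meq I I (compA t I D I (compA t D D I eva MD) Z) (compA t I D I eva (compA t I D D MD Z))"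
      by (rule compA_assoc[OF finI finD finD finI hZ hMD heva])
    also have "meq I I \<dots> (compA t I D I eva Z)" by (rule meq_comp[OF meq_refl MDZ])
    also have "meq I I \<dots> (compA t I D I (compA t D D I eva br) Y)"
      unfolding Z_def by (rule meq_sym[OF compA_assoc[OF finI finD finD finI hY hbr heva]])
    also have "meq I I \<dots> (compA t I D I eva Y)" by (rule meq_comp[OF evb meq_refl])
    finally show ?thesis .
  qed
  have "meq I I (compA t I D I (compA t D D I eva MD) (compA t I D D (compA t D D D MD (compA t D D D br MI))
      (compA t I D D MF (compA t I D D MI coe)))) (compA t I D I eva Y)"
    by (rule meq_trans[OF meq_comp[OF meq_refl meq_trans[OF meq_comp[OF meq_refl 1] meq_trans[OF 2 MDZ]]] 3])
  then have "compA t I D I (compA t D D I eva MD) (compA t I D D (compA t D D D MD (compA t D D D br MI))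
      (compA t I D D MF (compA t I D D MI coe))) 0 0 = compA t I D I eva Y 0 0"
    by (simp add: meq_def I_def)
  moreover have "cat_trace t X f = compA t I D I (compA t D D I eva MD) (compA t I D D (compA t D D D MD (compA t D D D br MI))
      (compA t I D D MF (compA t I D D MI coe))) 0 0 {}"
    by (simp add: cat_trace_def Let_def tcomp_def ev_def coev_def braid_def tens_def dual_def tunit_def dsum_def
      xs_def E_def D_def I_def MI_def MD_def MF_def Ed_def br_def eva_def coe_def)
  \<comment> \<open>Closing \<open>f\<close> with the idempotent \<open>E\<close> gives the trace of
    \<open>E\<close> after \<open>f\<close>, which is \<open>f\<close>.\<close>
  moreover have "compA t I D I eva Y 0 0 {} = trA t xs f"
    unfolding Y_def I_def D_def eva_def coe_def MF_def Ed_def using closure_tensA[OF fin hf hE, of t] by (simp add: fE)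
  ultimately show ?thesis by (simp add: xs_def)
qed

section \<open>Inversion over the poset of equivalence relations\<close>

lemma quotient_kernel_card:
  assumes "finite S"
  shows "card (S // kernel_on S h) = card (h ` S)"
proof -
  have "bij_betw (\<lambda>y. {u \<in> S. h u = y}) (h ` S) (S // kernel_on S h)"
  proof (rule bij_betw_imageI)
    show "inj_on (\<lambda>y. {u \<in> S. h u = y}) (h ` S)"
      by (rule inj_onI) blast
    have "kernel_on S h `` {u} = {v \<in> S. h v = h u}" if "u \<in> S" for u
      using that by (auto simp: kernel_on_def)
    then show "(\<lambda>y. {u \<in> S. h u = y}) ` (h ` S) = S // kernel_on S h"
      by (auto simp: quotient_def)
  qed
  from bij_betw_same_card[OF this] show ?thesis ..
qed

text \<open>The sums over coarsenings form a unitriangular system, solved from the coarsest relation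
  downwards. This is the uniqueness part of Moebius inversion; candidates for the inverse are then
  verified directly.\<close>

lemma coarsenings_sum_unique:
  fixes H :: "'a rel \<Rightarrow> 'k::ab_group_add"
  assumes "finite S" and H: "\<And>q. equiv S q \<Longrightarrow> (\<Sum>q'\<in>coarsenings S q. H q') = 0"
  shows "equiv S q \<Longrightarrow> H q = 0"
proof (induction "card (S \<times> S) - card q" arbitrary: q rule: less_induct)
  case less
  have sub: "q \<subseteq> S \<times> S" if "equiv S q" for q using that by (simp add: equiv_def)
  have q: "q \<in> coarsenings S q" using less.prems by (simp add: coarsenings_def)
  have "H q' = 0" if q': "q' \<in> coarsenings S q - {q}" for q'
  proof (rule less.hyps)
    show e: "equiv S q'" using q' by (simp add: coarsenings_def)
    have "finite q'" using sub[OF e] assms(1) finite_subset by blast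
    moreover have "q \<subset> q'" using q' by (auto simp: coarsenings_def)
    ultimately have "card q < card q'" by (rule psubset_card_mono)
    moreover have "card q' \<le> card (S \<times> S)" using sub[OF e] assms(1) by (intro card_mono) auto
    ultimately show "card (S \<times> S) - card q' < card (S \<times> S) - card q" by linarith
  qed
  then have "(\<Sum>q'\<in>coarsenings S q - {q}. H q') = 0" by (rule sum.neutral[OF ballI])
  then show ?case
    using H[OF less.prems] sum.remove[OF finite_coarsenings[OF assms(1)] q, of H] by simp
qed

text \<open>Adding or removing a point of \<open>x\<close> outside of \<open>A0\<close> pairs off
  the terms with opposite signs.\<close>

lemma alternating_sum_superset:
  assumes "finite x" "A0 \<subseteq> x"
  shows "(\<Sum>A | A0 \<subseteq> A \<and> A \<subseteq> x. (- 1) ^ card A) = (if A0 = x then (- 1) ^ card x else (0::'k::comm_ring_1))"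
proof (cases "A0 = x")
  case True
  then have "{A. A0 \<subseteq> A \<and> A \<subseteq> x} = {x}" by auto
  then show ?thesis using True by simp
next
  case False
  then obtain i where i: "i \<in> x" "i \<notin> A0" using assms(2) by auto
  let ?S = "{A. A0 \<subseteq> A \<and> A \<subseteq> x}"
  have fin: "finite ?S" by (rule finite_subset[of _ "Pow x"]) (use assms(1) in auto)
  have "(\<Sum>A\<in>?S. (- 1 :: 'k) ^ card A) = (\<Sum>A\<in>{A \<in> ?S. i \<notin> A}. (- 1) ^ card A) + (\<Sum>A\<in>{A \<in> ?S. i \<in> A}. (- 1) ^ card A)"
    using sum.Int_Diff[OF fin, of "\<lambda>A. (- 1 :: 'k) ^ card A" "{A. i \<notin> A}"] by (simp add: Int_def set_diff_eq)
  also have "(\<Sum>A\<in>{A \<in> ?S. i \<in> A}. (- 1 :: 'k) ^ card A) = (\<Sum>A\<in>{A \<in> ?S. i \<notin> A}. (- 1) ^ card (insert i A))"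
    by (rule sum.reindex_bij_witness[of _ "insert i" "\<lambda>A. A - {i}"]) (use i in \<open>auto simp: insert_absorb\<close>)
  also have "\<dots> = (\<Sum>A\<in>{A \<in> ?S. i \<notin> A}. - ((- 1) ^ card A))"
    by (intro sum.cong refl) (use finite_subset[OF _ assms(1)] in \<open>auto simp: card_insert_if\<close>)
  finally show ?thesis using False by (simp add: sum_negf)
qed

section \<open>The coefficients of the upper idempotent\<close>

text \<open>The partial matching that joins \<open>j\<close> to \<open>s j\<close> for \<open>j \<in> A\<close> and leaves all other points isolated.\<close>

definition pmatch :: "nat set \<Rightarrow> (nat \<Rightarrow> nat) \<Rightarrow> nat set \<Rightarrow> arel" where
  "pmatch x s A = kernel_on (x <+> x) (case_sum Inl (\<lambda>j. if j \<in> A then Inl (s j) else Inr j) :: nat + nat \<Rightarrow> nat + nat)"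

lemma pmatch_arels: "pmatch x s A \<in> arels x x"
  by (simp add: pmatch_def kernel_arels)

lemma pmatch_iff [simp]:
  "(Inl i, Inl i') \<in> pmatch x s A \<longleftrightarrow> i \<in> x \<and> i' = i"
  "(Inl i, Inr j) \<in> pmatch x s A \<longleftrightarrow> i \<in> x \<and> j \<in> x \<and> j \<in> A \<and> i = s j"
  "(Inr j, Inl i) \<in> pmatch x s A \<longleftrightarrow> i \<in> x \<and> j \<in> x \<and> j \<in> A \<and> i = s j"
  "inj s \<Longrightarrow> (Inr j, Inr j') \<in> pmatch x s A \<longleftrightarrow> j \<in> x \<and> j' = j"
  by (auto simp: pmatch_def kernel_on_def dest: injD)

lemma graph_rel_pmatch:
  assumes "s permutes x"
  shows "graph_rel x x s = pmatch x s x"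
proof -
  have "case_sum id s u = case_sum id s v \<longleftrightarrow>
      (case_sum Inl (\<lambda>j. if j \<in> x then Inl (s j) else Inr j) u :: nat + nat) = case_sum Inl (\<lambda>j. if j \<in> x then Inl (s j) else Inr j) v"
    if "u \<in> x <+> x" "v \<in> x <+> x" for u v
    using that by (cases u; cases v) auto
  then show ?thesis unfolding graph_rel_def pmatch_def kernel_on_def by blast
qed

text \<open>The points of the left copy lie in different classes, and each unmatched point of the
  right copy adds one more class.\<close>

lemma card_pmatch:
  assumes "finite x" "A \<subseteq> x" "s permutes x"
  shows "card ((x <+> x) // pmatch x s A) = 2 * card x - card A"
proof -
  let ?h = "case_sum Inl (\<lambda>j. if j \<in> A then Inl (s j) else Inr j) :: nat + nat \<Rightarrow> nat + nat"
  have "?h ` (x <+> x) = x <+> (x - A)"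
  proof -
    have "?h ` (x <+> x) = Inl ` x \<union> (\<lambda>j. if j \<in> A then Inl (s j) else Inr j) ` x"
      by (simp add: Plus_def image_Un image_image)
    also have "(\<lambda>j. if j \<in> A then Inl (s j) else Inr j :: nat + nat) ` x = Inl ` s ` A \<union> Inr ` (x - A)"
      using assms(2) by (auto simp: image_iff)
    also have "Inl ` x \<union> (Inl ` s ` A \<union> Inr ` (x - A)) = x <+> (x - A)"
      using assms(2,3) permutes_in_image[OF assms(3)] by (auto simp: Plus_def)
    finally show ?thesis .
  qed
  then have "card ((x <+> x) // pmatch x s A) = card (x <+> (x - A))"
    using assms(1) by (simp add: pmatch_def quotient_kernel_card)
  also have "\<dots> = card x + card (x - A)" using assms(1) by (simp add: card_Plus)
  also have "\<dots> = 2 * card x - card A"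
    using assms(1,2) card_mono[OF assms(1,2)] by (simp add: card_Diff_subset finite_subset)
  finally show ?thesis .
qed

lemma pmatch_subset_iff:
  assumes "s permutes x" "s' permutes x" "A \<subseteq> x"
  shows "pmatch x s A \<subseteq> pmatch x s' A' \<longleftrightarrow> (\<forall>j\<in>A. j \<in> A' \<and> s' j = s j)"
proof
  assume l: "pmatch x s A \<subseteq> pmatch x s' A'"
  have "(Inl (s j), Inr j) \<in> pmatch x s A" if "j \<in> A" for j
    using that assms(3) permutes_in_image[OF assms(1)] by auto
  then have "(Inl (s j), Inr j) \<in> pmatch x s' A'" if "j \<in> A" for j using l that by blast
  then show "\<forall>j\<in>A. j \<in> A' \<and> s' j = s j" by auto
next
  assume r: "\<forall>j\<in>A. j \<in> A' \<and> s' j = s j"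
  note i = permutes_inj[OF assms(1)] permutes_inj[OF assms(2)]
  show "pmatch x s A \<subseteq> pmatch x s' A'"
  proof (rule subrelI)
    fix u v assume "(u, v) \<in> pmatch x s A"
    then show "(u, v) \<in> pmatch x s' A'" using r i by (cases u; cases v) auto
  qed
qed

lemma pmatch_inject: "s permutes x \<Longrightarrow> A \<subseteq> x \<Longrightarrow> A' \<subseteq> x \<Longrightarrow> pmatch x s A = pmatch x s A' \<longleftrightarrow> A = A'"
  using pmatch_subset_iff[of s x s A A'] pmatch_subset_iff[of s x s A' A] by blast

text \<open>The relations that refine a permutation form a Boolean lattice: the classes of its graph
  are pairs, and a refinement either keeps a pair or breaks it up.\<close>

lemma subset_pmatch:
  assumes "s permutes x" "r \<in> arels x x" "r \<subseteq> pmatch x s A"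
  obtains B where "B \<subseteq> A \<inter> x" "r = pmatch x s B"
proof
  let ?B = "{j \<in> x. (Inl (s j), Inr j) \<in> r}"
  have r: "\<And>u. u \<in> x <+> x \<Longrightarrow> (u, u) \<in> r" "sym r" using assms(2) by (simp_all add: arels_def equiv_def refl_on_def)
  have sub: "(u, v) \<in> pmatch x s A" if "(u, v) \<in> r" for u v using that assms(3) by blast
  note i = permutes_inj[OF assms(1)]
  show "?B \<subseteq> A \<inter> x" using sub by force
  have "(u, v) \<in> r \<longleftrightarrow> (u, v) \<in> pmatch x s ?B" for u v
  proof (cases u; cases v)
    fix a b assume "u = Inl a" "v = Inl b"
    then show ?thesis using sub[of u v] r(1)[of u] by auto
  next
    fix a b assume "u = Inr a" "v = Inr b"
    then show ?thesis using sub[of u v] r(1)[of u] i by auto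
  next
    fix a b assume "u = Inl a" "v = Inr b"
    then show ?thesis using sub[of u v] permutes_in_image[OF assms(1)] by auto
  next
    fix a b assume "u = Inr a" "v = Inl b"
    then show ?thesis using sub[of u v] permutes_in_image[OF assms(1)] symD[OF r(2)] by auto
  qed
  then have iff: "(u, v) \<in> r \<longleftrightarrow> (u, v) \<in> pmatch x s ?B" for u v .
  show "r = pmatch x s ?B"
    by (intro equalityI subrelI; erule iff[THEN iffD1] iff[THEN iffD2])
qed

lemma falling_nonzero: "(t :: 'k::field_char_0) \<notin> \<nat> \<Longrightarrow> falling t k \<noteq> 0"
  unfolding falling_def by (auto simp: Nats_def)

lemma coarsenings_join:
  assumes "r \<in> arels x x"
  shows "coarsenings (x <+> x) ((r \<union> q)\<^sup>+) = {q' \<in> coarsenings (x <+> x) q. r \<subseteq> q'}"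
proof -
  have "(r \<union> q)\<^sup>+ \<subseteq> q' \<longleftrightarrow> r \<union> q \<subseteq> q'" if "equiv (x <+> x) q'" for q'
  proof
    assume "r \<union> q \<subseteq> q'"
    then have "(r \<union> q)\<^sup>+ \<subseteq> q'\<^sup>+" by (rule trancl_mono_subset)
    then show "(r \<union> q)\<^sup>+ \<subseteq> q'" using that by (simp add: equiv_def trancl_id)
  qed (use r_into_trancl' in blast)
  then show ?thesis by (auto simp: coarsenings_def)
qed

text \<open>The sign is the Moebius function of the Boolean interval from \<open>q'\<close> up to
  the graph of \<open>s\<close>, since a matching with a pairs has 2 \<open>card x\<close> - a
  classes. Its sum over an interval vanishes unless the interval is a point.\<close>

lemma sum_coarsenings_pmatch:
  assumes "finite x" "s permutes x" "q \<in> arels x x"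
  shows "(\<Sum>q'\<in>{q' \<in> coarsenings (x <+> x) q. q' \<subseteq> pmatch x s x}. (- 1) ^ (card x + card ((x <+> x) // q')))
    = (if q = pmatch x s x then 1 else (0::'k::comm_ring_1))"
proof (cases "q \<subseteq> pmatch x s x")
  case False
  then have "{q' \<in> coarsenings (x <+> x) q. q' \<subseteq> pmatch x s x} = {}" by (auto simp: coarsenings_def)
  moreover have "q \<noteq> pmatch x s x" using False by auto
  ultimately show ?thesis by (simp only: sum.empty if_False)
next
  case True
  then obtain B where B: "B \<subseteq> x" "q = pmatch x s B" using subset_pmatch[OF assms(2,3)] by (metis inf_idem)
  have sgn: "(- 1 :: 'k) ^ (card x + (2 * card x - card A)) = (- 1) ^ (card x + card A)" if "A \<subseteq> x" for A
  proof -
    have "card A \<le> card x" using that assms(1) by (rule card_mono[rotated])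
    then have "card x + (2 * card x - card A) + 2 * card A = 2 * card x + (card x + card A)" by simp
    then have "(- 1 :: 'k) ^ (card x + (2 * card x - card A)) * (- 1) ^ (2 * card A) = (- 1) ^ (2 * card x) * (- 1) ^ (card x + card A)"
      by (metis power_add)
    then show ?thesis by simp
  qed
  have "(\<Sum>q'\<in>{q' \<in> coarsenings (x <+> x) q. q' \<subseteq> pmatch x s x}. (- 1 :: 'k) ^ (card x + card ((x <+> x) // q')))
    = (\<Sum>A\<in>{A. B \<subseteq> A \<and> A \<subseteq> x}. (- 1) ^ (card x + card A))"
  proof (rule sum.reindex_bij_betw[THEN sym, THEN trans])
    show "bij_betw (pmatch x s) {A. B \<subseteq> A \<and> A \<subseteq> x} {q' \<in> coarsenings (x <+> x) q. q' \<subseteq> pmatch x s x}"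
    proof (rule bij_betw_imageI)
      show "inj_on (pmatch x s) {A. B \<subseteq> A \<and> A \<subseteq> x}"
        by (rule inj_onI) (auto simp: pmatch_inject[OF assms(2)])
      show "pmatch x s ` {A. B \<subseteq> A \<and> A \<subseteq> x} = {q' \<in> coarsenings (x <+> x) q. q' \<subseteq> pmatch x s x}"
      proof (intro equalityI subsetI)
        fix q' assume "q' \<in> pmatch x s ` {A. B \<subseteq> A \<and> A \<subseteq> x}"
        then obtain A where A: "B \<subseteq> A" "A \<subseteq> x" "q' = pmatch x s A" by auto
        then show "q' \<in> {q' \<in> coarsenings (x <+> x) q. q' \<subseteq> pmatch x s x}"
          using pmatch_arels[of x s A] B pmatch_subset_iff[OF assms(2,2)]
          by (auto simp: coarsenings_def arels_def)
      next
        fix q' assume q': "q' \<in> {q' \<in> coarsenings (x <+> x) q. q' \<subseteq> pmatch x s x}"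
        then have "q' \<in> arels x x" by (simp add: coarsenings_def arels_def)
        then obtain A where A: "A \<subseteq> x" "q' = pmatch x s A"
          using subset_pmatch[OF assms(2)] q' by (metis (no_types, lifting) inf_idem mem_Collect_eq)
        moreover have "B \<subseteq> A" using q' A B pmatch_subset_iff[OF assms(2,2) B(1), of A] by (auto simp: coarsenings_def)
        ultimately show "q' \<in> pmatch x s ` {A. B \<subseteq> A \<and> A \<subseteq> x}" by blast
      qed
    qed
    show "(\<Sum>A\<in>{A. B \<subseteq> A \<and> A \<subseteq> x}. (- 1 :: 'k) ^ (card x + card ((x <+> x) // pmatch x s A)))
      = (\<Sum>A\<in>{A. B \<subseteq> A \<and> A \<subseteq> x}. (- 1) ^ (card x + card A))"
      by (intro sum.cong refl) (simp add: card_pmatch assms sgn)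
  qed
  also have "\<dots> = (- 1) ^ card x * (\<Sum>A | B \<subseteq> A \<and> A \<subseteq> x. (- 1) ^ card A)"
    by (simp add: power_add sum_distrib_left)
  also have "\<dots> = (if q = pmatch x s x then 1 else 0)"
    unfolding alternating_sum_superset[OF assms(1) B(1)] B(2)
    using B(1) by (simp add: pmatch_inject[OF assms(2)] power_mult_distrib[symmetric])
  finally show ?thesis .
qed

text \<open>Let \<open>C q\<close> be the sum of the coefficients of \<open>e\<close> at the
  relations below \<open>q\<close>. Expanding the powers of \<open>t\<close> into falling factorials
  makes \<open>Psi q\<close> the sum of \<open>fall q' * C q'\<close> over the coarsenings
  \<open>q'\<close> of \<open>q\<close>. As \<open>Psi\<close> is supported on permutations,
  inverting this involves only the intervals below permutations, which are Boolean. A second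
  inversion, from below and inside the matchings of \<open>s\<close>, recovers the coefficient of
  \<open>e\<close> from \<open>C\<close>.\<close>

lemma dual_coefficients:
  fixes t :: "'k::field_char_0" and e :: "arel \<Rightarrow> 'k"
  assumes "finite x" "t \<notin> \<nat>"
  defines "Psi \<equiv> \<lambda>q. \<Sum>r\<in>arels x x. e r * t ^ joins x x r q"
  assumes zero: "\<And>q. q \<in> arels x x \<Longrightarrow> (\<And>s. s permutes x \<Longrightarrow> q \<noteq> graph_rel x x s) \<Longrightarrow> Psi q = 0"
    and s: "s permutes x"
  shows "e (graph_rel x x s) = (\<Sum>s'\<in>{s'. s' permutes x}. Psi (graph_rel x x s') *
      (\<Sum>A\<in>{A \<in> Pow x. \<forall>j\<in>A. s' j = s j}. inverse (falling t (2 * card x - card A))))"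
proof -
  let ?S = "x <+> x" and ?P = "{s. s permutes x}"
  have finS: "finite ?S" using assms(1) by simp
  have finP: "finite ?P" using assms(1) by (rule finite_permutations)
  have gr: "graph_rel x x s = pmatch x s x" if "s \<in> ?P" for s using that by (simp add: graph_rel_pmatch)
  define fall where "fall q = falling t (card (?S // q))" for q :: arel
  define C where "C q = (\<Sum>r\<in>{r \<in> arels x x. r \<subseteq> q}. e r)" for q
  \<comment> \<open>The candidate for \<open>fall q * C q\<close>: the Moebius inversion of
    \<open>Psi\<close>, to which only the permutations that are coarser than \<open>q\<close>
    contribute.\<close>
  define F where "F q = (\<Sum>s\<in>{s \<in> ?P. q \<subseteq> pmatch x s x}. (- 1) ^ (card x + card (?S // q)) * Psi (pmatch x s x))" for q
  have Psi1: "Psi q = (\<Sum>q'\<in>coarsenings ?S q. fall q' * C q')" if q: "q \<in> arels x x" for q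
  proof -
    have "t ^ joins x x r q = (\<Sum>q'\<in>{q' \<in> coarsenings ?S q. r \<subseteq> q'}. fall q')" if "r \<in> arels x x" for r
      unfolding joins_def fall_def coarsenings_join[OF that, symmetric]
      by (rule sum_coarsenings_falling[symmetric, OF finS equiv_join[OF that q]])
    then have "Psi q = (\<Sum>r\<in>arels x x. \<Sum>q'\<in>{q' \<in> coarsenings ?S q. r \<subseteq> q'}. e r * fall q')"
      unfolding Psi_def by (intro sum.cong refl) (simp add: sum_distrib_left)
    also have "\<dots> = (\<Sum>q'\<in>coarsenings ?S q. \<Sum>r\<in>{r \<in> arels x x. r \<subseteq> q'}. e r * fall q')"
      by (rule sum.swap_restrict[OF finite_arels[OF assms(1,1)] finite_coarsenings[OF finS]])
    finally show ?thesis unfolding C_def by (simp add: sum_distrib_left mult.commute)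
  qed
  have Psi2: "Psi q = (\<Sum>q'\<in>coarsenings ?S q. F q')" if q: "q \<in> arels x x" for q
  proof -
    have "(\<Sum>q'\<in>coarsenings ?S q. F q') = (\<Sum>s\<in>?P. \<Sum>q'\<in>{q' \<in> coarsenings ?S q. q' \<subseteq> pmatch x s x}.
        (- 1) ^ (card x + card (?S // q')) * Psi (pmatch x s x))"
      unfolding F_def by (rule sum.swap_restrict[OF finite_coarsenings[OF finS] finP])
    also have "\<dots> = (\<Sum>s\<in>?P. if q = pmatch x s x then Psi q else 0)"
      unfolding sum_distrib_right[symmetric]
      by (intro sum.cong refl) (use sum_coarsenings_pmatch[OF assms(1) _ q, where 'k = 'k] in simp)
    also have "\<dots> = Psi q"
    proof (cases "\<exists>s\<in>?P. q = pmatch x s x")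
      case True
      then obtain s where s: "s permutes x" "q = pmatch x s x" by auto
      have "q = pmatch x s' x \<longleftrightarrow> s' = s" if "s' permutes x" for s'
      proof
        assume "q = pmatch x s' x"
        then have "s' j = s j" if "j \<in> x" for j using pmatch_subset_iff[OF s(1) \<open>s' permutes x\<close> subset_refl, of x] s(2) that by auto
        then show "s' = s" using s(1) \<open>s' permutes x\<close> by (metis ext permutes_not_in)
      qed (use s in simp)
      then have "(\<Sum>s\<in>?P. if q = pmatch x s x then Psi q else 0) = (\<Sum>s'\<in>?P. if s' = s then Psi q else 0)"
        by (intro sum.cong refl) auto
      then show ?thesis using s(1) finP by simp
    next
      case False
      then have "Psi q = 0" using zero[OF q] by (metis gr mem_Collect_eq)
      then show ?thesis by (auto intro!: sum.neutral)
    qed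
    finally show ?thesis ..
  qed
  have FC: "fall q * C q = F q" if "q \<in> arels x x" for q
  proof -
    have "fall q * C q - F q = 0"
    proof (rule coarsenings_sum_unique[OF finS, where H = "\<lambda>q. fall q * C q - F q"])
      fix q assume "equiv ?S q"
      then have q: "q \<in> arels x x" by (simp add: arels_def)
      show "(\<Sum>q'\<in>coarsenings ?S q. fall q' * C q' - F q') = 0"
        unfolding sum_subtractf Psi1[OF q, symmetric] Psi2[OF q, symmetric] by simp
    qed (use that in \<open>simp add: arels_def\<close>)
    then show ?thesis by simp
  qed
  \<comment> \<open>The exponents add up to 4 \<open>card x\<close>, so the signs of the two
    inversions cancel.\<close>
  have sgn: "(- 1 :: 'k) ^ (card x + card A) * (- 1) ^ (card x + card (?S // pmatch x s A)) = 1" if "A \<subseteq> x" for A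
  proof -
    have "card A \<le> card x" using that assms(1) by (rule card_mono[rotated])
    then have "card x + card A + (card x + card (?S // pmatch x s A)) = 2 * (2 * card x)"
      using card_pmatch[OF assms(1) that s] by simp
    then show ?thesis by (metis (no_types) power_add power_minus1_even)
  qed
  have Ce: "C (pmatch x s A) = (\<Sum>A'\<in>Pow A. e (pmatch x s A'))" if A: "A \<subseteq> x" for A
  proof -
    have "bij_betw (pmatch x s) (Pow A) {r \<in> arels x x. r \<subseteq> pmatch x s A}"
    proof (rule bij_betw_imageI)
      show "inj_on (pmatch x s) (Pow A)" using A by (intro inj_onI) (auto simp: pmatch_inject[OF s])
      show "pmatch x s ` Pow A = {r \<in> arels x x. r \<subseteq> pmatch x s A}"
      proof (intro equalityI subsetI)
        fix r assume "r \<in> pmatch x s ` Pow A"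
        then obtain B where "B \<subseteq> A" "r = pmatch x s B" by auto
        moreover then have "pmatch x s B \<subseteq> pmatch x s A"
          using A by (subst pmatch_subset_iff[OF s s]) auto
        ultimately show "r \<in> {r \<in> arels x x. r \<subseteq> pmatch x s A}"
          using pmatch_arels by simp
      next
        fix r assume r: "r \<in> {r \<in> arels x x. r \<subseteq> pmatch x s A}"
        obtain B where "B \<subseteq> A \<inter> x" "r = pmatch x s B" using subset_pmatch[OF s, of r A] r by auto
        then show "r \<in> pmatch x s ` Pow A" by auto
      qed
    qed
    then show ?thesis unfolding C_def by (rule sum.reindex_bij_betw[symmetric])
  qed
  have "e (pmatch x s x) = (\<Sum>A'\<in>Pow x. if A' = x then e (pmatch x s A') else 0)"
    using assms(1) by simp
  \<comment> \<open>With the sign in front, the alternating sum over the sets between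
    \<open>A'\<close> and \<open>x\<close> is 1 for \<open>A' = x\<close> and 0 otherwise.\<close>
  also have "\<dots> = (\<Sum>A'\<in>Pow x. e (pmatch x s A') * ((- 1) ^ card x * (\<Sum>A | A' \<subseteq> A \<and> A \<subseteq> x. (- 1) ^ card A)))"
    by (intro sum.cong refl) (use assms(1) in \<open>auto simp: alternating_sum_superset power_mult_distrib[symmetric]\<close>)
  also have "\<dots> = (\<Sum>A'\<in>Pow x. \<Sum>A\<in>{A \<in> Pow x. A' \<subseteq> A}. (- 1) ^ (card x + card A) * e (pmatch x s A'))"
    unfolding sum_distrib_left by (intro sum.cong refl) (auto simp: power_add mult_ac)
  also have "\<dots> = (\<Sum>A\<in>Pow x. \<Sum>A'\<in>{A' \<in> Pow x. A' \<subseteq> A}. (- 1) ^ (card x + card A) * e (pmatch x s A'))"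
    by (rule sum.swap_restrict) (use assms(1) in auto)
  also have "\<dots> = (\<Sum>A\<in>Pow x. (- 1) ^ (card x + card A) * C (pmatch x s A))"
  proof (intro sum.cong refl)
    fix A assume "A \<in> Pow x"
    then have "{A' \<in> Pow x. A' \<subseteq> A} = Pow A" "A \<subseteq> x" by auto
    then show "(\<Sum>A'\<in>{A' \<in> Pow x. A' \<subseteq> A}. (- 1) ^ (card x + card A) * e (pmatch x s A')) = (- 1) ^ (card x + card A) * C (pmatch x s A)"
      using Ce by (simp add: sum_distrib_left)
  qed
  also have "\<dots> = (\<Sum>A\<in>Pow x. \<Sum>s'\<in>{s' \<in> ?P. \<forall>j\<in>A. s' j = s j}. Psi (pmatch x s' x) * inverse (falling t (2 * card x - card A)))"
  proof (intro sum.cong refl)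
    fix A assume "A \<in> Pow x"
    then have A: "A \<subseteq> x" by simp
    have fall: "fall (pmatch x s A) = falling t (2 * card x - card A)"
      unfolding fall_def card_pmatch[OF assms(1) A s] ..
    have "C (pmatch x s A) = inverse (falling t (2 * card x - card A)) * F (pmatch x s A)"
      unfolding FC[OF pmatch_arels, symmetric] fall using falling_nonzero[OF assms(2)] by simp
    also have "{s' \<in> ?P. pmatch x s A \<subseteq> pmatch x s' x} = {s' \<in> ?P. \<forall>j\<in>A. s' j = s j}"
      using A pmatch_subset_iff[OF s _ A, of _ x] by auto
    then have "F (pmatch x s A) = (- 1) ^ (card x + card (?S // pmatch x s A)) * (\<Sum>s'\<in>{s' \<in> ?P. \<forall>j\<in>A. s' j = s j}. Psi (pmatch x s' x))"
      unfolding F_def sum_distrib_left by simp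
    finally have "(- 1) ^ (card x + card A) * C (pmatch x s A) = ((- 1) ^ (card x + card A) * (- 1) ^ (card x + card (?S // pmatch x s A)))
       * (inverse (falling t (2 * card x - card A)) * (\<Sum>s'\<in>{s' \<in> ?P. \<forall>j\<in>A. s' j = s j}. Psi (pmatch x s' x)))"
      by (simp only: mult_ac)
    then show "(- 1) ^ (card x + card A) * C (pmatch x s A) = (\<Sum>s'\<in>{s' \<in> ?P. \<forall>j\<in>A. s' j = s j}. Psi (pmatch x s' x) * inverse (falling t (2 * card x - card A)))"
      unfolding sgn[OF A] by (simp add: sum_distrib_left mult.commute)
  qed
  also have "\<dots> = (\<Sum>s'\<in>?P. \<Sum>A\<in>{A \<in> Pow x. \<forall>j\<in>A. s' j = s j}. Psi (pmatch x s' x) * inverse (falling t (2 * card x - card A)))"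
    by (rule sum.swap_restrict) (use assms(1) finP in auto)
  finally show ?thesis
    using s gr by (simp add: sum_distrib_left)
qed

text \<open>A rank argument: the matrix of a permutation has one nonzero entry in each row and each
  column, so a factorization through \<open>z\<close> would embed the subsets of \<open>x\<close>
  into the subsets of \<open>z\<close>.\<close>

lemma comp_rel_through_small:
  assumes "finite x" "finite z" "card z < card x" "r \<in> arels x z" "s \<in> arels z x" "p permutes x"
  shows "comp_rel x x r s \<noteq> graph_rel x x p"
proof
  assume e: "comp_rel x x r s = graph_rel x x p"
  define c where "c a = {j \<in> x. p j \<in> a}" for a
  have p: "p ` x \<subseteq> x" using permutes_image[OF assms(6)] by simp
  have g: "relsem (graph_rel x x p) a d \<longleftrightarrow> d = c a" if "a \<subseteq> x" "d \<subseteq> x" for a d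
    unfolding c_def by (rule relsem_graph[OF that p])
  note rc = relsem_comp(2)[OF assms(1,2,1,4,5), unfolded e]
  have "\<exists>b\<subseteq>z. relsem r a b \<and> relsem s b (c a)" if a: "a \<subseteq> x" for a
  proof -
    have ca: "c a \<subseteq> x" by (auto simp: c_def)
    have "card {b \<in> Pow z. relsem r a b \<and> relsem s b (c a)} \<noteq> 0"
      unfolding rc[OF a ca] using g[OF a ca] by simp
    then have "{b \<in> Pow z. relsem r a b \<and> relsem s b (c a)} \<noteq> {}" by (metis card.empty)
    then show ?thesis by auto
  qed
  \<comment> \<open>\<open>b a\<close> is a middle subset through which the nonzero entry in row
    \<open>a\<close> is reached. It determines \<open>a\<close>, since sharing it would create a
    second nonzero entry in the row.\<close>
  then obtain b where b: "b a \<subseteq> z" "relsem r a (b a)" "relsem s (b a) (c a)" if "a \<subseteq> x" for a by metis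
  have "inj_on b (Pow x)"
  proof (rule inj_onI)
    fix a a' assume "a \<in> Pow x" "a' \<in> Pow x" and eq: "b a = b a'"
    then have a: "a \<subseteq> x" "a' \<subseteq> x" by auto
    have ca: "c a' \<subseteq> x" by (auto simp: c_def)
    have "b a \<in> {d \<in> Pow z. relsem r a d \<and> relsem s d (c a')}" using b[OF a(1)] b[OF a(2)] eq by simp
    then have "card {d \<in> Pow z. relsem r a d \<and> relsem s d (c a')} \<noteq> 0"
      using assms(2) by (metis (no_types, lifting) card_eq_0_iff empty_iff finite_Pow_iff finite_subset mem_Collect_eq subsetI)
    then have "relsem (graph_rel x x p) a (c a')" unfolding rc[OF a(1) ca] by (simp split: if_splits)
    then have "c a' = c a" using g[OF a(1) ca] by simp
    then have "j \<in> x \<Longrightarrow> p j \<in> a' \<longleftrightarrow> p j \<in> a" for j by (auto simp: c_def set_eq_iff)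
    then have "i \<in> x \<Longrightarrow> i \<in> a' \<longleftrightarrow> i \<in> a" for i using permutes_image[OF assms(6)] by (metis imageE)
    then show "a = a'" using a by blast
  qed
  then have "card (Pow x) \<le> card (Pow z)"
    by (rule card_inj_on_le) (use b(1) assms(2) in auto)
  then have "(2::nat) ^ card x \<le> 2 ^ card z" using assms(1,2) by (simp add: card_Pow)
  then show False using assms(3) by simp
qed

lemma comp0_through_small:
  assumes "finite x" "finite z" "card z < card x" "p permutes x"
  shows "comp0 t x z x g f (graph_rel x x p) = 0"
  unfolding comp0_def
proof (intro sum.neutral ballI)
  fix r s assume "r \<in> arels x z" "s \<in> arels z x"
  then have "comp_rel x x r s \<noteq> graph_rel x x p" using comp_rel_through_small[OF assms(1-3) _ _ assms(4)] by blast
  then have "bas (comp_rel x x r s) (graph_rel x x p) = (0::'a)" by (auto simp: bas_def)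
  then show "f r * g s * delta t ((x <+> x) // comp_rel x x r s) ((x <+> z <+> x) // fibre_rel r s) *
      bas (comp_rel x x r s) (graph_rel x x p) = 0" by (simp only: mult_zero_right)
qed

lemma relsem_kernel_sum:
  assumes "a \<subseteq> x" "b \<subseteq> y"
  shows "relsem (kernel_on (x <+> y) (case_sum h k)) a b \<longleftrightarrow>
    (\<forall>i\<in>x. \<forall>i'\<in>x. h i = h i' \<longrightarrow> (i \<in> a \<longleftrightarrow> i' \<in> a)) \<and> (\<forall>i\<in>x. \<forall>j\<in>y. h i = k j \<longrightarrow> (i \<in> a \<longleftrightarrow> j \<in> b))
    \<and> (\<forall>j\<in>y. \<forall>j'\<in>y. k j = k j' \<longrightarrow> (j \<in> b \<longleftrightarrow> j' \<in> b))" (is "_ \<longleftrightarrow> ?R")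
  unfolding relsem_kernel[OF assms]
proof
  assume l: "\<forall>u\<in>x <+> y. \<forall>v\<in>x <+> y. case_sum h k u = case_sum h k v \<longrightarrow> (u \<in> a <+> b) = (v \<in> a <+> b)"
  show ?R
  proof (intro conjI ballI impI)
    fix i i' assume "i \<in> x" "i' \<in> x" "h i = h i'"
    then show "i \<in> a \<longleftrightarrow> i' \<in> a" using l[rule_format, of "Inl i" "Inl i'"] by simp
  next
    fix i j assume "i \<in> x" "j \<in> y" "h i = k j"
    then show "i \<in> a \<longleftrightarrow> j \<in> b" using l[rule_format, of "Inl i" "Inr j"] by simp
  next
    fix j j' assume "j \<in> y" "j' \<in> y" "k j = k j'"
    then show "j \<in> b \<longleftrightarrow> j' \<in> b" using l[rule_format, of "Inr j" "Inr j'"] by simp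
  qed
next
  assume r: ?R
  show "\<forall>u\<in>x <+> y. \<forall>v\<in>x <+> y. case_sum h k u = case_sum h k v \<longrightarrow> (u \<in> a <+> b) = (v \<in> a <+> b)"
  proof (intro ballI impI)
    fix u v assume uv: "u \<in> x <+> y" "v \<in> x <+> y" "case_sum h k u = case_sum h k v"
    have aa: "i \<in> a \<longleftrightarrow> i' \<in> a" if "i \<in> x" "i' \<in> x" "h i = h i'" for i i' using r that by blast
    have ab: "i \<in> a \<longleftrightarrow> j \<in> b" if "i \<in> x" "j \<in> y" "h i = k j" for i j using r that by blast
    have bb: "j \<in> b \<longleftrightarrow> j' \<in> b" if "j \<in> y" "j' \<in> y" "k j = k j'" for j j' using r that by blast
    show "u \<in> a <+> b \<longleftrightarrow> v \<in> a <+> b"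
    proof (cases u)
      case u: (Inl i)
      show ?thesis
      proof (cases v)
        case (Inl j) then show ?thesis using aa[of i j] uv u by simp
      next
        case (Inr j) then show ?thesis using ab[of i j] uv u by simp
      qed
    next
      case u: (Inr i)
      show ?thesis
      proof (cases v)
        case (Inl j) then show ?thesis using ab[of j i] uv u by simp
      next
        case (Inr j) then show ?thesis using bb[of i j] uv u by simp
      qed
    qed
  qed
qed

text \<open>The relation factors through the set \<open>z\<close> of classes that meet both copies
  of \<open>x\<close>. It has at most \<open>card x\<close> elements; if it has exactly that many,
  both copies of \<open>x\<close> map bijectively onto it, and \<open>r\<close> is the graph of the
  resulting permutation.\<close>

lemma permutation_or_through_small:
  assumes "finite x" "r \<in> arels x x"
  obtains (perm) p where "p permutes x" "r = graph_rel x x p"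
  | (small) z s s' where "finite z" "card z < card x" "s \<in> arels x z" "s' \<in> arels z x" "comp_rel x x s s' = r"
proof -
  let ?S = "x <+> x"
  have er: "equiv ?S r" using assms(2) by (simp add: arels_def)
  then have "r \<subseteq> ?S \<times> ?S" by (simp add: equiv_def)
  then have "finite (?S // r)" using assms(1) by (intro finite_quotient) auto
  \<comment> \<open>Objects are sets of naturals, so the classes are labelled by naturals.\<close>
  then obtain l :: "(nat + nat) set \<Rightarrow> nat" where l: "inj_on l (?S // r)"
    using finite_imp_inj_to_nat_seg by metis
  define h where "h u = l (r `` {u})" for u
  have r: "r = kernel_on ?S h"
  proof -
    have "(u, v) \<in> r \<longleftrightarrow> u \<in> ?S \<and> v \<in> ?S \<and> h u = h v" for u v
      using eq_equiv_class_iff[OF er, of u v] inj_on_eq_iff[OF l quotientI quotientI, of u v] \<open>r \<subseteq> ?S \<times> ?S\<close>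
      unfolding h_def by blast
    then show ?thesis by (auto simp: kernel_on_def)
  qed
  define hl where "hl i = h (Inl i)" for i
  define hr where "hr j = h (Inr j)" for j
  define z where "z = hl ` x \<inter> hr ` x"
  have finz: "finite z" using assms(1) by (simp add: z_def)
  have cz: "card z \<le> card x" unfolding z_def
    by (rule le_trans[OF card_mono[OF _ Int_lower1] card_image_le]) (use assms(1) in auto)
  define s where "s = kernel_on (x <+> z) (case_sum hl id)"
  define s' where "s' = kernel_on (z <+> x) (case_sum id hr)"
  have sr: "s \<in> arels x z" "s' \<in> arels z x" by (simp_all add: s_def s'_def kernel_arels)
  have "comp_rel x x s s' = r"
  proof (rule relsem_inject[OF relsem_comp(1)[OF assms(1) finz assms(1) sr] assms(2)])
    fix a c assume a: "a \<subseteq> x" and c: "c \<subseteq> x"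
    have s: "relsem s a b \<longleftrightarrow> (\<forall>i\<in>x. \<forall>i'\<in>x. hl i = hl i' \<longrightarrow> (i \<in> a \<longleftrightarrow> i' \<in> a)) \<and> (\<forall>i\<in>x. \<forall>m\<in>z. hl i = m \<longrightarrow> (i \<in> a \<longleftrightarrow> m \<in> b))"
      if b: "b \<subseteq> z" for b
      unfolding s_def relsem_kernel_sum[OF a b] by simp
    have s': "relsem s' b c \<longleftrightarrow> (\<forall>m\<in>z. \<forall>i\<in>x. m = hr i \<longrightarrow> (m \<in> b \<longleftrightarrow> i \<in> c)) \<and> (\<forall>i\<in>x. \<forall>i'\<in>x. hr i = hr i' \<longrightarrow> (i \<in> c \<longleftrightarrow> i' \<in> c))"
      if b: "b \<subseteq> z" for b
      unfolding s'_def relsem_kernel_sum[OF b c] by simp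
    have h: "h = case_sum hl hr"
      by (rule ext) (simp add: hl_def hr_def split: sum.split)
    have rs: "relsem r a c \<longleftrightarrow> (\<forall>i\<in>x. \<forall>i'\<in>x. hl i = hl i' \<longrightarrow> (i \<in> a \<longleftrightarrow> i' \<in> a))
       \<and> (\<forall>i\<in>x. \<forall>j\<in>x. hl i = hr j \<longrightarrow> (i \<in> a \<longleftrightarrow> j \<in> c)) \<and> (\<forall>i\<in>x. \<forall>i'\<in>x. hr i = hr i' \<longrightarrow> (i \<in> c \<longleftrightarrow> i' \<in> c))"
      unfolding r h by (rule relsem_kernel_sum[OF a c])
    have "relsem (comp_rel x x s s') a c \<longleftrightarrow> card {b \<in> Pow z. relsem s a b \<and> relsem s' b c} \<noteq> 0"
      unfolding relsem_comp(2)[OF assms(1) finz assms(1) sr a c] by simp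
    also have "\<dots> \<longleftrightarrow> (\<exists>b\<subseteq>z. relsem s a b \<and> relsem s' b c)"
      using finz by (auto simp: card_eq_0_iff)
    also have "\<dots> \<longleftrightarrow> relsem r a c"
    proof
      assume "\<exists>b\<subseteq>z. relsem s a b \<and> relsem s' b c"
      then obtain b where b: "b \<subseteq> z" "relsem s a b" "relsem s' b c" by blast
      have "i \<in> a \<longleftrightarrow> j \<in> c" if "i \<in> x" "j \<in> x" "hl i = hr j" for i j
      proof -
        have "hl i \<in> z" "hr j \<in> z" unfolding z_def using that by (metis IntI imageI)+
        have "i \<in> a \<longleftrightarrow> hl i \<in> b" using b(2) that(1) \<open>hl i \<in> z\<close> unfolding s[OF b(1)] by blast
        moreover have "hr j \<in> b \<longleftrightarrow> j \<in> c" using b(3) that(2) \<open>hr j \<in> z\<close> unfolding s'[OF b(1)] by blast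
        ultimately
        show ?thesis using that by simp
      qed
      then have "\<forall>i\<in>x. \<forall>j\<in>x. hl i = hr j \<longrightarrow> (i \<in> a \<longleftrightarrow> j \<in> c)" by blast
      with conjunct1[OF b(2)[unfolded s[OF b(1)]]] conjunct2[OF b(3)[unfolded s'[OF b(1)]]]
      show "relsem r a c" unfolding rs by (intro conjI)
    next
      assume R: "relsem r a c"
      \<comment> \<open>The middle subset is forced: it consists of the labels in \<open>z\<close>
        of the points of \<open>a\<close>.\<close>
      define b where "b = z \<inter> hl ` a"
      have bz: "b \<subseteq> z" by (simp add: b_def)
      have hb: "i \<in> a \<longleftrightarrow> hl i \<in> b" if "i \<in> x" "hl i \<in> z" for i
      proof
        show "i \<in> a \<Longrightarrow> hl i \<in> b" using that by (simp add: b_def)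
        assume "hl i \<in> b"
        then obtain i' where "i' \<in> a" "hl i = hl i'" by (auto simp: b_def)
        then show "i \<in> a" using R a that unfolding rs by blast
      qed
      have "j \<in> c \<longleftrightarrow> hr j \<in> b" if "j \<in> x" "hr j \<in> z" for j
      proof -
        obtain i where "i \<in> x" "hr j = hl i" using \<open>hr j \<in> z\<close> by (auto simp: z_def)
        moreover then have "i \<in> a \<longleftrightarrow> j \<in> c"
          using conjunct1[OF conjunct2[OF R[unfolded rs]], rule_format, of i j] that by simp
        moreover have "i \<in> a \<longleftrightarrow> hl i \<in> b" using \<open>i \<in> x\<close> \<open>hr j = hl i\<close> that by (intro hb) simp_all
        ultimately show ?thesis by simp
      qed
      then have "relsem s a b \<and> relsem s' b c" using R hb unfolding rs s[OF bz] s'[OF bz] by blast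
      then show "\<exists>b\<subseteq>z. relsem s a b \<and> relsem s' b c" using bz by blast
    qed
    finally show "relsem (comp_rel x x s s') a c \<longleftrightarrow> relsem r a c" .
  qed
  moreover have thesis if "card z = card x"
  proof (rule perm)
    have 1: "card (hl ` x) = card x" "card (hr ` x) = card x"
      using that card_image_le[OF assms(1), of hl] card_image_le[OF assms(1), of hr]
        card_mono[of "hl ` x" z] card_mono[of "hr ` x" z] assms(1) by (auto simp: z_def)
    have inj: "inj_on hl x" "inj_on hr x" using 1 assms(1) by (auto intro: eq_card_imp_inj_on)
    have im: "hl ` x = z" "hr ` x = z"
    proof -
      have "z \<subseteq> hl ` x" "z \<subseteq> hr ` x" by (simp_all add: z_def)
      then show "hl ` x = z" "hr ` x = z"
        using that 1 assms(1) card_subset_eq[of "hl ` x" z] card_subset_eq[of "hr ` x" z] by simp_all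
    qed
    define p where "p j = (if j \<in> x then inv_into x hl (hr j) else j)" for j
    have p: "p j \<in> x" "hl (p j) = hr j" if "j \<in> x" for j
      using that im inv_into_into[of "hr j" hl x] f_inv_into_f[of "hr j" hl x] by (auto simp: p_def)
    show "p permutes x"
    proof (rule bij_imp_permutes)
      have "inj_on p x" using p inj(2) by (metis inj_on_def)
      moreover then have "p ` x = x" using p(1) assms(1) by (intro endo_inj_surj) auto
      ultimately show "bij_betw p x x" by (simp add: bij_betw_def)
    qed (simp add: p_def)
    have "h u = hl (case_sum id p u)" "case_sum id p u \<in> x" if "u \<in> ?S" for u
      using that p by (cases u; auto simp: hl_def hr_def)+
    then have "h u = h v \<longleftrightarrow> case_sum id p u = case_sum id p v" if "u \<in> ?S" "v \<in> ?S" for u v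
      using that inj(1) by (auto simp: inj_on_eq_iff)
    then show "r = graph_rel x x p" unfolding r graph_rel_def kernel_on_def by blast
  qed
  ultimately show thesis using small[OF finz _ sr] cz by fastforce
qed

text \<open>The intermediate quotient can be \<open>x\<close> itself, into which the smaller set
  embeds.\<close>

lemma proper_subquotientI:
  assumes "finite x" "finite z" "card z < card x"
  shows "proper_subquotient z x"
proof -
  obtain e where "e ` z \<subseteq> x" "inj_on e z" using card_le_inj[OF assms(2,1)] assms(3) by auto
  then have "subquotient z x" unfolding subquotient_def using assms(2) by (metis image_ident)
  moreover have "\<not> bij_betw h z x" for h using assms(3) bij_betw_same_card by fastforce
  ultimately show ?thesis by (simp add: proper_subquotient_def)
qed

lemma proper_subquotientD:
  assumes "finite x" "proper_subquotient z x"
  shows "finite z" "card z < card x"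
proof -
  obtain q e where e: "finite z" "inj_on e z" "e ` z \<subseteq> (q ` x :: nat set)" "\<not> (\<exists>h. bij_betw h z x)"
    using assms(2) unfolding proper_subquotient_def subquotient_def by blast
  have "card z \<le> card (q ` x)" using e assms(1) by (intro card_inj_on_le[of e]) auto
  then have "card z \<le> card x" using card_image_le[OF assms(1), of q] by simp
  moreover have "card z \<noteq> card x" using e(1,4) assms(1) finite_same_card_bij by blast
  ultimately show "finite z" "card z < card x" using e(1) by simp_all
qed

lemma compA_single: "compA t [x] [y] [z] g f 0 0 = comp0 t x y z (g 0 0) (f 0 0)"
  by (simp add: compA_def)

lemma dual_rel_graph:
  assumes "p permutes x"
  shows "dual_rel (graph_rel x x p) = graph_rel x x (inv p)"
proof (rule relsem_inject[OF dual_rel_arels[OF graph_rel_arels] graph_rel_arels])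
  fix a b assume a: "a \<subseteq> x" and b: "b \<subseteq> x"
  have p: "p ` x \<subseteq> x" "inv p ` x \<subseteq> x"
    using permutes_image[OF assms] permutes_image[OF permutes_inv[OF assms]] by simp_all
  show "relsem (dual_rel (graph_rel x x p)) a b \<longleftrightarrow> relsem (graph_rel x x (inv p)) a b"
    unfolding relsem_dual relsem_graph[OF b a p(1)] relsem_graph[OF a b p(2)]
  proof
    assume e: "a = {j \<in> x. p j \<in> b}"
    show "b = {j \<in> x. inv p j \<in> a}"
      using b permutes_inverses[OF assms] permutes_in_image[OF permutes_inv[OF assms]] unfolding e by auto
  next
    assume e: "b = {j \<in> x. inv p j \<in> a}"
    show "a = {j \<in> x. p j \<in> b}"
      using a permutes_inverses[OF assms] permutes_in_image[OF assms] unfolding e by auto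
  qed
qed

lemma thom_single:
  assumes "finite z" "finite x" "f \<in> hom0 z x"
  shows "mat1 f \<in> thom t (ob z) (ob x)"
proof -
  have "mat1 f \<in> homA [z] [x]" using assms(3) by (auto simp: homA_def mat1_def)
  moreover have "compA t [z] [z] [x] (mat1 f) (idA [z]) = mat1 f"
  proof (intro ext)
    fix i j u
    show "compA t [z] [z] [x] (mat1 f) (idA [z]) i j u = mat1 f i j u"
      by (cases "i = 0 \<and> j = 0") (auto simp: compA_def idA_def mat1_def comp0_linear comp0_id assms)
  qed
  moreover have "compA t [z] [x] [x] (idA [x]) (mat1 f) = mat1 f"
  proof (intro ext)
    fix i j u
    show "compA t [z] [x] [x] (idA [x]) (mat1 f) i j u = mat1 f i j u"
      by (cases "i = 0 \<and> j = 0") (auto simp: compA_def idA_def mat1_def comp0_linear comp0_id assms)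
  qed
  ultimately show ?thesis by (simp add: thom_def tcomp_def dsum_def)
qed

text \<open>The left-hand side is the coefficient of \<open>e\<close> at the graph of
  \<open>s\<close>. The trace form vanishes off the permutations because every other relation
  factors through a smaller set, and \<open>e\<close> annihilates the morphisms that come from
  there.\<close>

theorem upper_idempotent_trace:
  fixes t :: "'k::field_char_0"
  assumes "finite x" "t \<notin> \<nat>" "is_lower t x p" "s permutes x"
  defines "e \<equiv> idA [x] - p"
  shows "(if s = id then 1 else 0) = (\<Sum>s'\<in>{s'. s' permutes x}.
     tr0 t x (comp0 t x x x (e 0 0) (bas (graph_rel x x (inv s')))) *
     (\<Sum>A\<in>{A \<in> Pow x. \<forall>j\<in>A. s' j = s j}. inverse (falling t (2 * card x - card A))))"
proof -
  define e0 where "e0 = e 0 0"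
  let ?p = "p 0 0"
  have e0: "e0 = id0 x - ?p" by (simp add: e0_def e_def idA_def)
  have p: "?p \<in> hom0 x x" 
    using assms(3) homA_homs[of p "[x]" "[x]"] by (simp add: is_lower_def is_tobj_def homs_def)
  have h0: "e0 \<in> hom0 x x" unfolding e0 using p base_hom0(1) by (auto simp: hom0_def)
  have t0: "t \<noteq> 0" using assms(2) by auto
  obtain zs where zs: "\<forall>z\<in>set zs. proper_subquotient z x" "is_summand t (Obj [x] p) (dsum zs)"
    using assms(3) unfolding is_lower_def by blast
  \<comment> \<open>\<open>p\<close> is a sum of composites through the summands in
    \<open>zs\<close>, which are smaller sets, and such composites have coefficient 0 at
    permutations.\<close>
  have pg: "?p (graph_rel x x q) = 0" if "q permutes x" for q
  proof -
    obtain i j where "tcomp t (Obj [x] p) (dsum zs) (Obj [x] p) j i = p"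
      using zs(2) unfolding is_summand_def by auto
    then have "compA t [x] zs [x] j i = p" by (simp add: tcomp_def dsum_def)
    then have "?p (graph_rel x x q) = compA t [x] zs [x] j i 0 0 (graph_rel x x q)" by simp
    also have "\<dots> = (\<Sum>k<length zs. comp0 t x (zs ! k) x (j k 0) (i 0 k) (graph_rel x x q))"
      by (simp add: compA_def sum_fun_apply)
    also have "\<dots> = 0"
    proof (intro sum.neutral ballI)
      fix k assume "k \<in> {..<length zs}"
      then have "proper_subquotient (zs ! k) x" using zs(1) by simp
      from comp0_through_small[OF assms(1) proper_subquotientD[OF assms(1) this] that]
      show "comp0 t x (zs ! k) x (j k 0) (i 0 k) (graph_rel x x q) = 0" .
    qed
    finally show ?thesis .
  qed
  have inj: "graph_rel x x q = graph_rel x x q' \<longleftrightarrow> q = q'" if "q permutes x" "q' permutes x" for q q'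
  proof
    assume "graph_rel x x q = graph_rel x x q'"
    then have "pmatch x q x \<subseteq> pmatch x q' x" using graph_rel_pmatch[OF that(1)] graph_rel_pmatch[OF that(2)] by simp
    then have "\<forall>j\<in>x. q' j = q j" using pmatch_subset_iff[OF that subset_refl] by blast
    then show "q = q'" using that by (metis ext permutes_not_in)
  qed simp
  have e1: "e0 (graph_rel x x s) = (if s = id then 1 else 0)"
  proof -
    have "e0 (graph_rel x x s) = bas (graph_rel x x id) (graph_rel x x s) - ?p (graph_rel x x s)"
      unfolding e0 id0_def by simp
    then show ?thesis using inj[OF assms(4) permutes_id] pg[OF assms(4)] by (simp add: bas_def id_def)
  qed
  \<comment> \<open>\<open>p\<close> acts as the identity on the morphisms that factor through its
    image, so its complement annihilates them.\<close>
  have ef: "comp0 t z x x e0 f = 0" if z: "finite z" "card z < card x" and f: "f \<in> hom0 z x" for z f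
  proof -
    obtain g where g: "g \<in> thom t (ob z) (Obj [x] p)" "mat1 f = tcomp t (ob z) (Obj [x] p) (ob x) p g"
      using assms(3) proper_subquotientI[OF assms(1) z] thom_single[OF z(1) assms(1) f]
      unfolding is_lower_def by blast
    have "compA t [z] [x] [x] p g = g" using g(1) by (simp add: thom_def tcomp_def dsum_def)
    moreover have "mat1 f = compA t [z] [x] [x] p g" using g(2) by (simp add: tcomp_def dsum_def)
    ultimately have "compA t [z] [x] [x] p (mat1 f) 0 0 = mat1 f 0 0" by simp
    then have "comp0 t z x x ?p f = f" by (simp add: compA_single mat1_def)
    then show ?thesis unfolding e0 comp0_diff using comp0_id(2)[OF z(1) assms(1) f] by simp
  qed
  \<comment> \<open>Tracing a product of two relations gives the join of one with the dual of the
    other, hence the dual of \<open>q\<close> on the left.\<close>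
  have tr: "tr0 t x (comp0 t x x x e0 (bas (dual_rel q))) = (\<Sum>r\<in>arels x x. e0 r * t ^ joins x x r q)"
    if q: "q \<in> arels x x" for q
  proof -
    have "tr0 t x (comp0 t x x x e0 (bas (dual_rel q))) = tr0 t x (comp0 t x x x (bas (dual_rel q)) e0)"
      by (rule tr0_cyclic[OF assms(1,1) hom0_bas[OF dual_rel_arels[OF q]] h0])
    also have "\<dots> = tr0 t x (\<Sum>r\<in>arels x x. fscale (e0 r) (comp0 t x x x (bas (dual_rel q)) (bas r)))"
      by (subst hom0_expand[OF assms(1,1) h0]) (simp only: comp0_sum comp0_linear)
    also have "\<dots> = (\<Sum>r\<in>arels x x. e0 r * t ^ joins x x r q)"
      unfolding tr0_sum tr0_linear
      by (intro sum.cong refl) (simp add: tr0_comp_bas[OF assms(1,1) _ dual_rel_arels[OF q]])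
    finally show ?thesis .
  qed
  have zero: "(\<Sum>r\<in>arels x x. e0 r * t ^ joins x x r q) = 0"
    if q: "q \<in> arels x x" and np: "\<And>s. s permutes x \<Longrightarrow> q \<noteq> graph_rel x x s" for q
  proof -
    consider (perm) s where "s permutes x" "dual_rel q = graph_rel x x s"
      | (small) z r r' where "finite z" "card z < card x" "r \<in> arels x z" "r' \<in> arels z x" "comp_rel x x r r' = dual_rel q"
      by (rule permutation_or_through_small[OF assms(1) dual_rel_arels[OF q]])
    then show ?thesis
    proof cases
      case (perm s)
      then have "q = graph_rel x x (inv s)" using dual_rel_graph[OF perm(1)] dual_rel_dual_rel[of q] by simp
      then show ?thesis using np[OF permutes_inv[OF perm(1)]] by simp
    next
      case (small z r r')
      \<comment> \<open>Composing through \<open>z\<close> may create closed components; their power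
        of \<open>t\<close> is cancelled afterwards, as \<open>t\<close> is nonzero.\<close>
      have "comp0 t x z x (bas r') (bas r) = fscale (t ^ loops x z x r r') (bas (dual_rel q))"
        using comp0_bas[OF assms(1) small(1) assms(1) small(3,4)] small(5) by simp
      then have "fscale (t ^ loops x z x r r') (comp0 t x x x e0 (bas (dual_rel q))) = comp0 t x x x e0 (comp0 t x z x (bas r') (bas r))"
        by (simp only: comp0_linear)
      also have "\<dots> = comp0 t x z x (comp0 t z x x e0 (bas r')) (bas r)"
        by (rule comp0_assoc[symmetric]) (use assms(1) small h0 hom0_bas in auto)
      also have "\<dots> = 0" unfolding ef[OF small(1,2) hom0_bas[OF small(4)]] comp0_linear ..
      finally have "tr0 t x (fscale (t ^ loops x z x r r') (comp0 t x x x e0 (bas (dual_rel q)))) = 0"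
        by (simp only: tr0_linear)
      then have "tr0 t x (comp0 t x x x e0 (bas (dual_rel q))) = 0" using t0 by (simp add: tr0_linear)
      then show ?thesis using tr[OF q] by simp
    qed
  qed
  show ?thesis
    unfolding e1[symmetric] e0_def[symmetric]
  proof (rule trans[OF dual_coefficients[OF assms(1,2) zero assms(4)]])
    show "(\<Sum>s'\<in>{s'. s' permutes x}. (\<Sum>r\<in>arels x x. e0 r * t ^ joins x x r (graph_rel x x s')) *
        (\<Sum>A\<in>{A \<in> Pow x. \<forall>j\<in>A. s' j = s j}. inverse (falling t (2 * card x - card A))))
      = (\<Sum>s'\<in>{s'. s' permutes x}. tr0 t x (comp0 t x x x e0 (bas (graph_rel x x (inv s')))) *
        (\<Sum>A\<in>{A \<in> Pow x. \<forall>j\<in>A. s' j = s j}. inverse (falling t (2 * card x - card A))))"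
      by (intro sum.cong refl) (simp add: tr[OF graph_rel_arels, symmetric] dual_rel_graph)
  qed
qed

section \<open>Young symmetrizers and characters\<close>

text \<open>The identity of \<open>W\<close> factors as evaluation into the functions on
  \<open>U\<close>, followed by forming the linear combination of the vectors \<open>d u\<close>.
  Cyclicity turns the trace of \<open>f\<close> on \<open>W\<close> into a trace over
  \<open>U\<close>, so a redundant spanning system can be used in place of a basis.\<close>

lemma basis_trace:
  fixes W :: "('a \<Rightarrow> 'k::field) set"
  assumes U: "finite U" and W: "fvs.span W = W"
    and d: "\<And>u. u \<in> U \<Longrightarrow> d u \<in> W"
    and expand: "\<And>w. w \<in> W \<Longrightarrow> w = (\<Sum>u\<in>U. fscale (w u) (d u))"
    and f: "\<And>v w. f (v + w) = f v + f w" "\<And>c v. f (fscale c v) = fscale c (f v)"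
    and fW: "\<And>w. w \<in> W \<Longrightarrow> f w \<in> W"
    and B: "is_basis B W"
  shows "finite B" "(\<Sum>b\<in>B. fvs.representation B (f b) b) = (\<Sum>u\<in>U. f (d u) u)"
proof -
  have ind: "fvs.independent B" and BW: "B \<subseteq> W" and sp: "W \<subseteq> fvs.span B"
    using B by (auto simp: is_basis_def)
  have "W \<subseteq> fvs.span (d ` U)"
  proof
    fix w assume "w \<in> W"
    have "(\<Sum>u\<in>U. fscale (w u) (d u)) \<in> fvs.span (d ` U)"
      by (intro fvs.span_sum fvs.span_scale fvs.span_base) auto
    then show "w \<in> fvs.span (d ` U)" using expand[OF \<open>w \<in> W\<close>] by simp
  qed
  then have "B \<subseteq> fvs.span (d ` U)" using BW by blast
  then show finB: "finite B" using fvs.independent_span_bound[OF _ ind] U by blast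
  have f0: "f 0 = 0" using f(2)[of 0 0] by (simp add: fscale_def zero_fun_def)
  have fsum: "f (sum g I) = (\<Sum>i\<in>I. f (g i))" for g and I :: "'a set"
    by (induction I rule: infinite_finite_induct) (simp_all only: f f0 sum.infinite sum.empty sum.insert simp_thms)
  have apply_sum: "sum g I u = (\<Sum>i\<in>I. g i u)" for g :: "'c \<Rightarrow> 'a \<Rightarrow> 'k" and I u
    by (induction I rule: infinite_finite_induct) auto
  have rep: "fvs.representation B (f b) b = (\<Sum>u\<in>U. b u * fvs.representation B (f (d u)) b)" if "b \<in> B" for b
  proof -
    have "f b = f (\<Sum>u\<in>U. fscale (b u) (d u))"
      using expand[of b] that BW by (intro arg_cong[of _ _ f]) blast
    then have fb: "f b = (\<Sum>u\<in>U. fscale (b u) (f (d u)))" by (simp only: fsum f)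
    have sp': "f (d u) \<in> fvs.span B" if "u \<in> U" for u using fW d sp that by blast
    have "fvs.representation B (f b) = (\<lambda>b'. \<Sum>u\<in>U. fvs.representation B (fscale (b u) (f (d u))) b')"
      unfolding fb by (rule fvs.representation_sum[OF ind]) (intro fvs.span_scale sp')
    also have "\<dots> = (\<lambda>b'. \<Sum>u\<in>U. b u * fvs.representation B (f (d u)) b')"
      by (intro ext sum.cong refl) (simp add: fvs.representation_scale[OF ind sp'])
    finally show ?thesis by simp
  qed
  have "(\<Sum>b\<in>B. fvs.representation B (f b) b) = (\<Sum>b\<in>B. \<Sum>u\<in>U. b u * fvs.representation B (f (d u)) b)"
    by (intro sum.cong refl rep)
  also have "\<dots> = (\<Sum>u\<in>U. \<Sum>b\<in>B. b u * fvs.representation B (f (d u)) b)" by (rule sum.swap)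
  also have "\<dots> = (\<Sum>u\<in>U. (\<Sum>b\<in>B. fscale (fvs.representation B (f (d u)) b) b) u)"
    by (simp add: apply_sum fscale_def mult.commute)
  also have "\<dots> = (\<Sum>u\<in>U. f (d u) u)"
  proof (intro sum.cong refl)
    fix u assume "u \<in> U"
    then have "f (d u) \<in> fvs.span B" using fW d sp by blast
    from fvs.sum_representation_eq[OF ind this finB subset_refl]
    show "(\<Sum>b\<in>B. fscale (fvs.representation B (f (d u)) b) b) u = f (d u) u" by simp
  qed
  finally show "(\<Sum>b\<in>B. fvs.representation B (f b) b) = (\<Sum>u\<in>U. f (d u) u)" .
qed

lemma is_basis_SOME: "is_basis (SOME B. is_basis B W) W"
  by (rule someI_ex) (metis fvs.basis_exists is_basis_def)

section \<open>Cells of Young diagrams\<close>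

definition entry :: "nat list \<Rightarrow> nat \<Rightarrow> nat \<Rightarrow> nat" where
  "entry lam i j = sum_list (take i lam) + j"

lemma sum_take_Suc: "i < length lam \<Longrightarrow> sum_list (take (Suc i) lam) = sum_list (take i lam) + lam ! i"
  by (simp add: take_Suc_conv_app_nth)

lemma sum_take_mono: "i \<le> j \<Longrightarrow> sum_list (take i lam) \<le> sum_list (take j (lam :: nat list))"
proof -
  assume "i \<le> j"
  then have "take j lam = take i lam @ take (j - i) (drop i lam)" by (metis le_add_diff_inverse take_add)
  then show ?thesis by simp
qed

lemma row_of_props:
  assumes "k \<in> {1..sum_list lam}"
  shows "row_of lam k < length lam" "sum_list (take (row_of lam k) lam) < k"
    "1 \<le> col_of lam k" "col_of lam k \<le> lam ! row_of lam k" "entry lam (row_of lam k) (col_of lam k) = k"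
proof -
  let ?P = "\<lambda>i. k \<le> sum_list (take (Suc i) lam)"
  have ne: "lam \<noteq> []" using assms by auto
  then have P: "?P (length lam - 1)" using assms by simp
  then have "row_of lam k \<le> length lam - 1" unfolding row_of_def by (rule Least_le)
  then show r: "row_of lam k < length lam" using ne by (cases lam) auto
  have R: "?P (row_of lam k)" unfolding row_of_def using P by (rule LeastI)
  show s: "sum_list (take (row_of lam k) lam) < k"
  proof (cases "row_of lam k")
    case 0
    then show ?thesis using assms by simp
  next
    case (Suc i)
    then have "\<not> ?P i" using not_less_Least[of i ?P] unfolding row_of_def by simp
    then show ?thesis using Suc by simp
  qed
  then show "1 \<le> col_of lam k" "entry lam (row_of lam k) (col_of lam k) = k" by (simp_all add: col_of_def entry_def)
  show "col_of lam k \<le> lam ! row_of lam k" using R sum_take_Suc[OF r] by (simp add: col_of_def)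
qed

lemma entry_props:
  assumes "i < length lam" "1 \<le> j" "j \<le> lam ! i"
  shows "entry lam i j \<in> {1..sum_list lam}" "row_of lam (entry lam i j) = i" "col_of lam (entry lam i j) = j"
proof -
  have le: "entry lam i j \<le> sum_list (take (Suc i) lam)" using assms by (simp add: entry_def sum_take_Suc)
  also have "\<dots> \<le> sum_list (take (length lam) lam)" using assms(1) by (intro sum_take_mono) simp
  finally show "entry lam i j \<in> {1..sum_list lam}" using assms(2) by (simp add: entry_def)
  show r: "row_of lam (entry lam i j) = i" unfolding row_of_def
  proof (rule Least_equality)
    show "entry lam i j \<le> sum_list (take (Suc i) lam)" by (rule le)
    fix i' assume i': "entry lam i j \<le> sum_list (take (Suc i') lam)"
    show "i \<le> i'"
    proof (rule ccontr)
      assume "\<not> i \<le> i'"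
      then have "sum_list (take (Suc i') lam) \<le> sum_list (take i lam)" by (intro sum_take_mono) simp
      then show False using i' assms(2) by (simp add: entry_def)
    qed
  qed
  show "col_of lam (entry lam i j) = j" by (simp add: col_of_def r) (simp add: entry_def)
qed

lemma row_col_inject:
  assumes "k \<in> {1..sum_list lam}" "k' \<in> {1..sum_list lam}" "row_of lam k = row_of lam k'" "col_of lam k = col_of lam k'"
  shows "k = k'"
  using row_of_props(5)[OF assms(1)] row_of_props(5)[OF assms(2)] assms(3,4) by metis

text \<open>There are as many elements of \<open>A\<close> outside of the initial segment as numbers
  missing from it. The former are at least \<open>card A\<close> and the latter are smaller, so each
  exchange strictly increases the sum.\<close>

lemma sum_ge_initial:
  fixes A :: "nat set"
  assumes "finite A"
  shows "(\<Sum>i<card A. i) \<le> \<Sum>A" "\<Sum>A = (\<Sum>i<card A. i) \<Longrightarrow> A = {..<card A}"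
proof -
  let ?c = "card A"
  have A: "\<Sum>A = \<Sum>(A \<inter> {..<?c}) + \<Sum>(A - {..<?c})" using sum.Int_Diff[OF assms, of "\<lambda>i. i"] by simp
  have C: "(\<Sum>i<?c. i) = \<Sum>(A \<inter> {..<?c}) + \<Sum>({..<?c} - A)"
    using sum.Int_Diff[of "{..<?c}" "\<lambda>i. i" A] by (simp add: Int_commute)
  have cards: "card (A - {..<?c}) = card ({..<?c} - A)"
    using card_Diff_subset_Int[of A "{..<?c}"] card_Diff_subset_Int[of "{..<?c}" A] assms by (simp add: Int_commute)
  have u: "(\<Sum>i\<in>{..<?c} - A. i + 1) \<le> card ({..<?c} - A) * ?c"
    using sum_bounded_above[of "{..<?c} - A" "\<lambda>i. i + 1" ?c] by auto
  have l: "card (A - {..<?c}) * ?c \<le> \<Sum>(A - {..<?c})"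
    using sum_bounded_below[of "A - {..<?c}" ?c "\<lambda>i. i"] by auto
  have s: "(\<Sum>i\<in>{..<?c} - A. i + 1) = \<Sum>({..<?c} - A) + card ({..<?c} - A)" by (simp only: sum.distrib sum_constant) simp
  have *: "\<Sum>({..<?c} - A) + card ({..<?c} - A) \<le> \<Sum>(A - {..<?c})" using u l s cards by simp
  then show "(\<Sum>i<?c. i) \<le> \<Sum>A" using A C by simp
  assume "\<Sum>A = (\<Sum>i<?c. i)"
  then have "card ({..<?c} - A) = 0" using A C * by simp
  then have "{..<?c} \<subseteq> A" by simp
  then show "A = {..<?c}" using assms by (metis card_lessThan card_subset_eq)
qed

lemma partition_nth_mono:
  assumes "lam \<in> partitions_of n" "i \<le> i'" "i' < length lam"
  shows "lam ! i' \<le> lam ! i"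
  using assms sorted_wrt_nth_less[of "(\<ge>)" lam i i'] by (cases "i = i'") (auto simp: partitions_of_def)

definition column :: "nat list \<Rightarrow> nat \<Rightarrow> nat set" where
  "column lam m = {k \<in> {1..sum_list lam}. col_of lam k = m}"

text \<open>The parts decrease, so a column occupies an initial segment of the rows.\<close>

lemma column_rows:
  assumes "lam \<in> partitions_of n"
  shows "inj_on (row_of lam) (column lam m)" "row_of lam ` column lam m = {..<card (column lam m)}"
    "i < card (column lam m) \<Longrightarrow> i < length lam \<and> 1 \<le> m \<and> m \<le> lam ! i"
proof -
  show inj: "inj_on (row_of lam) (column lam m)"
    by (rule inj_onI) (auto simp: column_def intro: row_col_inject)
  have im: "row_of lam ` column lam m = {i. i < length lam \<and> 1 \<le> m \<and> m \<le> lam ! i}"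
  proof (intro equalityI subsetI)
    fix i assume "i \<in> row_of lam ` column lam m"
    then obtain k where "k \<in> {1..sum_list lam}" "i = row_of lam k" "col_of lam k = m" by (auto simp: column_def)
    then show "i \<in> {i. i < length lam \<and> 1 \<le> m \<and> m \<le> lam ! i}" using row_of_props[of k lam] by auto
  next
    fix i assume "i \<in> {i. i < length lam \<and> 1 \<le> m \<and> m \<le> lam ! i}"
    then have "entry lam i m \<in> column lam m" "row_of lam (entry lam i m) = i"
      using entry_props[of i lam m] by (auto simp: column_def)
    then show "i \<in> row_of lam ` column lam m" by force
  qed
  have fin: "finite (row_of lam ` column lam m)" by (simp add: column_def)
  have down: "i' \<in> row_of lam ` column lam m" if "i \<in> row_of lam ` column lam m" "i' \<le> i" for i i'
    using that partition_nth_mono[OF assms that(2)] unfolding im by auto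
  have "row_of lam ` column lam m = {..<card (row_of lam ` column lam m)}"
  proof (rule card_subset_eq[symmetric])
    show "{..<card (row_of lam ` column lam m)} \<subseteq> row_of lam ` column lam m"
    proof
      fix i assume i: "i \<in> {..<card (row_of lam ` column lam m)}"
      show "i \<in> row_of lam ` column lam m"
      proof (rule ccontr)
        assume "i \<notin> row_of lam ` column lam m"
        then have "row_of lam ` column lam m \<subseteq> {..<i}" using down by (meson lessThan_iff not_le subsetI)
        then have "card (row_of lam ` column lam m) \<le> i" using card_mono[of "{..<i}"] by simp
        then show False using i by simp
      qed
    qed
  qed (use fin in simp_all)
  then show im2: "row_of lam ` column lam m = {..<card (column lam m)}" using card_image[OF inj] by simp
  assume "i < card (column lam m)"
  then have "i \<in> row_of lam ` column lam m" using im2 by simp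
  then show "i < length lam \<and> 1 \<le> m \<and> m \<le> lam ! i" unfolding im by simp
qed

lemma sum_over_columns:
  "(\<Sum>k\<in>{1..sum_list mu}. h k) = (\<Sum>m\<in>col_of mu ` {1..sum_list mu}. \<Sum>k\<in>column mu m. h k)"
  unfolding column_def by (rule sum.group[symmetric]) auto

text \<open>The sum of i times the i-th part, with i counted from 0. It decreases along the
  dominance order and is used in its place, as any two partitions can be compared by it.\<close>

definition row_weight :: "nat list \<Rightarrow> nat" where
  "row_weight lam = (\<Sum>k\<in>{1..sum_list lam}. row_of lam k)"

text \<open>The combinatorial lemma behind Young symmetrizers. The entries of a column of
  \<open>mu\<close> go to different rows of \<open>lam\<close>, so their row indices sum to at least
  0 + 1 + 2 + ..., which is the contribution of the column to \<open>row_weight mu\<close>. With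
  \<open>le\<close>, equality holds in every column; each column then fills the top rows, and
  counting the cells in every row gives \<open>lam = mu\<close>.\<close>

lemma no_common_row_and_column:
  assumes lam: "lam \<in> partitions_of n" and mu: "mu \<in> partitions_of n" and s: "s permutes {1..n}"
    and sep: "\<And>i j. i \<in> {1..n} \<Longrightarrow> j \<in> {1..n} \<Longrightarrow> col_of mu i = col_of mu j \<Longrightarrow> row_of lam (s i) = row_of lam (s j) \<Longrightarrow> i = j"
    and le: "row_weight lam \<le> row_weight mu"
  shows "lam = mu" "\<And>k. k \<in> {1..n} \<Longrightarrow> row_of lam (s k) < card (column mu (col_of mu k))"
proof -
  have n: "sum_list lam = n" "sum_list mu = n" using lam mu by (simp_all add: partitions_of_def)
  define r where "r k = row_of lam (s k)" for k
  let ?M = "col_of mu ` {1..n}"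
  have inj: "inj_on r (column mu m)" for m
    unfolding r_def by (rule inj_onI) (auto simp: column_def n intro: sep)
  have fin: "finite (column mu m)" for m by (simp add: column_def)
  have mrow: "(\<Sum>k\<in>column mu m. row_of mu k) = (\<Sum>i<card (column mu m). i)" for m
    using sum.reindex[OF column_rows(1)[OF mu], of "\<lambda>i. i" m] column_rows(2)[OF mu, of m] by simp
  have srow: "(\<Sum>k\<in>column mu m. r k) = \<Sum>(r ` column mu m)" for m
    using sum.reindex[OF inj, of "\<lambda>i. i" m] by simp
  have ge: "(\<Sum>k\<in>column mu m. row_of mu k) \<le> (\<Sum>k\<in>column mu m. r k)" for m
    using sum_ge_initial(1)[of "r ` column mu m"] fin card_image[OF inj, of m] by (simp add: mrow srow)
  have "(\<Sum>k\<in>{1..n}. r k) = (\<Sum>k\<in>{1..n}. row_of lam k)"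
    unfolding r_def by (rule sum.permute[OF s, symmetric, unfolded o_def])
  also have "\<dots> \<le> (\<Sum>k\<in>{1..n}. row_of mu k)" using le by (simp add: row_weight_def n)
  finally have "(\<Sum>m\<in>?M. \<Sum>k\<in>column mu m. r k) \<le> (\<Sum>m\<in>?M. \<Sum>k\<in>column mu m. row_of mu k)"
    using sum_over_columns[of r mu] sum_over_columns[of "row_of mu" mu] by (simp add: n)
  \<comment> \<open>Every column sum is at least its minimum, and the total does not exceed the
    total of the minima.\<close>
  then have eq: "(\<Sum>k\<in>column mu m. r k) = (\<Sum>k\<in>column mu m. row_of mu k)" if "m \<in> ?M" for m
    using sum_mono_inv[of "\<lambda>m. \<Sum>k\<in>column mu m. row_of mu k" ?M "\<lambda>m. \<Sum>k\<in>column mu m. r k" m] ge that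
      sum_mono[of ?M "\<lambda>m. \<Sum>k\<in>column mu m. row_of mu k" "\<lambda>m. \<Sum>k\<in>column mu m. r k"] by force
  have im: "r ` column mu m = {..<card (column mu m)}" if "m \<in> ?M" for m
    using sum_ge_initial(2)[of "r ` column mu m"] fin card_image[OF inj, of m] eq[OF that] by (simp add: mrow srow)
  show "row_of lam (s k) < card (column mu (col_of mu k))" if "k \<in> {1..n}" for k
    using im[of "col_of mu k"] that by (auto simp: r_def column_def n)
  have ones: "(\<Sum>k\<in>column mu m. if r k = i then 1 else 0) = (\<Sum>k\<in>column mu m. if row_of mu k = i then 1 else (0::nat))"
    if "m \<in> ?M" for m i
    using sum.reindex[OF inj, of "\<lambda>j. if j = i then 1 else (0::nat)" m]
      sum.reindex[OF column_rows(1)[OF mu], of "\<lambda>j. if j = i then 1 else (0::nat)" m]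
      im[OF that] column_rows(2)[OF mu, of m] by simp
  have rowcard: "card {k \<in> {1..n}. row_of nu k = i} = part nu i" if "nu \<in> partitions_of n" for nu i
  proof -
    have nn: "sum_list nu = n" using that by (simp add: partitions_of_def)
    show ?thesis
    proof (cases "i < length nu")
      case True
      have "bij_betw (entry nu i) {1..nu ! i} {k \<in> {1..n}. row_of nu k = i}"
      proof (rule bij_betw_imageI)
        show "inj_on (entry nu i) {1..nu ! i}" by (simp add: entry_def inj_on_def)
        show "entry nu i ` {1..nu ! i} = {k \<in> {1..n}. row_of nu k = i}"
        proof (intro equalityI subsetI)
          fix k assume "k \<in> entry nu i ` {1..nu ! i}"
          then show "k \<in> {k \<in> {1..n}. row_of nu k = i}" using entry_props[OF True] nn by auto
        next
          fix k assume k: "k \<in> {k \<in> {1..n}. row_of nu k = i}"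
          then show "k \<in> entry nu i ` {1..nu ! i}" using row_of_props[of k nu] nn
            by (intro image_eqI[of _ _ "col_of nu k"]) auto
        qed
      qed
      from bij_betw_same_card[OF this] show ?thesis using True by (simp add: part_def)
    next
      case False
      then have "{k \<in> {1..n}. row_of nu k = i} = {}" using row_of_props(1)[of _ nu] nn by auto
      then have "card {k \<in> {1..n}. row_of nu k = i} = 0" by (simp only: card.empty)
      then show ?thesis using False by (simp add: part_def)
    qed
  qed
  have count: "card {k \<in> {1..n}. g k = i} = (\<Sum>k\<in>{1..n}. if g k = i then 1 else 0)" for g :: "nat \<Rightarrow> nat" and i
    by (simp add: sum.If_cases Int_def)
  have parts: "part lam i = part mu i" for i
  proof -
    have "part lam i = (\<Sum>k\<in>{1..n}. if row_of lam k = i then 1 else 0)"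
      using rowcard[OF lam, of i] unfolding count by simp
    also have "\<dots> = (\<Sum>k\<in>{1..n}. if r k = i then 1 else 0)"
      unfolding r_def by (rule sum.permute[OF s, unfolded o_def])
    also have "\<dots> = (\<Sum>m\<in>?M. \<Sum>k\<in>column mu m. if r k = i then 1 else 0)"
      by (rule sum_over_columns[of _ mu, unfolded n])
    also have "\<dots> = (\<Sum>m\<in>?M. \<Sum>k\<in>column mu m. if row_of mu k = i then 1 else 0)"
      by (intro sum.cong refl ones)
    also have "\<dots> = (\<Sum>k\<in>{1..n}. if row_of mu k = i then 1 else 0)"
      by (rule sum_over_columns[of _ mu, unfolded n, symmetric])
    also have "\<dots> = part mu i" using rowcard[OF mu, of i] unfolding count by simp
    finally show ?thesis .
  qed
  have nz: "part nu i \<noteq> 0 \<longleftrightarrow> i < length nu" if "nu \<in> partitions_of n" for nu i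
  proof -
    have "nu ! i \<noteq> 0" if "i < length nu"
    proof
      assume "nu ! i = 0"
      then have "0 \<in> set nu" using nth_mem[OF that] by simp
      then show False using \<open>nu \<in> partitions_of n\<close> by (simp add: partitions_of_def)
    qed
    then show ?thesis by (simp add: part_def)
  qed
  have "i < length lam \<longleftrightarrow> i < length mu" for i using nz[OF lam] nz[OF mu] parts by simp
  then have len: "length lam = length mu" by (metis linorder_neqE_nat less_irrefl)
  show "lam = mu"
  proof (rule nth_equalityI[OF len])
    fix i assume "i < length lam"
    then show "lam ! i = mu ! i" using parts[of i] len by (simp add: part_def)
  qed
qed

section \<open>The group algebra and Young symmetrizers\<close>

lemma finite_perms: "finite (perms n)"
  unfolding perms_def by (rule finite_permutations) simp

lemma id_perms [simp]: "id \<in> perms n" by (simp add: perms_def)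

lemma perms_comp: "p \<in> perms n \<Longrightarrow> q \<in> perms n \<Longrightarrow> p \<circ> q \<in> perms n"
  by (simp add: perms_def permutes_compose)

lemma perms_inv: "p \<in> perms n \<Longrightarrow> inv p \<in> perms n"
  by (simp add: perms_def permutes_inv)

lemma perms_inv_inv [simp]: "p \<in> perms n \<Longrightarrow> inv (inv p) = p"
  by (simp add: perms_def permutes_inv_inv)

lemma perms_inv_o [simp]:
  "p \<in> perms n \<Longrightarrow> inv p \<circ> p = id" "p \<in> perms n \<Longrightarrow> p \<circ> inv p = id"
  by (simp_all add: perms_def permutes_inv_o)

lemma perms_cancel [simp]:
  "p \<in> perms n \<Longrightarrow> inv p \<circ> (p \<circ> q) = q" "p \<in> perms n \<Longrightarrow> p \<circ> (inv p \<circ> q) = q"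
  by (simp_all add: o_assoc)

lemma perms_inv_comp: "p \<in> perms n \<Longrightarrow> q \<in> perms n \<Longrightarrow> inv (p \<circ> q) = inv q \<circ> inv p"
  by (simp add: perms_def o_inv_distrib permutes_bij)

lemma perms_left: "p \<in> perms n \<Longrightarrow> p \<circ> q \<in> perms n \<longleftrightarrow> q \<in> perms n"
  using perms_comp perms_inv perms_cancel by metis

lemma perms_right: "q \<in> perms n \<Longrightarrow> p \<circ> q \<in> perms n \<longleftrightarrow> p \<in> perms n"
proof
  assume q: "q \<in> perms n" and "p \<circ> q \<in> perms n"
  then have "(p \<circ> q) \<circ> inv q \<in> perms n" by (metis perms_comp perms_inv)
  then show "p \<in> perms n" using q by (simp add: o_assoc[symmetric])
qed (rule perms_comp)

lemma sum_perms_left: "p \<in> perms n \<Longrightarrow> (\<Sum>s\<in>perms n. h (p \<circ> s)) = (\<Sum>s\<in>perms n. h s)"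
  by (rule sum.reindex_bij_witness[of _ "\<lambda>s. inv p \<circ> s" "\<lambda>s. p \<circ> s"]) (auto simp: perms_left perms_inv)

lemma sum_perms_right: "p \<in> perms n \<Longrightarrow> (\<Sum>s\<in>perms n. h (s \<circ> p)) = (\<Sum>s\<in>perms n. h s)"
  by (rule sum.reindex_bij_witness[of _ "\<lambda>s. s \<circ> inv p" "\<lambda>s. s \<circ> p"])
    (auto simp: perms_right perms_inv o_assoc[symmetric])

lemma sum_perms_inv: "(\<Sum>s\<in>perms n. h (inv s)) = (\<Sum>s\<in>perms n. h s)"
  by (rule sum.reindex_bij_witness[of _ inv inv]) (auto simp: perms_inv)

lemma sign_perms: "p \<in> perms n \<Longrightarrow> q \<in> perms n \<Longrightarrow> sign (p \<circ> q) = sign p * sign q"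
  "p \<in> perms n \<Longrightarrow> sign (inv p) = sign p"
  by (auto simp: perms_def permutation_permutes intro!: sign_compose sign_inverse)

definition conv :: "nat \<Rightarrow> ((nat \<Rightarrow> nat) \<Rightarrow> 'k::comm_ring_1) \<Rightarrow> ((nat \<Rightarrow> nat) \<Rightarrow> 'k) \<Rightarrow> (nat \<Rightarrow> nat) \<Rightarrow> 'k" where
  "conv n f g w = (\<Sum>s\<in>perms n. f s * g (inv s \<circ> w))"

lemma conv_assoc: "conv n (conv n f g) h w = conv n f (conv n g h) w"
proof -
  have "conv n (conv n f g) h w = (\<Sum>s\<in>perms n. \<Sum>r\<in>perms n. f r * (g (inv r \<circ> s) * h (inv s \<circ> w)))"
    by (simp add: conv_def sum_distrib_right mult.assoc)
  also have "\<dots> = (\<Sum>r\<in>perms n. \<Sum>s\<in>perms n. f r * (g (inv r \<circ> s) * h (inv s \<circ> w)))" by (rule sum.swap)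
  also have "\<dots> = (\<Sum>r\<in>perms n. f r * conv n g h (inv r \<circ> w))"
  proof (intro sum.cong refl)
    fix r assume r: "r \<in> perms n"
    have "(\<Sum>s\<in>perms n. f r * (g (inv r \<circ> s) * h (inv s \<circ> w)))
      = (\<Sum>s\<in>perms n. f r * (g (inv r \<circ> (r \<circ> s)) * h (inv (r \<circ> s) \<circ> w)))"
      by (rule sum_perms_left[OF r, symmetric])
    also have "\<dots> = (\<Sum>s\<in>perms n. f r * (g s * h (inv s \<circ> (inv r \<circ> w))))"
      by (intro sum.cong refl) (use r in \<open>simp add: perms_inv_comp o_assoc[symmetric]\<close>)
    finally show "(\<Sum>s\<in>perms n. f r * (g (inv r \<circ> s) * h (inv s \<circ> w))) = f r * conv n g h (inv r \<circ> w)"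
      by (simp add: conv_def sum_distrib_left)
  qed
  finally show ?thesis by (simp add: conv_def)
qed

lemma row_group_perms: "p \<in> row_group lam \<Longrightarrow> p \<in> perms (sum_list lam)"
  and col_group_perms: "p \<in> col_group lam \<Longrightarrow> p \<in> perms (sum_list lam)"
  by (simp_all add: row_group_def col_group_def)

lemma stabilizer_group:
  defines "G \<equiv> \<lambda>(h :: nat \<Rightarrow> nat) n. {p \<in> perms n. \<forall>k\<in>{1..n}. h (p k) = h k}"
  shows "id \<in> G h n" "p \<in> G h n \<Longrightarrow> q \<in> G h n \<Longrightarrow> p \<circ> q \<in> G h n" "p \<in> G h n \<Longrightarrow> inv p \<in> G h n"
proof -
  show "id \<in> G h n" by (simp add: G_def)
  show "p \<circ> q \<in> G h n" if "p \<in> G h n" "q \<in> G h n"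
  proof -
    have "q k \<in> {1..n}" if "k \<in> {1..n}" for k using that \<open>q \<in> G h n\<close> permutes_in_image[of q "{1..n}"] by (simp add: G_def perms_def)
    then show ?thesis using that by (simp add: G_def perms_comp)
  qed
  show "inv p \<in> G h n" if p: "p \<in> G h n"
  proof -
    have pp: "p permutes {1..n}" using p by (simp add: G_def perms_def)
    have "h (inv p k) = h k" if k: "k \<in> {1..n}" for k
    proof -
      have "inv p k \<in> {1..n}" using k permutes_in_image[OF permutes_inv[OF pp]] by blast
      then have "h (p (inv p k)) = h (inv p k)" using p by (simp add: G_def)
      then show ?thesis using permutes_inverses[OF pp] by simp
    qed
    then show ?thesis using p by (simp add: G_def perms_inv)
  qed
qed

lemmas row_group_group = stabilizer_group[where h = "row_of lam" and n = "sum_list lam" for lam, folded row_group_def]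
lemmas col_group_group = stabilizer_group[where h = "col_of lam" and n = "sum_list lam" for lam, folded col_group_def]

lemma row_col_group_id:
  assumes "p \<in> row_group lam" "p \<in> col_group lam"
  shows "p = id"
proof
  fix k
  have p: "p permutes {1..sum_list lam}" using assms(1) by (simp add: row_group_def perms_def)
  show "p k = id k"
  proof (cases "k \<in> {1..sum_list lam}")
    case True
    then have "p k \<in> {1..sum_list lam}" using permutes_in_image[OF p] by blast
    then show ?thesis using row_col_inject[of "p k" lam k] True assms by (simp add: row_group_def col_group_def)
  next
    case False
    then show ?thesis using permutes_not_in[OF p] by simp
  qed
qed

text \<open>\<open>inv p' \<circ> p = q' \<circ> inv q\<close> preserves both rows and columns and
  so is the identity. Hence all coefficients of a Young symmetrizer are 0, 1 or -1.\<close>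

lemma row_col_unique:
  assumes "p \<in> row_group lam" "q \<in> col_group lam" "p' \<in> row_group lam" "q' \<in> col_group lam" "p \<circ> q = p' \<circ> q'"
  shows "p = p'" "q = q'"
proof -
  note P = row_group_perms[OF assms(1)] col_group_perms[OF assms(2)] row_group_perms[OF assms(3)] col_group_perms[OF assms(4)]
  have "inv p' \<circ> p = q' \<circ> inv q"
  proof -
    have "inv p' \<circ> (p \<circ> q) \<circ> inv q = inv p' \<circ> (p' \<circ> q') \<circ> inv q" using assms(5) by simp
    then show ?thesis using P by (simp add: o_assoc[symmetric])
  qed
  moreover have "inv p' \<circ> p \<in> row_group lam" "q' \<circ> inv q \<in> col_group lam"
    using assms by (simp_all add: row_group_group col_group_group)
  ultimately have e: "inv p' \<circ> p = id" "q' \<circ> inv q = id" using row_col_group_id by metis+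
  have "p' \<circ> (inv p' \<circ> p) = p'" "(q' \<circ> inv q) \<circ> q = q" using e by simp_all
  then show "p = p'" "q = q'" using P by (simp_all add: o_assoc[symmetric])
qed

lemma young_symmetrizer_prod:
  assumes "p \<in> row_group lam" "q \<in> col_group lam"
  shows "young_symmetrizer lam (p \<circ> q) = (of_int (sign q) :: 'k::comm_ring_1)"
proof -
  have fin: "finite (row_group lam)" "finite (col_group lam)"
    using finite_perms[of "sum_list lam"] by (auto simp: row_group_def col_group_def)
  have "young_symmetrizer lam (p \<circ> q) = (\<Sum>p'\<in>row_group lam. if p' = p then \<Sum>q'\<in>col_group lam. if q' = q then of_int (sign q) else 0 else (0::'k))"
    unfolding young_symmetrizer_def
    by (intro sum.cong refl) (use row_col_unique assms in \<open>auto intro!: sum.cong sum.neutral\<close>)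
  then show ?thesis using fin assms by simp
qed

lemma young_symmetrizer_zero:
  assumes "\<And>p q. p \<in> row_group lam \<Longrightarrow> q \<in> col_group lam \<Longrightarrow> s \<noteq> p \<circ> q"
  shows "young_symmetrizer lam s = 0"
  unfolding young_symmetrizer_def using assms by (auto intro!: sum.neutral)

lemma young_symmetrizer_id: "young_symmetrizer lam id = 1"
  using young_symmetrizer_prod[OF row_group_group(1) col_group_group(1), of lam] by simp

lemma young_symmetrizer_outside: "s \<notin> perms (sum_list lam) \<Longrightarrow> young_symmetrizer lam s = 0"
  by (rule young_symmetrizer_zero) (use row_group_perms col_group_perms perms_comp in blast)

lemma young_symmetrizer_left:
  assumes p: "p \<in> row_group lam"
  shows "young_symmetrizer lam (p \<circ> s) = (young_symmetrizer lam s :: 'k::comm_ring_1)"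
proof (cases "\<exists>p'\<in>row_group lam. \<exists>q\<in>col_group lam. s = p' \<circ> q")
  case True
  then obtain p' q where pq: "p' \<in> row_group lam" "q \<in> col_group lam" "s = p' \<circ> q" by auto
  have "p \<circ> s = (p \<circ> p') \<circ> q" using pq by (simp add: o_assoc)
  then show ?thesis using young_symmetrizer_prod[OF row_group_group(2)[OF p pq(1)] pq(2)] young_symmetrizer_prod[OF pq(1,2)] pq(3) by metis
next
  case False
  have "p \<circ> s \<noteq> p' \<circ> q" if "p' \<in> row_group lam" "q \<in> col_group lam" for p' q
  proof
    assume "p \<circ> s = p' \<circ> q"
    then have "inv p \<circ> (p \<circ> s) = (inv p \<circ> p') \<circ> q" by (simp add: o_assoc)
    then show False using False that p row_group_perms[OF p] row_group_group by simp blast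
  qed
  then show ?thesis using False young_symmetrizer_zero by metis
qed

lemma young_symmetrizer_right:
  assumes q: "q \<in> col_group lam"
  shows "young_symmetrizer lam (s \<circ> q) = (of_int (sign q) * young_symmetrizer lam s :: 'k::comm_ring_1)"
proof (cases "\<exists>p\<in>row_group lam. \<exists>q\<in>col_group lam. s = p \<circ> q")
  case True
  then obtain p q' where pq: "p \<in> row_group lam" "q' \<in> col_group lam" "s = p \<circ> q'" by auto
  have "s \<circ> q = p \<circ> (q' \<circ> q)" using pq by (simp add: o_assoc)
  then show ?thesis using young_symmetrizer_prod[OF pq(1) col_group_group(2)[OF pq(2) q]] young_symmetrizer_prod[OF pq(1,2)] pq(3)
     sign_perms(1)[OF col_group_perms[OF pq(2)] col_group_perms[OF q]] by (metis mult.commute of_int_mult)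
next
  case False
  have "s \<circ> q \<noteq> p \<circ> q'" if "p \<in> row_group lam" "q' \<in> col_group lam" for p q'
  proof
    assume "s \<circ> q = p \<circ> q'"
    then have "(s \<circ> q) \<circ> inv q = p \<circ> (q' \<circ> inv q)" by (simp add: o_assoc)
    then show False using False that q col_group_perms[OF q] col_group_group by (simp add: o_assoc[symmetric]) blast
  qed
  then have "young_symmetrizer lam (s \<circ> q) = (0::'k)" "young_symmetrizer lam s = (0::'k)" using False young_symmetrizer_zero by metis+
  then show ?thesis by simp
qed

text \<open>The functions \<open>x\<close> below are the elements of \<open>a A b\<close>, where \<open>a\<close> is the row symmetrizer of
  \<^term>\<open>lam\<close> and \<open>b\<close> is the column antisymmetrizer of \<^term>\<open>mu\<close>.\<close>

lemma two_sided_sign: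
  fixes x :: "(nat \<Rightarrow> nat) \<Rightarrow> 'k::field_char_0"
  assumes lam: "lam \<in> partitions_of n" and mu: "mu \<in> partitions_of n" and s: "s \<in> perms n"
    and left: "\<And>p w. p \<in> row_group lam \<Longrightarrow> w \<in> perms n \<Longrightarrow> x (p \<circ> w) = x w"
    and right: "\<And>q w. q \<in> col_group mu \<Longrightarrow> w \<in> perms n \<Longrightarrow> x (w \<circ> q) = of_int (sign q) * x w"
    and ij: "i \<in> {1..n}" "j \<in> {1..n}" "i \<noteq> j" "col_of mu i = col_of mu j" "row_of lam (s i) = row_of lam (s j)"
  shows "x s = 0"
proof -
  have n: "sum_list lam = n" "sum_list mu = n" using lam mu by (simp_all add: partitions_of_def)
  have sp: "s permutes {1..n}" using s by (simp add: perms_def)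
  let ?q = "transpose i j" and ?p = "transpose (s i) (s j)"
  have q: "?q \<in> col_group mu" using ij n by (auto simp: col_group_def perms_def permutes_swap_id transpose_def)
  have "s i \<in> {1..n}" "s j \<in> {1..n}" using ij permutes_in_image[OF sp] by blast+
  then have p: "?p \<in> row_group lam" using ij n by (auto simp: row_group_def perms_def permutes_swap_id transpose_def)
  have "s \<circ> ?q = ?p \<circ> s"
  proof
    fix k
    show "(s \<circ> ?q) k = (?p \<circ> s) k" using permutes_inj[OF sp] by (auto simp: transpose_def dest: injD)
  qed
  then have "of_int (sign ?q) * x s = x s" using left[OF p s] right[OF q s] by simp
  then show ?thesis using ij(3) by (simp add: sign_swap_id)
qed

text \<open>If no pair of entries forces the value to vanish, the combinatorial lemma gives
  \<open>lam = mu\<close>.\<close>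

lemma two_sided_zero:
  fixes x :: "(nat \<Rightarrow> nat) \<Rightarrow> 'k::field_char_0"
  assumes lam: "lam \<in> partitions_of n" and mu: "mu \<in> partitions_of n" and s: "s \<in> perms n"
    and left: "\<And>p w. p \<in> row_group lam \<Longrightarrow> w \<in> perms n \<Longrightarrow> x (p \<circ> w) = x w"
    and right: "\<And>q w. q \<in> col_group mu \<Longrightarrow> w \<in> perms n \<Longrightarrow> x (w \<circ> q) = of_int (sign q) * x w"
    and "lam \<noteq> mu" "row_weight lam \<le> row_weight mu"
  shows "x s = 0"
  using no_common_row_and_column(1)[OF lam mu s[unfolded perms_def mem_Collect_eq] _ assms(7)] assms(6)
    two_sided_sign[OF lam mu s left right] by metis

text \<open>For equal shapes the functions in question form a line. If two entries in a common
  column are sent to a common row, both sides vanish. Any other permutation is a row permutation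
  times a column permutation, and there the value is determined by the one at
  \<open>id\<close>.\<close>

lemma two_sided_multiple:
  fixes x :: "(nat \<Rightarrow> nat) \<Rightarrow> 'k::field_char_0"
  assumes lam: "lam \<in> partitions_of n" and s: "s \<in> perms n"
    and left: "\<And>p w. p \<in> row_group lam \<Longrightarrow> w \<in> perms n \<Longrightarrow> x (p \<circ> w) = x w"
    and right: "\<And>q w. q \<in> col_group lam \<Longrightarrow> w \<in> perms n \<Longrightarrow> x (w \<circ> q) = of_int (sign q) * x w"
  shows "x s = x id * young_symmetrizer lam s"
proof (cases "\<exists>i\<in>{1..n}. \<exists>j\<in>{1..n}. i \<noteq> j \<and> col_of lam i = col_of lam j \<and> row_of lam (s i) = row_of lam (s j)")
  case True
  then obtain i j where ij: "i \<in> {1..n}" "j \<in> {1..n}" "i \<noteq> j" "col_of lam i = col_of lam j" "row_of lam (s i) = row_of lam (s j)"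
    by blast
  have "x s = 0" by (rule two_sided_sign[OF lam lam s left right ij])
  moreover have "young_symmetrizer lam s = (0::'k)"
    by (rule two_sided_sign[OF lam lam s young_symmetrizer_left young_symmetrizer_right ij])
  ultimately show ?thesis by simp
next
  case False
  have n: "sum_list lam = n" using lam by (simp add: partitions_of_def)
  have sp: "s permutes {1..n}" using s by (simp add: perms_def)
  note rows = no_common_row_and_column(2)[OF lam lam sp _ le_refl]
  have cell: "row_of lam (s k) < length lam \<and> 1 \<le> col_of lam k \<and> col_of lam k \<le> lam ! row_of lam (s k)" if "k \<in> {1..n}" for k
    using column_rows(3)[OF lam rows[OF _ that]] False by blast
  \<comment> \<open>\<open>q\<close> moves each entry within its column to the row into which
    \<open>s\<close> sends it; then \<open>s \<circ> inv q\<close> preserves the rows.\<close>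
  define q where "q k = (if k \<in> {1..n} then entry lam (row_of lam (s k)) (col_of lam k) else k)" for k
  have qp: "q k \<in> {1..n}" "row_of lam (q k) = row_of lam (s k)" "col_of lam (q k) = col_of lam k" if "k \<in> {1..n}" for k
    using that cell[OF that] entry_props[of "row_of lam (s k)" lam "col_of lam k"] n by (simp_all add: q_def)
  have "inj_on q {1..n}"
  proof (rule inj_onI)
    fix k k' assume k: "k \<in> {1..n}" "k' \<in> {1..n}" "q k = q k'"
    then have "col_of lam k = col_of lam k'" "row_of lam (s k) = row_of lam (s k')" using qp by metis+
    then show "k = k'" using False k by blast
  qed
  moreover then have "q ` {1..n} = {1..n}" using qp(1) by (intro endo_inj_surj) auto
  ultimately have "bij_betw q {1..n} {1..n}" by (simp add: bij_betw_def)
  then have qperm: "q permutes {1..n}" by (rule bij_imp_permutes) (auto simp: q_def)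
  then have qc: "q \<in> col_group lam" using qp n by (simp add: col_group_def perms_def)
  have qn: "q \<in> perms n" using qperm by (simp add: perms_def)
  let ?p = "s \<circ> inv q"
  have "row_of lam (?p k) = row_of lam k" if "k \<in> {1..n}" for k
  proof -
    have "inv q k \<in> {1..n}" using that permutes_in_image[OF permutes_inv[OF qperm]] by blast
    then show ?thesis using qp(2)[of "inv q k"] permutes_inverses[OF qperm] by simp
  qed
  then have p: "?p \<in> row_group lam" using n s qn perms_comp perms_inv by (simp add: row_group_def)
  have spq: "s = ?p \<circ> q" using qn by (simp add: o_assoc[symmetric])
  have "x (?p \<circ> q) = of_int (sign q) * x id"
    using left[OF p qn] right[OF qc id_perms] by simp
  moreover have "young_symmetrizer lam (?p \<circ> q) = (of_int (sign q) :: 'k)" by (rule young_symmetrizer_prod[OF p qc])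
  ultimately show ?thesis using spq by (metis mult.commute)
qed

lemma conv_left:
  assumes "p \<in> perms n" "\<And>s. s \<in> perms n \<Longrightarrow> f (p \<circ> s) = f s"
  shows "conv n f g (p \<circ> w) = conv n f g w"
proof -
  have "conv n f g (p \<circ> w) = (\<Sum>s\<in>perms n. f (p \<circ> s) * g (inv (p \<circ> s) \<circ> (p \<circ> w)))"
    unfolding conv_def by (rule sum_perms_left[OF assms(1), symmetric])
  also have "\<dots> = conv n f g w"
    unfolding conv_def by (intro sum.cong refl) (use assms in \<open>simp add: perms_inv_comp o_assoc[symmetric]\<close>)
  finally show ?thesis .
qed

lemma conv_right:
  assumes "\<And>w. g (w \<circ> q) = c * g w"
  shows "conv n f g (w \<circ> q) = c * conv n f g w"
  unfolding conv_def by (simp add: assms o_assoc sum_distrib_left mult.left_commute)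

lemma conv_scale: "conv n (\<lambda>s. c * f s) g w = c * conv n f g w" "conv n f (\<lambda>s. c * g s) w = c * conv n f g w"
  by (simp_all add: conv_def sum_distrib_left mult_ac)

lemma conv_cong:
  assumes "\<And>s. s \<in> perms n \<Longrightarrow> f s = f' s" "\<And>s. s \<in> perms n \<Longrightarrow> g s = g' s" "w \<in> perms n"
  shows "conv n f g w = conv n f' g' w"
  unfolding conv_def by (intro sum.cong refl) (use assms in \<open>simp add: perms_comp perms_inv\<close>)

text \<open>Inversion of permutations extends to an anti-automorphism of the group algebra.\<close>

lemma conv_inv:
  assumes "w \<in> perms n"
  shows "conv n f g (inv w) = conv n (\<lambda>s. g (inv s)) (\<lambda>s. f (inv s)) w"
proof -
  have "conv n f g (inv w) = (\<Sum>s\<in>perms n. f (inv w \<circ> s) * g (inv (inv w \<circ> s) \<circ> inv w))"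
    unfolding conv_def by (rule sum_perms_left[OF perms_inv[OF assms], symmetric])
  also have "\<dots> = (\<Sum>s\<in>perms n. g (inv s) * f (inv (inv s \<circ> w)))"
  proof (intro sum.cong refl)
    fix s assume s: "s \<in> perms n"
    have "inv (inv w \<circ> s) = inv s \<circ> w" "inv (inv s \<circ> w) = inv w \<circ> s"
      using perms_inv_comp[OF perms_inv[OF assms] s] perms_inv_comp[OF perms_inv[OF s] assms] assms s by simp_all
    moreover have "inv s \<circ> w \<circ> inv w = inv s" using assms by (simp add: o_assoc[symmetric])
    ultimately show "f (inv w \<circ> s) * g (inv (inv w \<circ> s) \<circ> inv w) = g (inv s) * f (inv (inv s \<circ> w))"
      by simp
  qed
  finally show ?thesis by (simp add: conv_def)
qed

lemma perms_inv_conj: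
  assumes "u \<in> perms n" "s \<in> perms n"
  shows "inv (inv u \<circ> (s \<circ> u)) = inv u \<circ> (inv s \<circ> u)"
  unfolding perms_inv_comp[OF perms_inv[OF assms(1)] perms_comp[OF assms(2,1)]] perms_inv_comp[OF assms(2,1)]
    perms_inv_inv[OF assms(1)] by (simp only: o_assoc)

lemma conv_outside:
  assumes "\<And>s. s \<notin> perms n \<Longrightarrow> g s = 0" "w \<notin> perms n"
  shows "conv n f g w = 0"
  unfolding conv_def by (intro sum.neutral) (use assms perms_inv perms_left in auto)

text \<open>This is the product of the hook lengths, but only \<open>c * c = hook lam \<cdot> c\<close> and \<open>hook lam \<noteq> 0\<close> matter.\<close>

definition hook :: "nat list \<Rightarrow> 'k::comm_ring_1" where
  "hook lam = conv (sum_list lam) (young_symmetrizer lam) (young_symmetrizer lam) id"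

context
  fixes lam :: "nat list" and n :: nat
  assumes lam: "lam \<in> partitions_of n"
begin

lemma size_lam: "sum_list lam = n" using lam by (simp add: partitions_of_def)

text \<open>The product inherits invariance under row permutations from its left factor, so with the
  column signs it lies on the line spanned by the Young symmetrizer.\<close>

lemma sandwich:
  fixes f :: "(nat \<Rightarrow> nat) \<Rightarrow> 'k::field_char_0"
  assumes f: "\<And>w q. q \<in> col_group lam \<Longrightarrow> w \<in> perms n \<Longrightarrow> conv n (young_symmetrizer lam) f (w \<circ> q) = of_int (sign q) * conv n (young_symmetrizer lam) f w"
    and s: "s \<in> perms n"
  shows "conv n (young_symmetrizer lam) f s = conv n (young_symmetrizer lam) f id * young_symmetrizer lam s"
proof (rule two_sided_multiple[OF lam s _ f])
  fix p w assume p: "p \<in> row_group lam"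
  show "conv n (young_symmetrizer lam) f (p \<circ> w) = conv n (young_symmetrizer lam) f w"
  proof (rule conv_left)
    show "p \<in> perms n" using row_group_perms[OF p] by (simp only: size_lam)
    show "young_symmetrizer lam (p \<circ> s) = (young_symmetrizer lam s :: 'k)" for s by (rule young_symmetrizer_left[OF p])
  qed
qed

lemma young_square: "conv n (young_symmetrizer lam) (young_symmetrizer lam) s = hook lam * (young_symmetrizer lam s :: 'k::field_char_0)"
proof (cases "s \<in> perms n")
  case True
  show ?thesis unfolding hook_def size_lam
    by (rule sandwich[OF conv_right True]) (rule young_symmetrizer_right)
next
  case False
  have out: "young_symmetrizer lam s = (0::'k)" if "s \<notin> perms n" for s
    by (rule young_symmetrizer_outside) (use that in \<open>simp only: size_lam not_False_eq_True\<close>)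
  have "conv n (young_symmetrizer lam) (young_symmetrizer lam) s = (0::'k)"
    by (rule conv_outside[OF _ False]) (rule out)
  then show ?thesis unfolding out[OF False] by simp
qed

text \<open>Let c = ab, with \<open>a\<close> the sum of the row permutations and \<open>b\<close>
  the signed sum of the column permutations, and let \<open>D\<close> = aba. As \<open>D\<close> is
  invariant under inversion, the coefficient of the square of \<open>D\<close> at \<open>id\<close>
  is a sum of squares of integers, and the summand at \<open>id\<close> is positive. If cc were 0,
  the square of \<open>D\<close> = ca would be caca, a multiple of cca = 0.\<close>

lemma hook_nonzero: "hook lam \<noteq> (0 :: 'k::field_char_0)"
proof
  assume h0: "hook lam = (0 :: 'k)"
  define R where "R = row_group lam"
  \<comment> \<open>The coefficients are integers here, since the argument needs an order. The
    vanishing derived in the field is pulled back to the integers by characteristic 0.\<close>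
  define a where "a s = (if s \<in> row_group lam then 1 else 0 :: int)" for s
  define b where "b s = (if s \<in> col_group lam then sign s else 0 :: int)" for s
  define D where "D = conv n (conv n a b) a"
  let ?c = "young_symmetrizer lam :: _ \<Rightarrow> int" and ?k = "young_symmetrizer lam :: _ \<Rightarrow> 'k"
  have RP: "R \<subseteq> perms n" "finite R" and CP: "col_group lam \<subseteq> perms n" "finite (col_group lam)"
    using row_group_perms[of _ lam] col_group_perms[of _ lam] finite_perms[of n] size_lam
    by (auto simp: R_def intro: finite_subset)
  have "sum_list lam = n" by (rule size_lam)
  have sumR: "(\<Sum>s\<in>perms n. a s * h s) = (\<Sum>p\<in>R. h p)" for h :: "_ \<Rightarrow> int"
  proof -
    have "(\<Sum>s\<in>perms n. a s * h s) = (\<Sum>s\<in>perms n. if s \<in> R then h s else 0)"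
      by (intro sum.cong) (auto simp: a_def R_def)
    then show ?thesis using RP finite_perms[of n] by (simp add: sum.inter_restrict[symmetric] Int_absorb1)
  qed
  have ab: "conv n a b w = ?c w" for w
  proof -
    have "conv n a b w = (\<Sum>p\<in>R. b (inv p \<circ> w))" unfolding conv_def by (rule sumR)
    also have "\<dots> = (\<Sum>p\<in>R. \<Sum>q\<in>col_group lam. if w = p \<circ> q then sign q else 0)"
    proof (intro sum.cong refl)
      fix p assume "p \<in> R"
      then have p: "p \<in> perms n" using RP by auto
      have "w = p \<circ> q \<longleftrightarrow> q = inv p \<circ> w" for q using p perms_cancel by metis
      then show "b (inv p \<circ> w) = (\<Sum>q\<in>col_group lam. if w = p \<circ> q then sign q else 0)"
        using CP(2) by (simp add: b_def)
    qed
    finally show ?thesis by (simp add: young_symmetrizer_def R_def cong: if_cong)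
  qed
  have Dc: "D = conv n ?c a" using ab unfolding D_def by presburger
  have ainv: "a (inv s) = a s" "b (inv s) = b s" if "s \<in> perms n" for s
    using that row_group_group(3)[of s lam] row_group_group(3)[of "inv s" lam]
      col_group_group(3)[of s lam] col_group_group(3)[of "inv s" lam] sign_perms(2)[OF that] by (auto simp: a_def b_def)
  have Dinv: "D (inv s) = D s" if s: "s \<in> perms n" for s
  proof -
    have "D (inv s) = conv n (\<lambda>s. a (inv s)) (\<lambda>s. conv n a b (inv s)) s"
      unfolding D_def by (rule conv_inv[OF s])
    also have "\<dots> = conv n a (conv n b a) s"
    proof (rule conv_cong[OF _ _ s])
      fix w assume w: "w \<in> perms n"
      show "a (inv w) = a w" by (rule ainv[OF w])
      show "conv n a b (inv w) = conv n b a w"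
        unfolding conv_inv[OF w] by (rule conv_cong[OF _ _ w]) (simp_all add: ainv)
    qed
    also have "\<dots> = D s" unfolding D_def by (rule conv_assoc[symmetric])
    finally show ?thesis .
  qed
  have Did: "D id = int (card R)"
  proof -
    have "D id = (\<Sum>s\<in>perms n. a s * ?c s)"
      unfolding Dc conv_def by (intro sum.cong refl) (simp add: ainv mult.commute)
    also have "\<dots> = (\<Sum>p\<in>R. 1)" unfolding sumR
    proof (intro sum.cong refl)
      fix p assume "p \<in> R"
      then have "?c (p \<circ> id) = ?c id" unfolding R_def by (rule young_symmetrizer_left)
      then show "?c p = 1" unfolding young_symmetrizer_id by simp
    qed
    finally show ?thesis by simp
  qed
  have ofint: "of_int (conv n f g w) = conv n (\<lambda>s. of_int (f s)) (\<lambda>s. of_int (g s) :: 'k) w" for f g w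
    by (simp add: conv_def)
  have ofc: "of_int (?c s) = ?k s" for s
    by (simp add: young_symmetrizer_def if_distrib[of of_int] cong: if_cong)
  let ?A = "\<lambda>s. of_int (a s) :: 'k" and ?D = "\<lambda>s. of_int (D s) :: 'k"
  have D: "?D = conv n ?k ?A" unfolding Dc by (rule ext) (simp add: ofint ofc)
  \<comment> \<open>The Young symmetrizer is invariant under each row permutation, so their sum acts
    on it from the left as the order of the row group.\<close>
  have ac: "conv n ?A ?k w = of_int (card R) * ?k w" for w
  proof -
    have "conv n a ?c w = (\<Sum>p\<in>R. ?c (inv p \<circ> w))" unfolding conv_def by (rule sumR)
    also have "\<dots> = (\<Sum>p\<in>R. ?c w)"
      by (intro sum.cong refl young_symmetrizer_left) (simp add: R_def row_group_group)
    finally have "of_int (conv n a ?c w) = (of_int (int (card R) * ?c w) :: 'k)" by simp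
    then show ?thesis unfolding ofint ofc by (simp add: ofc)
  qed
  have "conv n ?D ?D id = conv n ?k (conv n ?A (conv n ?k ?A)) id"
    unfolding D by (rule conv_assoc)
  also have "conv n ?A (conv n ?k ?A) = conv n (conv n ?A ?k) ?A" by (rule ext) (rule conv_assoc[symmetric])
  also have "\<dots> = (\<lambda>s. of_int (card R) * conv n ?k ?A s)"
    using ac by (intro ext) (simp add: conv_def sum_distrib_left mult.assoc)
  also have "conv n ?k (\<lambda>s. of_int (card R) * conv n ?k ?A s) id = of_int (card R) * conv n (conv n ?k ?k) ?A id"
    by (simp only: conv_scale conv_assoc)
  also have "\<dots> = 0" by (simp add: young_square h0 conv_def[of n "conv n ?k ?k"])
  finally have "of_int (conv n D D id) = (0 :: 'k)" unfolding ofint .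
  then have "conv n D D id = 0" by (simp only: of_int_eq_0_iff)
  moreover have "conv n D D id = (\<Sum>s\<in>perms n. D s * D s)"
    unfolding conv_def by (intro sum.cong refl) (simp add: Dinv)
  ultimately have "\<forall>s\<in>perms n. D s * D s = 0"
    using sum_nonneg_eq_0_iff[of "perms n" "\<lambda>s. D s * D s"] finite_perms by simp
  then have "D id = 0" by simp
  moreover have "R \<noteq> {}" using row_group_group(1)[of lam] by (auto simp: R_def)
  ultimately show False using Did RP(2) by simp
qed

text \<open>Class functions are central in the group algebra.\<close>

lemma conv_class_function:
  assumes G: "\<And>s w. s \<in> perms n \<Longrightarrow> w \<in> perms n \<Longrightarrow> G (inv w \<circ> (s \<circ> w)) = G s" and w: "w \<in> perms n"
  shows "conv n f G w = conv n G f w"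
proof -
  have "conv n G f w = (\<Sum>s\<in>perms n. G (w \<circ> s) * f (inv (w \<circ> s) \<circ> w))"
    unfolding conv_def by (rule sum_perms_left[OF w, symmetric])
  also have "\<dots> = (\<Sum>s\<in>perms n. G (w \<circ> inv s) * f (inv (w \<circ> inv s) \<circ> w))"
    by (rule sum_perms_inv[symmetric])
  also have "\<dots> = conv n f G w" unfolding conv_def
  proof (intro sum.cong refl)
    fix s assume s: "s \<in> perms n"
    have "G (w \<circ> inv s) = G (inv w \<circ> ((w \<circ> inv s) \<circ> w))"
      by (rule G[symmetric]) (use s w in \<open>simp_all add: perms_comp perms_inv\<close>)
    also have "\<dots> = G (inv s \<circ> w)" using w by (simp add: o_assoc[symmetric])
    finally show "G (w \<circ> inv s) * f (inv (w \<circ> inv s) \<circ> w) = f s * G (inv s \<circ> w)"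
      using s w perms_inv[OF s] by (simp add: perms_inv_comp o_assoc[symmetric] mult.commute)
  qed
  finally show ?thesis ..
qed

text \<open>By centrality \<open>G\<close> can be moved to the left, where the product shows the
  column signs of the Young symmetrizer.\<close>

lemma conv_young_class:
  fixes G :: "(nat \<Rightarrow> nat) \<Rightarrow> 'k::field_char_0"
  assumes G: "\<And>s w. s \<in> perms n \<Longrightarrow> w \<in> perms n \<Longrightarrow> G (inv w \<circ> (s \<circ> w)) = G s" and s: "s \<in> perms n"
  shows "conv n (young_symmetrizer lam) G s = conv n (young_symmetrizer lam) G id * young_symmetrizer lam s"
proof (rule sandwich[OF _ s])
  fix w q assume q: "q \<in> col_group lam" and w: "w \<in> perms n"
  have "q \<in> perms n" using col_group_perms[OF q] by (simp add: size_lam)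
  have "conv n (young_symmetrizer lam) G (w \<circ> q) = conv n G (young_symmetrizer lam) (w \<circ> q)"
    by (rule conv_class_function[where G = G, OF G perms_comp[OF w \<open>q \<in> perms n\<close>]])
  also have "\<dots> = of_int (sign q) * conv n G (young_symmetrizer lam) w"
    by (intro conv_right young_symmetrizer_right q)
  also have "conv n G (young_symmetrizer lam) w = conv n (young_symmetrizer lam) G w"
    by (rule conv_class_function[where G = G, OF G w, symmetric])
  finally show "conv n (young_symmetrizer lam) G (w \<circ> q) = of_int (sign q) * conv n (young_symmetrizer lam) G w" .
qed

text \<open>Right multiplication by the Young symmetrizer c acts on the left ideal generated by c as
  the scalar \<open>hook lam\<close>, because cc is \<open>hook lam\<close> times c.\<close>

lemma specht_expand:
  fixes w :: "(nat \<Rightarrow> nat) \<Rightarrow> 'k::field_char_0"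
  assumes "w \<in> specht lam"
  shows "hook lam * w x = (\<Sum>u\<in>perms n. w u * young_symmetrizer lam (inv u \<circ> x))"
proof -
  let ?P = "\<lambda>w :: (nat \<Rightarrow> nat) \<Rightarrow> 'k. \<forall>x. hook lam * w x = (\<Sum>u\<in>perms n. w u * young_symmetrizer lam (inv u \<circ> x))"
  have "?P w"
  proof (rule fvs.span_induct[OF assms[unfolded specht_def]])
    show "fvs.subspace (Collect ?P)"
      by (rule fvs.subspaceI)
        (auto simp: fscale_def distrib_left distrib_right sum.distrib sum_distrib_left mult_ac)
    fix v :: "(nat \<Rightarrow> nat) \<Rightarrow> 'k" assume "v \<in> (\<lambda>s. perm_act s (young_symmetrizer lam)) ` perms (sum_list lam)"
    then obtain s where s: "s \<in> perms n" "v = perm_act s (young_symmetrizer lam)" by (auto simp: size_lam)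
    show "?P v"
    proof
      fix x
      have "(\<Sum>u\<in>perms n. v u * young_symmetrizer lam (inv u \<circ> x)) = (\<Sum>u\<in>perms n. v (s \<circ> u) * young_symmetrizer lam (inv (s \<circ> u) \<circ> x))"
        by (rule sum_perms_left[OF s(1), symmetric])
      also have "\<dots> = conv n (young_symmetrizer lam) (young_symmetrizer lam) (inv s \<circ> x)"
        unfolding conv_def by (intro sum.cong refl) (use s in \<open>simp add: perm_act_def perms_inv_comp o_assoc[symmetric]\<close>)
      finally show "hook lam * v x = (\<Sum>u\<in>perms n. v u * young_symmetrizer lam (inv u \<circ> x))"
        by (simp add: young_square s(2) perm_act_def)
    qed
  qed
  then show ?thesis by blast
qed

lemma perm_act_linear:
  "perm_act s (v + w) = perm_act s v + perm_act s w" "perm_act s (fscale c v) = fscale c (perm_act s v)"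
  by (auto simp: perm_act_def fscale_def fun_eq_iff)

lemma perm_act_specht:
  fixes v :: "(nat \<Rightarrow> nat) \<Rightarrow> 'k::field"
  assumes "s \<in> perms n" "v \<in> specht lam"
  shows "perm_act s v \<in> specht lam"
proof -
  have "v \<in> {v. perm_act s v \<in> specht lam}"
  proof (rule fvs.span_induct[OF assms(2)[unfolded specht_def]])
    have z: "perm_act s 0 = 0" by (simp add: perm_act_def fun_eq_iff)
    show "fvs.subspace {v. v \<in> {v. perm_act s v \<in> specht lam}}"
      unfolding specht_def
      by (rule fvs.subspaceI) (simp_all only: mem_Collect_eq perm_act_linear z fvs.span_zero fvs.span_add fvs.span_scale)
    fix v :: "(nat \<Rightarrow> nat) \<Rightarrow> 'k" assume "v \<in> (\<lambda>s. perm_act s (young_symmetrizer lam)) ` perms (sum_list lam)"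
    then obtain r where r: "r \<in> perms n" "v = perm_act r (young_symmetrizer lam)" by (auto simp: size_lam)
    have "perm_act s v = perm_act (s \<circ> r) (young_symmetrizer lam)"
      unfolding r(2) perm_act_def using r(1) assms(1) by (simp add: perms_inv_comp o_assoc)
    then show "v \<in> {v. perm_act s v \<in> specht lam}"
      using perms_comp[OF assms(1) r(1)] unfolding specht_def size_lam by (auto intro: fvs.span_base)
  qed
  then show ?thesis by simp
qed

text \<open>The character as a sum over the conjugates of the Young symmetrizer c. The formula
  arises from computing the trace on the left ideal with the spanning vectors uc divided by
  \<open>hook lam\<close>; the inverse of \<open>s\<close> comes from
  \<open>perm_act\<close>.\<close>

definition chi :: "(nat \<Rightarrow> nat) \<Rightarrow> 'k::field_char_0" where
  "chi s = (\<Sum>u\<in>perms n. young_symmetrizer lam (inv u \<circ> (inv s \<circ> u))) / hook lam"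

lemma specht_basis_trace:
  fixes B :: "((nat \<Rightarrow> nat) \<Rightarrow> 'k::field_char_0) set"
  assumes s: "s \<in> perms n" and B: "is_basis B (specht lam)"
  shows "finite B" "(\<Sum>b\<in>B. fvs.representation B (perm_act s b) b) = chi s"
proof -
  let ?c = "young_symmetrizer lam :: _ \<Rightarrow> 'k"
  define d where "d u = fscale (inverse (hook lam)) (perm_act u ?c)" for u
  have sp: "fvs.span (specht lam) = (specht lam :: ((nat \<Rightarrow> nat) \<Rightarrow> 'k) set)"
    unfolding specht_def by (rule fvs.span_span)
  have d: "d u \<in> specht lam" if "u \<in> perms n" for u
    unfolding d_def specht_def using that size_lam by (intro fvs.span_scale fvs.span_base) auto
  have ex: "w = (\<Sum>u\<in>perms n. fscale (w u) (d u))" if "w \<in> specht lam" for w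
  proof
    fix x
    have apply_sum: "sum g I x = (\<Sum>i\<in>I. g i x)" for g :: "(nat \<Rightarrow> nat) \<Rightarrow> (nat \<Rightarrow> nat) \<Rightarrow> 'k" and I
      by (induction I rule: infinite_finite_induct) auto
    have "(\<Sum>u\<in>perms n. fscale (w u) (d u)) x = inverse (hook lam) * (\<Sum>u\<in>perms n. w u * ?c (inv u \<circ> x))"
      unfolding apply_sum by (simp add: fscale_def d_def perm_act_def sum_distrib_left mult_ac)
    also have "\<dots> = w x" using specht_expand[OF that, of x, symmetric] hook_nonzero[where 'k = 'k] by simp
    finally show "w x = (\<Sum>u\<in>perms n. fscale (w u) (d u)) x" ..
  qed
  note bt = basis_trace[OF finite_perms sp d ex perm_act_linear perm_act_specht[OF s] B]
  show "finite B" by (rule bt(1))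
  have "(\<Sum>b\<in>B. fvs.representation B (perm_act s b) b) = (\<Sum>u\<in>perms n. perm_act s (d u) u)"
    by (rule bt(2))
  also have "\<dots> = chi s"
    by (simp add: chi_def d_def fscale_def perm_act_def sum_distrib_left divide_inverse mult.commute)
  finally show "(\<Sum>b\<in>B. fvs.representation B (perm_act s b) b) = chi s" .
qed

lemma sym_character_eq: "s \<in> perms n \<Longrightarrow> sym_character lam s = (chi s :: 'k::field_char_0)"
  unfolding sym_character_def trace_on_def Let_def
  by (rule specht_basis_trace(2)[OF _ is_basis_SOME])

lemma chi_id: "chi id = (fact n / hook lam :: 'k::field_char_0)"
proof -
  have "(\<Sum>u\<in>perms n. young_symmetrizer lam (inv u \<circ> (inv id \<circ> u))) = (\<Sum>u\<in>perms n. 1 :: 'k)"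
    by (intro sum.cong refl) (simp add: young_symmetrizer_id)
  also have "\<dots> = fact n" using card_permutations[of "{1..n}" n] by (simp add: perms_def)
  finally show ?thesis by (simp add: chi_def)
qed

lemma chi_class:
  assumes "w \<in> perms n" "s \<in> perms n"
  shows "chi (inv w \<circ> (s \<circ> w)) = (chi s :: 'k::field_char_0)"
proof -
  have "(\<Sum>u\<in>perms n. young_symmetrizer lam (inv u \<circ> (inv (inv w \<circ> (s \<circ> w)) \<circ> u)))
    = (\<Sum>u\<in>perms n. young_symmetrizer lam (inv (w \<circ> u) \<circ> (inv s \<circ> (w \<circ> u))) :: 'k)"
    unfolding perms_inv_conj[OF assms]
    by (intro sum.cong refl) (simp only: perms_inv_comp[OF assms(1)], simp only: o_assoc)
  also have "\<dots> = (\<Sum>u\<in>perms n. young_symmetrizer lam (inv u \<circ> (inv s \<circ> u)))"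
    by (rule sum_perms_left[OF assms(1)])
  finally show ?thesis by (simp add: chi_def)
qed

text \<open>As \<open>h\<close> is a class function, conjugating the summation variable shows that
  every \<open>u\<close> in the definition of \<open>chi\<close> contributes the same sum.\<close>

lemma sum_class_chi:
  fixes h :: "(nat \<Rightarrow> nat) \<Rightarrow> 'k::field_char_0"
  assumes h: "\<And>s w. s \<in> perms n \<Longrightarrow> w \<in> perms n \<Longrightarrow> h (inv w \<circ> (s \<circ> w)) = h s"
  shows "(\<Sum>s\<in>perms n. h s * chi s) = fact n / hook lam * (\<Sum>s\<in>perms n. h s * young_symmetrizer lam (inv s))"
proof -
  let ?c = "young_symmetrizer lam :: _ \<Rightarrow> 'k"
  have "(\<Sum>s\<in>perms n. h s * chi s) = (\<Sum>s\<in>perms n. \<Sum>u\<in>perms n. h s * ?c (inv u \<circ> (inv s \<circ> u))) / hook lam"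
    by (simp add: chi_def sum_distrib_left sum_divide_distrib)
  also have "(\<Sum>s\<in>perms n. \<Sum>u\<in>perms n. h s * ?c (inv u \<circ> (inv s \<circ> u))) = (\<Sum>u\<in>perms n. \<Sum>s\<in>perms n. h s * ?c (inv u \<circ> (inv s \<circ> u)))"
    by (rule sum.swap)
  also have "\<dots> = (\<Sum>u\<in>perms n. \<Sum>s\<in>perms n. h s * ?c (inv s))"
  proof (rule sum.cong[OF refl])
    fix u assume u: "u \<in> perms n"
    have "(\<Sum>s\<in>perms n. h s * ?c (inv u \<circ> (inv s \<circ> u))) = (\<Sum>s\<in>perms n. h (inv u \<circ> (s \<circ> u)) * ?c (inv (inv u \<circ> (s \<circ> u))))"
      by (intro sum.cong refl) (simp only: perms_inv_conj[OF u] h[OF _ u])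
    also have "\<dots> = (\<Sum>s\<in>perms n. h (inv u \<circ> s) * ?c (inv (inv u \<circ> s)))"
      by (rule sum_perms_right[OF u, of "\<lambda>s. h (inv u \<circ> s) * ?c (inv (inv u \<circ> s))"])
    also have "\<dots> = (\<Sum>s\<in>perms n. h s * ?c (inv s))"
      by (rule sum_perms_left[OF perms_inv[OF u]])
    finally show "(\<Sum>s\<in>perms n. h s * ?c (inv u \<circ> (inv s \<circ> u))) = (\<Sum>s\<in>perms n. h s * ?c (inv s))" .
  qed
  also have "\<dots> = fact n * (\<Sum>s\<in>perms n. h s * ?c (inv s))"
    using card_permutations[of "{1..n}" n] by (simp add: perms_def)
  finally show ?thesis by simp
qed

end

text \<open>Substituting an inverse and then a conjugate for \<open>s\<close> exchanges
  \<open>f\<close> and \<open>g\<close>. By this symmetry, orthogonality has to be shown only for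
  one order of the row weights.\<close>

lemma sum_conjugates_swap:
  "(\<Sum>u\<in>perms n. \<Sum>s\<in>perms n. f (inv u \<circ> (inv s \<circ> u)) * g s) =
   (\<Sum>u\<in>perms n. \<Sum>s\<in>perms n. g (inv u \<circ> (inv s \<circ> u)) * (f s :: 'k::comm_ring_1))"
proof -
  have "(\<Sum>u\<in>perms n. \<Sum>s\<in>perms n. f (inv u \<circ> (inv s \<circ> u)) * g s) = (\<Sum>u\<in>perms n. \<Sum>s\<in>perms n. g (u \<circ> (inv s \<circ> inv u)) * f s)"
  proof (rule sum.cong[OF refl])
    fix u assume u: "u \<in> perms n"
    have "(\<Sum>s\<in>perms n. f (inv u \<circ> (inv s \<circ> u)) * g s) = (\<Sum>s\<in>perms n. f (inv u \<circ> (inv (inv s) \<circ> u)) * g (inv s))"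
      by (rule sum_perms_inv[symmetric])
    also have "\<dots> = (\<Sum>s\<in>perms n. f (inv u \<circ> (s \<circ> u)) * g (u \<circ> (inv (inv u \<circ> (s \<circ> u)) \<circ> inv u)))"
    proof (intro sum.cong refl)
      fix s assume s: "s \<in> perms n"
      have "u \<circ> (inv (inv u \<circ> (s \<circ> u)) \<circ> inv u) = u \<circ> (inv u \<circ> (inv s \<circ> (u \<circ> inv u)))"
        unfolding perms_inv_conj[OF u s] by (simp only: o_assoc)
      also have "\<dots> = inv s" unfolding perms_cancel(2)[OF u] perms_inv_o(2)[OF u] by simp
      finally show "f (inv u \<circ> (inv (inv s) \<circ> u)) * g (inv s) =
          f (inv u \<circ> (s \<circ> u)) * g (u \<circ> (inv (inv u \<circ> (s \<circ> u)) \<circ> inv u))"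
        using perms_inv_inv[OF s] by simp
    qed
    also have "\<dots> = (\<Sum>s\<in>perms n. f (inv u \<circ> s) * g (u \<circ> (inv (inv u \<circ> s) \<circ> inv u)))"
      by (rule sum_perms_right[OF u, of "\<lambda>s. f (inv u \<circ> s) * g (u \<circ> (inv (inv u \<circ> s) \<circ> inv u))"])
    also have "\<dots> = (\<Sum>s\<in>perms n. f s * g (u \<circ> (inv s \<circ> inv u)))"
      by (rule sum_perms_left[OF perms_inv[OF u]])
    finally show "(\<Sum>s\<in>perms n. f (inv u \<circ> (inv s \<circ> u)) * g s) = (\<Sum>s\<in>perms n. g (u \<circ> (inv s \<circ> inv u)) * f s)"
      by (simp add: mult.commute)
  qed
  also have "\<dots> = (\<Sum>u\<in>perms n. \<Sum>s\<in>perms n. g (inv u \<circ> (inv s \<circ> inv (inv u))) * f s)"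
    by (rule sum_perms_inv[symmetric])
  also have "\<dots> = (\<Sum>u\<in>perms n. \<Sum>s\<in>perms n. g (inv u \<circ> (inv s \<circ> u)) * f s)"
    by (intro sum.cong refl) simp
  finally show ?thesis .
qed

text \<open>Orthogonality of characters, in the form used later. Each inner sum is the value at
  \<open>u\<close> of the product of the symmetrizer of \<open>mu\<close>, the element
  \<open>u\<close> and the symmetrizer of \<open>lam\<close>, which has row invariance for
  \<open>mu\<close> and column signs for \<open>lam\<close>. For different shapes it vanishes if the
  row weights are in the right order, and the symmetry of \<open>T\<close> covers the other order.
  For equal shapes it is a multiple of the symmetrizer, and the square formula is applied
  twice.\<close>

lemma chi_young_symmetrizer:
  assumes lam: "lam \<in> partitions_of n" and mu: "mu \<in> partitions_of n"
  shows "(\<Sum>s\<in>perms n. chi lam n s * young_symmetrizer mu s) = (if lam = mu then hook lam else (0 :: 'k::field_char_0))"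
proof -
  let ?c = "\<lambda>lam. young_symmetrizer lam :: _ \<Rightarrow> 'k"
  define T where "T lam mu = (\<Sum>u\<in>perms n. \<Sum>s\<in>perms n. ?c lam (inv u \<circ> (inv s \<circ> u)) * ?c mu s)" for lam mu
  have conv: "(\<Sum>s\<in>perms n. ?c lam (inv u \<circ> (inv s \<circ> u)) * ?c mu s) = conv n (?c mu) (\<lambda>w. ?c lam (inv u \<circ> w)) u" for lam mu u
    by (simp add: conv_def mult.commute)
  have left: "conv n (?c mu) g (p \<circ> w) = conv n (?c mu) g w"
    if "mu \<in> partitions_of n" "p \<in> row_group mu" for mu g p w
    by (rule conv_left) (use that row_group_perms[OF that(2)] young_symmetrizer_left in \<open>auto simp: partitions_of_def\<close>)
  have right: "conv n f (\<lambda>w. ?c lam (inv u \<circ> w)) (w \<circ> q) = of_int (sign q) * conv n f (\<lambda>w. ?c lam (inv u \<circ> w)) w"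
    if "q \<in> col_group lam" for lam f q u w
    by (rule conv_right) (simp add: o_assoc young_symmetrizer_right[OF that])
  have T0: "T lam mu = 0" if "lam \<in> partitions_of n" "mu \<in> partitions_of n" "lam \<noteq> mu" "row_weight mu \<le> row_weight lam" for lam mu
    unfolding T_def conv
  proof (rule sum.neutral, rule ballI)
    fix u assume u: "u \<in> perms n"
    show "conv n (?c mu) (\<lambda>w. ?c lam (inv u \<circ> w)) u = 0"
    proof (rule two_sided_zero[where x = "conv n (?c mu) (\<lambda>w. ?c lam (inv u \<circ> w))", OF that(2,1) u])
      show "conv n (?c mu) (\<lambda>w. ?c lam (inv u \<circ> w)) (p \<circ> w) = conv n (?c mu) (\<lambda>w. ?c lam (inv u \<circ> w)) w"
        if "p \<in> row_group mu" for p w by (rule left[OF \<open>mu \<in> _\<close> that])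
      show "conv n (?c mu) (\<lambda>w. ?c lam (inv u \<circ> w)) (w \<circ> q) = of_int (sign q) * conv n (?c mu) (\<lambda>w. ?c lam (inv u \<circ> w)) w"
        if "q \<in> col_group lam" for q w by (rule right[OF that])
    qed (use that in auto)
  qed
  have "T lam mu = (if lam = mu then hook lam * hook lam else 0)"
  proof (cases "lam = mu")
    case False
    have "T lam mu = T mu lam" unfolding T_def by (rule sum_conjugates_swap)
    then show ?thesis using T0[OF lam mu False] T0[OF mu lam] False by (cases "row_weight mu \<le> row_weight lam") auto
  next
    case True
    have "T lam lam = (\<Sum>u\<in>perms n. conv n (?c lam) (\<lambda>w. ?c lam (inv u \<circ> w)) id * ?c lam u)"
      unfolding T_def conv
    proof (rule sum.cong[OF refl])
      fix u assume u: "u \<in> perms n"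
      show "conv n (?c lam) (\<lambda>w. ?c lam (inv u \<circ> w)) u = conv n (?c lam) (\<lambda>w. ?c lam (inv u \<circ> w)) id * ?c lam u"
      proof (rule two_sided_multiple[where x = "conv n (?c lam) (\<lambda>w. ?c lam (inv u \<circ> w))", OF lam u])
        show "conv n (?c lam) (\<lambda>w. ?c lam (inv u \<circ> w)) (p \<circ> w) = conv n (?c lam) (\<lambda>w. ?c lam (inv u \<circ> w)) w"
          if "p \<in> row_group lam" for p w by (rule left[OF lam that])
        show "conv n (?c lam) (\<lambda>w. ?c lam (inv u \<circ> w)) (w \<circ> q) = of_int (sign q) * conv n (?c lam) (\<lambda>w. ?c lam (inv u \<circ> w)) w"
          if "q \<in> col_group lam" for q w by (rule right[OF that])
      qed
    qed
    also have "\<dots> = (\<Sum>u\<in>perms n. \<Sum>s\<in>perms n. ?c lam s * (?c lam u * ?c lam (inv u \<circ> inv s)))"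
      by (simp add: conv_def sum_distrib_left sum_distrib_right mult_ac)
    also have "\<dots> = (\<Sum>s\<in>perms n. \<Sum>u\<in>perms n. ?c lam s * (?c lam u * ?c lam (inv u \<circ> inv s)))"
      by (rule sum.swap)
    also have "\<dots> = (\<Sum>s\<in>perms n. ?c lam s * conv n (?c lam) (?c lam) (inv s))"
      by (simp add: conv_def sum_distrib_left)
    also have "\<dots> = (\<Sum>s\<in>perms n. ?c lam s * (hook lam * ?c lam (inv s)))"
      unfolding young_square[OF lam] ..
    also have "\<dots> = hook lam * conv n (?c lam) (?c lam) id"
      by (simp add: conv_def sum_distrib_left mult_ac)
    also have "\<dots> = hook lam * hook lam"
      unfolding young_square[OF lam] by (simp add: young_symmetrizer_id)
    finally show ?thesis using True by simp
  qed
  moreover have "(\<Sum>s\<in>perms n. chi lam n s * ?c mu s) = T lam mu / hook lam"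
    unfolding T_def by (subst sum.swap) (simp add: chi_def[OF lam] sum_distrib_right sum_divide_distrib)
  ultimately show ?thesis using hook_nonzero[OF lam, where 'k = 'k] by simp
qed

section \<open>Placements of cells in lines\<close>

text \<open>For finite \<open>B\<close> this is the product of the factorials of the sizes of the
  fibres of \<open>h\<close> on \<open>B\<close>.\<close>

definition fibre_perms :: "('a \<Rightarrow> 'b) \<Rightarrow> 'a set \<Rightarrow> nat" where
  "fibre_perms h B = card {q. q permutes B \<and> (\<forall>x\<in>B. h (q x) = h x)}"

text \<open>Sets \<open>B\<close> of \<open>k\<close> cells without two cells in a common line \<open>g\<close>, weighted by the number of their
  permutations that preserve \<open>h\<close>.\<close>

definition placements :: "('a \<Rightarrow> 'c) \<Rightarrow> ('a \<Rightarrow> 'b) \<Rightarrow> 'a set \<Rightarrow> nat \<Rightarrow> nat" where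
  "placements g h D k = (\<Sum>B\<in>{B. B \<subseteq> D \<and> inj_on g B \<and> card B = k}. fibre_perms h B)"

lemma fibre_perms_empty [simp]: "fibre_perms h {} = 1"
proof -
  have "{q. q permutes {} \<and> (\<forall>x\<in>{}. h (q x) = h x)} = {id}" by auto
  then show ?thesis by (simp add: fibre_perms_def)
qed

text \<open>Splitting off the transposition of \<open>a\<close> with its image \<open>b\<close>
  leaves a permutation of \<open>B\<close>, and \<open>b\<close> ranges over the fibre of
  \<open>a\<close>.\<close>

lemma fibre_perms_insert:
  assumes "finite B" "a \<notin> B"
  shows "fibre_perms h (insert a B) = (card {b \<in> B. h b = h a} + 1) * fibre_perms h B"
proof -
  let ?Q = "{q. q permutes B \<and> (\<forall>x\<in>B. h (q x) = h x)}"
  let ?C = "{b \<in> insert a B. h b = h a}"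
  have "{q. q permutes insert a B \<and> (\<forall>x\<in>insert a B. h (q x) = h x)} = (\<lambda>(b, q). transpose a b \<circ> q) ` (?C \<times> ?Q)" (is "?L = ?f ` _")
  proof (intro equalityI subsetI)
    fix q assume q: "q \<in> ?L"
    then have "q \<in> {p. p permutes insert a B}" by simp
    then obtain b p where bp: "q = transpose a b \<circ> p" "b \<in> insert a B" "p permutes B"
      unfolding permutes_insert by auto
    have pa: "p a = a" using bp(3) assms(2) by (rule permutes_not_in)
    then have "q a = b" by (simp add: bp(1))
    then have hb: "h b = h a" using q by auto
    have "h (p x) = h x" if "x \<in> B" for x
    proof -
      have "h (transpose a b y) = h y" for y using hb by (auto simp: transpose_def)
      then show ?thesis using q that by (auto simp: bp(1))
    qed
    then show "q \<in> ?f ` (?C \<times> ?Q)" using bp hb by (intro image_eqI[of _ _ "(b, p)"]) auto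
  next
    fix q assume "q \<in> ?f ` (?C \<times> ?Q)"
    then obtain b p where bp: "q = transpose a b \<circ> p" "b \<in> insert a B" "h b = h a" "p permutes B" "\<forall>x\<in>B. h (p x) = h x" by auto
    have "q permutes insert a B" using permutes_insert[of a B] bp by auto
    moreover have "h (transpose a b y) = h y" for y using bp(3) by (auto simp: transpose_def)
    moreover have "p a = a" using bp(4) assms(2) by (rule permutes_not_in)
    ultimately show "q \<in> ?L" using bp by auto
  qed
  moreover have "inj_on ?f (?C \<times> ?Q)"
  proof (rule inj_onI, clarify)
    fix b p b' p' assume p: "p permutes B" "p' permutes B" and e: "transpose a b \<circ> p = transpose a b' \<circ> p'"
    have "(transpose a b \<circ> p) a = (transpose a b' \<circ> p') a" using e by simp
    then have "b = b'" using permutes_not_in[OF p(1) assms(2)] permutes_not_in[OF p(2) assms(2)] by simp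
    moreover then have "transpose a b \<circ> (transpose a b \<circ> p) = transpose a b \<circ> (transpose a b \<circ> p')" using e by simp
    then have "p = p'" by (simp add: o_assoc)
    ultimately show "b = b' \<and> p = p'" by simp
  qed
  ultimately have "fibre_perms h (insert a B) = card (?C \<times> ?Q)"
    unfolding fibre_perms_def by (simp add: card_image)
  moreover have "?C = insert a {b \<in> B. h b = h a}" by auto
  ultimately show ?thesis using assms by (simp add: card_cartesian_product fibre_perms_def)
qed

lemma placements_0: "finite D \<Longrightarrow> placements g h D 0 = 1"
proof -
  assume "finite D"
  then have "{B. B \<subseteq> D \<and> inj_on g B \<and> card B = 0} = {{}}" by (auto simp: card_eq_0_iff dest: finite_subset)
  then show ?thesis by (simp add: placements_def)
qed

text \<open>A set of \<open>Suc k\<close> cells either avoids the new line or consists of one cell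
  of the line and \<open>k\<close> old cells. In the second case the weights sum over the line to
  \<open>card L + k\<close> times the old weight: each old cell lies in the fibre of exactly one
  cell of the line, which adds \<open>k\<close>, and each new cell adds 1.\<close>

lemma placements_line:
  assumes fin: "finite D" "finite L" and disj: "\<And>x y. x \<in> L \<Longrightarrow> y \<in> D \<Longrightarrow> g x \<noteq> g y"
    and line: "\<And>x y. x \<in> L \<Longrightarrow> y \<in> L \<Longrightarrow> g x = g y" and inj: "inj_on h L" and sub: "h ` D \<subseteq> h ` L"
  shows "placements g h (D \<union> L) (Suc k) = placements g h D (Suc k) + (card L + k) * placements g h D k"
proof -
  have DL: "D \<inter> L = {}" using disj by auto
  let ?S = "\<lambda>k. {B. B \<subseteq> D \<and> inj_on g B \<and> card B = k}"
  have finS: "finite (?S k)" for k by (rule finite_subset[of _ "Pow D"]) (use fin in auto)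
  have "{B. B \<subseteq> D \<union> L \<and> inj_on g B \<and> card B = Suc k} = ?S (Suc k) \<union> (\<lambda>(B, a). insert a B) ` (?S k \<times> L)" (is "?A = ?X \<union> ?Y")
  proof (intro equalityI subsetI)
    fix B assume B: "B \<in> ?A"
    show "B \<in> ?X \<union> ?Y"
    proof (cases "B \<inter> L = {}")
      case True
      then show ?thesis using B by auto
    next
      case False
      then obtain a where a: "a \<in> B" "a \<in> L" by auto
      have "y \<notin> L" if "y \<in> B - {a}" for y
        using B a that line[of y a] by (auto simp: inj_on_def)
      then have "B - {a} \<in> ?S k" using B a fin by (auto intro: inj_on_subset simp: card_Diff_singleton)
      then show ?thesis using a by (intro UnI2 image_eqI[of _ _ "(B - {a}, a)"]) auto
    qed
  next
    fix B assume "B \<in> ?X \<union> ?Y"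
    then show "B \<in> ?A"
    proof
      assume "B \<in> ?Y"
      then obtain B' a where B': "B' \<in> ?S k" "a \<in> L" "B = insert a B'" by auto
      then have "a \<notin> B'" "finite B'" using DL fin finite_subset by auto
      moreover have "g a \<notin> g ` B'" using B' disj by auto
      ultimately show "B \<in> ?A" using B' by auto
    qed auto
  qed
  moreover have "?X \<inter> ?Y = {}" using DL by auto
  moreover have "finite ?Y" using finS fin by auto
  ultimately have "placements g h (D \<union> L) (Suc k) = placements g h D (Suc k) + (\<Sum>B\<in>?Y. fibre_perms h B)"
    unfolding placements_def using finS by (simp add: sum.union_disjoint)
  also have "(\<Sum>B\<in>?Y. fibre_perms h B) = (\<Sum>(B, a)\<in>?S k \<times> L. fibre_perms h (insert a B))"
  proof -
    have "inj_on (\<lambda>(B, a). insert a B) (?S k \<times> L)"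
    proof (rule inj_onI, clarify)
      fix B a B' a' assume B: "B \<subseteq> D" "B' \<subseteq> D" "a \<in> L" "a' \<in> L" and e: "insert a B = insert a' B'"
      have "a \<notin> B" "a \<notin> B'" "a' \<notin> B" "a' \<notin> B'" using B DL by auto
      moreover then have "a = a'" using e by blast
      ultimately show "B = B' \<and> a = a'" using e insert_ident by metis
    qed
    then show ?thesis by (simp add: sum.reindex case_prod_unfold)
  qed
  also have "\<dots> = (\<Sum>B\<in>?S k. \<Sum>a\<in>L. fibre_perms h (insert a B))" by (simp add: sum.cartesian_product)
  also have "\<dots> = (\<Sum>B\<in>?S k. (card L + k) * fibre_perms h B)"
  proof (intro sum.cong refl)
    fix B assume B: "B \<in> ?S k"
    then have finB: "finite B" using fin finite_subset by auto
    have "(\<Sum>a\<in>L. fibre_perms h (insert a B)) = (\<Sum>a\<in>L. (card {b \<in> B. h b = h a} + 1) * fibre_perms h B)"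
      by (intro sum.cong refl fibre_perms_insert finB) (use B DL in auto)
    also have "\<dots> = ((\<Sum>a\<in>L. card {b \<in> B. h b = h a}) + card L) * fibre_perms h B"
      by (simp only: sum_distrib_right[symmetric] sum.distrib sum_constant) simp
    also have "(\<Sum>a\<in>L. card {b \<in> B. h b = h a}) = card (\<Union>a\<in>L. {b \<in> B. h b = h a})"
      by (rule card_UN_disjoint[symmetric]) (use fin finB inj in \<open>auto simp: inj_on_def\<close>)
    also have "(\<Union>a\<in>L. {b \<in> B. h b = h a}) = B" using B sub by blast
    finally show "(\<Sum>a\<in>L. fibre_perms h (insert a B)) = (card L + k) * fibre_perms h B" using B by (simp add: add.commute)
  qed
  also have "\<dots> = (card L + k) * placements g h D k" by (simp add: placements_def sum_distrib_left)
  finally show ?thesis .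
qed

lemma placements_eq_0: "card (g ` D) < k \<Longrightarrow> finite D \<Longrightarrow> placements g h D k = 0"
proof -
  assume k: "card (g ` D) < k" and "finite D"
  have "{B. B \<subseteq> D \<and> inj_on g B \<and> card B = k} = {}"
  proof (rule ccontr)
    assume "{B. B \<subseteq> D \<and> inj_on g B \<and> card B = k} \<noteq> {}"
    then obtain B where B: "B \<subseteq> D" "inj_on g B" "card B = k" by auto
    then have "k = card (g ` B)" by (simp add: card_image)
    also have "\<dots> \<le> card (g ` D)" using B \<open>finite D\<close> by (intro card_mono) auto
    finally show False using k by simp
  qed
  then show ?thesis unfolding placements_def by (simp only: sum.empty)
qed

lemma falling_Suc: "falling t (Suc k) = falling t k * (t - of_nat k)"
  by (simp add: falling_def)

lemma falling_Suc_left: "falling t (Suc k) = t * falling (t - 1) k"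
proof -
  have "falling t (Suc k) = (t - of_nat 0) * (\<Prod>i<k. t - of_nat (Suc i))"
    unfolding falling_def prod.lessThan_Suc_shift by simp
  also have "\<dots> = t * falling (t - 1) k" by (simp add: falling_def diff_diff_eq)
  finally show ?thesis .
qed

lemma falling_add: "falling t (a + b) = falling t a * falling (t - of_nat a) b"
  by (induction b) (simp_all add: falling_Suc falling_def[of _ 0] algebra_simps)

text \<open>A new line multiplies a weighted sum over placements by \<open>q\<close>, provided that
  the weights before and after satisfy the two-term recurrence \<open>c\<close>. The row computation
  and the column computation are instances with different weights.\<close>

lemma placement_sum_step:
  fixes c c' :: "nat \<Rightarrow> 'k::comm_ring_1"
  assumes fin: "finite D" "finite L" and disj: "\<And>x y. x \<in> L \<Longrightarrow> y \<in> D \<Longrightarrow> g x \<noteq> g y"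
    and line: "\<And>x y. x \<in> L \<Longrightarrow> y \<in> L \<Longrightarrow> g x = g y" and inj: "inj_on h L" and sub: "h ` D \<subseteq> h ` L"
    and m: "card (g ` D) \<le> m"
    and c: "\<And>k. k \<le> m \<Longrightarrow> c' k + of_nat (card L + k) * c' (Suc k) = q * c k"
  shows "(\<Sum>k\<le>Suc m. of_nat (placements g h (D \<union> L) k) * c' k) = q * (\<Sum>k\<le>m. of_nat (placements g h D k) * c k)"
proof -
  let ?W = "\<lambda>k. of_nat (placements g h D k) :: 'k"
  \<comment> \<open>There are at most \<open>m\<close> old lines, so \<open>Suc m\<close> cells
    cannot be placed.\<close>
  have z: "?W (Suc m) = 0" using placements_eq_0[of g D "Suc m" h] m fin by simp
  have "(\<Sum>k\<le>Suc m. of_nat (placements g h (D \<union> L) k) * c' k)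
    = of_nat (placements g h (D \<union> L) 0) * c' 0 + (\<Sum>k\<le>m. of_nat (placements g h (D \<union> L) (Suc k)) * c' (Suc k))"
    by (rule sum.atMost_Suc_shift)
  also have "(\<Sum>k\<le>m. of_nat (placements g h (D \<union> L) (Suc k)) * c' (Suc k))
    = (\<Sum>k\<le>m. ?W (Suc k) * c' (Suc k)) + (\<Sum>k\<le>m. of_nat (card L + k) * ?W k * c' (Suc k))"
  proof -
    have pl: "placements g h (D \<union> L) (Suc k) = placements g h D (Suc k) + (card L + k) * placements g h D k" for k
      using fin disj line inj sub by (rule placements_line)
    show ?thesis by (simp only: pl of_nat_add of_nat_mult distrib_right sum.distrib)
  qed
  also have "of_nat (placements g h (D \<union> L) 0) * c' 0 + ((\<Sum>k\<le>m. ?W (Suc k) * c' (Suc k)) + (\<Sum>k\<le>m. of_nat (card L + k) * ?W k * c' (Suc k)))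
    = (\<Sum>k\<le>Suc m. ?W k * c' k) + (\<Sum>k\<le>m. of_nat (card L + k) * ?W k * c' (Suc k))"
    unfolding sum.atMost_Suc_shift using fin by (simp add: placements_0)
  also have "\<dots> = (\<Sum>k\<le>m. ?W k * c' k) + (\<Sum>k\<le>m. of_nat (card L + k) * ?W k * c' (Suc k))"
    by (simp add: z)
  also have "\<dots> = (\<Sum>k\<le>m. ?W k * (c' k + of_nat (card L + k) * c' (Suc k)))"
    by (simp add: sum.distrib[symmetric] algebra_simps)
  also have "\<dots> = (\<Sum>k\<le>m. ?W k * (q * c k))"
    by (intro sum.cong refl) (simp only: c atMost_iff)
  also have "\<dots> = q * (\<Sum>k\<le>m. ?W k * c k)"
    by (simp add: sum_distrib_left mult.left_commute)
  finally show ?thesis .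
qed

text \<open>Composition with the transposition of two elements of a common fibre of \<open>g\<close>
  reverses the sign.\<close>

lemma sum_sign_fibre_perms:
  fixes g :: "'a \<Rightarrow> 'b"
  assumes "finite B"
  shows "(\<Sum>p\<in>{p. p permutes B \<and> (\<forall>x\<in>B. g (p x) = g x)}. sign p) = (if inj_on g B then 1 else 0)"
proof (cases "inj_on g B")
  case True
  have "p = id" if "p permutes B" "\<forall>x\<in>B. g (p x) = g x" for p
  proof
    fix x show "p x = id x"
      using that True permutes_in_image[OF that(1)] permutes_not_in[OF that(1)] by (cases "x \<in> B") (auto simp: inj_on_def)
  qed
  then have "{p. p permutes B \<and> (\<forall>x\<in>B. g (p x) = g x)} = {id}" using permutes_id by auto
  then show ?thesis using True by simp
next
  case False
  then obtain a b where ab: "a \<in> B" "b \<in> B" "a \<noteq> b" "g a = g b" by (auto simp: inj_on_def)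
  let ?S = "{p. p permutes B \<and> (\<forall>x\<in>B. g (p x) = g x)}"
  let ?t = "transpose a b"
  have t: "?t permutes B" using ab by (simp add: permutes_swap_id)
  have gt: "g (?t x) = g x" for x using ab by (simp add: transpose_def)
  have "(\<Sum>p\<in>?S. sign p) = (\<Sum>p\<in>?S. sign (?t \<circ> p))"
    by (rule sum.reindex_bij_witness[of _ "\<lambda>p. ?t \<circ> p" "\<lambda>p. ?t \<circ> p"])
      (use t gt in \<open>auto simp: o_assoc permutes_compose\<close>)
  also have "\<dots> = (\<Sum>p\<in>?S. - sign p)"
  proof (intro sum.cong refl)
    fix p assume "p \<in> ?S"
    then have "permutation p" "permutation ?t" using assms t permutation_permutes by blast+
    then show "sign (?t \<circ> p) = - sign p" using ab(3) by (simp add: sign_compose sign_swap_id)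
  qed
  finally show ?thesis using False by (simp add: sum_negf)
qed

lemma row_group_restrict:
  assumes "B \<subseteq> {1..sum_list lam}"
  shows "{p \<in> row_group lam. p permutes B} = {p. p permutes B \<and> (\<forall>k\<in>B. row_of lam (p k) = row_of lam k)}"
    "{q \<in> col_group lam. q permutes B} = {q. q permutes B \<and> (\<forall>k\<in>B. col_of lam (q k) = col_of lam k)}"
  using assms permutes_subset[of _ B "{1..sum_list lam}"] permutes_not_in[of _ B]
  unfolding row_group_def col_group_def perms_def by fastforce+

text \<open>If \<open>p \<circ> q\<close> fixes a point, then \<open>q\<close> moves it within its
  column to a cell that \<open>p\<close> moves back within its row. That cell has the row and the
  column of the point, so both permutations fix the point.\<close>

lemma row_col_prod_permutes:
  assumes p: "p \<in> row_group lam" and q: "q \<in> col_group lam" and B: "B \<subseteq> {1..sum_list lam}"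
  shows "p \<circ> q permutes B \<longleftrightarrow> p permutes B \<and> q permutes B"
proof
  assume pq: "p \<circ> q permutes B"
  have pp: "p permutes {1..sum_list lam}" and qp: "q permutes {1..sum_list lam}"
    using p q by (simp_all add: row_group_def col_group_def perms_def)
  have fix1: "q a = a" if a: "a \<in> {1..sum_list lam} - B" for a
  proof -
    have e: "p (q a) = a" using permutes_not_in[OF pq, of a] a by simp
    have qa: "q a \<in> {1..sum_list lam}" using a permutes_in_image[OF qp] by blast
    then have "row_of lam (q a) = row_of lam a" using p e unfolding row_group_def by (metis (mono_tags, lifting) mem_Collect_eq)
    moreover have "col_of lam (q a) = col_of lam a" using q a by (simp add: col_group_def)
    ultimately show ?thesis using row_col_inject[OF qa] a by simp
  qed
  then have "q permutes B" by (intro permutes_superset[OF qp])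
  moreover have "p a = a" if a: "a \<in> {1..sum_list lam} - B" for a
    using permutes_not_in[OF pq, of a] fix1[OF a] a by simp
  then have "p permutes B" by (intro permutes_superset[OF pp])
  ultimately show "p permutes B \<and> q permutes B" by simp
qed (simp add: permutes_compose)

text \<open>The elements of the support that permute \<open>B\<close> are the products of a row
  permutation and a column permutation of \<open>B\<close>, so the restricted sum is again a double
  sum.\<close>

lemma sum_young_permutes:
  fixes F :: "(nat \<Rightarrow> nat) \<Rightarrow> 'k::comm_ring_1"
  assumes "sum_list lam = n" "B \<subseteq> {1..n}"
  shows "(\<Sum>s\<in>{s \<in> perms n. s permutes B}. young_symmetrizer lam s * F s) =
    (\<Sum>p\<in>{p. p permutes B \<and> (\<forall>k\<in>B. row_of lam (p k) = row_of lam k)}.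
     \<Sum>q\<in>{q. q permutes B \<and> (\<forall>k\<in>B. col_of lam (q k) = col_of lam k)}. of_int (sign q) * F (p \<circ> q))"
proof -
  let ?S = "{s \<in> perms n. s permutes B}" and ?R = "row_group lam" and ?C = "col_group lam"
  have fin: "finite ?R" "finite ?C" "finite ?S"
    using finite_perms[of n] assms(1) by (auto simp: row_group_def col_group_def)
  have "(\<Sum>s\<in>?S. young_symmetrizer lam s * F s) = (\<Sum>s\<in>?S. \<Sum>p\<in>?R. \<Sum>q\<in>?C. if s = p \<circ> q then of_int (sign q) * F s else 0)"
    unfolding young_symmetrizer_def sum_distrib_right by (intro sum.cong refl) auto
  also have "\<dots> = (\<Sum>p\<in>?R. \<Sum>s\<in>?S. \<Sum>q\<in>?C. if s = p \<circ> q then of_int (sign q) * F s else 0)"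
    by (rule sum.swap)
  also have "\<dots> = (\<Sum>p\<in>?R. \<Sum>q\<in>?C. \<Sum>s\<in>?S. if s = p \<circ> q then of_int (sign q) * F s else 0)"
    by (intro sum.cong refl sum.swap)
  also have "\<dots> = (\<Sum>p\<in>?R. \<Sum>q\<in>?C. if p permutes B \<and> q permutes B then of_int (sign q) * F (p \<circ> q) else 0)"
  proof (intro sum.cong refl)
    fix p q assume p: "p \<in> ?R" and q: "q \<in> ?C"
    have "p \<circ> q \<in> perms n" using perms_comp[OF row_group_perms[OF p] col_group_perms[OF q]] assms(1) by simp
    then have "p \<circ> q \<in> ?S \<longleftrightarrow> p permutes B \<and> q permutes B"
      using row_col_prod_permutes[OF p q] assms by simp
    moreover have "(\<Sum>s\<in>?S. if s = p \<circ> q then of_int (sign q) * F s else 0) = (if p \<circ> q \<in> ?S then of_int (sign q) * F (p \<circ> q) else 0)"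
      using fin(3) by (simp only: sum.delta)
    ultimately show "(\<Sum>s\<in>?S. if s = p \<circ> q then of_int (sign q) * F s else 0) =
        (if p permutes B \<and> q permutes B then of_int (sign q) * F (p \<circ> q) else 0)" by simp
  qed
  also have "\<dots> = (\<Sum>p\<in>?R. if p permutes B then \<Sum>q\<in>?C. if q permutes B then of_int (sign q) * F (p \<circ> q) else 0 else 0)"
    by (intro sum.cong refl) auto
  also have "\<dots> = (\<Sum>p\<in>{p \<in> ?R. p permutes B}. \<Sum>q\<in>{q \<in> ?C. q permutes B}. of_int (sign q) * F (p \<circ> q))"
    using fin by (simp add: sum.inter_filter)
  finally show ?thesis using row_group_restrict[of B lam] assms by simp
qed

lemma sum_by_card:
  fixes F :: "nat \<Rightarrow> 'k::comm_ring_1"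
  assumes "finite K"
  shows "(\<Sum>B\<in>Pow K. F (card B) * (if inj_on g B then of_nat (fibre_perms h B) else 0)) = (\<Sum>k\<le>card K. of_nat (placements g h K k) * F k)"
proof -
  have "(\<Sum>B\<in>Pow K. F (card B) * (if inj_on g B then of_nat (fibre_perms h B) else 0))
    = (\<Sum>k\<le>card K. \<Sum>B\<in>{B \<in> Pow K. card B = k}. F (card B) * (if inj_on g B then of_nat (fibre_perms h B) else 0))"
    by (rule sum.group[symmetric]) (use assms card_mono in auto)
  also have "\<dots> = (\<Sum>k\<le>card K. of_nat (placements g h K k) * F k)"
  proof (intro sum.cong refl)
    fix k
    have "(\<Sum>B\<in>{B \<in> Pow K. card B = k}. F (card B) * (if inj_on g B then of_nat (fibre_perms h B) else 0))
      = (\<Sum>B\<in>{B \<in> Pow K. card B = k}. if inj_on g B then F k * of_nat (fibre_perms h B) else 0)"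
      by (intro sum.cong) auto
    also have "\<dots> = (\<Sum>B\<in>{B \<in> {B \<in> Pow K. card B = k}. inj_on g B}. F k * of_nat (fibre_perms h B))"
      by (rule sum.inter_filter[symmetric]) (use assms in auto)
    also have "{B \<in> {B \<in> Pow K. card B = k}. inj_on g B} = {B. B \<subseteq> K \<and> inj_on g B \<and> card B = k}" by auto
    finally show "(\<Sum>B\<in>{B \<in> Pow K. card B = k}. F (card B) * (if inj_on g B then of_nat (fibre_perms h B) else 0))
      = of_nat (placements g h K k) * F k"
      by (simp add: placements_def sum_distrib_left mult.commute)
  qed
  finally show ?thesis .
qed

text \<open>In the first sum the additional sign turns \<open>sign q\<close> into
  \<open>sign p\<close>; the row permutations cancel unless \<open>B\<close> has at most one cell in
  each row. In the second sum the column permutations do so. The permutations without sign provide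
  the weight \<open>fibre_perms\<close>.\<close>

lemma young_placements:
  fixes F :: "nat \<Rightarrow> 'k::comm_ring_1"
  assumes "sum_list lam = n"
  shows "(\<Sum>s\<in>perms n. young_symmetrizer lam s * (of_int (sign s) * (\<Sum>B\<in>{B \<in> Pow {1..n}. s permutes B}. F (card B))))
      = (\<Sum>k\<le>n. of_nat (placements (row_of lam) (col_of lam) {1..n} k) * F k)" (is ?rows)
    and "(\<Sum>s\<in>perms n. young_symmetrizer lam s * (\<Sum>B\<in>{B \<in> Pow {1..n}. s permutes B}. F (card B)))
      = (\<Sum>k\<le>n. of_nat (placements (col_of lam) (row_of lam) {1..n} k) * F k)" (is ?cols)
proof -
  let ?K = "{1..n}"
  let ?RB = "\<lambda>B. {p. p permutes B \<and> (\<forall>k\<in>B. row_of lam (p k) = row_of lam k)}"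
  let ?CB = "\<lambda>B. {p. p permutes B \<and> (\<forall>k\<in>B. col_of lam (p k) = col_of lam k)}"
  have swap: "(\<Sum>s\<in>perms n. \<Sum>B\<in>{B \<in> Pow ?K. s permutes B}. H s B) = (\<Sum>B\<in>Pow ?K. \<Sum>s\<in>{s \<in> perms n. s permutes B}. H s B)" for H :: "_ \<Rightarrow> _ \<Rightarrow> 'k"
    by (rule sum.swap_restrict) (simp_all add: finite_perms)
  have finB: "finite B" if "B \<subseteq> ?K" for B using that finite_subset by auto
  have "(\<Sum>s\<in>perms n. young_symmetrizer lam s * (of_int (sign s) * (\<Sum>B\<in>{B \<in> Pow ?K. s permutes B}. F (card B))))
    = (\<Sum>s\<in>perms n. \<Sum>B\<in>{B \<in> Pow ?K. s permutes B}. F (card B) * (young_symmetrizer lam s * of_int (sign s)))"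
    by (simp add: sum_distrib_left mult_ac)
  also have "\<dots> = (\<Sum>B\<in>Pow ?K. F (card B) * (\<Sum>s\<in>{s \<in> perms n. s permutes B}. young_symmetrizer lam s * of_int (sign s)))"
    unfolding swap by (simp add: sum_distrib_left)
  also have "\<dots> = (\<Sum>B\<in>Pow ?K. F (card B) * (if inj_on (row_of lam) B then of_nat (fibre_perms (col_of lam) B) else 0))"
  proof (intro sum.cong refl arg_cong2[where f = "(*)"])
    fix B assume "B \<in> Pow ?K"
    then have B: "B \<subseteq> ?K" by simp
    have "(\<Sum>s\<in>{s \<in> perms n. s permutes B}. young_symmetrizer lam s * of_int (sign s))
      = (\<Sum>p\<in>?RB B. \<Sum>q\<in>?CB B. of_int (sign q) * (of_int (sign (p \<circ> q)) :: 'k))"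
      by (rule sum_young_permutes[OF assms B])
    also have "\<dots> = (\<Sum>p\<in>?RB B. \<Sum>q\<in>?CB B. of_int (sign p))"
    proof (intro sum.cong refl)
      fix p q assume "p \<in> ?RB B" "q \<in> ?CB B"
      then have "permutation p" "permutation q" using finB[OF B] permutation_permutes by blast+
      then have "sign q * sign (p \<circ> q) = sign p" by (simp add: sign_compose mult.left_commute)
      then show "of_int (sign q) * of_int (sign (p \<circ> q)) = (of_int (sign p) :: 'k)" by (metis of_int_mult)
    qed
    also have "\<dots> = of_int (\<Sum>p\<in>?RB B. sign p) * of_nat (card (?CB B))" by (simp add: sum_distrib_left mult.commute)
    also have "\<dots> = (if inj_on (row_of lam) B then of_nat (fibre_perms (col_of lam) B) else 0)"
      unfolding sum_sign_fibre_perms[OF finB[OF B]] by (simp add: fibre_perms_def)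
    finally show "(\<Sum>s\<in>{s \<in> perms n. s permutes B}. young_symmetrizer lam s * of_int (sign s)) =
      (if inj_on (row_of lam) B then of_nat (fibre_perms (col_of lam) B) else (0 :: 'k))" .
  qed
  also have "\<dots> = (\<Sum>k\<le>n. of_nat (placements (row_of lam) (col_of lam) ?K k) * F k)"
    using sum_by_card[of ?K] by simp
  finally show ?rows .
  have "(\<Sum>s\<in>perms n. young_symmetrizer lam s * (\<Sum>B\<in>{B \<in> Pow ?K. s permutes B}. F (card B)))
    = (\<Sum>s\<in>perms n. \<Sum>B\<in>{B \<in> Pow ?K. s permutes B}. F (card B) * (young_symmetrizer lam s * 1))"
    by (simp add: sum_distrib_left mult_ac)
  also have "\<dots> = (\<Sum>B\<in>Pow ?K. F (card B) * (\<Sum>s\<in>{s \<in> perms n. s permutes B}. young_symmetrizer lam s * 1))"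
    unfolding swap by (simp add: sum_distrib_left)
  also have "\<dots> = (\<Sum>B\<in>Pow ?K. F (card B) * (if inj_on (col_of lam) B then of_nat (fibre_perms (row_of lam) B) else 0))"
  proof (intro sum.cong refl arg_cong2[where f = "(*)"])
    fix B assume "B \<in> Pow ?K"
    then have B: "B \<subseteq> ?K" by simp
    have "(\<Sum>s\<in>{s \<in> perms n. s permutes B}. young_symmetrizer lam s * 1)
      = (\<Sum>p\<in>?RB B. \<Sum>q\<in>?CB B. of_int (sign q) * (1 :: 'k))"
      by (rule sum_young_permutes[OF assms B])
    also have "\<dots> = of_nat (card (?RB B)) * of_int (\<Sum>q\<in>?CB B. sign q)" by simp
    also have "\<dots> = (if inj_on (col_of lam) B then of_nat (fibre_perms (row_of lam) B) else 0)"
      unfolding sum_sign_fibre_perms[OF finB[OF B]] by (simp add: fibre_perms_def)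
    finally show "(\<Sum>s\<in>{s \<in> perms n. s permutes B}. young_symmetrizer lam s * 1) =
      (if inj_on (col_of lam) B then of_nat (fibre_perms (row_of lam) B) else (0 :: 'k))" .
  qed
  also have "\<dots> = (\<Sum>k\<le>n. of_nat (placements (col_of lam) (row_of lam) ?K k) * F k)"
    using sum_by_card[of ?K] by simp
  finally show ?cols .
qed

section \<open>Evaluation of the placement sums of a Young diagram\<close>

lemma row_cells:
  assumes lam: "lam \<in> partitions_of n"
  shows "inj_on (col_of lam) {k \<in> {1..n}. row_of lam k = i}"
    "col_of lam ` {k \<in> {1..n}. row_of lam k = i} = {1..part lam i}"
    "card {k \<in> {1..n}. row_of lam k = i} = part lam i"
proof -
  have n: "sum_list lam = n" using lam by (simp add: partitions_of_def)
  show inj: "inj_on (col_of lam) {k \<in> {1..n}. row_of lam k = i}"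
    by (rule inj_onI) (auto simp: n intro: row_col_inject[of _ lam])
  show im: "col_of lam ` {k \<in> {1..n}. row_of lam k = i} = {1..part lam i}"
  proof (intro equalityI subsetI)
    fix j assume "j \<in> col_of lam ` {k \<in> {1..n}. row_of lam k = i}"
    then obtain k where "k \<in> {1..sum_list lam}" "row_of lam k = i" "j = col_of lam k" using n by auto
    then show "j \<in> {1..part lam i}" using row_of_props[of k lam] by (auto simp: part_def)
  next
    fix j assume "j \<in> {1..part lam i}"
    then have "i < length lam" "1 \<le> j" "j \<le> lam ! i" by (auto simp: part_def split: if_splits)
    from entry_props[OF this] show "j \<in> col_of lam ` {k \<in> {1..n}. row_of lam k = i}"
      using n by (intro image_eqI[of _ _ "entry lam i j"]) auto
  qed
  show "card {k \<in> {1..n}. row_of lam k = i} = part lam i"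
    using card_image[OF inj] im by simp
qed

lemma part_antimono: "lam \<in> partitions_of n \<Longrightarrow> i \<le> i' \<Longrightarrow> part lam i' \<le> part lam i"
  using partition_nth_mono[of lam n i i'] by (auto simp: part_def)

lemma part_le:
  assumes "lam \<in> partitions_of n"
  shows "part lam i \<le> n" "length lam \<le> n"
proof -
  have n: "sum_list lam = n" and nz: "0 \<notin> set lam" using assms by (simp_all add: partitions_of_def)
  show "part lam i \<le> n" using member_le_sum_list[of "lam ! i" lam] n by (auto simp: part_def)
  have "sum_list (map (\<lambda>_. 1) lam) \<le> sum_list (map (\<lambda>x. x) lam)"
    by (rule sum_list_mono) (use nz in \<open>metis One_nat_def Suc_leI gr0I\<close>)
  then show "length lam \<le> n" using n by (simp add: sum_list_triv)
qed

text \<open>The heights of the columns form the conjugate partition.\<close>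

lemma column_card:
  assumes lam: "lam \<in> partitions_of n"
  shows "i < card (column lam (Suc j)) \<longleftrightarrow> j < part lam i"
proof
  assume "i < card (column lam (Suc j))"
  then show "j < part lam i" using column_rows(3)[OF lam, of i "Suc j"] by (auto simp: part_def)
next
  assume "j < part lam i"
  then have i: "i < length lam" "Suc j \<le> lam ! i" by (auto simp: part_def split: if_splits)
  then have "i \<in> row_of lam ` column lam (Suc j)"
    using entry_props[OF i(1), of "Suc j"] by (intro image_eqI[of _ _ "entry lam i (Suc j)"]) (auto simp: column_def)
  then show "i < card (column lam (Suc j))" using column_rows(2)[OF lam] by simp
qed

lemma row_of_less:
  assumes lam: "lam \<in> partitions_of n" and "k \<in> {1..n}"
  shows "row_of lam k < n"
proof -
  have "sum_list lam = n" using lam by (simp add: partitions_of_def)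
  then have "row_of lam k < length lam" using row_of_props(1)[of k lam] assms(2) by simp
  then show ?thesis using part_le(2)[OF lam] by simp
qed

text \<open>The rows are added from the bottom, starting with the possibly empty row
  \<open>n - 1\<close>, so that the columns met by a new row include those of the earlier rows. For
  a row of length h the recurrence is (t)_(m+1-k) - (h+k) (t)_(m-k) = (t - m - h) (t)_(m-k), where k
  cancels in the factor.\<close>

lemma row_placements:
  fixes t :: "'k::comm_ring_1"
  assumes lam: "lam \<in> partitions_of n"
  shows "m \<le> n \<Longrightarrow> (\<Sum>k\<le>m. of_nat (placements (row_of lam) (col_of lam) {k \<in> {1..n}. n - m \<le> row_of lam k} k) * ((- 1) ^ k * falling t (m - k)))
    = (\<Prod>j<m. t - of_nat (j + part lam (n - 1 - j)))"
proof (induction m)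
  case 0
  have "{k \<in> {1..n}. n - 0 \<le> row_of lam k} = {}" using row_of_less[OF lam] by fastforce
  then show ?case by (simp add: placements_0 falling_def)
next
  case (Suc m)
  let ?D = "{k \<in> {1..n}. n - m \<le> row_of lam k}" and ?i = "n - 1 - m"
  let ?L = "{k \<in> {1..n}. row_of lam k = ?i}"
  have m: "m < n" using Suc.prems by simp
  have U: "{k \<in> {1..n}. n - Suc m \<le> row_of lam k} = ?D \<union> ?L" using m by auto
  have "(\<Sum>k\<le>Suc m. of_nat (placements (row_of lam) (col_of lam) (?D \<union> ?L) k) * ((- 1) ^ k * falling t (Suc m - k)))
    = (t - of_nat (m + part lam ?i)) * (\<Sum>k\<le>m. of_nat (placements (row_of lam) (col_of lam) ?D k) * ((- 1) ^ k * falling t (m - k)))"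
  proof (rule placement_sum_step)
    show "inj_on (col_of lam) ?L" by (rule row_cells(1)[OF lam])
    show "col_of lam ` ?D \<subseteq> col_of lam ` ?L"
      unfolding row_cells(2)[OF lam]
    proof (rule image_subsetI)
      fix k assume k: "k \<in> ?D"
      then have "col_of lam k \<in> {1..part lam (row_of lam k)}" using row_cells(2)[OF lam, of "row_of lam k"] by blast
      moreover have "part lam (row_of lam k) \<le> part lam ?i" by (rule part_antimono[OF lam]) (use k in auto)
      ultimately show "col_of lam k \<in> {1..part lam ?i}" by auto
    qed
    have "row_of lam ` ?D \<subseteq> {n - m..<n}" using row_of_less[OF lam] by auto
    from card_mono[OF _ this] show "card (row_of lam ` ?D) \<le> m" using m by simp
    fix k assume k: "k \<le> m"
    then have "Suc m - k = Suc (m - k)" "of_nat (m - k) = (of_nat m - of_nat k :: 'k)" by (simp_all add: Suc_diff_le of_nat_diff)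
    then show "(- 1) ^ k * falling t (Suc m - k) + of_nat (card ?L + k) * ((- 1) ^ Suc k * falling t (Suc m - Suc k))
      = (t - of_nat (m + part lam ?i)) * ((- 1) ^ k * falling t (m - k))"
      unfolding row_cells(3)[OF lam] by (simp add: falling_Suc algebra_simps)
  qed (use m in auto)
  then show ?case using Suc.IH m unfolding U by (simp add: mult.commute)
qed

lemma row_placements_full:
  fixes t :: "'k::comm_ring_1"
  assumes lam: "lam \<in> partitions_of n"
  shows "(\<Sum>k\<le>n. of_nat (placements (row_of lam) (col_of lam) {1..n} k) * ((- 1) ^ k * falling t (n - k)))
    = (\<Prod>i<n. t - of_nat (part lam i + (n - 1 - i)))"
proof -
  have "(\<Prod>j<n. t - of_nat (j + part lam (n - 1 - j))) = (\<Prod>i<n. t - of_nat (part lam i + (n - 1 - i)))"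
    by (rule prod.reindex_bij_witness[of _ "\<lambda>i. n - 1 - i" "\<lambda>i. n - 1 - i"]) (auto simp: add.commute)
  moreover have "{k \<in> {1..n}. n - n \<le> row_of lam k} = {1..n}" by auto
  ultimately show ?thesis using row_placements[OF lam le_refl, of t] by (simp only:)
qed

text \<open>The columns are added from the right. With u = t - (2n - 1 - m) and a column of height
  h, the recurrence is 1/(u)_k + (h+k)/(u)_(k+1) = (u + h)/(u (u-1)_k). The argument moves by 1 with
  every column and ends at t - n, which fits (t)_(n+k) = (t)_n (t-n)_k.\<close>

lemma column_placements:
  fixes t :: "'k::field_char_0"
  assumes lam: "lam \<in> partitions_of n" and t: "t \<notin> \<nat>"
  shows "m \<le> n \<Longrightarrow> (\<Sum>k\<le>m. of_nat (placements (col_of lam) (row_of lam) {k \<in> {1..n}. n - m < col_of lam k} k) * inverse (falling (t - of_nat (2 * n - m)) k))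
    = (\<Prod>j<m. (t - of_nat (2 * n - 1 - j) + of_nat (card (column lam (n - j)))) / (t - of_nat (2 * n - 1 - j)))"
proof (induction m)
  case 0
  have "col_of lam k \<le> n" if "k \<in> {1..n}" for k
    using row_of_props(1,4)[of k lam] that part_le(1)[OF lam, of "row_of lam k"] lam by (auto simp: partitions_of_def part_def)
  then have "{k \<in> {1..n}. n < col_of lam k} = {}" by fastforce
  then show ?case by (simp add: placements_0 falling_def)
next
  case (Suc m)
  let ?D = "{k \<in> {1..n}. n - m < col_of lam k}" and ?L = "column lam (n - m)"
  have n: "sum_list lam = n" using lam by (simp add: partitions_of_def)
  have m: "m < n" using Suc.prems by simp
  have U: "{k \<in> {1..n}. n - Suc m < col_of lam k} = ?D \<union> ?L" using m by (auto simp: column_def n)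
  define u where "u = t - of_nat (2 * n - 1 - m)"
  have u: "t - of_nat (2 * n - Suc m) = u" "t - of_nat (2 * n - m) = u - 1"
  proof -
    have "2 * n - m = Suc (2 * n - 1 - m)" using m by simp
    then show "t - of_nat (2 * n - Suc m) = u" "t - of_nat (2 * n - m) = u - 1" by (simp_all add: u_def)
  qed
  have nz: "u - of_nat k \<noteq> 0" for k
  proof
    assume "u - of_nat k = 0"
    then have "t = of_nat (2 * n - 1 - m + k)" by (simp add: u_def algebra_simps)
    then show False using t by (metis of_nat_in_Nats)
  qed
  have nz1: "falling u k \<noteq> 0" "falling (u - 1) k \<noteq> 0" for k
    using nz nz[of "Suc _"] by (auto simp: falling_def algebra_simps)
  have "(\<Sum>k\<le>Suc m. of_nat (placements (col_of lam) (row_of lam) (?D \<union> ?L) k) * inverse (falling u k))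
    = ((u + of_nat (card ?L)) / u) * (\<Sum>k\<le>m. of_nat (placements (col_of lam) (row_of lam) ?D k) * inverse (falling (u - 1) k))"
  proof (rule placement_sum_step)
    show "finite ?L" by (simp add: column_def)
    show "inj_on (row_of lam) ?L" by (rule column_rows(1)[OF lam])
    show "row_of lam ` ?D \<subseteq> row_of lam ` ?L"
      unfolding column_rows(2)[OF lam]
    proof (rule image_subsetI)
      fix k assume k: "k \<in> ?D"
      then have "k \<in> column lam (Suc (col_of lam k - 1))" by (auto simp: column_def n)
      then have "row_of lam k < card (column lam (Suc (col_of lam k - 1)))" using column_rows(2)[OF lam] by blast
      then have "col_of lam k - 1 < part lam (row_of lam k)" unfolding column_card[OF lam] .
      then have "n - m - 1 < part lam (row_of lam k)" using k by auto
      then have "row_of lam k < card (column lam (Suc (n - m - 1)))" unfolding column_card[OF lam] .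
      moreover have "Suc (n - m - 1) = n - m" using m by simp
      ultimately show "row_of lam k \<in> {..<card (column lam (n - m))}" by (simp only: lessThan_iff)
    qed
    have "col_of lam k \<le> n" if "k \<in> {1..n}" for k
      using row_of_props(1,4)[of k lam] that part_le(1)[OF lam, of "row_of lam k"] lam by (auto simp: partitions_of_def part_def)
    then have "col_of lam ` ?D \<subseteq> {n - m<..n}" by auto
    from card_mono[OF _ this] show "card (col_of lam ` ?D) \<le> m" using m by simp
    fix k
    have "falling u (Suc k) = u * falling (u - 1) k" "falling u (Suc k) = falling u k * (u - of_nat k)"
      by (rule falling_Suc_left falling_Suc)+
    then have "inverse (falling u k) = (u - of_nat k) / (u * falling (u - 1) k)" "inverse (falling u (Suc k)) = 1 / (u * falling (u - 1) k)"
      using nz1 nz by (auto simp: field_simps)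
    then have "inverse (falling u k) + of_nat (card ?L + k) * inverse (falling u (Suc k))
      = ((u - of_nat k) + of_nat (card ?L + k)) / (u * falling (u - 1) k)"
      by (simp only: add_divide_distrib[symmetric] times_divide_eq_right mult_1_right)
    then show "inverse (falling u k) + of_nat (card ?L + k) * inverse (falling u (Suc k)) = (u + of_nat (card ?L)) / u * inverse (falling (u - 1) k)"
      by (simp add: divide_inverse mult.assoc)
  qed (auto simp: column_def)
  then show ?case using Suc.IH m unfolding U u by (simp add: u_def mult.commute)
qed

lemma telescope_rows:
  fixes a :: "'k::field"
  assumes "\<And>j. j \<le> m \<Longrightarrow> a + 1 - of_nat j \<noteq> 0"
  shows "(\<Prod>j<m. (a - of_nat j + 1) / (a - of_nat j)) = (a + 1) / (a + 1 - of_nat m)"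
  using assms
proof (induction m)
  case (Suc m)
  have "a + 1 - of_nat m \<noteq> 0" "a - of_nat m \<noteq> 0" using Suc.prems[of m] Suc.prems[of "Suc m"] by simp_all
  moreover have "(\<Prod>j<m. (a - of_nat j + 1) / (a - of_nat j)) = (a + 1) / (a + 1 - of_nat m)" using Suc by simp
  ultimately show ?case by (simp add: field_simps)
qed simp

lemma telescope_columns:
  fixes a :: "'k::field"
  assumes "\<And>i. i < h \<Longrightarrow> a + of_nat i \<noteq> 0" "a \<noteq> 0"
  shows "(\<Prod>i<h. (a + of_nat i + 1) / (a + of_nat i)) = (a + of_nat h) / a"
  using assms
proof (induction h)
  case (Suc h)
  have "a + of_nat h \<noteq> 0" using Suc.prems(1)[of h] by simp
  moreover have "(\<Prod>i<h. (a + of_nat i + 1) / (a + of_nat i)) = (a + of_nat h) / a" using Suc by simp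
  ultimately show ?case by (simp add: add_ac)
qed simp

text \<open>The product over columns becomes a product over rows by way of the cells. The factor of
  column j is the telescoping product of (u - j + i + 1)/(u - j + i) over its cells (i, j), and
  along a row the same factors telescope in j. Here u = t - n, and the numerators of the row factors
  multiply to (t)_n.\<close>

lemma column_placements_full:
  fixes t :: "'k::field_char_0"
  assumes lam: "lam \<in> partitions_of n" and t: "t \<notin> \<nat>"
  shows "(\<Sum>k\<le>n. of_nat (placements (col_of lam) (row_of lam) {1..n} k) * inverse (falling t (n + k)))
    = inverse (\<Prod>i<n. t - of_nat (part lam i + (n - 1 - i)))"
proof -
  define u where "u = t - of_nat n"
  have nz: "u + of_nat i - of_nat j \<noteq> 0" if "i \<le> n" for i j
  proof
    assume "u + of_nat i - of_nat j = 0"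
    then have "t = of_nat (n + j) - of_nat i" by (simp add: u_def algebra_simps)
    also have "\<dots> = of_nat (n + j - i)" using that by (simp add: of_nat_diff)
    finally show False using t by (metis of_nat_in_Nats)
  qed
  have h: "card (column lam (Suc j)) \<le> n" for j
    using column_card[OF lam, of n j] part_le(2)[OF lam] by (auto simp: part_def)
  have D: "{k \<in> {1..n}. 0 < col_of lam k} = {1..n}"
    using row_of_props(3)[of _ lam] lam by (force simp: partitions_of_def)
  have "(\<Sum>k\<le>n. of_nat (placements (col_of lam) (row_of lam) {1..n} k) * inverse (falling u k))
    = (\<Prod>j<n. (t - of_nat (2 * n - 1 - j) + of_nat (card (column lam (n - j)))) / (t - of_nat (2 * n - 1 - j)))"
    using column_placements[OF lam t le_refl] by (simp only: D u_def diff_self_eq_0 mult_2 diff_add_inverse)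
  also have "\<dots> = (\<Prod>j<n. (u - of_nat j + of_nat (card (column lam (Suc j)))) / (u - of_nat j))"
  proof (rule prod.reindex_bij_witness[of _ "\<lambda>j. n - 1 - j" "\<lambda>j. n - 1 - j"])
    fix j assume j: "j \<in> {..<n}"
    then have "2 * n - 1 - j = n + (n - 1 - j)" "n - j = Suc (n - 1 - j)" by auto
    then have "t - of_nat (2 * n - 1 - j) = u - of_nat (n - 1 - j)" by (simp only: u_def of_nat_add diff_diff_eq)
    then show "(u - of_nat (n - 1 - j) + of_nat (card (column lam (Suc (n - 1 - j))))) / (u - of_nat (n - 1 - j)) =
       (t - of_nat (2 * n - 1 - j) + of_nat (card (column lam (n - j)))) / (t - of_nat (2 * n - 1 - j))"
      by (simp only: \<open>n - j = _\<close>)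
  qed auto
  also have "\<dots> = (\<Prod>j<n. \<Prod>i<n. if j < part lam i then (u - of_nat j + of_nat i + 1) / (u - of_nat j + of_nat i) else 1)"
  proof (intro prod.cong refl)
    fix j
    have "(u - of_nat j + of_nat (card (column lam (Suc j)))) / (u - of_nat j)
      = (\<Prod>i<card (column lam (Suc j)). (u - of_nat j + of_nat i + 1) / (u - of_nat j + of_nat i))"
      using telescope_columns[of "card (column lam (Suc j))" "u - of_nat j"] nz[of _ j] nz[of 0 j] h[of j]
      by (simp add: algebra_simps)
    also have "\<dots> = (\<Prod>i\<in>{i \<in> {..<n}. j < part lam i}. (u - of_nat j + of_nat i + 1) / (u - of_nat j + of_nat i))"
    proof -
      have "{i \<in> {..<n}. j < part lam i} = {i \<in> {..<n}. i < card (column lam (Suc j))}" by (simp only: column_card[OF lam])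
      also have "\<dots> = {..<card (column lam (Suc j))}" using h[of j] by auto
      finally show ?thesis by (simp only:)
    qed
    also have "\<dots> = (\<Prod>i<n. if j < part lam i then (u - of_nat j + of_nat i + 1) / (u - of_nat j + of_nat i) else 1)"
      by (rule prod.inter_filter) simp
    finally show "(u - of_nat j + of_nat (card (column lam (Suc j)))) / (u - of_nat j) =
      (\<Prod>i<n. if j < part lam i then (u - of_nat j + of_nat i + 1) / (u - of_nat j + of_nat i) else 1)" .
  qed
  also have "\<dots> = (\<Prod>i<n. \<Prod>j<n. if j < part lam i then (u - of_nat j + of_nat i + 1) / (u - of_nat j + of_nat i) else 1)"
    by (rule prod.swap)
  also have "\<dots> = (\<Prod>i<n. (u + of_nat i + 1) / (u + of_nat i + 1 - of_nat (part lam i)))"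
  proof (intro prod.cong refl)
    fix i assume i: "i \<in> {..<n}"
    have "(\<Prod>j<n. if j < part lam i then (u - of_nat j + of_nat i + 1) / (u - of_nat j + of_nat i) else 1)
      = (\<Prod>j\<in>{j \<in> {..<n}. j < part lam i}. (u - of_nat j + of_nat i + 1) / (u - of_nat j + of_nat i))"
      by (rule prod.inter_filter[symmetric]) simp
    also have "\<dots> = (\<Prod>j<part lam i. (u + of_nat i - of_nat j + 1) / (u + of_nat i - of_nat j))"
      by (rule prod.cong) (use part_le(1)[OF lam, of i] in \<open>auto simp: algebra_simps\<close>)
    also have "\<dots> = (u + of_nat i + 1) / (u + of_nat i + 1 - of_nat (part lam i))"
    proof (rule telescope_rows)
      fix j show "u + of_nat i + 1 - of_nat j \<noteq> 0" using nz[of "Suc i" j] i by (simp add: algebra_simps)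
    qed
    finally show "(\<Prod>j<n. if j < part lam i then (u - of_nat j + of_nat i + 1) / (u - of_nat j + of_nat i) else 1)
       = (u + of_nat i + 1) / (u + of_nat i + 1 - of_nat (part lam i))" .
  qed
  also have "\<dots> = (\<Prod>i<n. u + of_nat i + 1) / (\<Prod>i<n. u + of_nat i + 1 - of_nat (part lam i))"
    by (rule prod_dividef)
  also have "(\<Prod>i<n. u + of_nat i + 1) = falling t n"
    unfolding falling_def
    by (rule prod.reindex_bij_witness[of _ "\<lambda>i. n - 1 - i" "\<lambda>i. n - 1 - i"]) (auto simp: u_def of_nat_diff algebra_simps)
  also have "(\<Prod>i<n. u + of_nat i + 1 - of_nat (part lam i)) = (\<Prod>i<n. t - of_nat (part lam i + (n - 1 - i)))"
    by (rule prod.cong) (auto simp: u_def of_nat_diff algebra_simps)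
  finally have main: "(\<Sum>k\<le>n. of_nat (placements (col_of lam) (row_of lam) {1..n} k) * inverse (falling u k))
    = falling t n / (\<Prod>i<n. t - of_nat (part lam i + (n - 1 - i)))" .
  have "falling t n \<noteq> 0" using t by (auto simp: falling_def Nats_def)
  moreover have "(\<Sum>k\<le>n. of_nat (placements (col_of lam) (row_of lam) {1..n} k) * inverse (falling t (n + k)))
    = inverse (falling t n) * (\<Sum>k\<le>n. of_nat (placements (col_of lam) (row_of lam) {1..n} k) * inverse (falling u k))"
    by (simp add: falling_add u_def sum_distrib_left mult_ac)
  ultimately show ?thesis unfolding main by (simp add: field_simps)
qed

section \<open>Cycle types and conjugacy\<close>

text \<open>\<open>cycle_type\<close> over an arbitrary set, so that orbits can be removed in
  inductions.\<close>

definition orbit_type :: "'a set \<Rightarrow> ('a \<Rightarrow> 'a) \<Rightarrow> nat multiset" where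
  "orbit_type S s = image_mset card (mset_set (orbit s ` S))"

definition z_mset :: "nat multiset \<Rightarrow> nat" where
  "z_mset M = (\<Prod>i\<in>set_mset M. i ^ count M i * fact (count M i))"

text \<open>If \<open>k\<close> has multiplicity m, its factor k^m m! becomes k^(m+1) (m+1)!, and
  all other factors stay.\<close>

lemma z_mset_add: "z_mset (add_mset k M) = k * Suc (count M k) * z_mset M"
proof -
  let ?f = "\<lambda>M i. i ^ count M i * fact (count M i) :: nat"
  have eq: "z_mset M = ?f M k * prod (?f M) (set_mset M - {k})" for M
  proof (cases "k \<in># M")
    case True
    then show ?thesis unfolding z_mset_def by (rule prod.remove[rotated]) simp
  next
    case False
    then have "count M k = 0" by (simp add: not_in_iff)
    then show ?thesis using False unfolding z_mset_def by simp
  qed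
  have "prod (?f (add_mset k M)) (set_mset (add_mset k M) - {k}) = prod (?f M) (set_mset M - {k})"
    by (rule prod.cong) auto
  then show ?thesis unfolding eq[of "add_mset k M"] eq[of M] by (simp add: algebra_simps)
qed

lemma orbit_cycle:
  assumes "permutation s"
  shows "bij_betw (\<lambda>i. (s ^^ i) a) {..<card (orbit s a)} (orbit s a)" "(s ^^ card (orbit s a)) a = a"
    "0 < card (orbit s a)"
proof -
  have set: "set (support s a) = orbit s a"
    using support_set[OF assms, of a] orbit_altdef_permutation[OF assms, of a] by auto
  have "card (orbit s a) = least_power s a"
    using distinct_card[OF cycle_of_permutation[OF assms, of a]] unfolding set by simp
  moreover have "inj_on (\<lambda>i. (s ^^ i) a) {..<least_power s a}"
    using cycle_of_permutation[OF assms, of a] by (simp add: distinct_map atLeast0LessThan)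
  moreover have "(\<lambda>i. (s ^^ i) a) ` {..<least_power s a} = orbit s a"
    using set by (simp add: atLeast0LessThan)
  ultimately show "bij_betw (\<lambda>i. (s ^^ i) a) {..<card (orbit s a)} (orbit s a)"
    "(s ^^ card (orbit s a)) a = a" "0 < card (orbit s a)"
    using least_power_of_permutation[OF assms, of a] by (simp_all add: bij_betw_def)
qed

lemma orbit_eq_iff:
  assumes "permutation s"
  shows "orbit s x = orbit s y \<longleftrightarrow> y \<in> orbit s x"
  using permutation_self_in_orbit[OF assms] orbit_cyclic_eq3[OF cyclic_on_orbit'[OF assms]] by metis

lemma card_points_on_orbits:
  assumes "s permutes S" "finite S"
  shows "card {b \<in> S. card (orbit s b) = k} = k * count (orbit_type S s) k"
proof -
  have s: "permutation s" using assms permutation_permutes by blast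
  have "{b \<in> S. card (orbit s b) = k} = \<Union>{Q \<in> orbit s ` S. card Q = k}"
  proof (intro equalityI subsetI)
    fix x assume "x \<in> {b \<in> S. card (orbit s b) = k}"
    then show "x \<in> \<Union>{Q \<in> orbit s ` S. card Q = k}" using permutation_self_in_orbit[OF s, of x] by auto
  next
    fix x assume "x \<in> \<Union>{Q \<in> orbit s ` S. card Q = k}"
    then obtain b where b: "b \<in> S" "x \<in> orbit s b" "card (orbit s b) = k" by auto
    then have "x \<in> S" using permutes_orbit_subset[OF assms(1)] by blast
    moreover have "orbit s b = orbit s x" using b(2) orbit_eq_iff[OF s] by simp
    ultimately show "x \<in> {b \<in> S. card (orbit s b) = k}" using b(3) by simp
  qed
  moreover have "card (\<Union>{Q \<in> orbit s ` S. card Q = k}) = (\<Sum>Q\<in>{Q \<in> orbit s ` S. card Q = k}. card Q)"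
  proof (rule card_Union_disjoint)
    show "pairwise disjnt {Q \<in> orbit s ` S. card Q = k}"
      using orbit_eq_iff[OF s] unfolding pairwise_def disjnt_def by blast
  qed (use permutes_orbit_subset[OF assms(1)] finite_subset[OF _ assms(2)] in auto)
  moreover have "count (orbit_type S s) k = card {Q \<in> orbit s ` S. card Q = k}"
    using assms(2) by (simp add: orbit_type_def count_image_mset' count_mset_set' sum.If_cases Int_def conj_commute eq_commute[of k])
  ultimately show ?thesis by simp
qed

lemma orbit_type_image:
  assumes s: "\<And>x. x \<in> S \<Longrightarrow> orbit s x \<subseteq> S \<and> x \<in> orbit s x" and w: "inj_on w S" "\<And>x. x \<in> S \<Longrightarrow> w (s x) = s' (w x)"
  shows "orbit_type (w ` S) s' = orbit_type S s"
proof -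
  have orb: "w ` orbit s x = orbit s' (w x)" if "x \<in> S" for x
    by (rule orbit_inverse) (use s[OF that] w(2) in auto)
  have "orbit s' ` (w ` S) = (`) w ` (orbit s ` S)" using orb by (auto simp: image_iff)
  moreover have "inj_on ((`) w) (orbit s ` S)"
    by (rule inj_on_subset[OF inj_on_image_Pow[OF w(1)]]) (use s in auto)
  moreover have "card (w ` A) = card A" if "A \<in> orbit s ` S" for A
    by (rule card_image, rule inj_on_subset[OF w(1)]) (use that s in auto)
  ultimately show ?thesis
    by (auto simp: orbit_type_def image_mset_mset_set[symmetric] multiset.map_comp intro!: image_mset_cong)
     (metis (no_types, lifting) elem_mset_set infinite_set_mset_mset_set empty_iff)
qed

lemma orbit_type_remove:
  assumes "s permutes S" "finite S" "a \<in> S"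
  shows "orbit_type S s = add_mset (card (orbit s a)) (orbit_type (S - orbit s a) (perm_restrict s (S - orbit s a)))"
proof -
  let ?O = "orbit s a" and ?r = "perm_restrict s (S - orbit s a)"
  have s: "permutation s" using assms permutation_permutes by blast
  have "orbit s x \<inter> ?O = {}" if "x \<notin> ?O" for x
    using that orbit_eq_iff[OF s] by blast
  then have sub: "orbit s x \<subseteq> S - ?O" if "x \<in> S - ?O" for x
    using that permutes_orbit_subset[OF assms(1), of x] by blast
  have "orbit ?r x = orbit s x" if "x \<in> S - ?O" for x
    by (rule orbit_cong[OF permutation_self_in_orbit[OF s]]) (use sub[OF that] in \<open>auto simp: perm_restrict_def\<close>)
  then have "orbit ?r ` (S - ?O) = orbit s ` (S - ?O)" by (rule image_cong[OF refl])
  moreover have "orbit s ` S = insert ?O (orbit s ` (S - ?O))"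
    using orbit_eq_iff[OF s, of a] assms(3) by auto
  moreover have "?O \<notin> orbit s ` (S - ?O)" using permutation_self_in_orbit[OF s] by auto
  ultimately show ?thesis using assms(2) by (simp add: orbit_type_def)
qed

lemma cycle_of_list_nth:
  assumes "distinct cs" "i < length cs"
  shows "cycle_of_list cs (cs ! i) = cs ! (Suc i mod length cs)"
proof -
  have "map (cycle_of_list cs) cs ! i = rotate1 cs ! i" using cyclic_rotation[OF assms(1), of 1] by simp
  then show ?thesis using assms(2) by (simp add: nth_rotate1)
qed

lemma sign_cycle_of_list: "distinct cs \<Longrightarrow> sign (cycle_of_list cs) = (- 1) ^ (length cs - 1)"
  by (induction cs rule: cycle_of_list.induct)
    (simp_all add: sign_compose permutation_swap_id permutation_of_cycle sign_swap_id)

lemma orbit_add_cycle: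
  assumes "p permutes I" "distinct cs" "set cs \<inter> I = {}" "x \<in> set cs"
  shows "orbit (cycle_of_list cs \<circ> p) x = set cs"
proof -
  let ?s = "cycle_of_list cs \<circ> p"
  have step: "?s (cs ! i) = cs ! (Suc i mod length cs)" if "i < length cs" for i
  proof -
    have "p (cs ! i) = cs ! i" using assms(1,3) that by (metis IntI empty_iff nth_mem permutes_not_in)
    then show ?thesis using cycle_of_list_nth[OF assms(2) that] by simp
  qed
  obtain j where j: "j < length cs" "x = cs ! j" using assms(4) by (metis in_set_conv_nth)
  have pow: "(?s ^^ i) x = cs ! ((j + i) mod length cs)" for i
  proof (induction i)
    case (Suc i)
    have "(j + i) mod length cs < length cs" by (rule mod_less_divisor) (use j in auto)
    then show ?case using Suc step[of "(j + i) mod length cs"] by (simp add: mod_Suc_eq)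
  qed (use j in simp)
  have "(?s ^^ length cs) x = x" using pow[of "length cs"] j by simp
  moreover have "0 < length cs" using j by auto
  ultimately have "orbit ?s x = {(?s ^^ m) x |m. m < length cs}" by (rule orbit_altdef_bounded)
  also have "\<dots> = {cs ! ((j + m) mod length cs) |m. m < length cs}" unfolding pow ..
  also have "\<dots> = set cs"
  proof (intro equalityI subsetI)
    fix y assume "y \<in> set cs"
    then obtain i where i: "i < length cs" "y = cs ! i" by (metis in_set_conv_nth)
    have "(j + (length cs - j + i) mod length cs) mod length cs = i"
      using i j by (simp add: mod_add_right_eq)
    then show "y \<in> {cs ! ((j + m) mod length cs) |m. m < length cs}"
      using i(2) \<open>0 < length cs\<close> by (metis (mono_tags, lifting) mem_Collect_eq mod_less_divisor)
  qed (use \<open>0 < length cs\<close> in auto)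
  finally show ?thesis .
qed

lemma permutes_add_cycle:
  assumes "p permutes I"
  shows "cycle_of_list cs \<circ> p permutes set cs \<union> I"
  using permutes_subset[OF assms, of "set cs \<union> I"] permutes_subset[OF cycle_permutes[of cs], of "set cs \<union> I"]
  by (auto intro: permutes_compose)

lemma orbit_type_add_cycle:
  assumes p: "p permutes I" "finite I" and cs: "distinct cs" "set cs \<inter> I = {}" "cs \<noteq> []"
  shows "orbit_type (set cs \<union> I) (cycle_of_list cs \<circ> p) = add_mset (length cs) (orbit_type I p)"
proof -
  let ?s = "cycle_of_list cs \<circ> p"
  have hd: "hd cs \<in> set cs" using cs(3) by simp
  have orb: "orbit ?s (hd cs) = set cs" by (rule orbit_add_cycle[OF p(1) cs(1,2) hd])
  have "perm_restrict ?s I = p"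
  proof
    fix x
    show "perm_restrict ?s I x = p x"
    proof (cases "x \<in> I")
      case True
      then have "p x \<notin> set cs" using permutes_in_image[OF p(1)] cs(2) by blast
      then show ?thesis using True by (simp add: perm_restrict_def id_outside_supp)
    qed (use p(1) in \<open>simp add: perm_restrict_def permutes_not_in\<close>)
  qed
  moreover have "set cs \<union> I - set cs = I" using cs(2) by blast
  ultimately show ?thesis
    using orbit_type_remove[OF permutes_add_cycle[OF p(1), of cs], of "hd cs"] p(2) hd orb distinct_card[OF cs(1)] by simp
qed

text \<open>Decomposition into disjoint cycles as an induction rule. Empty cycles are excluded, so
  that each step adds exactly one orbit, possibly a fixed point.\<close>

lemma cycle_decomp_induct [consumes 2, case_names empty cycle]:
  assumes "s permutes S" "finite S"
    and "P {} id"
    and "\<And>I p cs. p permutes I \<Longrightarrow> finite I \<Longrightarrow> P I p \<Longrightarrow> distinct cs \<Longrightarrow> set cs \<inter> I = {} \<Longrightarrow> cs \<noteq> [] \<Longrightarrow>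
      P (set cs \<union> I) (cycle_of_list cs \<circ> p)"
  shows "P S s"
proof -
  have "cycle_decomp S s \<Longrightarrow> s permutes S \<and> finite S \<and> P S s"
  proof (induction rule: cycle_decomp.induct)
    case (comp I p cs)
    then have "p permutes I" "finite I" "P I p" by blast+
    note step = assms(4)[OF this comp(2,3)] permutes_add_cycle[OF this(1), of cs]
    show ?case
    proof (cases "cs = []")
      case True
      then show ?thesis using \<open>p permutes I\<close> \<open>finite I\<close> \<open>P I p\<close> by (simp add: fun.map_id0)
    next
      case False
      then show ?thesis using step \<open>finite I\<close> by blast
    qed
  next
    case empty
    show ?case using assms(3) by (simp only: permutes_empty) simp
  qed
  then show ?thesis using cycle_decomposition[OF assms(1,2)] by blast
qed

text \<open>A cycle of length k + 1 has sign (-1)^k, so its length and its sign together contribute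
  (-1)^(2k+1) = -1, as one orbit should. The other two facts say that the type is a partition of
  \<open>card S\<close>.\<close>

lemma sign_orbit_type:
  assumes "s permutes S" "finite S"
  shows "(- 1) ^ size (orbit_type S s) = (- 1) ^ card S * (sign s :: int)"
    and "sum_mset (orbit_type S s) = card S" "0 \<notin># orbit_type S s"
proof -
  have "(- 1) ^ size (orbit_type S s) = (- 1) ^ card S * (sign s :: int) \<and> sum_mset (orbit_type S s) = card S \<and> 0 \<notin># orbit_type S s"
    using assms
  proof (induction rule: cycle_decomp_induct)
    case (cycle I p cs)
    obtain k where k: "length cs = Suc k" using cycle.hyps(5) by (cases cs) auto
    have "permutation p" using cycle(1,2) permutation_permutes by blast
    then have sgn: "sign (cycle_of_list cs \<circ> p) = (- 1) ^ k * sign p"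
      by (simp add: sign_compose permutation_of_cycle sign_cycle_of_list cycle.hyps(3) k)
    have card: "card (set cs \<union> I) = Suc (k + card I)"
      using cycle by (simp add: card_Un_disjoint distinct_card k)
    note type = orbit_type_add_cycle[OF cycle.hyps]
    have "(- 1) ^ size (orbit_type (set cs \<union> I) (cycle_of_list cs \<circ> p)) = - ((- 1) ^ card I * (sign p :: int))"
      unfolding type using cycle.IH by simp
    also have "\<dots> = (- 1) ^ Suc (k + card I) * ((- 1) ^ k * sign p)"
      by (cases "even k") (simp_all add: power_add)
    finally have "(- 1) ^ size (orbit_type (set cs \<union> I) (cycle_of_list cs \<circ> p))
      = (- 1) ^ card (set cs \<union> I) * (sign (cycle_of_list cs \<circ> p) :: int)"
      unfolding card sgn .
    moreover have "sum_mset (orbit_type (set cs \<union> I) (cycle_of_list cs \<circ> p)) = card (set cs \<union> I)"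
      "0 \<notin># orbit_type (set cs \<union> I) (cycle_of_list cs \<circ> p)"
      unfolding card type using cycle.IH k by simp_all
    ultimately show ?case by blast
  qed (simp add: orbit_type_def)
  then show "(- 1) ^ size (orbit_type S s) = (- 1) ^ card S * (sign s :: int)"
    "sum_mset (orbit_type S s) = card S" "0 \<notin># orbit_type S s" by auto
qed

text \<open>The bijections that conjugate \<open>s\<close> into \<open>s'\<close>. Two sets occur
  since removing a cycle on both sides leaves different sets; \<open>extensional\<close> keeps the
  number of functions finite.\<close>

definition intertwiners :: "'a set \<Rightarrow> ('a \<Rightarrow> 'a) \<Rightarrow> 'b set \<Rightarrow> ('b \<Rightarrow> 'b) \<Rightarrow> ('a \<Rightarrow> 'b) set" where
  "intertwiners S s S' s' = {w \<in> extensional S. bij_betw w S S' \<and> (\<forall>x\<in>S. w (s x) = s' (w x))}"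

text \<open>Once the image \<open>b\<close> of the first element is chosen, the cycle has to follow
  the orbit of \<open>b\<close>; what remains is an intertwiner of the complements.\<close>

lemma intertwiners_add_cycle:
  assumes p: "p permutes I" "finite I" and cs: "distinct cs" "set cs \<inter> I = {}" "cs \<noteq> []"
    and s': "s' permutes S'" "finite S'" and b: "b \<in> S'" "card (orbit s' b) = length cs"
  shows "bij_betw (\<lambda>w. restrict w I) {w \<in> intertwiners (set cs \<union> I) (cycle_of_list cs \<circ> p) S' s'. w (hd cs) = b}
    (intertwiners I p (S' - orbit s' b) (perm_restrict s' (S' - orbit s' b)))"
    (is "bij_betw ?R ?A ?B")
proof -
  let ?s = "cycle_of_list cs \<circ> p" and ?Q = "orbit s' b"
  define k where "k = length cs"
  have k: "0 < k" using cs(3) by (simp add: k_def)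
  have perm: "permutation s'" using s' permutation_permutes by blast
  have pow: "bij_betw (\<lambda>i. (s' ^^ i) b) {..<k} ?Q" "(s' ^^ k) b = b"
    using orbit_cycle[OF perm, of b] b(2) by (simp_all add: k_def)
  have sp: "?s x = p x" if "x \<in> I" for x
  proof -
    have "p x \<notin> set cs" using permutes_in_image[OF p(1)] that cs(2) by blast
    then show ?thesis by (simp add: id_outside_supp)
  qed
  have sc: "?s (cs ! i) = cs ! (Suc i mod k)" if "i < k" for i
  proof -
    have "p (cs ! i) = cs ! i" using p(1) cs(2) that by (metis IntI empty_iff k_def nth_mem permutes_not_in)
    then show ?thesis using cycle_of_list_nth[OF cs(1)] that by (simp add: k_def)
  qed
  have pQ: "S' - ?Q \<subseteq> S'" "?Q \<subseteq> S'" using permutes_orbit_subset[OF s'(1) b(1)] by auto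
  have on_cs: "w (cs ! i) = (s' ^^ i) b" if w: "w \<in> ?A" and "i < k" for w i
    using that(2)
  proof (induction i)
    case 0
    then show ?case using w cs(3) by (simp add: hd_conv_nth)
  next
    case (Suc i)
    then have "cs ! i \<in> set cs \<union> I" by (simp add: k_def)
    then have "w (?s (cs ! i)) = s' (w (cs ! i))" using w by (simp only: intertwiners_def mem_Collect_eq)
    then show ?case using Suc sc[of i] by simp
  qed
  \<comment> \<open>The forced values: the i-th element of the cycle goes to the i-th iterate of
    \<open>s'\<close> at \<open>b\<close>.\<close>
  define g where "g x = (s' ^^ (THE i. i < k \<and> cs ! i = x)) b" for x
  have g: "g (cs ! i) = (s' ^^ i) b" if "i < k" for i
  proof -
    have "(THE j. j < k \<and> cs ! j = cs ! i) = i"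
      using that cs(1) by (intro the_equality) (auto simp: k_def nth_eq_iff_index_eq)
    then show ?thesis by (simp add: g_def)
  qed
  have nth: "\<exists>i<k. x = cs ! i" if "x \<in> set cs" for x using that by (metis in_set_conv_nth k_def)
  have gA: "w x = g x" if "w \<in> ?A" "x \<in> set cs" for w x
    using nth[OF that(2)] on_cs[OF that(1)] g by auto
  have csk: "bij_betw ((!) cs) {..<k} (set cs)" using cs(1) by (simp add: bij_betw_nth k_def)
  have gQ: "bij_betw g (set cs) ?Q"
  proof -
    have "bij_betw (g \<circ> (!) cs) {..<k} ?Q" using pow(1) by (rule bij_betw_cong[THEN iffD1, rotated]) (simp add: g)
    then show ?thesis using bij_betw_comp_iff[OF csk] by blast
  qed
  have gs: "g (?s x) = s' (g x)" if "x \<in> set cs" for x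
  proof -
    obtain i where i: "i < k" "x = cs ! i" using nth \<open>x \<in> set cs\<close> by blast
    have "g (?s x) = (s' ^^ (Suc i mod k)) b" unfolding i(2) sc[OF i(1)] by (rule g) (use k in simp)
    also have "\<dots> = (s' ^^ Suc i) b"
    proof (cases "Suc i = k")
      case True
      then show ?thesis using pow(2) by (simp del: funpow.simps)
    next
      case False
      then show ?thesis using i(1) by simp
    qed
    finally show ?thesis using g[OF i(1)] i(2) by simp
  qed
  have "inj_on ?R ?A"
  proof (rule inj_onI)
    fix w w' assume w: "w \<in> ?A" "w' \<in> ?A" and eq: "?R w = ?R w'"
    show "w = w'"
    proof (rule extensionalityI[of _ "set cs \<union> I"])
      fix x assume "x \<in> set cs \<union> I"
      then show "w x = w' x"
        using gA[OF w(1), of x] gA[OF w(2), of x] fun_cong[OF eq, of x] by (cases "x \<in> set cs") auto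
    qed (use w in \<open>simp_all add: intertwiners_def\<close>)
  qed
  moreover have "?R w \<in> ?B" if w: "w \<in> ?A" for w
  proof -
    have bij: "bij_betw w (set cs \<union> I) S'" and com: "\<And>x. x \<in> set cs \<union> I \<Longrightarrow> w (?s x) = s' (w x)"
      using w by (auto simp only: intertwiners_def mem_Collect_eq)
    have "w ` set cs = ?Q" using gA[OF w] gQ by (auto simp: bij_betw_def image_iff)
    moreover have "I = (set cs \<union> I) - set cs" using cs(2) by blast
    ultimately have "w ` I = S' - ?Q"
      using bij inj_on_image_set_diff[of w "set cs \<union> I" "set cs \<union> I" "set cs"] by (auto simp: bij_betw_def)
    then have wI: "bij_betw w I (S' - ?Q)" using bij by (auto simp: bij_betw_def inj_on_Un)
    moreover have "w (p x) = perm_restrict s' (S' - ?Q) (w x)" if "x \<in> I" for x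
      using com[of x] sp[OF that] that bij_betwE[OF wI] by (simp add: perm_restrict_def)
    ultimately show ?thesis
      using permutes_in_image[OF p(1)] by (simp add: intertwiners_def cong: bij_betw_cong)
  qed
  moreover have "\<exists>w\<in>?A. ?R w = v" if v: "v \<in> ?B" for v
  proof -
    define w where "w x = (if x \<in> set cs then g x else v x)" for x
    have ext: "v x = undefined" if "x \<notin> I" for x using v that by (auto simp: intertwiners_def extensional_def)
    have bv: "bij_betw v I (S' - ?Q)" using v by (simp add: intertwiners_def)
    have cv: "v (p x) = s' (v x)" if "x \<in> I" for x
      using v that bij_betwE[OF bv] by (simp add: intertwiners_def perm_restrict_def)
    have wcs: "w x = g x" if "x \<in> set cs" for x using that by (simp add: w_def)
    have wI: "w x = v x" if "x \<in> I" for x using that cs(2) by (auto simp: w_def)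
    have "bij_betw w (set cs) ?Q" using gQ wcs by (simp cong: bij_betw_cong)
    moreover have "bij_betw w I (S' - ?Q)" using bv wI by (simp cong: bij_betw_cong)
    ultimately have "bij_betw w (set cs \<union> I) (?Q \<union> (S' - ?Q))" by (rule bij_betw_combine) blast
    then have "bij_betw w (set cs \<union> I) S'" using pQ by (simp add: Un_absorb1 Un_Diff_cancel)
    moreover have "w \<in> extensional (set cs \<union> I)" using ext by (simp add: extensional_def w_def)
    moreover have "w (?s x) = s' (w x)" if "x \<in> set cs \<union> I" for x
    proof (cases "x \<in> set cs")
      case True
      then obtain i where i: "i < k" "x = cs ! i" using nth by blast
      then have "?s x \<in> set cs" using sc k by (simp add: k_def)
      then show ?thesis using gs[OF True] wcs True by simp
    next
      case False
      then have x: "x \<in> I" using that by blast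
      then have "p x \<in> I" using permutes_in_image[OF p(1)] by blast
      then show ?thesis using x sp[OF x] cv[OF x] wI by simp
    qed
    moreover have "w (hd cs) = b" using g[OF k] cs(3) by (simp add: w_def hd_conv_nth)
    ultimately have "w \<in> ?A" by (simp only: intertwiners_def mem_Collect_eq) blast
    moreover have "?R w = v"
      by (rule extensionalityI[of _ I]) (use ext wI in \<open>auto simp: extensional_def\<close>)
    ultimately show ?thesis by blast
  qed
  ultimately show ?thesis unfolding bij_betw_def by blast
qed

lemma card_intertwiners_empty: "card (intertwiners {} (id :: 'a \<Rightarrow> 'a) {} s') = z_mset (orbit_type {} (id :: 'a \<Rightarrow> 'a))"
proof -
  have "intertwiners {} (id :: 'a \<Rightarrow> 'a) {} s' = {\<lambda>_. undefined}" by (auto simp: intertwiners_def bij_betw_def)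
  then show ?thesis by (simp add: z_mset_def orbit_type_def)
qed

text \<open>The first element of a cycle of length k can go to any point on an orbit of length k,
  and there are k times the multiplicity of k of these. This is the factor by which
  \<open>z_mset\<close> grows when the part is added.\<close>

lemma card_intertwiners:
  assumes "s permutes S" "finite S" "s' permutes S'" "finite S'" "orbit_type S s = orbit_type S' s'"
  shows "card (intertwiners S s S' s') = z_mset (orbit_type S s)"
  using assms
proof (induction arbitrary: S' s' rule: cycle_decomp_induct)
  case empty
  then have "orbit_type S' s' = {#}" by (simp add: orbit_type_def)
  then have "card S' = 0" using sign_orbit_type(2)[OF empty(1,2)] by simp
  then have "S' = {}" using empty(2) by simp
  then show ?case using card_intertwiners_empty[of s'] by blast
next
  case (cycle I p cs)
  let ?s = "cycle_of_list cs \<circ> p" and ?S = "set cs \<union> I" and ?k = "length cs"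
  let ?A = "intertwiners ?S ?s S' s'" and ?B = "{b \<in> S'. card (orbit s' b) = ?k}"
  note s' = cycle.prems(1,2)
  have type: "orbit_type S' s' = add_mset ?k (orbit_type I p)"
    unfolding cycle.prems(3)[symmetric] by (rule orbit_type_add_cycle[OF cycle.hyps])
  have hd: "hd cs \<in> set cs" using cycle.hyps(5) by simp
  have "w (hd cs) \<in> ?B" if w: "w \<in> ?A" for w
  proof -
    have bij: "bij_betw w ?S S'" and com: "\<And>x. x \<in> ?S \<Longrightarrow> s' (w x) = w (?s x)"
      using w by (auto simp only: intertwiners_def mem_Collect_eq)
    have orb: "orbit ?s (hd cs) = set cs" by (rule orbit_add_cycle[OF cycle.hyps(1,3,4) hd])
    have "w ` orbit ?s (hd cs) = orbit s' (w (hd cs))"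
      by (rule orbit_inverse) (use orb hd com in auto)
    moreover have "card (w ` set cs) = ?k"
      using bij distinct_card[OF cycle.hyps(3)] by (auto simp: bij_betw_def inj_on_Un card_image)
    ultimately show ?thesis using bij_betwE[OF bij] hd orb by auto
  qed
  then have "card ?A = card (\<Union>b\<in>?B. {w \<in> ?A. w (hd cs) = b})" by (intro arg_cong[where f = card]) blast
  also have "\<dots> = (\<Sum>b\<in>?B. card {w \<in> ?A. w (hd cs) = b})"
  proof (rule card_UN_disjoint)
    have "?A \<subseteq> ?S \<rightarrow>\<^sub>E S'" by (auto simp: intertwiners_def bij_betw_def PiE_def)
    then have "finite ?A" using finite_subset finite_PiE cycle.hyps(2) s'(2) by (metis (mono_tags) List.finite_set finite_UnI)
    then show "\<forall>b\<in>?B. finite {w \<in> ?A. w (hd cs) = b}" by simp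
  qed (use s' in auto)
  also have "\<dots> = (\<Sum>b\<in>?B. z_mset (orbit_type I p))"
  proof (rule sum.cong[OF refl])
    fix b assume "b \<in> ?B"
    then have b: "b \<in> S'" "card (orbit s' b) = ?k" by auto
    let ?T = "S' - orbit s' b"
    have "perm_restrict s' ?T permutes ?T"
      by (rule perm_restrict_diff_cyclic[OF s'(1) cyclic_on_orbit[OF s']])
    moreover have "orbit_type I p = orbit_type ?T (perm_restrict s' ?T)"
      using orbit_type_remove[OF s' b(1)] type b(2) by simp
    ultimately have "card (intertwiners I p ?T (perm_restrict s' ?T)) = z_mset (orbit_type I p)"
      using cycle.IH[of "perm_restrict s' ?T" ?T] s'(2) by simp
    then show "card {w \<in> ?A. w (hd cs) = b} = z_mset (orbit_type I p)"
      using bij_betw_same_card[OF intertwiners_add_cycle[OF cycle.hyps s' b]] by simp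
  qed
  also have "\<dots> = ?k * count (orbit_type S' s') ?k * z_mset (orbit_type I p)"
    using card_points_on_orbits[OF s', of ?k] by simp
  also have "\<dots> = z_mset (orbit_type S' s')" unfolding type by (simp add: z_mset_add)
  finally show ?case unfolding cycle.prems(3) .
qed

lemma exists_orbit_type:
  assumes "0 \<notin> set mu"
  shows "\<exists>s. s permutes {1..sum_list mu} \<and> orbit_type {1..sum_list mu} s = mset mu"
  using assms
proof (induction mu)
  case Nil
  have "orbit_type {} id = {#}" by (simp add: orbit_type_def)
  moreover have "{1..sum_list ([] :: nat list)} = {}" by simp
  ultimately show ?case unfolding mset.simps by (metis permutes_id)
next
  case (Cons k mu)
  let ?m = "sum_list mu"
  obtain s where s: "s permutes {1..?m}" "orbit_type {1..?m} s = mset mu" using Cons by auto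
  let ?cs = "[Suc ?m..<Suc (?m + k)]"
  have S: "set ?cs \<union> {1..?m} = {1..sum_list (k # mu)}" by auto
  have len: "length ?cs = k" by simp
  have "orbit_type (set ?cs \<union> {1..?m}) (cycle_of_list ?cs \<circ> s) = add_mset (length ?cs) (orbit_type {1..?m} s)"
    by (rule orbit_type_add_cycle[OF s(1)]) (use Cons.prems in auto)
  then show ?case using permutes_add_cycle[OF s(1), of ?cs] unfolding S len s(2) mset.simps by blast
qed

section \<open>Conjugacy classes of the symmetric group\<close>

lemma cycle_type_orbit_type: "cycle_type n s = orbit_type {1..n} s"
  by (simp add: cycle_type_def orbit_type_def)

lemma z_part_mset: "z_part mu = z_mset (mset mu)"
  by (simp add: z_part_def z_mset_def count_mset count_list_eq_length_filter)

lemma cycle_type_conj: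
  assumes "w \<in> perms n" "s \<in> perms n"
  shows "cycle_type n (w \<circ> (s \<circ> inv w)) = cycle_type n s"
proof -
  have w: "w permutes {1..n}" and s: "s permutes {1..n}" using assms by (simp_all add: perms_def)
  have "permutation s" using s permutation_permutes by blast
  have "orbit_type (w ` {1..n}) (w \<circ> (s \<circ> inv w)) = orbit_type {1..n} s"
  proof (rule orbit_type_image)
    fix x assume "x \<in> {1..n}"
    then show "orbit s x \<subseteq> {1..n} \<and> x \<in> orbit s x"
      using permutes_orbit_subset[OF s] permutation_self_in_orbit[OF \<open>permutation s\<close>] by blast
    show "w (s x) = (w \<circ> (s \<circ> inv w)) (w x)" by (simp add: permutes_inverses(2)[OF w])
  qed (rule permutes_inj_on[OF w])
  then show ?thesis unfolding permutes_image[OF w] cycle_type_orbit_type .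
qed

lemma card_conjugators:
  assumes s: "s \<in> perms n" "s' \<in> perms n" and type: "cycle_type n s = cycle_type n s'"
  shows "card {w \<in> perms n. w \<circ> s = s' \<circ> w} = z_mset (cycle_type n s)"
proof -
  let ?S = "{1..n}"
  have p: "s permutes ?S" "s' permutes ?S" using s by (simp_all add: perms_def)
  have "bij_betw (\<lambda>w. restrict w ?S) {w \<in> perms n. w \<circ> s = s' \<circ> w} (intertwiners ?S s ?S s')"
  proof (rule bij_betw_byWitness[where f' = "\<lambda>v x. if x \<in> ?S then v x else x"])
    show "\<forall>w\<in>{w \<in> perms n. w \<circ> s = s' \<circ> w}. (\<lambda>x. if x \<in> ?S then restrict w ?S x else x) = w"
      by (auto simp: perms_def fun_eq_iff permutes_not_in)
    show "\<forall>v\<in>intertwiners ?S s ?S s'. restrict (\<lambda>x. if x \<in> ?S then v x else x) ?S = v"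
      by (auto simp: intertwiners_def fun_eq_iff extensional_def)
    show "(\<lambda>w. restrict w ?S) ` {w \<in> perms n. w \<circ> s = s' \<circ> w} \<subseteq> intertwiners ?S s ?S s'"
    proof (rule image_subsetI)
      fix w assume "w \<in> {w \<in> perms n. w \<circ> s = s' \<circ> w}"
      then have w: "w permutes ?S" and com: "w (s x) = s' (w x)" for x by (auto simp: perms_def dest: fun_cong)
      have "bij_betw (restrict w ?S) ?S ?S" using permutes_imp_bij[OF w] by simp
      moreover have "s x \<in> ?S" if "x \<in> ?S" for x using permutes_in_image[OF p(1)] that by blast
      ultimately show "restrict w ?S \<in> intertwiners ?S s ?S s'" using com by (simp add: intertwiners_def)
    qed
    show "(\<lambda>v x. if x \<in> ?S then v x else x) ` intertwiners ?S s ?S s' \<subseteq> {w \<in> perms n. w \<circ> s = s' \<circ> w}"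
    proof (rule image_subsetI)
      fix v assume v: "v \<in> intertwiners ?S s ?S s'"
      let ?w = "\<lambda>x. if x \<in> ?S then v x else x"
      have bv: "bij_betw v ?S ?S" and com: "\<And>x. x \<in> ?S \<Longrightarrow> v (s x) = s' (v x)"
        using v by (auto simp: intertwiners_def)
      have "bij_betw ?w ?S ?S" using bv by (rule bij_betw_cong[THEN iffD1, rotated]) simp
      then have "?w permutes ?S" by (rule bij_imp_permutes) auto
      moreover have "?w (s x) = s' (?w x)" for x
      proof (cases "x \<in> ?S")
        case True
        then have "s x \<in> ?S" using permutes_in_image[OF p(1)] by blast
        then show ?thesis using True com[OF True] by simp
      next
        case False
        have "s x = x" "s' x = x" using permutes_not_in[OF p(1) False] permutes_not_in[OF p(2) False] by auto
        then show ?thesis using False by (simp only: if_False)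
      qed
      ultimately show "?w \<in> {w \<in> perms n. w \<circ> s = s' \<circ> w}" by (simp add: perms_def fun_eq_iff)
    qed
  qed
  from bij_betw_same_card[OF this] show ?thesis
    using card_intertwiners[OF p(1) _ p(2)] type by (simp add: cycle_type_orbit_type)
qed

lemma z_mset_pos: "0 \<notin># M \<Longrightarrow> 0 < z_mset M"
  unfolding z_mset_def by (rule prod_pos) (metis gr0I nat_0_less_mult_iff fact_gt_zero zero_less_power)

text \<open>The number of conjugating permutations is a value of \<open>z_mset\<close> and hence
  positive.\<close>

lemma cycle_type_conjugate:
  assumes s: "s \<in> perms n" "s' \<in> perms n" and type: "cycle_type n s = cycle_type n s'"
  obtains w where "w \<in> perms n" "s = inv w \<circ> (s' \<circ> w)"
proof -
  have "0 \<notin># cycle_type n s" using sign_orbit_type(3)[of s "{1..n}"] s by (simp add: perms_def cycle_type_orbit_type)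
  then have "card {w \<in> perms n. w \<circ> s = s' \<circ> w} \<noteq> 0"
    unfolding card_conjugators[OF assms] using z_mset_pos by blast
  then have "{w \<in> perms n. w \<circ> s = s' \<circ> w} \<noteq> {}" by (metis card.empty)
  then obtain w where w: "w \<in> perms n" "w \<circ> s = s' \<circ> w" by blast
  then have "s = inv w \<circ> (s' \<circ> w)" using perms_cancel(1)[OF w(1), of s] by simp
  then show thesis using that w(1) by blast
qed

text \<open>The permutations are sorted by the conjugate of \<open>s0\<close> that they produce;
  each conjugate arises from \<open>z_mset\<close> of them.\<close>

lemma card_class:
  assumes s0: "s0 \<in> perms n"
  shows "card {s \<in> perms n. cycle_type n s = cycle_type n s0} * z_mset (cycle_type n s0) = fact n"
proof -
  let ?C = "{s \<in> perms n. cycle_type n s = cycle_type n s0}"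
  have "fact n = card (perms n)" unfolding perms_def by (simp add: card_permutations)
  also have "perms n = (\<Union>s\<in>?C. {w \<in> perms n. w \<circ> s0 = s \<circ> w})"
  proof (intro equalityI subsetI)
    fix w assume w: "w \<in> perms n"
    let ?s = "w \<circ> (s0 \<circ> inv w)"
    have "?s \<in> ?C" using cycle_type_conj[OF w s0] perms_comp[OF w perms_comp[OF s0 perms_inv[OF w]]] by simp
    moreover have "w \<circ> s0 = ?s \<circ> w" using perms_inv_o(1)[OF w] by (simp add: o_assoc[symmetric])
    ultimately show "w \<in> (\<Union>s\<in>?C. {w \<in> perms n. w \<circ> s0 = s \<circ> w})" using w by blast
  qed blast
  also have "card \<dots> = (\<Sum>s\<in>?C. card {w \<in> perms n. w \<circ> s0 = s \<circ> w})"
  proof (rule card_UN_disjoint)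
    show "\<forall>s\<in>?C. \<forall>s'\<in>?C. s \<noteq> s' \<longrightarrow> {w \<in> perms n. w \<circ> s0 = s \<circ> w} \<inter> {w \<in> perms n. w \<circ> s0 = s' \<circ> w} = {}"
    proof (intro ballI impI equals0I)
      fix s s' w assume "s \<noteq> s'" and w: "w \<in> {w \<in> perms n. w \<circ> s0 = s \<circ> w} \<inter> {w \<in> perms n. w \<circ> s0 = s' \<circ> w}"
      then have "s \<circ> w \<circ> inv w = s' \<circ> w \<circ> inv w" "w \<in> perms n" by auto
      then show False using \<open>s \<noteq> s'\<close> by (simp add: o_assoc[symmetric])
    qed
  qed (simp_all add: finite_perms)
  also have "\<dots> = (\<Sum>s\<in>?C. z_mset (cycle_type n s0))"
    by (rule sum.cong[OF refl]) (use card_conjugators[OF s0] in auto)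
  finally show ?thesis by simp
qed

lemma partitions_mset_inj:
  assumes "mu \<in> partitions_of n" "mu' \<in> partitions_of n" "mset mu = mset mu'"
  shows "mu = mu'"
proof -
  have "sorted (rev mu)" "sorted (rev mu')" using assms by (simp_all add: partitions_of_def sorted_wrt_rev)
  then have "rev mu = rev mu'" using assms(3) properties_for_sort by (metis mset_rev)
  then show ?thesis by simp
qed

lemma finite_partitions: "finite (partitions_of n)"
proof (rule finite_subset)
  show "partitions_of n \<subseteq> {xs. set xs \<subseteq> {..n} \<and> length xs \<le> n}"
  proof
    fix mu assume mu: "mu \<in> partitions_of n"
    then have "sum_list mu = n" by (simp add: partitions_of_def)
    then show "mu \<in> {xs. set xs \<subseteq> {..n} \<and> length xs \<le> n}"
      using part_le(2)[OF mu] member_le_sum_list[of _ mu] by auto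
  qed
qed (simp add: finite_lists_length_le)

definition shape :: "nat \<Rightarrow> (nat \<Rightarrow> nat) \<Rightarrow> nat list" where
  "shape n s = rev (sorted_list_of_multiset (cycle_type n s))"

lemma shape:
  assumes "s \<in> perms n"
  shows "shape n s \<in> partitions_of n" "mset (shape n s) = cycle_type n s"
proof -
  show m: "mset (shape n s) = cycle_type n s" by (simp add: shape_def)
  have "sum_mset (cycle_type n s) = n" "0 \<notin># cycle_type n s"
    using sign_orbit_type(2,3)[of s "{1..n}"] assms by (simp_all add: perms_def cycle_type_orbit_type)
  then have "sum_list (shape n s) = n" "0 \<notin> set (shape n s)"
    unfolding m[symmetric] sum_mset_sum_list set_mset_mset by simp_all
  moreover have "sorted_wrt (\<ge>) (shape n s)" by (simp add: shape_def sorted_wrt_rev)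
  ultimately show "shape n s \<in> partitions_of n" by (simp add: partitions_of_def)
qed

lemma shape_eqI: "s \<in> perms n \<Longrightarrow> mu \<in> partitions_of n \<Longrightarrow> cycle_type n s = mset mu \<Longrightarrow> shape n s = mu"
  using partitions_mset_inj shape by metis

lemma exists_cycle_type:
  assumes "mu \<in> partitions_of n"
  shows "\<exists>s. s \<in> perms n \<and> cycle_type n s = mset mu"
  using exists_orbit_type[of mu] assms by (auto simp: partitions_of_def perms_def cycle_type_orbit_type)

text \<open>The class of cycle type mu has n! divided by \<open>z_part mu\<close> elements, so
  weighting representatives with the inverse of \<open>z_part\<close> averages a class function over
  the group.\<close>

lemma sum_partitions_perms:
  fixes H :: "(nat \<Rightarrow> nat) \<Rightarrow> 'k::field_char_0"
  assumes H: "\<And>s w. s \<in> perms n \<Longrightarrow> w \<in> perms n \<Longrightarrow> H (inv w \<circ> (s \<circ> w)) = H s"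
    and rep: "\<And>mu. mu \<in> partitions_of n \<Longrightarrow> rep mu \<in> perms n \<and> cycle_type n (rep mu) = mset mu"
  shows "(\<Sum>mu\<in>partitions_of n. inverse (of_nat (z_part mu)) * H (rep mu)) = (\<Sum>s\<in>perms n. H s) / fact n"
proof -
  have "(\<Sum>s\<in>perms n. H s) = (\<Sum>mu\<in>partitions_of n. \<Sum>s\<in>{s \<in> perms n. shape n s = mu}. H s)"
    by (rule sum.group[symmetric]) (auto simp: finite_perms finite_partitions shape)
  also have "\<dots> = (\<Sum>mu\<in>partitions_of n. fact n * (inverse (of_nat (z_part mu)) * H (rep mu)))"
  proof (rule sum.cong[OF refl])
    fix mu assume mu: "mu \<in> partitions_of n"
    note r = rep[OF mu, THEN conjunct1] rep[OF mu, THEN conjunct2]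
    have C: "{s \<in> perms n. shape n s = mu} = {s \<in> perms n. cycle_type n s = cycle_type n (rep mu)}"
    proof -
      have "shape n s = mu \<longleftrightarrow> cycle_type n s = cycle_type n (rep mu)" if "s \<in> perms n" for s
        using shape_eqI[OF that mu] shape(2)[OF that] r(2) by metis
      then show ?thesis by blast
    qed
    have "H s = H (rep mu)" if "s \<in> perms n" "cycle_type n s = cycle_type n (rep mu)" for s
      using cycle_type_conjugate[OF that(1) r(1) that(2)] H[OF r(1)] by metis
    then have "(\<Sum>s\<in>{s \<in> perms n. shape n s = mu}. H s)
      = of_nat (card {s \<in> perms n. cycle_type n s = cycle_type n (rep mu)}) * H (rep mu)"
      unfolding C by simp
    moreover have "of_nat (card {s \<in> perms n. cycle_type n s = cycle_type n (rep mu)}) * of_nat (z_part mu) = (fact n :: 'k)"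
      using card_class[OF r(1)] by (metis of_nat_fact of_nat_mult r(2) z_part_mset)
    moreover have "of_nat (z_part mu) \<noteq> (0 :: 'k)"
      using z_mset_pos[of "mset mu"] mu by (simp add: z_part_mset partitions_of_def)
    ultimately show "(\<Sum>s\<in>{s \<in> perms n. shape n s = mu}. H s) = fact n * (inverse (of_nat (z_part mu)) * H (rep mu))"
      by (simp add: field_simps)
  qed
  finally show ?thesis by (simp add: sum_distrib_left[symmetric])
qed

text \<open>The Charlier polynomial is a sum over the subsets of the fixed points. Their complements
  are the sets \<open>B\<close> with \<open>s permutes B\<close>, which includes that
  \<open>s\<close> fixes every point outside of \<open>B\<close>. The parity of the number of cycles
  gives (-1)^n times the sign.\<close>

lemma charlier_fixed_points:
  fixes t :: "'k::field_char_0"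
  assumes s: "s \<in> perms n" and mu: "cycle_type n s = mset mu"
  shows "(- 1) ^ length mu * charlier (count_list mu 1) t
    = of_int (sign s) * (\<Sum>B\<in>{B \<in> Pow {1..n}. s permutes B}. (- 1) ^ card B * falling t (n - card B))"
proof -
  let ?S = "{1..n}" and ?F = "{j \<in> {1..n}. s j = j}"
  have p: "s permutes ?S" using s by (simp add: perms_def)
  have "permutation s" using p permutation_permutes by blast
  then have "card (orbit s b) = 1 \<longleftrightarrow> s b = b" for b
    using permutation_self_in_orbit[of s b] orbit_eq_singleton_iff[of s b] by (auto simp: card_1_singleton_iff)
  then have m: "count_list mu 1 = card ?F"
    using card_points_on_orbits[OF p, of 1] mu by (simp add: cycle_type_orbit_type count_mset count_list_eq_length_filter)
  have "length mu = size (orbit_type ?S s)" using mu by (metis cycle_type_orbit_type size_mset)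
  then have "(- 1) ^ length mu = ((- 1) ^ n * sign s :: int)" using sign_orbit_type(1)[OF p] by simp
  then have "of_int ((- 1) ^ length mu) = (of_int ((- 1) ^ n * sign s) :: 'k)" by (simp only:)
  then have l: "(- 1) ^ length mu = ((- 1) ^ n * of_int (sign s) :: 'k)" by simp
  have "charlier (card ?F) t = (\<Sum>k\<le>card ?F. \<Sum>A\<in>{A \<in> Pow ?F. card A = k}. (- 1) ^ card A * falling t (card A))"
    unfolding charlier_def by (rule sum.cong[OF refl]) (simp add: n_subsets)
  also have "\<dots> = (\<Sum>A\<in>Pow ?F. (- 1) ^ card A * falling t (card A))"
    by (rule sum.group) (use card_mono[of ?F] in auto)
  also have "\<dots> = (\<Sum>B\<in>{B \<in> Pow ?S. s permutes B}. (- 1) ^ (n - card B) * falling t (n - card B))"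
  proof (rule sum.reindex_bij_witness[of _ "\<lambda>B. ?S - B" "\<lambda>A. ?S - A"])
    fix A assume A: "A \<in> Pow ?F"
    then show "?S - A \<in> {B \<in> Pow ?S. s permutes B}"
      using permutes_superset[OF p, of "?S - A"] by auto
    show "(- 1) ^ (n - card (?S - A)) * falling t (n - card (?S - A)) = (- 1) ^ card A * falling t (card A)"
    proof -
      have "A \<subseteq> ?S" using A by auto
      then have "card (?S - A) = n - card A" "card A \<le> n"
        using card_mono[of ?S A] finite_subset[of A ?S] by (simp_all add: card_Diff_subset)
      then show ?thesis by simp
    qed
  qed (auto simp: permutes_not_in)
  finally have c: "charlier (card ?F) t = (\<Sum>B\<in>{B \<in> Pow ?S. s permutes B}. (- 1) ^ (n - card B) * falling t (n - card B))" .
  have "(- 1) ^ n * (- 1) ^ (n - card B) = ((- 1) ^ card B :: 'k)" if "B \<subseteq> ?S" for B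
  proof -
    have "card B \<le> n" using card_mono[OF _ that] by simp
    then obtain d where "n = card B + d" using le_Suc_ex by blast
    then show ?thesis by (cases "even d") (simp_all add: power_add)
  qed
  then have "(\<Sum>B\<in>{B \<in> Pow ?S. s permutes B}. (- 1) ^ card B * falling t (n - card B))
    = (\<Sum>B\<in>{B \<in> Pow ?S. s permutes B}. (- 1) ^ n * (- 1) ^ (n - card B) * falling t (n - card B))"
    by (intro sum.cong) auto
  also have "\<dots> = (- 1) ^ n * (\<Sum>B\<in>{B \<in> Pow ?S. s permutes B}. (- 1) ^ (n - card B) * falling t (n - card B))"
    by (simp only: sum_distrib_left mult.assoc)
  finally show ?thesis unfolding m l c by (simp only: mult_ac)
qed

section \<open>Dimensions of the simple objects\<close>

lemma compA_sum_right:
  "compA t xs ys zs g (\<lambda>i j. \<Sum>c\<in>C. fscale (a c) (F c i j)) i k = (\<Sum>c\<in>C. fscale (a c) (compA t xs ys zs g (F c) i k))"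
  unfolding compA_def comp0_sum comp0_linear fvs.scale_sum_right by (rule sum.swap)

text \<open>By cyclicity, the summand of a basis vector \<open>b\<close> is the trace of
  \<open>\<iota> lam (perm_act s b)\<close> followed by \<open>\<pi> lam b\<close>. Expanding
  \<open>perm_act s b\<close> in the basis, orthogonality leaves the coefficient at \<open>b\<close>
  times the dimension of \<open>X lam\<close>. Summed over the basis, the coefficients give the
  character value.\<close>

lemma top_family_trace:
  fixes t :: "'k::field_char_0"
  assumes top: "is_top_family t n X"
  obtains p where "is_lower t {1..n} p"
    "\<And>s. s \<in> perms n \<Longrightarrow> tr0 t {1..n} (comp0 t {1..n} {1..n} {1..n} ((idA [{1..n}] - p) 0 0) (bas (graph_rel {1..n} {1..n} (inv s))))
      = (\<Sum>lam\<in>partitions_of n. cat_dim t (X lam) * chi lam n s)"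
proof -
  let ?x = "{1..n}"
  let ?xs = "[?x]"
  obtain p e U \<iota> B \<pi> where p: "is_lower t ?x p" and e: "e = idA ?xs - p" and U: "U = Obj ?xs e"
    and \<iota>_all: "\<forall>lam\<in>partitions_of n.
           (\<forall>v\<in>specht lam. \<iota> lam v \<in> thom t (X lam) U)
         \<and> (\<forall>v\<in>specht lam. \<forall>w\<in>specht lam. \<iota> lam (v + w) = \<iota> lam v + \<iota> lam w)
         \<and> (\<forall>c. \<forall>v\<in>specht lam. \<iota> lam (fscale c v) = (\<lambda>i j. fscale c (\<iota> lam v i j)))
         \<and> (\<forall>s\<in>perms n. \<forall>v\<in>specht lam.
              \<iota> lam (perm_act s v) = tcomp t (X lam) U U (upper_act t ?x e s) (\<iota> lam v))"
    and B_all: "\<forall>lam\<in>partitions_of n. is_basis (B lam) (specht lam) \<and> (\<forall>b\<in>B lam. \<pi> lam b \<in> thom t U (X lam))"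
    and orth: "\<forall>lam\<in>partitions_of n. \<forall>mu\<in>partitions_of n. \<forall>b\<in>B lam. \<forall>c\<in>B mu.
      tcomp t (X mu) U (X lam) (\<pi> lam b) (\<iota> mu c) = (if lam = mu \<and> b = c then idem (X lam) else 0)"
    and total: "(\<Sum>lam\<in>partitions_of n. \<Sum>b\<in>B lam. tcomp t U (X lam) U (\<iota> lam b) (\<pi> lam b)) = e"
    using top unfolding is_top_family_def by (elim exE conjE) (rule that; assumption)
  have \<iota>: "v \<in> specht lam \<Longrightarrow> \<iota> lam v \<in> thom t (X lam) U"
      "v \<in> specht lam \<Longrightarrow> w \<in> specht lam \<Longrightarrow> \<iota> lam (v + w) = \<iota> lam v + \<iota> lam w"
      "v \<in> specht lam \<Longrightarrow> \<iota> lam (fscale c v) = (\<lambda>i j. fscale c (\<iota> lam v i j))"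
      "s \<in> perms n \<Longrightarrow> v \<in> specht lam \<Longrightarrow> \<iota> lam (perm_act s v) = tcomp t (X lam) U U (upper_act t ?x e s) (\<iota> lam v)"
    if "lam \<in> partitions_of n" for lam v w c s
    using bspec[OF \<iota>_all that] by blast+
  have B: "is_basis (B lam) (specht lam)" if "lam \<in> partitions_of n" for lam
    using B_all that by blast
  have \<pi>: "\<pi> lam b \<in> thom t U (X lam)" if "lam \<in> partitions_of n" "b \<in> B lam" for lam b
    using B_all that by blast
  have simple: "is_tobj t (X lam)" if "lam \<in> partitions_of n" for lam
    using top that by (simp add: is_top_family_def is_simple_def)
  have summand: "trA t ?xs (compA t ?xs ?xs ?xs (tcomp t U (X lam) U (\<iota> lam b) (\<pi> lam b)) (mat1 (bas (graph_rel ?x ?x (inv s)))))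
    = fvs.representation (B lam) (perm_act s b) b * cat_dim t (X lam)"
    if lam: "lam \<in> partitions_of n" and b: "b \<in> B lam" and s: "s \<in> perms n" for lam b s
  proof -
    define Y where "Y = summands (X lam)"
    define G where "G = (mat1 (bas (graph_rel ?x ?x (inv s))) :: 'k mor)"
    define i where "i = \<iota> lam b"
    define q where "q = \<pi> lam b"
    have tob: "is_tobj t (X lam)" by (rule simple[OF lam])
    have fin: "fins ?xs" "fins Y" using tob by (simp_all add: fins_def is_tobj_def Y_def)
    have bV: "b \<in> specht lam" using B[OF lam] b by (auto simp: is_basis_def)
    have i: "homs Y ?xs i" "compA t Y ?xs ?xs e i = i"
      using \<iota>(1)[OF lam bV] by (simp_all add: thom_def U tcomp_def Y_def i_def homA_homs)
    have q: "homs ?xs Y q" "compA t ?xs ?xs Y q e = q"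
      using \<pi>[OF lam b] by (simp_all add: thom_def U tcomp_def Y_def q_def homA_homs)
    have "inv s permutes ?x" using s by (simp add: perms_def permutes_inv)
    then have G: "homs ?xs ?xs G"
      using graph_rel_arels[of ?x ?x "inv s"] by (auto simp: homs_def G_def mat1_def bas_def hom0_def)
    have "p 0 0 \<in> hom0 ?x ?x" using p homA_homs[of p ?xs ?xs] by (simp add: is_lower_def is_tobj_def homs_def)
    moreover have "e 0 0 = id0 ?x - p 0 0" by (simp add: e idA_def)
    ultimately have eh: "homs ?xs ?xs e" using base_hom0(1)[of ?x] by (auto simp: homs_def hom0_def)
    note hG = homs_comp[OF fin(2,1,1)] homs_comp[OF fin(1,1,1)] homs_comp[OF fin(1,1,2)]
    have "trA t ?xs (compA t ?xs ?xs ?xs (compA t ?xs Y ?xs i q) G) = trA t ?xs (compA t ?xs Y ?xs i (compA t ?xs ?xs Y q G))"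
      by (rule trA_cong[OF compA_assoc[OF fin(1,1,2,1) G q(1) i(1)]])
    also have "\<dots> = trA t Y (compA t Y ?xs Y (compA t ?xs ?xs Y q G) i)"
      by (rule trA_cyclic[OF fin hG(3) i(1)])
    also have "\<dots> = trA t Y (compA t Y ?xs Y q (compA t Y ?xs ?xs G i))"
      by (rule trA_cong[OF compA_assoc[OF fin(2,1,1,2) i(1) G q(1)]])
    \<comment> \<open>Equivariance of \<open>\<iota>\<close> replaces the graph of
      \<open>inv s\<close> by the action on the vector; the factors \<open>e\<close> inside
      \<open>upper_act\<close> are absorbed by \<open>q\<close> and \<open>i\<close>.\<close>
    also have "\<dots> = trA t Y (compA t Y ?xs Y q (\<iota> lam (perm_act s b)))"
    proof (rule trA_cong)
      have "meq Y ?xs (\<iota> lam (perm_act s b)) (compA t Y ?xs ?xs e (compA t Y ?xs ?xs (compA t ?xs ?xs ?xs G e) i))"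
        using compA_assoc[OF fin(2,1,1,1) i(1) hG(2) eh]
        unfolding \<iota>(4)[OF lam s bV] tcomp_def U upper_act_def tobj.sel Y_def[symmetric] i_def[symmetric] G_def[symmetric] .
      also have "meq Y ?xs (compA t Y ?xs ?xs e (compA t Y ?xs ?xs (compA t ?xs ?xs ?xs G e) i))
        (compA t Y ?xs ?xs e (compA t Y ?xs ?xs G (compA t Y ?xs ?xs e i)))"
        by (rule meq_comp[OF meq_refl compA_assoc[OF fin(2,1,1,1) i(1) eh G]])
      finally have "meq Y ?xs (\<iota> lam (perm_act s b)) (compA t Y ?xs ?xs e (compA t Y ?xs ?xs G i))" unfolding i(2) .
      then have "meq Y Y (compA t Y ?xs Y q (\<iota> lam (perm_act s b))) (compA t Y ?xs Y q (compA t Y ?xs ?xs e (compA t Y ?xs ?xs G i)))"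
        by (rule meq_comp[OF meq_refl])
      also have "meq Y Y (compA t Y ?xs Y q (compA t Y ?xs ?xs e (compA t Y ?xs ?xs G i))) (compA t Y ?xs Y (compA t ?xs ?xs Y q e) (compA t Y ?xs ?xs G i))"
        by (rule meq_sym[OF compA_assoc[OF fin(2,1,1,2) hG(1) eh q(1)]])
      finally show "meq Y Y (compA t Y ?xs Y q (compA t Y ?xs ?xs G i)) (compA t Y ?xs Y q (\<iota> lam (perm_act s b)))"
        unfolding q(2) by (rule meq_sym)
    qed
    also have "\<dots> = fvs.representation (B lam) (perm_act s b) b * cat_dim t (X lam)"
    proof -
      define r where "r = fvs.representation (B lam) (perm_act s b)"
      have finB: "finite (B lam)" by (rule specht_basis_trace(1)[OF lam s B[OF lam]])
      have BV: "B lam \<subseteq> specht lam" and ind: "fvs.independent (B lam)" and span: "specht lam \<subseteq> fvs.span (B lam)"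
        using B[OF lam] by (auto simp: is_basis_def)
      have sp: "fvs.subspace (specht lam :: ((nat \<Rightarrow> nat) \<Rightarrow> 'k) set)" unfolding specht_def by (rule fvs.subspace_span)
      \<comment> \<open>Linearity of \<open>\<iota> lam\<close> is given on
        \<open>specht lam\<close>, so it is extended to finite sums inside of this subspace.\<close>
      have expand: "\<iota> lam (\<Sum>c\<in>C. fscale (r c) c) = (\<lambda>i j. \<Sum>c\<in>C. fscale (r c) (\<iota> lam c i j))" if "C \<subseteq> B lam" for C
        using finite_subset[OF that finB] that
      proof (induction C rule: finite_induct)
        case empty
        have "\<iota> lam (fscale 0 0) = (\<lambda>i j. fscale 0 (\<iota> lam 0 i j))" by (rule \<iota>(3)[OF lam fvs.subspace_0[OF sp]])
        then show ?case by (simp only: sum.empty fvs.scale_zero_left)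
      next
        case (insert c C)
        then have c: "c \<in> specht lam" and C: "\<And>c. c \<in> C \<Longrightarrow> c \<in> specht lam" using BV by auto
        have "\<iota> lam (fscale (r c) c + (\<Sum>c\<in>C. fscale (r c) c)) = \<iota> lam (fscale (r c) c) + \<iota> lam (\<Sum>c\<in>C. fscale (r c) c)"
          by (rule \<iota>(2)[OF lam fvs.subspace_scale[OF sp c] fvs.subspace_sum[OF sp fvs.subspace_scale[OF sp C]]])
        moreover have "\<iota> lam (\<Sum>c\<in>C. fscale (r c) c) = (\<lambda>i j. \<Sum>c\<in>C. fscale (r c) (\<iota> lam c i j))"
          using insert by simp
        ultimately show ?case unfolding sum.insert[OF insert.hyps] \<iota>(3)[OF lam c] by (simp add: plus_fun_def)
      qed
      have "perm_act s b = (\<Sum>c\<in>B lam. fscale (r c) c)"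
        unfolding r_def using fvs.sum_representation_eq[OF ind _ finB order_refl, of "perm_act s b"] span perm_act_specht[OF lam s bV] by auto
      then have E: "\<iota> lam (perm_act s b) = (\<lambda>i j. \<Sum>c\<in>B lam. fscale (r c) (\<iota> lam c i j))" using expand[OF order_refl] by simp
      have "compA t Y ?xs Y q (\<iota> lam (perm_act s b)) j j = fscale (r b) (idem (X lam) j j)" for j
      proof -
        have "compA t Y ?xs Y q (\<iota> lam (perm_act s b)) j j = (\<Sum>c\<in>B lam. fscale (r c) (compA t Y ?xs Y q (\<iota> lam c) j j))"
          unfolding E by (rule compA_sum_right)
        also have "\<dots> = (\<Sum>c\<in>B lam. if b = c then fscale (r b) (idem (X lam) j j) else 0)"
        proof (rule sum.cong[OF refl])
          fix c assume "c \<in> B lam"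
          from orth[rule_format, OF lam lam b this] have "compA t Y ?xs Y q (\<iota> lam c) = (if b = c then idem (X lam) else 0)"
            by (simp add: tcomp_def U Y_def q_def)
          then show "fscale (r c) (compA t Y ?xs Y q (\<iota> lam c) j j) = (if b = c then fscale (r b) (idem (X lam) j j) else 0)"
            by (cases "b = c") (simp_all only: if_True if_False simp_thms zero_fun_apply fvs.scale_zero_right)
        qed
        also have "\<dots> = fscale (r b) (idem (X lam) j j)" using sum.delta'[OF finB, of b "\<lambda>_. fscale (r b) (idem (X lam) j j)"] b by (simp only: if_True)
        finally show ?thesis .
      qed
      then have "trA t Y (compA t Y ?xs Y q (\<iota> lam (perm_act s b))) = r b * trA t Y (idem (X lam))"
        by (simp add: trA_def tr0_linear sum_distrib_left)
      moreover have "trA t Y (idem (X lam)) = cat_dim t (X lam)"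
        unfolding cat_dim_def Y_def
        by (rule cat_trace_eq[OF tob, symmetric]) (use tob in \<open>simp add: thom_def is_tobj_def tcomp_def\<close>)
      ultimately show ?thesis by (simp add: r_def)
    qed
    finally show ?thesis by (simp only: tcomp_def U tobj.sel Y_def i_def q_def G_def)
  qed
  show thesis
  proof (rule that[OF p])
    fix s assume s: "s \<in> perms n"
    let ?g = "bas (graph_rel ?x ?x (inv s)) :: arel \<Rightarrow> 'k"
    let ?M = "\<lambda>lam b. tcomp t U (X lam) U (\<iota> lam b) (\<pi> lam b)"
    have "(idA ?xs - p) 0 0 = (\<Sum>lam\<in>partitions_of n. \<Sum>b\<in>B lam. ?M lam b 0 0)"
      unfolding e[symmetric] total[symmetric] sum_fun_apply ..
    then have "tr0 t ?x (comp0 t ?x ?x ?x ((idA ?xs - p) 0 0) ?g)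
      = (\<Sum>lam\<in>partitions_of n. \<Sum>b\<in>B lam. tr0 t ?x (comp0 t ?x ?x ?x (?M lam b 0 0) ?g))"
      by (simp only: comp0_sum tr0_sum)
    also have "\<dots> = (\<Sum>lam\<in>partitions_of n. \<Sum>b\<in>B lam. fvs.representation (B lam) (perm_act s b) b * cat_dim t (X lam))"
    proof (rule sum.cong[OF refl], rule sum.cong[OF refl])
      fix lam b assume "lam \<in> partitions_of n" "b \<in> B lam"
      from summand[OF this s] show "tr0 t ?x (comp0 t ?x ?x ?x (?M lam b 0 0) ?g) = fvs.representation (B lam) (perm_act s b) b * cat_dim t (X lam)"
        by (simp add: trA_def compA_single mat1_def)
    qed
    also have "\<dots> = (\<Sum>lam\<in>partitions_of n. cat_dim t (X lam) * chi lam n s)"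
    proof (rule sum.cong[OF refl])
      fix lam assume lam: "lam \<in> partitions_of n"
      show "(\<Sum>b\<in>B lam. fvs.representation (B lam) (perm_act s b) b * cat_dim t (X lam)) = cat_dim t (X lam) * chi lam n s"
        unfolding sum_distrib_right[symmetric] specht_basis_trace(2)[OF lam s B[OF lam]] by (rule mult.commute)
    qed
    finally show "tr0 t ?x (comp0 t ?x ?x ?x ((idA ?xs - p) 0 0) ?g) = (\<Sum>lam\<in>partitions_of n. cat_dim t (X lam) * chi lam n s)" .
  qed
qed

section \<open>Class functions built from permuted subsets, and the dimension\<close>

lemma permutes_iff_fixes:
  assumes "s \<in> perms n"
  shows "s permutes B \<longleftrightarrow> (\<forall>x. x \<notin> B \<longrightarrow> s x = x)"
proof -
  have "bij s" using assms by (simp add: perms_def permutes_bij)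
  then show ?thesis by (auto simp: permutes_def bij_iff)
qed

text \<open>The map \<open>w\<close> carries the sets permuted by the conjugate to the sets permuted
  by \<open>s\<close> and preserves their sizes.\<close>

lemma sum_permuted_conj:
  assumes s: "s \<in> perms n" and w: "w \<in> perms n"
  shows "(\<Sum>B\<in>{B \<in> Pow {1..n}. inv w \<circ> (s \<circ> w) permutes B}. F (card B)) = (\<Sum>B\<in>{B \<in> Pow {1..n}. s permutes B}. F (card B))"
proof (rule sum.reindex_bij_witness[of _ "\<lambda>B. inv w ` B" "\<lambda>B. w ` B"])
  have wp: "w permutes {1..n}" using w by (simp add: perms_def)
  have conj: "inv w \<circ> (s \<circ> w) \<in> perms n" using perms_comp perms_inv s w by blast
  have inv: "w (inv w x) = x" "inv w (w x) = x" for x using permutes_inverses[OF wp] by blast+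
  have inj: "inj w" "inj (inv w)" using permutes_inj[OF wp] permutes_inj[OF permutes_inv[OF wp]] by blast+
  fix B
  show "inv w ` (w ` B) = B" "w ` (inv w ` B) = B" by (simp_all add: image_image inv)
  show "F (card (w ` B)) = F (card B)" by (simp add: card_image inj_on_subset[OF inj(1)])
  show "w ` B \<in> {B \<in> Pow {1..n}. s permutes B}" if "B \<in> {B \<in> Pow {1..n}. inv w \<circ> (s \<circ> w) permutes B}"
  proof -
    have B: "B \<subseteq> {1..n}" and fixed: "\<And>x. x \<notin> B \<Longrightarrow> inv w (s (w x)) = x" using that permutes_iff_fixes[OF conj, of B] by auto
    have "s x = x" if "x \<notin> w ` B" for x
      using fixed[of "inv w x"] that inv by (metis image_eqI)
    then show ?thesis using B permutes_image[OF wp] permutes_iff_fixes[OF s] by blast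
  qed
  show "inv w ` B \<in> {B \<in> Pow {1..n}. inv w \<circ> (s \<circ> w) permutes B}" if "B \<in> {B \<in> Pow {1..n}. s permutes B}"
  proof -
    have B: "B \<subseteq> {1..n}" and fixed: "\<And>x. x \<notin> B \<Longrightarrow> s x = x" using that permutes_iff_fixes[OF s, of B] by auto
    have "inv w (s (w x)) = x" if "x \<notin> inv w ` B" for x
      using fixed[of "w x"] that inv by (metis image_eqI)
    then show ?thesis using B permutes_image[OF permutes_inv[OF wp]] permutes_iff_fixes[OF conj] by auto
  qed
qed

lemma sum_permuted_inv:
  assumes "s \<in> perms n"
  shows "(\<Sum>B\<in>{B \<in> Pow {1..n}. inv s permutes B}. F (card B)) = (\<Sum>B\<in>{B \<in> Pow {1..n}. s permutes B}. F (card B))"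
proof -
  have "inv s permutes B \<longleftrightarrow> s permutes B" for B
    using permutes_inv perms_inv_inv[OF assms] by metis
  then show ?thesis by simp
qed

text \<open>The identity for the coefficients of \<open>e\<close> is multiplied by the Young
  symmetrizer c and summed over the group. On the left c(id) = 1 remains. On the right the class
  function acts on c as the inverse of the product, and orthogonality isolates \<open>lam\<close>
  with the factor \<open>hook lam\<close>.\<close>

lemma cat_dim_top_family:
  fixes t :: "'k::field_char_0"
  assumes t: "t \<notin> \<nat>" and lam: "lam \<in> partitions_of n" and top: "is_top_family t n X"
  shows "cat_dim t (X lam) = (\<Prod>i<n. t - of_nat (part lam i + (n - 1 - i))) / hook lam"
proof -
  let ?x = "{1..n}" and ?c = "young_symmetrizer lam :: _ \<Rightarrow> 'k"
  let ?P = "\<Prod>i<n. t - of_nat (part lam i + (n - 1 - i))"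
  let ?G = "\<lambda>w. \<Sum>B\<in>{B \<in> Pow ?x. w permutes B}. inverse (falling t (n + card B))"
  have n: "sum_list lam = n" using lam by (simp add: partitions_of_def)
  obtain p where p: "is_lower t ?x p" and tr: "\<And>s. s \<in> perms n \<Longrightarrow>
      tr0 t ?x (comp0 t ?x ?x ?x ((idA [?x] - p) 0 0) (bas (graph_rel ?x ?x (inv s))))
      = (\<Sum>lam\<in>partitions_of n. cat_dim t (X lam) * chi lam n s)"
    using top_family_trace[OF top] by blast
  define Psi where "Psi s = (\<Sum>lam\<in>partitions_of n. cat_dim t (X lam) * chi lam n s)" for s
  \<comment> \<open>\<open>B\<close> is the complement of a set \<open>A\<close> of points at which
    \<open>s\<close> and \<open>s'\<close> agree, so that 2n - \<open>card A\<close> = n +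
    \<open>card B\<close>.\<close>
  have fixes_sum: "(\<Sum>A\<in>{A \<in> Pow ?x. \<forall>j\<in>A. s' j = s j}. inverse (falling t (2 * card ?x - card A))) = ?G (inv s \<circ> s')"
    if s: "s \<in> perms n" and s': "s' \<in> perms n" for s s'
  proof (rule sum.reindex_bij_witness[of _ "\<lambda>B. ?x - B" "\<lambda>A. ?x - A"])
    have w: "inv s \<circ> s' \<in> perms n" using s s' perms_comp perms_inv by blast
    have iff: "inv s (s' j) = j \<longleftrightarrow> s' j = s j" for j
      using permutes_inverses[of s ?x] s by (metis mem_Collect_eq perms_def)
    have out: "inv s (s' j) = j" if "j \<notin> ?x" for j
      using that w permutes_not_in[of "inv s \<circ> s'" ?x j] by (simp add: perms_def)
    fix A assume A: "A \<in> {A \<in> Pow ?x. \<forall>j\<in>A. s' j = s j}"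
    then show "?x - A \<in> {B \<in> Pow ?x. inv s \<circ> s' permutes B}"
      using permutes_iff_fixes[OF w, of "?x - A"] iff out by auto
    have "A \<subseteq> ?x" using A by blast
    then have "card (?x - A) = n - card A" "card A \<le> n"
      using card_mono[of ?x A] finite_subset[of A ?x] by (simp_all add: card_Diff_subset)
    then have "n + card (?x - A) = 2 * card ?x - card A" by simp
    then show "inverse (falling t (n + card (?x - A))) = inverse (falling t (2 * card ?x - card A))" by (simp only:)
    show "?x - (?x - A) = A" using A by blast
  next
    have w: "inv s \<circ> s' \<in> perms n" using s s' perms_comp perms_inv by blast
    have iff: "inv s (s' j) = j \<longleftrightarrow> s' j = s j" for j
      using permutes_inverses[of s ?x] s by (metis mem_Collect_eq perms_def)
    fix B assume B: "B \<in> {B \<in> Pow ?x. inv s \<circ> s' permutes B}"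
    then show "?x - B \<in> {A \<in> Pow ?x. \<forall>j\<in>A. s' j = s j}"
      using permutes_iff_fixes[OF w, of B] iff by auto
    show "?x - (?x - B) = B" using B by blast
  qed
  have delta: "(if s = id then 1 else 0) = (\<Sum>s'\<in>perms n. Psi s' * ?G (inv s \<circ> s'))" if s: "s \<in> perms n" for s
  proof -
    have "s permutes ?x" using s by (simp add: perms_def)
    from upper_idempotent_trace[OF _ t p this]
    have "(if s = id then 1 else 0) = (\<Sum>s'\<in>perms n.
       tr0 t ?x (comp0 t ?x ?x ?x ((idA [?x] - p) 0 0) (bas (graph_rel ?x ?x (inv s')))) *
       (\<Sum>A\<in>{A \<in> Pow ?x. \<forall>j\<in>A. s' j = s j}. inverse (falling t (2 * card ?x - card A))))"
      unfolding perms_def by simp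
    also have "\<dots> = (\<Sum>s'\<in>perms n. Psi s' * ?G (inv s \<circ> s'))"
      by (rule sum.cong[OF refl]) (simp only: fixes_sum[OF s] tr Psi_def)
    finally show ?thesis .
  qed
  \<comment> \<open>The scalar by which the class function acts on c is the coefficient at
    \<open>id\<close>, where the convolution is a sum over column placements.\<close>
  have K: "conv n ?c ?G id = inverse ?P"
  proof -
    have "conv n ?c ?G id = (\<Sum>s\<in>perms n. ?c s * ?G s)"
      unfolding conv_def by (rule sum.cong[OF refl]) (simp only: comp_id sum_permuted_inv[of _ n "\<lambda>k. inverse (falling t (n + k))"])
    then show ?thesis unfolding young_placements(2)[OF n, of "\<lambda>k. inverse (falling t (n + k))"] column_placements_full[OF lam t] .
  qed
  have "1 = (\<Sum>s\<in>perms n. ?c s * (if s = id then 1 else 0))"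
    by (simp add: finite_perms young_symmetrizer_id if_distrib[of "\<lambda>z. _ * z"] cong: if_cong)
  also have "\<dots> = (\<Sum>s\<in>perms n. \<Sum>s'\<in>perms n. Psi s' * (?c s * ?G (inv s \<circ> s')))"
    by (rule sum.cong[OF refl]) (simp only: delta sum_distrib_left mult.left_commute)
  also have "\<dots> = (\<Sum>s'\<in>perms n. \<Sum>s\<in>perms n. Psi s' * (?c s * ?G (inv s \<circ> s')))" by (rule sum.swap)
  also have "\<dots> = (\<Sum>s'\<in>perms n. Psi s' * conv n ?c ?G s')"
    by (simp only: conv_def sum_distrib_left)
  also have "\<dots> = (\<Sum>s'\<in>perms n. inverse ?P * (Psi s' * ?c s'))"
  proof (rule sum.cong[OF refl])
    fix s' assume s': "s' \<in> perms n"
    have "conv n ?c ?G s' = conv n ?c ?G id * ?c s'"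
      by (rule conv_young_class[OF lam _ s']) (rule sum_permuted_conj[where F = "\<lambda>k. inverse (falling t (n + k))"])
    then show "Psi s' * conv n ?c ?G s' = inverse ?P * (Psi s' * ?c s')" unfolding K by (simp only: mult.left_commute)
  qed
  also have "\<dots> = inverse ?P * (\<Sum>mu\<in>partitions_of n. \<Sum>s\<in>perms n. cat_dim t (X mu) * (chi mu n s * ?c s))"
    unfolding sum_distrib_left[symmetric] Psi_def sum_distrib_right
    by (subst sum.swap) (simp only: mult.assoc sum_distrib_left)
  also have "\<dots> = inverse ?P * (\<Sum>mu\<in>partitions_of n. cat_dim t (X mu) * (if mu = lam then hook mu else 0))"
    using chi_young_symmetrizer[OF _ lam, where 'k = 'k] by (simp add: sum_distrib_left[symmetric])
  also have "\<dots> = inverse ?P * (cat_dim t (X lam) * hook lam)"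
    using lam by (simp add: finite_partitions if_distrib[of "\<lambda>z. _ * z"] cong: if_cong)
  finally have "1 = inverse ?P * (cat_dim t (X lam) * hook lam)" .
  \<comment> \<open>As \<open>inverse 0 = 0\<close>, the equation just obtained excludes a vanishing
    product.\<close>
  moreover have "?P \<noteq> 0" using calculation by (metis inverse_zero mult_zero_left zero_neq_one)
  ultimately show ?thesis using hook_nonzero[OF lam, where 'k = 'k] by (simp add: field_simps)
qed

section \<open>Degrees and the sum over cycle types\<close>

lemma sym_character_at_eq:
  assumes lam: "lam \<in> partitions_of n" and mu: "mu \<in> partitions_of n"
  shows "sym_character_at lam mu = (chi lam n (SOME s. s \<in> perms n \<and> cycle_type n s = mset mu) :: 'k::field_char_0)"
proof -
  have "sum_list mu = n" using mu by (simp add: partitions_of_def)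
  then show ?thesis unfolding sym_character_at_def
    using sym_character_eq[OF lam someI_ex[OF exists_cycle_type[OF mu], THEN conjunct1]] by (simp only:)
qed

text \<open>A permutation with the cycle type of the identity is conjugate to it and hence equal to
  it, so the choice of a representative is determined.\<close>

lemma character_degree_hook:
  assumes lam: "lam \<in> partitions_of n"
  shows "character_degree lam = (fact n / hook lam :: 'k::field_char_0)"
proof -
  let ?one = "replicate n (1 :: nat)"
  have n: "sum_list lam = n" using lam by (simp add: partitions_of_def)
  have one: "?one \<in> partitions_of n" by (simp add: partitions_of_def sum_list_replicate sorted_wrt_iff_nth_less)
  define s where "s = (SOME s. s \<in> perms n \<and> cycle_type n s = mset ?one)"
  have s: "s \<in> perms n" "cycle_type n s = mset ?one"
    using someI_ex[OF exists_cycle_type[OF one]] by (simp_all only: s_def)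
  have "orbit id ` {1..n} = (\<lambda>x. {x}) ` {1..n}"
    by (rule image_cong[OF refl]) (simp add: orbit_eq_singleton_iff)
  then have "cycle_type n id = image_mset card (image_mset (\<lambda>x. {x}) (mset_set {1..n}))"
    unfolding cycle_type_def by (simp add: image_mset_mset_set inj_on_def)
  also have "\<dots> = mset ?one" by (simp add: multiset.map_comp comp_def image_mset_const_eq)
  finally have "cycle_type n s = cycle_type n id" using s(2) by simp
  from cycle_type_conjugate[OF s(1) id_perms this] obtain w where "w \<in> perms n" "s = inv w \<circ> (id \<circ> w)" .
  then have "s = id" by simp
  then show ?thesis unfolding character_degree_def n sym_character_at_eq[OF lam one] s_def[symmetric]
    using chi_id[OF lam] by simp
qed

text \<open>The sum over cycle types is the average over the group of the character times the class
  function \<open>h\<close>. In such an average the character can be replaced by the Young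
  symmetrizer, up to n! and \<open>hook lam\<close>. What remains is the signed placement sum, which
  the rows evaluate.\<close>

lemma character_sum_hook:
  fixes t :: "'k::field_char_0"
  assumes lam: "lam \<in> partitions_of n"
  shows "(\<Sum>mu\<in>partitions_of n. (- 1) ^ length mu * inverse (of_nat (z_part mu)) * sym_character_at lam mu * charlier (count_list mu 1) t)
    = (\<Prod>i<n. t - of_nat (part lam i + (n - 1 - i))) / hook lam"
proof -
  define rep where "rep mu = (SOME s. s \<in> perms n \<and> cycle_type n s = mset mu)" for mu
  define h where "h s = of_int (sign s) * (\<Sum>B\<in>{B \<in> Pow {1..n}. s permutes B}. (- 1) ^ card B * falling t (n - card B))" for s
  have n: "sum_list lam = n" using lam by (simp add: partitions_of_def)
  have rep: "rep mu \<in> perms n \<and> cycle_type n (rep mu) = mset mu" if "mu \<in> partitions_of n" for mu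
    unfolding rep_def by (rule someI_ex[OF exists_cycle_type[OF that]])
  have h_class: "h (inv w \<circ> (s \<circ> w)) = h s" if s: "s \<in> perms n" and w: "w \<in> perms n" for s w
  proof -
    have "sign (inv w \<circ> (s \<circ> w)) = sign w * (sign s * sign w)"
      by (simp add: sign_perms(1)[OF perms_inv[OF w] perms_comp[OF s w]] sign_perms(1)[OF s w] sign_perms(2)[OF w])
    also have "\<dots> = sign s" by (simp add: mult.left_commute)
    finally show ?thesis
      unfolding h_def using sum_permuted_conj[OF s w, of "\<lambda>k. (- 1) ^ k * falling t (n - k)"] by simp
  qed
  have "(\<Sum>mu\<in>partitions_of n. (- 1) ^ length mu * inverse (of_nat (z_part mu)) * sym_character_at lam mu * charlier (count_list mu 1) t)
    = (\<Sum>mu\<in>partitions_of n. inverse (of_nat (z_part mu)) * (h (rep mu) * chi lam n (rep mu)))"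
  proof (rule sum.cong[OF refl])
    fix mu assume mu: "mu \<in> partitions_of n"
    have "(- 1) ^ length mu * charlier (count_list mu 1) t = h (rep mu)"
      using charlier_fixed_points[of "rep mu" n mu t] rep[OF mu] by (simp only: h_def)
    then show "(- 1) ^ length mu * inverse (of_nat (z_part mu)) * sym_character_at lam mu * charlier (count_list mu 1) t
      = inverse (of_nat (z_part mu)) * (h (rep mu) * chi lam n (rep mu))"
      unfolding sym_character_at_eq[OF lam mu] rep_def[symmetric] by (metis (no_types, lifting) mult.assoc mult.commute)
  qed
  also have "\<dots> = (\<Sum>s\<in>perms n. h s * chi lam n s) / fact n"
    by (rule sum_partitions_perms) (use h_class chi_class[OF lam] rep in auto)
  also have "\<dots> = (\<Sum>s\<in>perms n. h s * young_symmetrizer lam (inv s)) / hook lam"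
  proof -
    have "(\<Sum>s\<in>perms n. h s * chi lam n s) = fact n / hook lam * (\<Sum>s\<in>perms n. h s * young_symmetrizer lam (inv s))"
      by (rule sum_class_chi[OF lam]) (rule h_class)
    then show ?thesis by simp
  qed
  also have "(\<Sum>s\<in>perms n. h s * young_symmetrizer lam (inv s)) = (\<Sum>s\<in>perms n. h (inv s) * young_symmetrizer lam s)"
    using sum_perms_inv[of "\<lambda>s. h (inv s) * young_symmetrizer lam s" n] by simp
  also have "\<dots> = (\<Sum>s\<in>perms n. young_symmetrizer lam s * h s)"
  proof (rule sum.cong[OF refl])
    fix s assume s: "s \<in> perms n"
    then have "h (inv s) = h s"
      unfolding h_def using sum_permuted_inv[OF s, of "\<lambda>k. (- 1) ^ k * falling t (n - k)"] sign_perms(2)[OF s] by simp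
    then show "h (inv s) * young_symmetrizer lam s = young_symmetrizer lam s * h s" by simp
  qed
  also have "\<dots> = (\<Prod>i<n. t - of_nat (part lam i + (n - 1 - i)))"
    unfolding h_def young_placements(1)[OF n, of "\<lambda>k. (- 1) ^ k * falling t (n - k)"] by (rule row_placements_full[OF lam])
  finally show ?thesis .
qed

text \<open>The dimension, the sum and the last expression all equal the product divided by
  \<open>hook lam\<close>, since the degree is n! divided by \<open>hook lam\<close>.\<close>

theorem corollary6p13:
  fixes t :: "'k::{alg_closed_field, field_char_0}" and n :: nat and lam :: "nat list"
  assumes "t \<notin> \<nat>" and "lam \<in> partitions_of n"
  shows "(\<forall>X. is_top_family t n X \<longrightarrow>
            cat_dim t (X lam) = (\<Sum>mu\<in>partitions_of n. (- 1) ^ length mu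
              * inverse (of_nat (z_part mu)) * sym_character_at lam mu
              * charlier (count_list mu 1) t))
       \<and> (\<Sum>mu\<in>partitions_of n. (- 1) ^ length mu
              * inverse (of_nat (z_part mu)) * sym_character_at lam mu
              * charlier (count_list mu 1) t)
         = character_degree lam / fact n * (\<Prod>i<n. t - of_nat (part lam i + (n - 1 - i)))"
  unfolding character_sum_hook[OF assms(2)] using cat_dim_top_family[OF assms]
  by (simp add: character_degree_hook[OF assms(2)])

end
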